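(* Let $G$ be a quasi-split symplectic or special orthogonal group over a $p$-adic field $F$ and let $\psi$ be an Arthur parameter of $G$. Let $\chi$ be a character of $\pi_0(Z(\widehat G)^{\Gamma_F})$ and let $\tilde\zeta$ be a character of $Z(\widehat G_{\mathrm{sc}})$. Suppose the pull-back of $\chi$ along $\widehat Z^\sharp_{\mathrm{sc}}\to Z(\widehat G)^{\Gamma_F}\to\pi_0(Z(\widehat G)^{\Gamma_F})$ coincides with the restriction of $\tilde\zeta$ to $\widehat Z^\sharp_{\mathrm{sc}}\hookrightarrow Z(\widehat G_{\mathrm{sc}})$. Then there is a canonical bijection $$\operatorname{Rep}(A_\psi,\chi)\to\operatorname{Rep}(\mathcal S_{\psi,\mathrm{sc}},\tilde\zeta).$$
   Context: $\Gamma_F$ is the absolute Galois group of $F$, $W_F$ the Weil group, $L_F=W_F\times SL(2,\mathbb C)$; $\widehat G$ is the complex dual group of $G$ with its $\Gamma_F$-action, ${}^LG=\widehat G\rtimes W_F$; $\widehat G_{\mathrm{sc}}$ is the simply connected cover of the derived group of $\widehat G$, and $\widehat G_{\mathrm{ad}}$ the adjoint group. An element of ${}^LG$ is semisimple if conjugation by it is a semisimple automorphism of $\widehat G$. An Arthur parameter is a homomorphism $\psi:L_F\times SL(2,\mathbb C)\to{}^LG$ over $W_F$ such that $\psi|_{L_F}$ is a Langlands parameter (continuous, algebraic on $SL(2,\mathbb C)$, with $\psi(W_F)$ consisting of semisimple elements), $\psi$ is algebraic on the last $SL(2,\mathbb C)$, and the $\widehat G$-component of $\psi|_{W_F}$ has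 bounded image. Set $S_\psi=Z_{\widehat G}(\psi)$ and $\bar S_\psi=S_\psi/Z(\widehat G)^{\Gamma_F}\subseteq\widehat G_{\mathrm{ad}}$. Let $S_{\psi,\mathrm{sc}}$ be the preimage of $\bar S_\psi$ under $\widehat G_{\mathrm{sc}}\to\widehat G_{\mathrm{ad}}$ and let $\widehat Z^\sharp_{\mathrm{sc}}$ be the preimage of $Z(\widehat G)^{\Gamma_F}$ in $\widehat G_{\mathrm{sc}}$. Component groups: $A_\psi=\pi_0(S_\psi)$ and $\mathcal S_{\psi,\mathrm{sc}}=\pi_0(S_{\psi,\mathrm{sc}})$. $\operatorname{Rep}(A_\psi,\chi)$ is the set of equivalence classes of $\chi$-equivariant representations of $A_\psi$, i.e. those whose pull-back along $\pi_0(Z(\widehat G)^{\Gamma_F})\to A_\psi$ is given by the scalar character $\chi$; $\operatorname{Rep}(\mathcal S_{\psi,\mathrm{sc}},\tilde\zeta)$ is the set of isomorphism classes of $\tilde\zeta$-equivariant representations of $\mathcal S_{\psi,\mathrm{sc}}$, i.e. those whose pull-back along $Z(\widehat G_{\mathrm{sc}})\to\mathcal S_{\psi,\mathrm{sc}}$ is given by the scalar character $\tilde\zeta$. *)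

theory Defs
  imports
    "HOL-Analysis.Homeomorphism"
    "HOL-Analysis.Function_Topology"
    "HOL-Analysis.Product_Topology"
    "Jordan_Normal_Form.Determinant"
    "Jordan_Normal_Form.Gauss_Jordan_Elimination"
    "HOL-Algebra.Solvable_Groups"
begin


section \<open>Generalities\<close>

text \<open>The entrywise topology on matrices: the disjoint union, over all formats, of the product
  topologies.\<close>

instantiation mat :: (topological_space) topological_space
begin

definition open_mat :: "'a mat set \<Rightarrow> bool" where
  "open_mat U \<longleftrightarrow> (\<forall>nr nc. open {f :: nat \<times> nat \<Rightarrow> 'a. mat nr nc f \<in> U})"

instance
proof
  show "open (UNIV :: 'a mat set)" by (simp add: open_mat_def)
next
  fix S T :: "'a mat set" assume "open S" "open T"
  then show "open (S \<inter> T)" by (simp add: open_mat_def Collect_conj_eq open_Int)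
next
  fix K :: "'a mat set set" assume K: "\<forall>S\<in>K. open S"
  have "{f. mat nr nc f \<in> \<Union>K} = (\<Union>S\<in>K. {f :: nat \<times> nat \<Rightarrow> 'a. mat nr nc f \<in> S})" for nr nc
    by auto
  with K show "open (\<Union>K)" by (auto simp: open_mat_def)
qed

end

definition mat_group :: "nat \<Rightarrow> 'a::comm_ring_1 mat set \<Rightarrow> 'a mat monoid" where
  "mat_group N X = \<lparr>carrier = X, monoid.mult = (*), one = 1\<^sub>m N\<rparr>"

definition GL :: "nat \<Rightarrow> complex mat monoid" where
  "GL d = mat_group d {A \<in> carrier_mat d d. invertible_mat A}"

definition SL2 :: "complex mat monoid" where
  "SL2 = mat_group 2 {A \<in> carrier_mat 2 2. det A = 1}"

definition Cstar :: "complex monoid" where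
  "Cstar = \<lparr>carrier = - {0}, monoid.mult = (*), one = 1\<rparr>"

text \<open>The group of matrices of determinant one preserving the bilinear form with Gram matrix
  \<open>B\<close>. If \<open>B\<close> is symmetric, this is the special orthogonal group;
  if \<open>B\<close> is alternating, the condition on the determinant is automatic and this is the
  symplectic group.\<close>

definition special_isometry_group :: "'a::comm_ring_1 mat \<Rightarrow> 'a mat monoid" where
  "special_isometry_group B = mat_group (dim_row B)
     {A \<in> carrier_mat (dim_row B) (dim_row B). transpose_mat A * B * A = B \<and> det A = 1}"

definition center :: "('a, 'b) monoid_scheme \<Rightarrow> 'a set" where
  "center G = {z \<in> carrier G. \<forall>g \<in> carrier G. z \<otimes>\<^bsub>G\<^esub> g = g \<otimes>\<^bsub>G\<^esub> z}"

inductive_set polynomial_functions :: "nat \<Rightarrow> ('a::comm_ring_1 mat \<Rightarrow> 'a) set" for N where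
  const: "(\<lambda>A. c) \<in> polynomial_functions N"
| entry: "i < N \<Longrightarrow> j < N \<Longrightarrow> (\<lambda>A. A $$ (i, j)) \<in> polynomial_functions N"
| add: "f \<in> polynomial_functions N \<Longrightarrow> g \<in> polynomial_functions N \<Longrightarrow>
    (\<lambda>A. f A + g A) \<in> polynomial_functions N"
| mult: "f \<in> polynomial_functions N \<Longrightarrow> g \<in> polynomial_functions N \<Longrightarrow>
    (\<lambda>A. f A * g A) \<in> polynomial_functions N"

definition zariski_closed :: "nat \<Rightarrow> 'a::comm_ring_1 mat set \<Rightarrow> bool" where
  "zariski_closed N X \<longleftrightarrow>
    (\<exists>I \<subseteq> polynomial_functions N. X = {A \<in> carrier_mat N N. \<forall>f \<in> I. f A = 0})"

definition zariski_connected :: "nat \<Rightarrow> 'a::comm_ring_1 mat set \<Rightarrow> bool" where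
  "zariski_connected N X \<longleftrightarrow>
    \<not> (\<exists>Y Z. zariski_closed N Y \<and> zariski_closed N Z \<and> X \<subseteq> Y \<union> Z \<and>
         X \<inter> Y \<inter> Z = {} \<and> X \<inter> Y \<noteq> {} \<and> X \<inter> Z \<noteq> {})"


section \<open>p-adic fields, Galois groups and Weil groups\<close>

definition is_subfield :: "'k::field set \<Rightarrow> bool" where
  "is_subfield K \<longleftrightarrow> 0 \<in> K \<and> 1 \<in> K \<and>
     (\<forall>x\<in>K. \<forall>y\<in>K. x + y \<in> K \<and> x * y \<in> K) \<and> (\<forall>x\<in>K. - x \<in> K \<and> inverse x \<in> K)"

text \<open>The type \<open>'k\<close> plays the role of an algebraic closure of the p-adic field \<open>F\<close>, and
  \<open>v\<close> is the absolute value on it which extends the p-adic one on \<open>\<rat>\<close>.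
  The closure \<open>Qp\<close> of \<open>\<rat>\<close> is required to be complete, hence is the field of p-adic
  numbers, and \<open>F\<close> is a finite extension of it.\<close>

locale padic_field =
  fixes F :: "'k::{alg_closed_field, field_char_0} set" and v :: "'k \<Rightarrow> real"
  assumes v_nonneg: "v x \<ge> 0"
    and v_eq_0: "v x = 0 \<longleftrightarrow> x = 0"
    and v_mult: "v (x * y) = v x * v y"
    and v_add: "v (x + y) \<le> max (v x) (v y)"
    and v_padic: "\<exists>p::nat. prime p \<and> v (of_nat p) = 1 / real p"
  fixes Qp :: "'k set"
  defines Qp_def: "Qp \<equiv> {x. \<forall>e>0. \<exists>r\<in>\<rat>. v (x - r) < e}"
  assumes Qp_complete:
    "\<lbrakk>\<And>n. X n \<in> Qp; \<And>e. e > 0 \<Longrightarrow> \<exists>M::nat. \<forall>m\<ge>M. \<forall>n\<ge>M. v (X m - X n) < e\<rbrakk> \<Longrightarrow>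
       \<exists>x\<in>Qp. (\<lambda>n. v (X n - x)) \<longlonglongrightarrow> 0"
    and F_subfield: "is_subfield F"
    and Qp_subset: "Qp \<subseteq> F"
    and F_finite: "\<exists>E \<subseteq> F. finite E \<and>
       (\<forall>x\<in>F. \<exists>c. (\<forall>e\<in>E. c e \<in> Qp) \<and> x = (\<Sum>e\<in>E. c e * e))"
    and algebraic: "\<exists>f::'k poly. f \<noteq> 0 \<and> (\<forall>i. coeff f i \<in> F) \<and> poly f x = 0"

definition galois_group :: "'k::field set \<Rightarrow> ('k \<Rightarrow> 'k) monoid" where
  "galois_group F = \<lparr>carrier = {\<sigma>. bij \<sigma> \<and> (\<forall>x y. \<sigma> (x + y) = \<sigma> x + \<sigma> y) \<and>
       (\<forall>x y. \<sigma> (x * y) = \<sigma> x * \<sigma> y) \<and> (\<forall>x\<in>F. \<sigma> x = x)},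
     monoid.mult = (\<circ>), one = id\<rparr>"

definition residue_card :: "'k::field set \<Rightarrow> ('k \<Rightarrow> real) \<Rightarrow> nat" where
  "residue_card F v =
     (let R = {x \<in> F. v x \<le> 1} in card (R // {(x, y). x \<in> R \<and> y \<in> R \<and> v (x - y) < 1}))"

definition inertia_group :: "'k::field set \<Rightarrow> ('k \<Rightarrow> real) \<Rightarrow> ('k \<Rightarrow> 'k) set" where
  "inertia_group F v = {\<sigma> \<in> carrier (galois_group F). \<forall>x. v x \<le> 1 \<longrightarrow> v (\<sigma> x - x) < 1}"

text \<open>The Weil group: the automorphisms inducing an integral power of \<open>x \<mapsto> x ^ q\<close> on the
  residue field of the algebraic closure. The second alternative says that the inverse of
  \<open>\<sigma>\<close> induces the \<open>n\<close>-th power.\<close>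

definition weil_group :: "'k::field set \<Rightarrow> ('k \<Rightarrow> real) \<Rightarrow> ('k \<Rightarrow> 'k) monoid" where
  "weil_group F v = (galois_group F) \<lparr>carrier := {\<sigma> \<in> carrier (galois_group F).
     \<exists>n::nat. (\<forall>x. v x \<le> 1 \<longrightarrow> v (\<sigma> x - x ^ (residue_card F v ^ n)) < 1) \<or>
              (\<forall>x. v x \<le> 1 \<longrightarrow> v (x - \<sigma> x ^ (residue_card F v ^ n)) < 1)}\<rparr>"

text \<open>The topology of the Weil group, in which the inertia group with its profinite topology is
  an open subgroup; the generating sets are the cosets of the open subgroups of inertia fixing
  a finite set pointwise.\<close>

definition weil_topology :: "'k::field set \<Rightarrow> ('k \<Rightarrow> real) \<Rightarrow> ('k \<Rightarrow> 'k) topology" where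
  "weil_topology F v = topology_generated_by
     {{\<sigma> \<circ> \<tau> |\<tau>. \<tau> \<in> inertia_group F v \<and> (\<forall>x\<in>A. \<tau> x = x)} |\<sigma> A.
        \<sigma> \<in> carrier (weil_group F v) \<and> finite A}"


section \<open>Quasi-split classical groups and their dual groups\<close>

text \<open>The symplectic and special orthogonal groups over \<open>F\<close> are given by a Gram matrix
  \<open>B\<close> with entries in \<open>F\<close>. They are identified with their points over the algebraic
  closure. As \<open>F\<close> is perfect, being defined over \<open>F\<close> amounts to stability under
  the absolute Galois group.\<close>

datatype form_type = Alternating | Symmetric

definition classical_form :: "'k::field set \<Rightarrow> form_type \<Rightarrow> 'k mat \<Rightarrow> bool" where
  "classical_form F ty B \<longleftrightarrow> square_mat B \<and> elements_mat B \<subseteq> F \<and> det B \<noteq> 0 \<and>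
     (case ty of Alternating \<Rightarrow> transpose_mat B = - B | Symmetric \<Rightarrow> transpose_mat B = B)"

definition closed_connected_solvable :: "nat \<Rightarrow> 'a::field mat monoid \<Rightarrow> 'a mat set \<Rightarrow> bool" where
  "closed_connected_solvable N G H \<longleftrightarrow> subgroup H G \<and> zariski_closed N H \<and>
     zariski_connected N H \<and> solvable (G\<lparr>carrier := H\<rparr>)"

definition borel_subgroup :: "nat \<Rightarrow> 'a::field mat monoid \<Rightarrow> 'a mat set \<Rightarrow> bool" where
  "borel_subgroup N G H \<longleftrightarrow> closed_connected_solvable N G H \<and>
     (\<forall>H'. closed_connected_solvable N G H' \<and> H \<subseteq> H' \<longrightarrow> H' = H)"

definition quasi_split :: "'k::field set \<Rightarrow> 'k mat \<Rightarrow> bool" where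
  "quasi_split F B \<longleftrightarrow> (\<exists>H. borel_subgroup (dim_row B) (special_isometry_group B) H \<and>
     (\<forall>\<sigma> \<in> carrier (galois_group F). \<forall>h \<in> H. map_mat \<sigma> h \<in> H))"

definition split_form :: "form_type \<Rightarrow> nat \<Rightarrow> complex mat" where
  "split_form ty N = mat N N (\<lambda>(i, j). if i + j + 1 = N
     then (case ty of Symmetric \<Rightarrow> 1 | Alternating \<Rightarrow> if i < j then 1 else - 1) else 0)"

text \<open>The dual group of \<open>Sp(2n)\<close> is \<open>SO(2n+1, \<complex>)\<close>, that of \<open>SO(2n+1)\<close> is
  \<open>Sp(2n, \<complex>)\<close> and that of \<open>SO(2n)\<close> is \<open>SO(2n, \<complex>)\<close>.\<close>

definition dual_group :: "form_type \<Rightarrow> 'k mat \<Rightarrow> complex mat monoid" where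
  "dual_group ty B = special_isometry_group (case ty of
       Alternating \<Rightarrow> split_form Symmetric (dim_row B + 1)
     | Symmetric \<Rightarrow> if odd (dim_row B) then split_form Alternating (dim_row B - 1)
                    else split_form Symmetric (dim_row B))"

text \<open>The action of the Galois group on the dual group is trivial except for even special
  orthogonal groups. There it factors through the extension generated by a square root of the
  discriminant of the form, and the nontrivial element acts by the outer automorphism preserving
  the standard pinning, which is conjugation by the permutation matrix exchanging the two
  middle basis vectors.\<close>

definition galois_action ::
    "form_type \<Rightarrow> 'k::field mat \<Rightarrow> ('k \<Rightarrow> 'k) \<Rightarrow> complex mat \<Rightarrow> complex mat" where
  "galois_action ty B \<sigma> g =
     (let N = dim_row B; n = N div 2; \<theta> = swaprows_mat N (n - 1) n in
      if ty = Symmetric \<and> even N \<and> (\<exists>s. s ^ 2 = (- 1) ^ n * det B \<and> \<sigma> s \<noteq> s)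
      then \<theta> * g * \<theta> else g)"

definition L_group ::
    "'k::field set \<Rightarrow> ('k \<Rightarrow> real) \<Rightarrow> form_type \<Rightarrow> 'k mat \<Rightarrow> (complex mat \<times> ('k \<Rightarrow> 'k)) monoid" where
  "L_group F v ty B =
     \<lparr>carrier = carrier (dual_group ty B) \<times> carrier (weil_group F v),
      monoid.mult = (\<lambda>(g, \<sigma>) (h, \<tau>). (g * galois_action ty B \<sigma> h, \<sigma> \<circ> \<tau>)),
      one = \<one>\<^bsub>dual_group ty B \<times>\<times> weil_group F v\<^esub>\<rparr>"

definition L_topology ::
    "'k::field set \<Rightarrow> ('k \<Rightarrow> real) \<Rightarrow> form_type \<Rightarrow> 'k mat \<Rightarrow> (complex mat \<times> ('k \<Rightarrow> 'k)) topology" where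
  "L_topology F v ty B =
     prod_topology (top_of_set (carrier (dual_group ty B))) (weil_topology F v)"


section \<open>Arthur parameters\<close>

text \<open>An automorphism \<open>\<alpha>\<close> of a closed subgroup \<open>G\<close> of \<open>SL(N)\<close> is semisimple if
  composition with \<open>\<alpha>\<close> is a diagonalizable operator on the coordinate ring of \<open>G\<close>, that
  is, if the coordinate ring is spanned by eigenfunctions. Elements of the coordinate
  ring are represented by polynomial functions, which are compared on \<open>G\<close> only.\<close>

definition eigenfunction ::
    "complex mat monoid \<Rightarrow> (complex mat \<Rightarrow> complex mat) \<Rightarrow> (complex mat \<Rightarrow> complex) \<Rightarrow> bool" where
  "eigenfunction G \<alpha> f \<longleftrightarrow> (\<exists>c. \<forall>h \<in> carrier G. f (\<alpha> h) = c * f h)"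

definition semisimple_automorphism ::
    "nat \<Rightarrow> complex mat monoid \<Rightarrow> (complex mat \<Rightarrow> complex mat) \<Rightarrow> bool" where
  "semisimple_automorphism N G \<alpha> \<longleftrightarrow>
     (\<forall>f \<in> polynomial_functions N. \<exists>E. finite E \<and> E \<subseteq> polynomial_functions N \<and>
        (\<forall>e \<in> E. eigenfunction G \<alpha> e) \<and> (\<forall>h \<in> carrier G. f h = (\<Sum>e\<in>E. e h)))"

definition dual_dim :: "form_type \<Rightarrow> 'k mat \<Rightarrow> nat" where
  "dual_dim ty B = dim_row \<one>\<^bsub>dual_group ty B\<^esub>"

definition L_semisimple ::
    "'k::field set \<Rightarrow> ('k \<Rightarrow> real) \<Rightarrow> form_type \<Rightarrow> 'k mat \<Rightarrow> complex mat \<times> ('k \<Rightarrow> 'k) \<Rightarrow> bool" where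
  "L_semisimple F v ty B x \<longleftrightarrow>
     semisimple_automorphism (dual_dim ty B) (dual_group ty B)
       (\<lambda>h. fst (x \<otimes>\<^bsub>L_group F v ty B\<^esub> (h, id) \<otimes>\<^bsub>L_group F v ty B\<^esub> inv\<^bsub>L_group F v ty B\<^esub> x))"

text \<open>A map from \<open>SL(2)\<close> is algebraic if its matrix entries are polynomials in the
  four coordinates.\<close>

definition algebraic_on_SL2 :: "nat \<Rightarrow> (complex mat \<Rightarrow> complex mat) \<Rightarrow> bool" where
  "algebraic_on_SL2 N f \<longleftrightarrow> (\<forall>i<N. \<forall>j<N. \<exists>P \<in> polynomial_functions 2.
     \<forall>x \<in> carrier SL2. f x $$ (i, j) = P x)"

definition langlands_parameter ::
    "'k::field set \<Rightarrow> ('k \<Rightarrow> real) \<Rightarrow> form_type \<Rightarrow> 'k mat \<Rightarrow>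
     (('k \<Rightarrow> 'k) \<times> complex mat \<Rightarrow> complex mat \<times> ('k \<Rightarrow> 'k)) \<Rightarrow> bool" where
  "langlands_parameter F v ty B \<phi> \<longleftrightarrow>
     \<phi> \<in> hom (weil_group F v \<times>\<times> SL2) (L_group F v ty B) \<and>
     (\<forall>w \<in> carrier (weil_group F v). \<forall>x \<in> carrier SL2. snd (\<phi> (w, x)) = w) \<and>
     continuous_map (prod_topology (weil_topology F v) (top_of_set (carrier SL2)))
       (L_topology F v ty B) \<phi> \<and>
     algebraic_on_SL2 (dual_dim ty B) (\<lambda>x. fst (\<phi> (id, x))) \<and>
     (\<forall>w \<in> carrier (weil_group F v). L_semisimple F v ty B (\<phi> (w, 1\<^sub>m 2)))"

definition arthur_parameter ::
    "'k::field set \<Rightarrow> ('k \<Rightarrow> real) \<Rightarrow> form_type \<Rightarrow> 'k mat \<Rightarrow>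
     ((('k \<Rightarrow> 'k) \<times> complex mat) \<times> complex mat \<Rightarrow> complex mat \<times> ('k \<Rightarrow> 'k)) \<Rightarrow> bool" where
  "arthur_parameter F v ty B \<psi> \<longleftrightarrow>
     \<psi> \<in> hom ((weil_group F v \<times>\<times> SL2) \<times>\<times> SL2) (L_group F v ty B) \<and>
     (\<forall>w \<in> carrier (weil_group F v). \<forall>x \<in> carrier SL2. \<forall>y \<in> carrier SL2. snd (\<psi> ((w, x), y)) = w) \<and>
     langlands_parameter F v ty B (\<lambda>l. \<psi> (l, 1\<^sub>m 2)) \<and>
     algebraic_on_SL2 (dual_dim ty B) (\<lambda>y. fst (\<psi> ((id, 1\<^sub>m 2), y))) \<and>
     (\<exists>b. \<forall>w \<in> carrier (weil_group F v). \<forall>i < dual_dim ty B. \<forall>j < dual_dim ty B.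
        cmod (fst (\<psi> ((w, 1\<^sub>m 2), 1\<^sub>m 2)) $$ (i, j)) \<le> b)"


section \<open>Component groups and representations\<close>

definition identity_component :: "'a::topological_space monoid \<Rightarrow> 'a set" where
  "identity_component G = connected_component_set (carrier G) \<one>\<^bsub>G\<^esub>"

definition pi0 :: "'a::topological_space monoid \<Rightarrow> 'a set monoid" where
  "pi0 G = G Mod identity_component G"

text \<open>The map induced on component groups by a continuous homomorphism \<open>f\<close> into \<open>H\<close>; the
  cosets in the union all coincide.\<close>

definition pi0_map ::
    "'b::topological_space monoid \<Rightarrow> ('a \<Rightarrow> 'b) \<Rightarrow> 'a set \<Rightarrow> 'b set" where
  "pi0_map H f C = (\<Union>x\<in>C. identity_component H #>\<^bsub>H\<^esub> f x)"

text \<open>Finite-dimensional complex representations are pairs consisting of the dimension and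
  a homomorphism.\<close>

definition representations :: "('a, 'b) monoid_scheme \<Rightarrow> (nat \<times> ('a \<Rightarrow> complex mat)) set" where
  "representations A = {(d, \<rho>). \<rho> \<in> hom A (GL d)}"

definition rep_equiv ::
    "('a, 'b) monoid_scheme \<Rightarrow> ((nat \<times> ('a \<Rightarrow> complex mat)) \<times> (nat \<times> ('a \<Rightarrow> complex mat))) set" where
  "rep_equiv A = {((d, \<rho>), (d', \<rho>')). (d, \<rho>) \<in> representations A \<and> (d', \<rho>') \<in> representations A \<and>
     d = d' \<and> (\<exists>T \<in> carrier (GL d). \<forall>a \<in> carrier A. \<rho>' a * T = T * \<rho> a)}"

definition equivariant_reps ::
    "('a, 'b) monoid_scheme \<Rightarrow> ('c, 'd) monoid_scheme \<Rightarrow> ('c \<Rightarrow> 'a) \<Rightarrow> ('c \<Rightarrow> complex) \<Rightarrow>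
     (nat \<times> ('a \<Rightarrow> complex mat)) set" where
  "equivariant_reps A Z \<iota> chi =
     {(d, \<rho>). (d, \<rho>) \<in> representations A \<and>
       (\<forall>z \<in> carrier Z. \<rho> (\<iota> z) = chi z \<cdot>\<^sub>m 1\<^sub>m d)}"

definition Rep_equivariant ::
    "('a, 'b) monoid_scheme \<Rightarrow> ('c, 'd) monoid_scheme \<Rightarrow> ('c \<Rightarrow> 'a) \<Rightarrow> ('c \<Rightarrow> complex) \<Rightarrow>
     (nat \<times> ('a \<Rightarrow> complex mat)) set set" where
  "Rep_equivariant A Z \<iota> chi = equivariant_reps A Z \<iota> chi // rep_equiv A"

definition topological_group :: "'a::topological_space monoid \<Rightarrow> bool" where
  "topological_group G \<longleftrightarrow> group G \<and>
     continuous_on (carrier G \<times> carrier G) (\<lambda>(x, y). x \<otimes>\<^bsub>G\<^esub> y) \<and>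
     continuous_on (carrier G) (\<lambda>x. inv\<^bsub>G\<^esub> x)"

text \<open>For a connected complex semisimple group \<open>H\<close>, the simply connected cover in the sense of
  algebraic groups is the universal covering group for the complex topology.\<close>

definition simply_connected_cover ::
    "'a::topological_space monoid \<Rightarrow> ('a \<Rightarrow> 'b) \<Rightarrow> 'b::topological_space monoid \<Rightarrow> bool" where
  "simply_connected_cover G p H \<longleftrightarrow> topological_group G \<and> p \<in> hom G H \<and>
     covering_space (carrier G) p (carrier H) \<and> simply_connected (carrier G)"


section \<open>The groups attached to a parameter\<close>

definition dual_derived :: "form_type \<Rightarrow> 'k::field mat \<Rightarrow> complex mat monoid" where
  "dual_derived ty B = (dual_group ty B)
     \<lparr>carrier := derived (dual_group ty B) (carrier (dual_group ty B))\<rparr>"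

definition dual_adjoint :: "form_type \<Rightarrow> 'k::field mat \<Rightarrow> complex mat set monoid" where
  "dual_adjoint ty B = dual_group ty B Mod center (dual_group ty B)"

definition to_adjoint :: "form_type \<Rightarrow> 'k::field mat \<Rightarrow> complex mat \<Rightarrow> complex mat set" where
  "to_adjoint ty B g = center (dual_group ty B) #>\<^bsub>dual_group ty B\<^esub> g"

definition Z_Gamma :: "'k::field set \<Rightarrow> form_type \<Rightarrow> 'k mat \<Rightarrow> complex mat monoid" where
  "Z_Gamma F ty B = (dual_group ty B) \<lparr>carrier := {z \<in> center (dual_group ty B).
     \<forall>\<sigma> \<in> carrier (galois_group F). galois_action ty B \<sigma> z = z}\<rparr>"

definition S_psi ::
    "'k::field set \<Rightarrow> ('k \<Rightarrow> real) \<Rightarrow> form_type \<Rightarrow> 'k mat \<Rightarrow>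
     ((('k \<Rightarrow> 'k) \<times> complex mat) \<times> complex mat \<Rightarrow> complex mat \<times> ('k \<Rightarrow> 'k)) \<Rightarrow> complex mat monoid" where
  "S_psi F v ty B \<psi> = (dual_group ty B) \<lparr>carrier := {g \<in> carrier (dual_group ty B).
     \<forall>l \<in> carrier ((weil_group F v \<times>\<times> SL2) \<times>\<times> SL2).
       (g, id) \<otimes>\<^bsub>L_group F v ty B\<^esub> \<psi> l = \<psi> l \<otimes>\<^bsub>L_group F v ty B\<^esub> (g, id)}\<rparr>"

text \<open>The quotient of \<open>S_psi\<close> by \<open>Z_Gamma\<close>, as a subgroup of the adjoint group.\<close>

definition S_psi_bar ::
    "'k::field set \<Rightarrow> ('k \<Rightarrow> real) \<Rightarrow> form_type \<Rightarrow> 'k mat \<Rightarrow>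
     ((('k \<Rightarrow> 'k) \<times> complex mat) \<times> complex mat \<Rightarrow> complex mat \<times> ('k \<Rightarrow> 'k)) \<Rightarrow>
     complex mat set monoid" where
  "S_psi_bar F v ty B \<psi> =
     (dual_adjoint ty B) \<lparr>carrier := to_adjoint ty B ` carrier (S_psi F v ty B \<psi>)\<rparr>"

definition S_psi_sc ::
    "'k::field set \<Rightarrow> ('k \<Rightarrow> real) \<Rightarrow> form_type \<Rightarrow> 'k mat \<Rightarrow>
     ((('k \<Rightarrow> 'k) \<times> complex mat) \<times> complex mat \<Rightarrow> complex mat \<times> ('k \<Rightarrow> 'k)) \<Rightarrow>
     'g monoid \<Rightarrow> ('g \<Rightarrow> complex mat) \<Rightarrow> 'g monoid" where
  "S_psi_sc F v ty B \<psi> Gsc p =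
     Gsc \<lparr>carrier := {x \<in> carrier Gsc. to_adjoint ty B (p x) \<in> carrier (S_psi_bar F v ty B \<psi>)}\<rparr>"

definition Z_sc :: "'g monoid \<Rightarrow> 'g monoid" where
  "Z_sc Gsc = Gsc \<lparr>carrier := center Gsc\<rparr>"

definition Z_sharp_sc ::
    "'k::field set \<Rightarrow> form_type \<Rightarrow> 'k mat \<Rightarrow> 'g monoid \<Rightarrow> ('g \<Rightarrow> complex mat) \<Rightarrow> 'g set" where
  "Z_sharp_sc F ty B Gsc p = {x \<in> carrier Gsc. p x \<in> carrier (Z_Gamma F ty B)}"

definition A_psi ::
    "'k::field set \<Rightarrow> ('k \<Rightarrow> real) \<Rightarrow> form_type \<Rightarrow> 'k mat \<Rightarrow>
     ((('k \<Rightarrow> 'k) \<times> complex mat) \<times> complex mat \<Rightarrow> complex mat \<times> ('k \<Rightarrow> 'k)) \<Rightarrow>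
     complex mat set monoid" where
  "A_psi F v ty B \<psi> = pi0 (S_psi F v ty B \<psi>)"

definition comp_psi_sc ::
    "'k::field set \<Rightarrow> ('k \<Rightarrow> real) \<Rightarrow> form_type \<Rightarrow> 'k mat \<Rightarrow>
     ((('k \<Rightarrow> 'k) \<times> complex mat) \<times> complex mat \<Rightarrow> complex mat \<times> ('k \<Rightarrow> 'k)) \<Rightarrow>
     'g::topological_space monoid \<Rightarrow> ('g \<Rightarrow> complex mat) \<Rightarrow> 'g set monoid" where
  "comp_psi_sc F v ty B \<psi> Gsc p = pi0 (S_psi_sc F v ty B \<psi> Gsc p)"

definition Rep_A ::
    "'k::field set \<Rightarrow> ('k \<Rightarrow> real) \<Rightarrow> form_type \<Rightarrow> 'k mat \<Rightarrow>
     ((('k \<Rightarrow> 'k) \<times> complex mat) \<times> complex mat \<Rightarrow> complex mat \<times> ('k \<Rightarrow> 'k)) \<Rightarrow>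
     (complex mat set \<Rightarrow> complex) \<Rightarrow> (nat \<times> (complex mat set \<Rightarrow> complex mat)) set set" where
  "Rep_A F v ty B \<psi> chi = Rep_equivariant (A_psi F v ty B \<psi>) (pi0 (Z_Gamma F ty B))
     (pi0_map (S_psi F v ty B \<psi>) (\<lambda>z. z)) chi"

definition Rep_sc ::
    "'k::field set \<Rightarrow> ('k \<Rightarrow> real) \<Rightarrow> form_type \<Rightarrow> 'k mat \<Rightarrow>
     ((('k \<Rightarrow> 'k) \<times> complex mat) \<times> complex mat \<Rightarrow> complex mat \<times> ('k \<Rightarrow> 'k)) \<Rightarrow>
     'g::topological_space monoid \<Rightarrow> ('g \<Rightarrow> complex mat) \<Rightarrow> ('g \<Rightarrow> complex) \<Rightarrow>
     (nat \<times> ('g set \<Rightarrow> complex mat)) set set" where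
  "Rep_sc F v ty B \<psi> Gsc p zeta = Rep_equivariant (comp_psi_sc F v ty B \<psi> Gsc p) (Z_sc Gsc)
     (\<lambda>z. identity_component (S_psi_sc F v ty B \<psi> Gsc p) #>\<^bsub>S_psi_sc F v ty B \<psi> Gsc p\<^esub> z) zeta"

end

theory Submission
  imports Defs
begin

text \<open>The cover \<open>p\<close> maps \<open>S_psi_sc\<close> into \<open>S_psi\<close>, and \<open>S_psi\<close> is generated by the image and the central
  subgroup \<open>Z_Gamma\<close>. Pulling back along the map of component groups is therefore a bijection on
  equivariant representations as soon as the identity component of \<open>S_psi\<close> is the product of the
  images of the other two identity components: a representation of \<open>pi0 S_psi_sc\<close> with central
  character \<open>zeta\<close> extends uniquely by \<open>chi\<close>.
  If the dual group is not \<open>SO(2)\<close>, it is perfect, so that \<open>p\<close> is onto, its centre is fixed by the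
  Galois action, and paths in the centralizer \<open>S_psi\<close> lift to \<open>S_psi_sc\<close>. An element \<open>g\<close> of \<open>S_psi\<close> for
  which \<open>1 + g\<close> is invertible is joined to \<open>1\<close> by the Cayley path, which is a rational function of
  \<open>g\<close> and hence stays in the centralizer.
  If the dual group is \<open>SO(2)\<close>, the cover is trivial, and \<open>S_psi = Z_Gamma\<close> because the Weil group
  already contains an element acting as the nontrivial automorphism.\<close>


section \<open>Moving square roots by Weil group elements\<close>

text \<open>\<open>Z_Gamma\<close> is cut out by the whole Galois group, but an element of
  \<open>S_psi\<close> commutes only with the values of \<psi> and so feels only the Weil group. For
  \<open>SO(2)\<close> the two must be compared: if a Galois automorphism moves a square root of the
  discriminant, a Weil element has to move it too. That element is a Frobenius lift, prescribed as
  conjugation on the quadratic extension and as the \<open>q\<close>-th power on the roots of unity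
  of order prime to the residue characteristic. Whether the two prescriptions are compatible is
  decided in the residue field, which is why the arithmetic of p-adic fields is developed from the
  bare axioms, including the Galois invariance of \<open>v\<close>. For the other groups the
  obstacle is that the identity component is a connected component and not a path component, and
  that the Cayley path reaches only the elements with \<open>1 + g\<close> invertible. These form an
  open neighbourhood of \<open>1\<close>, and its translates make membership in the image of the
  cover a locally constant condition on the identity component.\<close>

context padic_field begin

section \<open>Elementary properties of the absolute value\<close>

lemma v_zero [simp]: "v 0 = 0"
  by (simp add: v_eq_0)

lemma v_pos: "x \<noteq> 0 \<Longrightarrow> 0 < v x"
  using v_nonneg[of x] v_eq_0[of x] by linarith

lemma v_one [simp]: "v 1 = 1"
  using v_mult[of 1 1] v_eq_0[of 1] by simp

lemma v_minus [simp]: "v (- x) = v x"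
proof -
  have "v (-1) * v (-1) = 1"
    using v_mult[of "-1" "-1"] by simp
  then have "v (-1) = 1"
    using v_nonneg[of "-1"] by (metis abs_of_nonneg power2_eq_square real_sqrt_abs real_sqrt_one)
  then show ?thesis
    using v_mult[of "-1" x] by simp
qed

lemma v_minus_commute: "v (x - y) = v (y - x)"
  using v_minus[of "x - y"] by simp

lemma v_diff: "v (x - y) \<le> max (v x) (v y)"
  using v_add[of x "- y"] by simp

lemma v_diff_trans: "v (x - z) \<le> max (v (x - y)) (v (y - z))"
  using v_add[of "x - y" "y - z"] by simp

lemma v_power: "v (x ^ n) = v x ^ n"
  by (induction n) (simp_all add: v_mult)

lemma v_inverse: "v (inverse x) = inverse (v x)"
proof (cases "x = 0")
  case False
  then have "v x * v (inverse x) = 1"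
    using v_mult[of x "inverse x"] by simp
  then show ?thesis
    by (metis inverse_unique)
qed simp

lemma v_divide: "v (x / y) = v x / v y"
  by (simp add: divide_inverse v_mult v_inverse)

lemma v_sum_le:
  assumes "\<And>i. i \<in> A \<Longrightarrow> v (f i) \<le> c" and "0 \<le> c"
  shows "v (sum f A) \<le> c"
  using assms(1)
proof (induction A rule: infinite_finite_induct)
  case (insert i A)
  then show ?case
    using v_add[of "f i" "sum f A"] by fastforce
qed (use assms(2) in auto)

lemma v_sum_less:
  assumes "\<And>i. i \<in> A \<Longrightarrow> v (f i) < c" and "0 < c"
  shows "v (sum f A) < c"
  using assms(1)
proof (induction A rule: infinite_finite_induct)
  case (insert i A)
  then show ?case
    using v_add[of "f i" "sum f A"] by fastforce
qed (use assms(2) in auto)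

lemma v_of_nat_le: "v (of_nat n) \<le> 1"
proof (induction n)
  case (Suc n)
  then show ?case
    using v_add[of 1 "of_nat n"] by simp
qed simp

lemma v_of_int_le: "v (of_int n) \<le> 1"
  by (cases n) (simp_all add: v_of_nat_le del: of_nat_Suc)

lemma v_prod: "v (prod f A) = (\<Prod>x\<in>A. v (f x))"
  by (induction A rule: infinite_finite_induct) (simp_all add: v_mult)

text \<open>An ultrametric triangle is isosceles, so \<open>v\<close> is locally constant away from
  0.\<close>

lemma v_eq_close:
  assumes "v (x - y) < v x"
  shows "v y = v x"
proof (rule antisym)
  show "v y \<le> v x"
    using v_diff[of x "x - y"] assms by simp
  show "v x \<le> v y"
    using v_add[of "x - y" y] assms by simp
qed

section \<open>The closure of the rational numbers is a field\<close>

lemma Qp_iff: "x \<in> Qp \<longleftrightarrow> (\<forall>e>0. \<exists>r\<in>\<rat>. v (x - r) < e)"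
  by (simp add: Qp_def)

lemma Rats_Qp: "x \<in> \<rat> \<Longrightarrow> x \<in> Qp"
  unfolding Qp_iff by (metis diff_self v_zero)

lemma Qp_add:
  assumes "x \<in> Qp" "y \<in> Qp"
  shows "x + y \<in> Qp"
  unfolding Qp_iff
proof (intro allI impI)
  fix e :: real assume "e > 0"
  with assms obtain r s where rs: "r \<in> \<rat>" "v (x - r) < e" "s \<in> \<rat>" "v (y - s) < e"
    unfolding Qp_iff by metis
  have "v (x + y - (r + s)) \<le> max (v (x - r)) (v (y - s))"
    using v_add[of "x - r" "y - s"] by (simp add: algebra_simps)
  with rs show "\<exists>r\<in>\<rat>. v (x + y - r) < e"
    by (metis Rats_add max_less_iff_conj order_le_less_trans)
qed

lemma Qp_mult:
  assumes "x \<in> Qp" "y \<in> Qp"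
  shows "x * y \<in> Qp"
  unfolding Qp_iff
proof (intro allI impI)
  fix e :: real assume e: "e > 0"
  \<comment> \<open>The error is \<open>x * (y - s) + s * (x - r)\<close>. The precision required of
    \<open>r\<close> depends on \<open>s\<close>, so \<open>s\<close> is chosen first; adding 1
    keeps the denominators positive.\<close>
  have "e / (v x + 1) > 0"
    using e v_nonneg[of x] by simp
  then obtain s where s: "s \<in> \<rat>" "v (y - s) < e / (v x + 1)"
    using assms(2) unfolding Qp_iff by blast
  have "e / (v s + 1) > 0"
    using e v_nonneg[of s] by simp
  then obtain r where r: "r \<in> \<rat>" "v (x - r) < e / (v s + 1)"
    using assms(1) unfolding Qp_iff by blast
  have small: "v a * v b < e" if "v b < e / (v a + 1)" for a b
  proof -
    have "v a * v b \<le> (v a + 1) * v b"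
      using v_nonneg[of b] by (simp add: mult_right_mono)
    also have "\<dots> < e"
      using that v_nonneg[of a] by (simp add: field_simps)
    finally show ?thesis .
  qed
  have "x * y - r * s = x * (y - s) + s * (x - r)"
    by (simp add: algebra_simps)
  then have "v (x * y - r * s) < e"
    using v_add[of "x * (y - s)" "s * (x - r)"] small[OF s(2)] small[OF r(2)] by (simp add: v_mult)
  then show "\<exists>r\<in>\<rat>. v (x * y - r) < e"
    using r(1) s(1) Rats_mult by blast
qed

lemma Qp_minus: "x \<in> Qp \<Longrightarrow> - x \<in> Qp"
  using Qp_mult[of "-1" x] Rats_Qp[of "-1"] by simp

lemma Qp_inverse:
  assumes "x \<in> Qp"
  shows "inverse x \<in> Qp"
proof (cases "x = 0")
  case True
  with assms show ?thesis by simp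
next
  case False
  show ?thesis
    unfolding Qp_iff
  proof (intro allI impI)
    fix e :: real assume e: "e > 0"
    have pos: "v x > 0"
      using False by (rule v_pos)
    \<comment> \<open>The first bound forces \<open>v r = v x\<close>, hence
      \<open>r \<noteq> 0\<close>; the second controls the error, which is then
      \<open>v (x - r) / (v x * v x)\<close>.\<close>
    then have "min (v x) (e * (v x * v x)) > 0"
      using e by simp
    then obtain r where r: "r \<in> \<rat>" "v (x - r) < min (v x) (e * (v x * v x))"
      using assms unfolding Qp_iff by blast
    have vr: "v r = v x"
      using r(2) by (intro v_eq_close) simp
    then have "r \<noteq> 0"
      using pos by auto
    then have "inverse x - inverse r = (r - x) / (x * r)"
      using False by (simp add: field_simps)
    then have "v (inverse x - inverse r) = v (x - r) / (v x * v x)"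
      by (simp add: v_divide v_mult vr v_minus_commute)
    also have "\<dots> < e"
      using r(2) pos by (simp add: field_simps)
    finally show "\<exists>r\<in>\<rat>. v (inverse x - r) < e"
      using r(1) Rats_inverse by blast
  qed
qed

lemma residue_char:
  obtains p where "prime p" "v (of_nat p) = 1 / real p"
  using v_padic by blast

text \<open>Bezout: were both \<open>p\<close> and \<open>a\<close> of absolute value below 1, so
  would be a combination of them equal to 1.\<close>

lemma v_coprime:
  assumes "prime p" "v (of_nat p) = 1 / real p" "\<not> int p dvd a"
  shows "v (of_int a) = 1"
proof (rule ccontr)
  assume "v (of_int a) \<noteq> 1"
  then have small: "v (of_int a) < 1"
    using v_of_int_le[of a] by simp
  have "coprime (int p) a"
    using assms(1,3) by (simp add: prime_imp_coprime)
  then obtain u w where "u * int p + w * a = 1"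
    using bezout_int[of "int p" a] by auto
  then have "of_int u * of_nat p + of_int w * of_int a = (1 :: 'k)"
    by (metis of_int_1 of_int_add of_int_mult of_int_of_nat_eq)
  moreover have "v (of_int u * of_nat p) < 1"
    using v_of_int_le[of u] prime_gt_1_nat[OF assms(1)]
    by (auto simp: v_mult assms(2) field_simps intro: le_less_trans[of _ 1])
  moreover have "v (of_int w * of_int a) < 1"
    using v_of_int_le[of w] small v_nonneg[of "of_int w"] v_nonneg[of "of_int a"]
    by (metis le_less_trans mult.commute mult_left_le v_mult)
  ultimately show False
    using v_add[of "of_int u * of_nat p" "of_int w * of_int a"] by simp
qed

text \<open>The denominator \<open>b\<close> of a \<open>p\<close>-integral rational number is prime
  to \<open>p\<close>, hence invertible modulo \<open>p ^ n\<close>; \<open>j\<close> is the residue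
  of the numerator times that inverse. Only finitely many \<open>j\<close> occur, and this is the
  source of all total boundedness below.\<close>

lemma Rats_approx_nat:
  assumes p: "prime p" "v (of_nat p) = 1 / real p" and r: "r \<in> \<rat>" "v r \<le> 1"
  shows "\<exists>j < p ^ n. v (r - of_nat j) \<le> (1 / real p) ^ n"
proof -
  obtain a b where ab: "b > 0" "coprime a b" "r = of_int a / of_int b"
    using r(1) Rats_cases' by metis
  have p1: "p > 1"
    using p(1) by (rule prime_gt_1_nat)
  have nd: "\<not> int p dvd b"
  proof
    assume d: "int p dvd b"
    then have "\<not> int p dvd a"
      using ab(2) p1 coprime_common_divisor[of a b "int p"] by auto
    then have "v (of_int a) = 1"
      by (rule v_coprime[OF p])
    moreover obtain c where "b = int p * c"
      using d by blast
    then have "v (of_int b) = v (of_int c) / real p"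
      by (simp add: v_mult p(2))
    then have "v (of_int b) < 1"
      using v_of_int_le[of c] p1 by (simp add: divide_less_eq)
    moreover have "v (of_int b) > 0"
      using ab(1) by (intro v_pos) simp
    ultimately show False
      using r(2) ab(3) by (simp add: v_divide field_simps)
  qed
  then have vb: "v (of_int b) = 1"
    by (rule v_coprime[OF p])
  have "coprime (int p ^ n) b"
    using nd p(1) by (simp add: prime_imp_coprime)
  then obtain u w where uw: "u * int p ^ n + w * b = 1"
    using bezout_int[of "int p ^ n" b] by auto
  define j where "j = nat ((a * w) mod (int p ^ n))"
  have j: "int j = (a * w) mod (int p ^ n)"
    using p1 by (simp add: j_def)
  have lt: "j < p ^ n"
  proof -
    have "int j < int (p ^ n)"
      using p1 by (simp add: j)
    then show ?thesis by linarith
  qed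
  have "int p ^ n dvd a - int j * b"
  proof -
    have "int p ^ n dvd a * w - int j"
      by (simp add: j minus_mod_eq_mult_div[symmetric] flip: minus_mod_eq_mult_div)
    then have "int p ^ n dvd (a * w - int j) * b + a * u * int p ^ n"
      by simp
    also have "(a * w - int j) * b + a * u * int p ^ n = a * (u * int p ^ n + w * b) - int j * b"
      by (simp add: algebra_simps)
    finally show ?thesis
      by (simp add: uw)
  qed
  then obtain c where c: "a - int j * b = int p ^ n * c"
    by blast
  have "r - of_nat j = of_int (a - int j * b) / of_int b"
    using ab by (simp add: field_simps)
  then have "v (r - of_nat j) = v (of_int (int p ^ n * c))"
    by (simp only: c v_divide vb div_by_1)
  also have "\<dots> = (1 / real p) ^ n * v (of_int c)"
    by (simp add: v_mult v_power p(2))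
  also have "\<dots> \<le> (1 / real p) ^ n"
    using v_of_int_le[of c] by (simp add: mult_left_le)
  finally show ?thesis
    using lt by blast
qed

section \<open>Completeness and total boundedness with respect to the absolute value\<close>

definition v_complete :: "'k set \<Rightarrow> bool" where
  "v_complete V \<longleftrightarrow> (\<forall>X. (\<forall>n::nat. X n \<in> V) \<longrightarrow>
     (\<forall>e>0. \<exists>M. \<forall>m\<ge>M. \<forall>n\<ge>M. v (X m - X n) < e) \<longrightarrow> (\<exists>x\<in>V. (\<lambda>n. v (X n - x)) \<longlonglongrightarrow> 0))"

definition v_totally_bounded :: "'k set \<Rightarrow> bool" where
  "v_totally_bounded V \<longleftrightarrow>
     (\<forall>R d. d > 0 \<longrightarrow> (\<exists>T. finite T \<and> (\<forall>z\<in>V. v z \<le> R \<longrightarrow> (\<exists>t\<in>T. v (z - t) \<le> d))))"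

definition Qp_span :: "'k set \<Rightarrow> 'k set" where
  "Qp_span B = {\<Sum>b\<in>B. c b * b |c. \<forall>b\<in>B. c b \<in> Qp}"

definition Qp_linear :: "('k \<Rightarrow> 'k) \<Rightarrow> bool" where
  "Qp_linear f \<longleftrightarrow> (\<forall>x y. f (x + y) = f x + f y) \<and> (\<forall>c\<in>Qp. \<forall>x. f (c * x) = c * f x)"

lemma Qp_complete': "v_complete Qp"
  using Qp_complete unfolding v_complete_def by blast

text \<open>Multiplication by \<open>p ^ a\<close> brings the ball of radius \<open>R\<close> into
  the unit ball, where the integers below \<open>p ^ (a + b)\<close> approximate up to
  \<open>(1 / p) ^ (a + b)\<close>. Dividing back costs a factor \<open>p ^ a\<close>, whence the
  exponent \<open>a + b\<close>.\<close>

lemma Qp_totally_bounded: "v_totally_bounded Qp"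
  unfolding v_totally_bounded_def
proof (intro allI impI)
  fix R d :: real assume d: "d > 0"
  obtain p where p: "prime p" "v (of_nat p) = 1 / real p"
    by (rule residue_char)
  have p1: "real p > 1"
    using prime_gt_1_nat[OF p(1)] by simp
  obtain a where a: "R < real p ^ a"
    using real_arch_pow[OF p1] by blast
  obtain b where b: "(1 / real p) ^ b < d"
    using real_arch_pow_inv[OF d, of "1 / real p"] p1 by auto
  let ?T = "(\<lambda>j. of_nat j / of_nat p ^ a :: 'k) ` {..<p ^ (a + b)}"
  have p0: "of_nat p \<noteq> (0 :: 'k)"
    using p1 by auto
  have "\<exists>t\<in>?T. v (c - t) \<le> d" if c: "c \<in> Qp" "v c \<le> R" for c
  proof -
    let ?e = "(1 / real p) ^ (a + b)"
    have e: "0 < ?e" "?e \<le> 1"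
      using p1 by (auto intro!: power_le_one)
    have "c * of_nat p ^ a \<in> Qp"
      using c(1) by (intro Qp_mult Rats_Qp[of "of_nat p ^ a"]) auto
    then obtain r where r: "r \<in> \<rat>" "v (c * of_nat p ^ a - r) < ?e"
      using e unfolding Qp_iff by blast
    have "v (c * of_nat p ^ a) \<le> 1"
      using c a p1 by (simp add: v_mult v_power p(2) power_one_over field_simps)
    then have "v r \<le> 1"
      using v_diff[of "c * of_nat p ^ a" "c * of_nat p ^ a - r"] r(2) e by simp
    then obtain j where j: "j < p ^ (a + b)" "v (r - of_nat j) \<le> ?e"
      using Rats_approx_nat[OF p r(1)] by blast
    have "c - of_nat j / of_nat p ^ a = (c * of_nat p ^ a - of_nat j) / of_nat p ^ a"
      using p0 by (simp add: field_simps)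
    then have "v (c - of_nat j / of_nat p ^ a) = v (c * of_nat p ^ a - of_nat j) * real p ^ a"
      by (simp add: v_divide v_power p(2) power_one_over)
    also have "\<dots> \<le> ?e * real p ^ a"
      using v_diff_trans[of "c * of_nat p ^ a" "of_nat j" r] r(2) j(2) p1
      by (intro mult_right_mono) auto
    also have "\<dots> = (1 / real p) ^ b"
      using p1 by (simp add: power_add power_one_over)
    finally show ?thesis
      using b j(1) by force
  qed
  then show "\<exists>T. finite T \<and> (\<forall>z\<in>Qp. v z \<le> R \<longrightarrow> (\<exists>t\<in>T. v (z - t) \<le> d))"
    by (intro exI[of _ ?T]) auto
qed

lemma Qp_zero: "0 \<in> Qp" and Qp_one: "1 \<in> Qp"
  using Rats_Qp[of 0] Rats_Qp[of 1] by auto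

lemma Qp_span_add: "x \<in> Qp_span B \<Longrightarrow> y \<in> Qp_span B \<Longrightarrow> x + y \<in> Qp_span B"
proof -
  assume "x \<in> Qp_span B" "y \<in> Qp_span B"
  then obtain c d where "x = (\<Sum>b\<in>B. c b * b)" "\<forall>b\<in>B. c b \<in> Qp"
    "y = (\<Sum>b\<in>B. d b * b)" "\<forall>b\<in>B. d b \<in> Qp"
    unfolding Qp_span_def by blast
  then show ?thesis
    unfolding Qp_span_def
    by (auto intro!: exI[of _ "\<lambda>b. c b + d b"] Qp_add simp: sum.distrib distrib_right)
qed

lemma Qp_span_scale: "x \<in> Qp_span B \<Longrightarrow> a \<in> Qp \<Longrightarrow> a * x \<in> Qp_span B"
proof -
  assume "x \<in> Qp_span B" "a \<in> Qp"
  moreover from this obtain c where "x = (\<Sum>b\<in>B. c b * b)" "\<forall>b\<in>B. c b \<in> Qp"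
    unfolding Qp_span_def by blast
  ultimately show ?thesis
    unfolding Qp_span_def
    by (auto intro!: exI[of _ "\<lambda>b. a * c b"] Qp_mult simp: sum_distrib_left mult.assoc)
qed

lemma Qp_span_diff: "x \<in> Qp_span B \<Longrightarrow> y \<in> Qp_span B \<Longrightarrow> x - y \<in> Qp_span B"
  using Qp_span_add[of x B "-1 * y"] Qp_span_scale[of y B "-1"] Qp_minus[OF Qp_one] by simp

lemma Qp_span_zero: "0 \<in> Qp_span B"
  unfolding Qp_span_def by (auto intro!: exI[of _ "\<lambda>_. 0"] Qp_zero)

lemma Qp_span_base: "finite B \<Longrightarrow> b \<in> B \<Longrightarrow> b \<in> Qp_span B"
  unfolding Qp_span_def
  by (auto intro!: exI[of _ "\<lambda>x. if x = b then 1 else 0"] Qp_zero Qp_one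
      simp: if_distrib[of "\<lambda>x. x * _"] cong: if_cong)

lemma Qp_span_sum: "(\<And>i. i \<in> I \<Longrightarrow> f i \<in> Qp_span B) \<Longrightarrow> sum f I \<in> Qp_span B"
  by (induction I rule: infinite_finite_induct) (auto intro: Qp_span_zero Qp_span_add)

lemma Qp_span_insert:
  assumes "finite B" "b \<notin> B"
  shows "Qp_span (insert b B) = {y + c * b |y c. y \<in> Qp_span B \<and> c \<in> Qp}"
proof (intro equalityI subsetI)
  fix z assume "z \<in> Qp_span (insert b B)"
  then obtain c where c: "z = (\<Sum>x\<in>insert b B. c x * x)" "\<forall>x\<in>insert b B. c x \<in> Qp"
    unfolding Qp_span_def by blast
  then have "z = (\<Sum>x\<in>B. c x * x) + c b * b"
    using assms by simp
  then show "z \<in> {y + c * b |y c. y \<in> Qp_span B \<and> c \<in> Qp}"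
    using c(2) unfolding Qp_span_def by blast
next
  fix z assume "z \<in> {y + c * b |y c. y \<in> Qp_span B \<and> c \<in> Qp}"
  then obtain c d where c: "z = (\<Sum>x\<in>B. c x * x) + d * b" "\<forall>x\<in>B. c x \<in> Qp" "d \<in> Qp"
    unfolding Qp_span_def by blast
  have "(\<Sum>x\<in>insert b B. (c(b := d)) x * x) = d * b + (\<Sum>x\<in>B. (c(b := d)) x * x)"
    using assms by simp
  also have "(\<Sum>x\<in>B. (c(b := d)) x * x) = (\<Sum>x\<in>B. c x * x)"
    using assms by (intro sum.cong) auto
  finally show "z \<in> Qp_span (insert b B)"
    using c unfolding Qp_span_def by (auto intro!: exI[of _ "c(b := d)"])
qed

text \<open>The induction adds one basis vector at a time: a complete subspace is closed, so a vector
  outside has positive distance from it, which bounds the coordinates.\<close>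

lemma finite_dim_Qp:
  assumes "finite B" and lin: "Qp_linear f"
  shows "v_complete (Qp_span B) \<and> v_totally_bounded (Qp_span B) \<and>
    (\<exists>C>0. \<forall>x\<in>Qp_span B. v (f x) \<le> C * v x)"
  using assms(1)
proof (induction B rule: finite_induct)
  case empty
  have "f 0 = 0"
    using lin unfolding Qp_linear_def by (metis add_cancel_right_right)
  moreover have "Qp_span {} = {0}"
    by (simp add: Qp_span_def)
  moreover have "v_complete {0}"
    by (simp add: v_complete_def)
  moreover have "v_totally_bounded {0}"
    unfolding v_totally_bounded_def by (metis diff_self finite.simps less_imp_le singletonD v_zero insertI1)
  moreover have "(0 :: real) < 1"
    by simp
  ultimately show ?case
    by (metis mult.left_neutral order_refl singletonD v_zero)
next
  case (insert b B)
  let ?V = "Qp_span B" and ?W = "Qp_span (insert b B)"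
  note IHc = insert.IH[THEN conjunct1] and IHt = insert.IH[THEN conjunct2, THEN conjunct1]
  obtain C where C: "C > 0" "\<And>x. x \<in> ?V \<Longrightarrow> v (f x) \<le> C * v x"
    using insert.IH by blast
  have W: "?W = {y + c * b |y c. y \<in> ?V \<and> c \<in> Qp}"
    using insert.hyps by (rule Qp_span_insert)
  show ?case
  proof (cases "b \<in> ?V")
    case True
    have "y + c * b \<in> ?V" if "y \<in> ?V" "c \<in> Qp" for y c
      using that True by (intro Qp_span_add Qp_span_scale)
    moreover have "y \<in> ?W" if "y \<in> ?V" for y
      unfolding W using that Qp_zero by force
    ultimately have "?W = ?V"
      unfolding W by blast
    then show ?thesis
      using insert.IH by simp
  next
    case False
    have "\<exists>d>0. \<forall>y\<in>?V. d \<le> v (b + y)"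
    proof (rule ccontr)
      assume "\<not> ?thesis"
      then have "\<exists>y\<in>?V. v (b + y) < 1 / real (Suc n)" for n
        using spec[where x="1 / real (Suc n)"] by (metis not_le of_nat_0_less_iff zero_less_Suc zero_less_divide_1_iff)
      then obtain X where X: "X n \<in> ?V" "v (b + X n) < 1 / real (Suc n)" for n
        by metis
      have "\<exists>M. \<forall>m\<ge>M. \<forall>n\<ge>M. v (X m - X n) < e" if e: "e > 0" for e
      proof -
        obtain M where M: "1 / real (Suc M) < e"
          using nat_approx_posE[OF e] by metis
        have "v (X m - X n) < e" if "m \<ge> M" "n \<ge> M" for m n
        proof -
          have "v (b + X k) < e" if "k \<ge> M" for k
          proof -
            have "1 / real (Suc k) \<le> 1 / real (Suc M)"
              using that by (intro divide_left_mono) auto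
            then show ?thesis
              using X(2)[of k] M by linarith
          qed
          from this[of m] this[of n] show ?thesis
            using v_diff[of "b + X m" "b + X n"] that by simp
        qed
        then show ?thesis by blast
      qed
      then obtain y where y: "y \<in> ?V" "(\<lambda>n. v (X n - y)) \<longlonglongrightarrow> 0"
        using IHc X(1) unfolding v_complete_def by blast
      have "(\<lambda>n. max (v (b + X n)) (v (X n - y))) \<longlonglongrightarrow> max 0 0"
      proof (intro tendsto_max y(2))
        show "(\<lambda>n. v (b + X n)) \<longlonglongrightarrow> 0"
          by (rule tendsto_sandwich[OF _ _ tendsto_const lim_1_over_n[THEN LIMSEQ_Suc]])
            (auto simp: v_nonneg intro!: always_eventually less_imp_le[OF X(2)[simplified]])
      qed
      moreover have "v (b + y) \<le> max (v (b + X n)) (v (X n - y))" for n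
        using v_diff[of "b + X n" "X n - y"] by simp
      ultimately have "v (b + y) \<le> 0"
        using LIMSEQ_le_const[of _ "max 0 0 :: real" "v (b + y)"] by auto
      then have "b = - y"
        using v_nonneg[of "b + y"] v_eq_0[of "b + y"] by (simp add: eq_neg_iff_add_eq_0)
      then show False
        using False y(1) Qp_span_diff[OF Qp_span_zero, of y B] by simp
    qed
    then obtain d where d: "d > 0" "\<And>y. y \<in> ?V \<Longrightarrow> d \<le> v (b + y)"
      by blast
    have dist: "d * v c \<le> v (y + c * b)" if "y \<in> ?V" "c \<in> Qp" for y c
    proof (cases "c = 0")
      case False
      have "y + c * b = c * (b + inverse c * y)"
        using False by (simp add: field_simps)
      moreover have "d \<le> v (b + inverse c * y)"
        using that by (intro d(2) Qp_span_scale Qp_inverse)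
      ultimately show ?thesis
        using v_nonneg[of c] by (simp only: v_mult mult.commute[of d] mult_left_mono)
    qed (use v_nonneg in simp)
    \<comment> \<open>\<open>v y\<close> is at most the maximum of \<open>v (y + c * b)\<close> and
      \<open>v (c * b)\<close>, and the latter is at most \<open>v b / d\<close> times the former;
      the 1 covers the first alternative.\<close>
    define K where "K = max 1 (v b / d)"
    have K: "K \<ge> 1" "v b / d \<le> K"
      by (auto simp: K_def)
    have comp: "v c \<le> v (y + c * b) / d" "v y \<le> K * v (y + c * b)"
      if "y \<in> ?V" "c \<in> Qp" for y c
    proof -
      show c: "v c \<le> v (y + c * b) / d"
        using dist[OF that] d(1) by (simp add: field_simps)
      have "v (c * b) \<le> v (y + c * b) / d * v b"
        using c v_nonneg[of b] by (simp only: v_mult mult_right_mono)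
      also have "\<dots> = v b / d * v (y + c * b)"
        by simp
      also have "\<dots> \<le> K * v (y + c * b)"
        using K(2) v_nonneg by (intro mult_right_mono)
      finally have "v (c * b) \<le> K * v (y + c * b)" .
      moreover have "v (y + c * b) \<le> K * v (y + c * b)"
        using K(1) v_nonneg[of "y + c * b"] by (simp add: mult_le_cancel_right1)
      ultimately show "v y \<le> K * v (y + c * b)"
        using v_diff[of "y + c * b" "c * b"] by simp
    qed
    have "v_complete ?W"
      unfolding v_complete_def
    proof (intro allI impI)
      fix X assume "\<forall>n::nat. X n \<in> ?W"
        and cauchy: "\<forall>e>0. \<exists>M. \<forall>m\<ge>M. \<forall>n\<ge>M. v (X m - X n) < e"
      then obtain Y c where Yc: "\<And>n. Y n \<in> ?V" "\<And>n. c n \<in> Qp" "\<And>n. X n = Y n + c n * b"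
        unfolding W mem_Collect_eq by metis
      have diff: "X m - X n = (Y m - Y n) + (c m - c n) * b" for m n
        by (simp add: Yc(3) algebra_simps)
      have mem: "Y m - Y n \<in> ?V" "c m - c n \<in> Qp" for m n
        using Yc Qp_span_diff Qp_add[OF Yc(2) Qp_minus[OF Yc(2)]] by auto
      have "\<forall>e>0. \<exists>M. \<forall>m\<ge>M. \<forall>n\<ge>M. v (c m - c n) < e"
      proof (intro allI impI)
        fix e :: real assume "e > 0"
        then have "e * d > 0"
          using d(1) by simp
        then obtain M where M: "\<forall>m\<ge>M. \<forall>n\<ge>M. v (X m - X n) < e * d"
          using cauchy by blast
        have "v (c m - c n) < e" if "m \<ge> M" "n \<ge> M" for m n
        proof -
          have "v (c m - c n) \<le> v (X m - X n) / d"
            using comp(1)[OF mem] by (simp add: diff)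
          also have "\<dots> < e"
            using M that d(1) by (simp add: field_simps)
          finally show ?thesis .
        qed
        then show "\<exists>M. \<forall>m\<ge>M. \<forall>n\<ge>M. v (c m - c n) < e"
          by blast
      qed
      then obtain c' where c': "c' \<in> Qp" "(\<lambda>n. v (c n - c')) \<longlonglongrightarrow> 0"
        using Qp_complete' Yc(2) unfolding v_complete_def by blast
      have "\<forall>e>0. \<exists>M. \<forall>m\<ge>M. \<forall>n\<ge>M. v (Y m - Y n) < e"
      proof (intro allI impI)
        fix e :: real assume "e > 0"
        then have "e / K > 0"
          using K(1) by simp
        then obtain M where M: "\<forall>m\<ge>M. \<forall>n\<ge>M. v (X m - X n) < e / K"
          using cauchy by blast
        have "v (Y m - Y n) < e" if "m \<ge> M" "n \<ge> M" for m n
        proof -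
          have "v (Y m - Y n) \<le> K * v (X m - X n)"
            using comp(2)[OF mem] by (simp add: diff)
          also have "\<dots> < e"
            using M that K(1) by (simp add: field_simps)
          finally show ?thesis .
        qed
        then show "\<exists>M. \<forall>m\<ge>M. \<forall>n\<ge>M. v (Y m - Y n) < e"
          by blast
      qed
      then obtain y where y: "y \<in> ?V" "(\<lambda>n. v (Y n - y)) \<longlonglongrightarrow> 0"
        using IHc Yc(1) unfolding v_complete_def by blast
      have "(\<lambda>n. max (v (Y n - y)) (v (c n - c') * v b)) \<longlonglongrightarrow> max 0 (0 * v b)"
        by (intro tendsto_max tendsto_mult y(2) c'(2) tendsto_const)
      then have "(\<lambda>n. max (v (Y n - y)) (v (c n - c') * v b)) \<longlonglongrightarrow> 0"
        by simp
      from _ _ tendsto_const this have "(\<lambda>n. v (X n - (y + c' * b))) \<longlonglongrightarrow> 0"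
      proof (rule tendsto_sandwich)
        have "v (X n - (y + c' * b)) \<le> max (v (Y n - y)) (v (c n - c') * v b)" for n
          using v_add[of "Y n - y" "(c n - c') * b"] unfolding v_mult[symmetric] by (simp add: Yc(3) algebra_simps)
        then show "\<forall>\<^sub>F n in sequentially.
            v (X n - (y + c' * b)) \<le> max (v (Y n - y)) (v (c n - c') * v b)"
          by simp
      qed (simp add: v_nonneg)
      then show "\<exists>x\<in>?W. (\<lambda>n. v (X n - x)) \<longlonglongrightarrow> 0"
        unfolding W using y(1) c'(1) by blast
    qed
    moreover have "v_totally_bounded ?W"
      unfolding v_totally_bounded_def
    proof (intro allI impI)
      fix R e :: real assume e: "e > 0"
      have "e / (v b + 1) > 0"
        using e v_nonneg[of b] by simp
      then obtain T where T: "finite T" "\<And>c. c \<in> Qp \<Longrightarrow> v c \<le> R / d \<Longrightarrow> \<exists>t\<in>T. v (c - t) \<le> e / (v b + 1)"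
        using Qp_totally_bounded unfolding v_totally_bounded_def by meson
      obtain U where U: "finite U" "\<And>y. y \<in> ?V \<Longrightarrow> v y \<le> K * R \<Longrightarrow> \<exists>u\<in>U. v (y - u) \<le> e"
        using IHt e unfolding v_totally_bounded_def by meson
      let ?S = "(\<lambda>(u, t). u + t * b) ` (U \<times> T)"
      have "\<exists>s\<in>?S. v (z - s) \<le> e" if z: "z \<in> ?W" "v z \<le> R" for z
      proof -
        obtain y c where yc: "y \<in> ?V" "c \<in> Qp" "z = y + c * b"
          using z(1) unfolding W by blast
        have "v c \<le> R / d"
          using comp(1)[OF yc(1,2), folded yc(3)] divide_right_mono[OF z(2), of d] d(1) by linarith
        then obtain t where t: "t \<in> T" "v (c - t) \<le> e / (v b + 1)"
          using T(2) yc(2) by blast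
        have "v y \<le> K * R"
          using comp(2)[OF yc(1,2), folded yc(3)] z(2) K(1) mult_left_mono[of "v z" R K] by linarith
        then obtain u where u: "u \<in> U" "v (y - u) \<le> e"
          using U(2) yc(1) by blast
        have "v ((c - t) * b) \<le> e / (v b + 1) * v b"
          using t(2) v_nonneg by (simp only: v_mult mult_right_mono)
        also have "\<dots> \<le> e"
          using e v_nonneg[of b] by (simp add: field_simps)
        finally have "v ((c - t) * b) \<le> e" .
        moreover have "z - (u + t * b) = (y - u) + (c - t) * b"
          by (simp add: yc(3) algebra_simps)
        ultimately have "v (z - (u + t * b)) \<le> e"
          using v_add[of "y - u" "(c - t) * b"] u(2) by (metis max.boundedI order_trans)
        then show ?thesis
          using t(1) u(1) by force
      qed
      then show "\<exists>T. finite T \<and> (\<forall>z\<in>?W. v z \<le> R \<longrightarrow> (\<exists>t\<in>T. v (z - t) \<le> e))"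
        using T(1) U(1) by (intro exI[of _ ?S]) auto
    qed
    moreover have "\<exists>C>0. \<forall>x\<in>?W. v (f x) \<le> C * v x"
    proof -
      \<comment> \<open>\<open>C * K\<close> bounds the contribution of \<open>f y\<close>, and
        \<open>v (f b) / d\<close> that of \<open>c * f b\<close>.\<close>
      define C' where "C' = max (C * K) (v (f b) / d)"
      have "v (f x) \<le> C' * v x" if x: "x \<in> ?W" for x
      proof -
        obtain y c where yc: "y \<in> ?V" "c \<in> Qp" "x = y + c * b"
          using x unfolding W by blast
        have fx: "f x = f y + c * f b"
          using lin yc unfolding Qp_linear_def by simp
        have "v (f y) \<le> C * (K * v x)"
          using C(2)[OF yc(1)] comp(2)[OF yc(1,2), folded yc(3)] C(1) mult_left_mono[of "v y" "K * v x" C]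
          by linarith
        also have "\<dots> \<le> C' * v x"
          using v_nonneg[of x] mult_right_mono[of "C * K" C' "v x"] by (simp add: C'_def mult.assoc)
        finally have 1: "v (f y) \<le> C' * v x" .
        have "v (c * f b) \<le> v x / d * v (f b)"
          using comp(1)[OF yc(1,2)] v_nonneg yc(3) by (simp only: v_mult mult_right_mono)
        also have "\<dots> \<le> C' * v x"
          using v_nonneg[of x] mult_right_mono[of "v (f b) / d" C' "v x"] by (simp add: C'_def mult.commute)
        finally have "v (c * f b) \<le> C' * v x" .
        with 1 show ?thesis
          using v_add[of "f y" "c * f b"] by (simp add: fx)
      qed
      moreover have "C' > 0"
        using C(1) K(1) by (simp add: C'_def less_max_iff_disj)
      ultimately show ?thesis by blast
    qed
    ultimately show ?thesis by blast
  qed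
qed

end

context padic_field begin

section \<open>Finite extensions and the invariance of the absolute value\<close>

lemma F_add: "x \<in> F \<Longrightarrow> y \<in> F \<Longrightarrow> x + y \<in> F"
  and F_mult: "x \<in> F \<Longrightarrow> y \<in> F \<Longrightarrow> x * y \<in> F"
  and F_minus: "x \<in> F \<Longrightarrow> - x \<in> F"
  and F_inverse: "x \<in> F \<Longrightarrow> inverse x \<in> F"
  and F_zero: "0 \<in> F" and F_one: "1 \<in> F"
  using F_subfield unfolding is_subfield_def by auto

lemma F_diff: "x \<in> F \<Longrightarrow> y \<in> F \<Longrightarrow> x - y \<in> F"
  using F_add[of x "- y"] F_minus by simp

lemma F_divide: "x \<in> F \<Longrightarrow> y \<in> F \<Longrightarrow> x / y \<in> F"
  using F_mult[of x "inverse y"] F_inverse by (simp add: divide_inverse)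

lemma F_finite_span: obtains E where "E \<subseteq> F" "finite E" "F \<subseteq> Qp_span E"
proof -
  obtain E where "E \<subseteq> F" "finite E"
    "\<forall>x\<in>F. \<exists>c. (\<forall>e\<in>E. c e \<in> Qp) \<and> x = (\<Sum>e\<in>E. c e * e)"
    using F_finite by blast
  then show ?thesis
    by (intro that[of E]) (auto simp: Qp_span_def)
qed

text \<open>The point is that one finite-dimensional space contains all powers of \<open>x\<close>:
  \<open>x\<close> is algebraic over \<open>F\<close>, and \<open>F\<close> is finite over
  \<open>Qp\<close>. A bound for linear maps on that space is therefore uniform in the
  exponent.\<close>

lemma powers_finite_span: "\<exists>B. finite B \<and> (\<forall>m. x ^ m \<in> Qp_span B)"
proof -
  obtain E where E: "E \<subseteq> F" "finite E" "F \<subseteq> Qp_span E"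
    by (rule F_finite_span)
  obtain f where f: "f \<noteq> 0" "\<And>i. coeff f i \<in> F" "poly f x = 0"
    using algebraic by blast
  define n where "n = degree f"
  define B where "B = (\<lambda>(e, i). e * x ^ i) ` (E \<times> {..<n})"
  have finB: "finite B"
    using E(2) by (simp add: B_def)
  have lc: "coeff f n \<noteq> 0"
    using f(1) by (simp add: n_def)
  have fx: "poly f x = (\<Sum>i<n. coeff f i * x ^ i) + coeff f n * x ^ n"
    by (simp add: poly_altdef n_def lessThan_Suc_atMost[symmetric])
  have xn: "x ^ n = (\<Sum>i<n. (- coeff f i / coeff f n) * x ^ i)"
  proof -
    have "coeff f n * x ^ n = - (\<Sum>i<n. coeff f i * x ^ i)"
      using f(3) fx by (simp add: eq_neg_iff_add_eq_0 add.commute)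
    then have "x ^ n = - (\<Sum>i<n. coeff f i * x ^ i) / coeff f n"
      using lc by (simp add: field_simps)
    then show ?thesis
      by (simp add: sum_divide_distrib sum_negf)
  qed
  have "\<exists>a. (\<forall>i. a i \<in> F) \<and> x ^ m = (\<Sum>i<n. a i * x ^ i)" for m
  proof (induction m)
    case 0
    show ?case
    proof (cases "n = 0")
      case True
      then have "poly f x = coeff f 0"
        by (simp add: poly_altdef n_def)
      then show ?thesis
        using lc f(3) True by simp
    next
      case False
      then have "(\<Sum>i<n. (if i = 0 then 1 else 0) * x ^ i) = 1"
        by (subst sum.remove[of _ 0]) auto
      then show ?thesis
        by (intro exI[of _ "\<lambda>i. if i = 0 then 1 else 0"]) (auto intro: F_zero F_one)
    qed
  next
    case (Suc m)
    then obtain a where a: "\<And>i. a i \<in> F" "x ^ m = (\<Sum>i<n. a i * x ^ i)"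
      by blast
    show ?case
    proof (cases n)
      case 0
      then show ?thesis
        using a F_zero by (intro exI[of _ "\<lambda>_. 0"]) simp
    next
      case (Suc l)
      \<comment> \<open>Multiplication by \<open>x\<close> shifts the coefficients; the overflow
        \<open>a l * x ^ n\<close> is reduced by the relation \<open>xn\<close>.\<close>
      let ?b = "\<lambda>i. (if i = 0 then 0 else a (i - 1)) + a l * (- coeff f i / coeff f n)"
      have "x ^ Suc m = (\<Sum>i<n. a i * x ^ Suc i)"
        by (simp add: a(2) sum_distrib_left mult_ac)
      also have "\<dots> = (\<Sum>i<l. a i * x ^ Suc i) + a l * x ^ n"
        by (simp add: Suc)
      also have "(\<Sum>i<l. a i * x ^ Suc i) = (\<Sum>i<n. (if i = 0 then 0 else a (i - 1)) * x ^ i)"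
        unfolding Suc by (subst sum.lessThan_Suc_shift) simp
      also have "a l * x ^ n = (\<Sum>i<n. a l * (- coeff f i / coeff f n) * x ^ i)"
        by (subst xn) (simp add: sum_distrib_left mult.assoc)
      finally have "x ^ Suc m = (\<Sum>i<n. ?b i * x ^ i)"
        by (simp only: sum.distrib distrib_right)
      moreover have "?b i \<in> F" for i
        by (intro F_add F_mult F_divide F_minus a(1) f(2)) (simp add: a(1) F_zero)
      ultimately show ?thesis
        by (intro exI[of _ ?b]) blast
    qed
  qed
  moreover have "a * x ^ i \<in> Qp_span B" if a: "a \<in> F" and i: "i < n" for a i
  proof -
    obtain c where c: "a = (\<Sum>e\<in>E. c e * e)" "\<forall>e\<in>E. c e \<in> Qp"
      using a E(3) unfolding Qp_span_def by blast
    have "a * x ^ i = (\<Sum>e\<in>E. c e * (e * x ^ i))"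
      by (simp add: c(1) sum_distrib_right mult.assoc)
    also have "\<dots> \<in> Qp_span B"
    proof (rule Qp_span_sum)
      fix e assume e: "e \<in> E"
      then have "e * x ^ i \<in> B"
        using i by (force simp: B_def)
      then show "c e * (e * x ^ i) \<in> Qp_span B"
        using c(2) e by (intro Qp_span_scale Qp_span_base finB) auto
    qed
    finally show ?thesis .
  qed
  ultimately have "x ^ m \<in> Qp_span B" for m
    using Qp_span_sum[where I = "{..<n}" and B = B] by (metis (no_types, lifting) lessThan_iff)
  with finB show ?thesis by blast
qed

text \<open>Bijectivity is not part of the notion because it follows from algebraicity, see
  \<open>F_hom_galois\<close>; only ring identities then have to be checked when an automorphism is
  constructed.\<close>

definition F_hom :: "('k \<Rightarrow> 'k) \<Rightarrow> bool" where
  "F_hom f \<longleftrightarrow> (\<forall>x y. f (x + y) = f x + f y) \<and> (\<forall>x y. f (x * y) = f x * f y) \<and> (\<forall>x\<in>F. f x = x)"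

lemma F_homD:
  assumes "F_hom f"
  shows "f (x + y) = f x + f y" "f (x * y) = f x * f y" "x \<in> F \<Longrightarrow> f x = x"
    "f 0 = 0" "f 1 = 1" "f (- x) = - f x" "f (x - y) = f x - f y" "f (x ^ n) = f x ^ n"
proof -
  show add: "f (x + y) = f x + f y" for x y
    using assms by (auto simp: F_hom_def)
  show mult: "f (x * y) = f x * f y" for x y
    using assms by (auto simp: F_hom_def)
  show id: "x \<in> F \<Longrightarrow> f x = x" for x
    using assms by (auto simp: F_hom_def)
  show zero: "f 0 = 0" and one: "f 1 = 1"
    by (simp_all add: id F_zero F_one)
  show neg: "f (- x) = - f x" for x
    using add[of x "- x"] zero by (simp add: eq_neg_iff_add_eq_0 add.commute)
  show "f (x - y) = f x - f y"
    using add[of x "- y"] neg by simp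
  show "f (x ^ n) = f x ^ n"
    by (induction n) (simp_all add: one mult)
qed

text \<open>A power trick. \<open>f\<close> is \<open>Qp\<close>-linear, hence bounded by some
  \<open>C\<close> on the span of the powers of \<open>x\<close>, so
  \<open>(v (f x) / v x) ^ m \<le> C\<close> for every \<open>m\<close>; this forces the quotient to
  be at most 1. In this way \<open>v\<close> is seen to be compatible with Galois automorphisms,
  which the locale does not postulate.\<close>

lemma F_hom_v:
  assumes f: "F_hom f"
  shows "v (f x) \<le> v x"
proof (cases "x = 0")
  case False
  obtain B where B: "finite B" "\<And>m. x ^ m \<in> Qp_span B"
    using powers_finite_span[of x] by (elim exE conjE) simp
  have "Qp_linear f"
    using F_homD[OF f] Qp_subset unfolding Qp_linear_def by auto
  then obtain C where C: "C > 0" "\<forall>x\<in>Qp_span B. v (f x) \<le> C * v x"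
    using finite_dim_Qp[OF B(1)] by blast
  have pos: "v x > 0"
    using False by (rule v_pos)
  have "(v (f x) / v x) ^ m \<le> C" for m
  proof -
    have "v (f x) ^ m \<le> C * v x ^ m"
      using C(2) B(2)[of m] by (metis F_homD(8)[OF f] v_power)
    then show ?thesis
      using pos by (simp add: power_divide field_simps)
  qed
  then have "\<not> v (f x) / v x > 1"
    using real_arch_pow[of "v (f x) / v x" C] by (auto simp: not_less[symmetric])
  then show ?thesis
    using pos by (simp add: field_simps)
qed (use F_homD(4)[OF f] in simp)

section \<open>Congruence modulo the maximal ideal: residue fields through representatives\<close>

definition req :: "'k \<Rightarrow> 'k \<Rightarrow> bool" (infix "\<doteq>" 50) where
  "x \<doteq> y \<longleftrightarrow> v (x - y) < 1"

lemma req_refl [simp]: "x \<doteq> x"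
  by (simp add: req_def)

lemma req_sym: "x \<doteq> y \<Longrightarrow> y \<doteq> x"
  by (simp add: req_def v_minus_commute)

lemma req_trans [trans]: "x \<doteq> y \<Longrightarrow> y \<doteq> z \<Longrightarrow> x \<doteq> z"
  using v_diff_trans[of x z y] by (auto simp: req_def)

lemma req_add: "x \<doteq> y \<Longrightarrow> z \<doteq> w \<Longrightarrow> x + z \<doteq> y + w"
  using v_add[of "x - y" "z - w"] by (auto simp: req_def algebra_simps)

lemma req_minus: "x \<doteq> y \<Longrightarrow> - x \<doteq> - y"
  by (simp add: req_def v_minus_commute)

lemma req_diff: "x \<doteq> y \<Longrightarrow> z \<doteq> w \<Longrightarrow> x - z \<doteq> y - w"
  using req_add[of x y "- z" "- w"] req_minus[of z w] by simp

text \<open>\<open>x * z - y * w = x * (z - w) + w * (x - y)\<close>. The congruence is compatible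
  with products only among integral elements, and this decomposition asks for integrality of
  \<open>x\<close> and \<open>w\<close>.\<close>

lemma req_mult:
  assumes "x \<doteq> y" "z \<doteq> w" "v x \<le> 1" "v w \<le> 1"
  shows "x * z \<doteq> y * w"
proof -
  have "v (x * (z - w)) < 1" "v (w * (x - y)) < 1"
    using assms v_nonneg mult_left_le_one_le[of "v (z - w)" "v x"] mult_left_le_one_le[of "v (x - y)" "v w"]
    by (fastforce simp: v_mult req_def intro: le_less_trans)+
  then show ?thesis
    using v_add[of "x * (z - w)" "w * (x - y)"] by (simp add: req_def algebra_simps)
qed

lemma v_power_le: "v x \<le> 1 \<Longrightarrow> v (x ^ n) \<le> 1"
  using v_nonneg[of x] by (simp add: v_power power_le_one)

lemma v_mult_le: "v x \<le> 1 \<Longrightarrow> v y \<le> 1 \<Longrightarrow> v (x * y) \<le> 1"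
  using v_nonneg[of x] v_nonneg[of y] by (simp add: v_mult mult_le_one)

lemma req_v_le: "x \<doteq> y \<Longrightarrow> v x \<le> 1 \<Longrightarrow> v y \<le> 1"
  using v_diff[of x "x - y"] by (auto simp: req_def)

lemma req_power: "x \<doteq> y \<Longrightarrow> v x \<le> 1 \<Longrightarrow> x ^ n \<doteq> y ^ n"
  by (induction n) (auto intro!: req_mult v_power_le intro: req_v_le)

lemma req_sum: "(\<And>i. i \<in> A \<Longrightarrow> f i \<doteq> g i) \<Longrightarrow> sum f A \<doteq> sum g A"
  using v_sum_less[of A "\<lambda>i. f i - g i" 1] by (simp add: req_def sum_subtractf)

lemma v_add_le: "v x \<le> 1 \<Longrightarrow> v y \<le> 1 \<Longrightarrow> v (x + y) \<le> 1"
  using v_add[of x y] by simp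

lemma req_zero: "x \<doteq> 0 \<longleftrightarrow> v x < 1"
  by (simp add: req_def)

lemma req_mult_zero: "x * y \<doteq> 0 \<Longrightarrow> v x \<le> 1 \<Longrightarrow> v y \<le> 1 \<Longrightarrow> x \<doteq> 0 \<or> y \<doteq> 0"
  by (auto simp: req_zero v_mult not_less intro: antisym)

text \<open>Over the residue field a nonzero polynomial has at most as many roots as its degree. The
  usual proof is run on representatives: synthetic division splits off one root \<open>s\<close>,
  and \<open>t - s\<close> is a unit for every other root \<open>t\<close>.\<close>

lemma poly_residue_zero:
  assumes "finite S" "\<And>s. s \<in> S \<Longrightarrow> v s \<le> 1" "\<And>s t. s \<in> S \<Longrightarrow> t \<in> S \<Longrightarrow> s \<noteq> t \<Longrightarrow> \<not> s \<doteq> t"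
    and "\<And>i. v (coeff G i) \<le> 1" "degree G < card S" "\<And>s. s \<in> S \<Longrightarrow> poly G s \<doteq> 0"
  shows "coeff G i \<doteq> 0"
  using assms
proof (induction S arbitrary: G i rule: finite_induct)
  case (insert s S)
  define H where "H = synthetic_div G s"
  have G: "G = [:- s, 1:] * H + [:poly G s:]"
    unfolding H_def by (rule synthetic_div_correct'[symmetric])
  have vs: "v s \<le> 1"
    using insert.prems(1) by simp
  have poly_le: "v (poly p s) \<le> 1" if "\<And>i. v (coeff p i) \<le> 1" for p
    unfolding poly_altdef using that by (intro v_sum_le v_mult_le v_power_le vs) auto
  have synth_le: "v (coeff (synthetic_div p s) i) \<le> 1" if "\<And>i. v (coeff p i) \<le> 1" for p i
    using that
  proof (induction p arbitrary: i)
    case (pCons a p)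
    then have p: "v (coeff p i) \<le> 1" for i
      by (metis coeff_pCons_Suc)
    with pCons show ?case
      by (simp add: synthetic_div_pCons coeff_pCons poly_le split: nat.split)
  qed simp
  have H0: "coeff H j \<doteq> 0" for j
  proof (cases "degree G = 0")
    case True
    then have "H = 0"
      by (simp add: H_def synthetic_div_eq_0_iff)
    then show ?thesis by simp
  next
    case False
    show ?thesis
    proof (rule insert.IH)
      show "degree H < card S"
        using False insert.prems(4) insert.hyps by (simp add: H_def degree_synthetic_div)
      show "v (coeff H i) \<le> 1" for i
        unfolding H_def by (intro synth_le insert.prems(3))
      fix t assume t: "t \<in> S"
      then have vt: "v t \<le> 1"
        using insert.prems(1) by simp
      have ts: "\<not> t - s \<doteq> 0"
        using t insert.hyps insert.prems(2)[of t s] by (auto simp: req_def)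
      have "(t - s) * poly H t = poly G t - poly G s"
        by (subst (1) G) (simp add: algebra_simps)
      also have "\<dots> \<doteq> 0 - 0"
        using t insert.prems(5) by (intro req_diff) auto
      finally have "(t - s) * poly H t \<doteq> 0" by simp
      moreover have "v (poly H t) \<le> 1"
        unfolding poly_altdef H_def
        by (intro v_sum_le v_mult_le v_power_le vt synth_le insert.prems(3)) auto
      moreover have "v (t - s) \<le> 1"
        using v_diff[of t s] vt vs by simp
      ultimately show "poly H t \<doteq> 0"
        using ts req_mult_zero by blast
    qed (use insert.prems in auto)
  qed
  have "coeff G i = - s * coeff H i + (if i = 0 then 0 else coeff H (i - 1)) + coeff [:poly G s:] i"
    by (subst G) (simp add: coeff_pCons split: nat.split)
  also have "\<dots> \<doteq> - s * 0 + 0 + 0"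
    using H0 insert.prems(5)[of s] vs
    by (intro req_add req_mult) (auto simp: coeff_pCons split: nat.split)
  finally show ?case by simp
qed simp

text \<open>Total boundedness at radius 1/2; any radius below 1 turns the non-strict estimate into a
  congruence.\<close>

lemma Qp_span_residues:
  assumes "finite B"
  shows "\<exists>U. finite U \<and> (\<forall>x\<in>Qp_span B. v x \<le> 1 \<longrightarrow> (\<exists>t\<in>U. x \<doteq> t))"
proof -
  have "Qp_linear id"
    by (simp add: Qp_linear_def)
  then have "v_totally_bounded (Qp_span B)"
    using finite_dim_Qp[OF assms] by blast
  moreover have "(1/2 :: real) > 0"
    by simp
  ultimately obtain U where U: "finite U" "\<forall>x\<in>Qp_span B. v x \<le> 1 \<longrightarrow> (\<exists>t\<in>U. v (x - t) \<le> 1/2)"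
    unfolding v_totally_bounded_def by blast
  then show ?thesis
    by (intro exI[of _ U]) (force simp: req_def)
qed

definition residue_system :: "'k set \<Rightarrow> bool" where
  "residue_system T \<longleftrightarrow> finite T \<and> card T = residue_card F v \<and> T \<subseteq> F \<and> (\<forall>t\<in>T. v t \<le> 1) \<and>
     (\<forall>s\<in>T. \<forall>t\<in>T. s \<doteq> t \<longrightarrow> s = t) \<and> (\<forall>x\<in>F. v x \<le> 1 \<longrightarrow> (\<exists>t\<in>T. x \<doteq> t))"

lemma residue_systemD:
  assumes "residue_system T"
  shows "finite T" "card T = residue_card F v" "T \<subseteq> F" "\<And>t. t \<in> T \<Longrightarrow> v t \<le> 1"
    "\<And>s t. s \<in> T \<Longrightarrow> t \<in> T \<Longrightarrow> s \<doteq> t \<Longrightarrow> s = t"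
    "\<And>x. x \<in> F \<Longrightarrow> v x \<le> 1 \<Longrightarrow> \<exists>t\<in>T. x \<doteq> t"
  using assms unfolding residue_system_def by blast+

text \<open>The content is that the residue field is finite, so that \<open>residue_card\<close> is
  its true cardinality: \<open>F\<close> lies in a finite-dimensional space over \<open>Qp\<close>,
  whose integers fall into finitely many classes.\<close>

lemma residue_system_exists:
  obtains T where "residue_system T"
proof -
  define R where "R = {x \<in> F. v x \<le> 1}"
  define r where "r = {(x, y). x \<in> R \<and> y \<in> R \<and> v (x - y) < 1}"
  have card: "residue_card F v = card (R // r)"
    by (simp add: residue_card_def R_def r_def)
  have eq: "equiv R r"
  proof (rule equivI)
    show "r \<subseteq> R \<times> R" "refl_on R r"
      by (auto simp: r_def refl_on_def)
    show "sym r"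
      by (auto simp: r_def sym_def v_minus_commute)
    show "trans r"
      unfolding trans_def r_def using req_trans by (simp add: req_def) blast
  qed
  obtain E where "E \<subseteq> F" and E: "finite E" "F \<subseteq> Qp_span E"
    by (rule F_finite_span)
  obtain U where U: "finite U" "\<forall>x\<in>Qp_span E. v x \<le> 1 \<longrightarrow> (\<exists>t\<in>U. x \<doteq> t)"
    using Qp_span_residues[OF E(1)] by (elim exE conjE)
  \<comment> \<open>The approximating points \<open>t\<close> need not lie in \<open>F\<close>, but
    a residue class of \<open>F\<close> is recovered from any \<open>t\<close> to which one of its
    members is congruent.\<close>
  have "R // r \<subseteq> (\<lambda>t. {z \<in> R. z \<doteq> t}) ` U"
  proof
    fix C assume "C \<in> R // r"
    then obtain x where x: "C = r `` {x}" "x \<in> R"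
      by (rule quotientE)
    then have "x \<in> Qp_span E" "v x \<le> 1"
      using E(2) by (auto simp: R_def)
    then obtain t where t: "t \<in> U" "x \<doteq> t"
      using U(2) by blast
    then have "x \<doteq> z \<longleftrightarrow> z \<doteq> t" for z
      using req_trans[of z x t] req_trans[of x t z] req_sym[of x z] req_sym[of z t] by blast
    then have "C = {z \<in> R. z \<doteq> t}"
      using x by (auto simp: r_def req_def[symmetric])
    with t show "C \<in> (\<lambda>t. {z \<in> R. z \<doteq> t}) ` U" by blast
  qed
  then have fin: "finite (R // r)"
    using U(1) finite_surj by blast
  define g where "g = (\<lambda>C. SOME x. x \<in> (C :: 'k set))"
  have g: "g C \<in> C" if "C \<in> R // r" for C
    using in_quotient_imp_non_empty[OF eq that] unfolding g_def by (simp add: some_in_eq)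
  have sub: "C \<subseteq> R" if "C \<in> R // r" for C
    using that eq in_quotient_imp_subset by blast
  have inj: "C = D" if "C \<in> R // r" "D \<in> R // r" "g C \<doteq> g D" for C D
  proof -
    have "(g C, g D) \<in> r"
      using that(3) g[OF that(1)] g[OF that(2)] sub[OF that(1)] sub[OF that(2)]
      by (auto simp: r_def req_def)
    then show ?thesis
      by (rule quotient_eqI[OF eq that(1,2) g[OF that(1)] g[OF that(2)]])
  qed
  show ?thesis
  proof (rule that[of "g ` (R // r)"], unfold residue_system_def, intro conjI ballI impI)
    show "card (g ` (R // r)) = residue_card F v"
      unfolding card by (rule card_image) (rule inj_onI, rule inj, auto)
    show "\<exists>t\<in>g ` (R // r). x \<doteq> t" if "x \<in> F" "v x \<le> 1" for x
    proof -
      have x: "x \<in> R"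
        using that by (simp add: R_def)
      then have C: "r `` {x} \<in> R // r"
        by (rule quotientI)
      then have "(x, g (r `` {x})) \<in> r"
        using g by blast
      then show ?thesis
        using C by (auto simp: r_def req_def)
    qed
    show "s = t" if "s \<in> g ` (R // r)" "t \<in> g ` (R // r)" "s \<doteq> t" for s t
      using that inj by blast
    have "g C \<in> R" if "C \<in> R // r" for C
      using g sub that by blast
    then show "g ` (R // r) \<subseteq> F" "\<And>t. t \<in> g ` (R // r) \<Longrightarrow> v t \<le> 1"
      by (auto simp: R_def)
  qed (use fin in simp)
qed

lemma residue_card_ge_2: "residue_card F v \<ge> 2"
proof -
  obtain T where "residue_system T"
    by (rule residue_system_exists)
  note T = residue_systemD[OF this]
  obtain a b where "a \<in> T" "0 \<doteq> a" "b \<in> T" "1 \<doteq> b"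
    using T(6)[of 0] T(6)[of 1] F_zero F_one by auto
  moreover have "a \<noteq> b"
    using req_trans[of 0 a 1] req_sym[of 1 b] \<open>0 \<doteq> a\<close> \<open>1 \<doteq> b\<close> by (auto simp: req_def)
  ultimately have "card {a, b} = 2" "{a, b} \<subseteq> T"
    by auto
  then show ?thesis
    using T(1,2) card_mono by metis
qed

text \<open>If \<open>v x < 1\<close>, both sides vanish in the residue field. Otherwise
  multiplication by \<open>x\<close> permutes the representatives of the nonzero classes up to
  congruence, and comparing the products gives \<open>x ^ (q - 1)\<close> congruent to 1.\<close>

lemma residue_fermat:
  assumes x: "x \<in> F" "v x \<le> 1"
  shows "x ^ residue_card F v \<doteq> x"
proof (cases "v x < 1")
  case True
  then have "x ^ residue_card F v \<doteq> 0 ^ residue_card F v" "x \<doteq> 0"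
    using x(2) by (auto intro!: req_power simp: req_zero)
  moreover have "residue_card F v \<noteq> 0"
    using residue_card_ge_2 by linarith
  ultimately show ?thesis
    using req_trans[of "x ^ residue_card F v" 0 x] req_sym[of x 0] by (simp add: power_0_left)
next
  case False
  with x have vx: "v x = 1" by simp
  obtain T where "residue_system T"
    by (rule residue_system_exists)
  note T = residue_systemD[OF this]
  obtain z where z: "z \<in> T" "0 \<doteq> z"
    using T(6)[of 0] F_zero by auto
  \<comment> \<open>The class of 0 is represented by some \<open>z\<close>, which need not be 0
    itself.\<close>
  define U where "U = T - {z}"
  have vU: "v t = 1" if "t \<in> U" for t
  proof (rule ccontr)
    assume "v t \<noteq> 1"
    then have "t \<doteq> 0"
      using that T(4)[of t] by (auto simp: U_def req_zero)
    then have "t \<doteq> z"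
      using z(2) by (rule req_trans)
    then show False
      using T(5)[of t z] that z(1) by (simp add: U_def)
  qed
  have cardU: "card U = residue_card F v - 1"
    using z(1) T(1,2) by (simp add: U_def)
  define \<pi> where "\<pi> t = (SOME s. s \<in> T \<and> x * t \<doteq> s)" for t
  have \<pi>: "\<pi> t \<in> T" "x * t \<doteq> \<pi> t" if "t \<in> U" for t
  proof -
    have "x * t \<in> F" "v (x * t) \<le> 1"
      using that x T(3,4) by (auto simp: U_def intro: F_mult v_mult_le)
    then have "\<exists>s. s \<in> T \<and> x * t \<doteq> s"
      using T(6) by blast
    then show "\<pi> t \<in> T" "x * t \<doteq> \<pi> t"
      unfolding \<pi>_def by (metis (mono_tags, lifting) someI_ex)+
  qed
  have \<pi>U: "\<pi> t \<in> U" if "t \<in> U" for t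
  proof -
    have "\<not> \<pi> t \<doteq> 0"
      using \<pi>(2)[OF that] vU[OF that] vx req_trans[of "x * t" "\<pi> t" 0] by (auto simp: req_zero v_mult)
    then show ?thesis
      using \<pi>(1)[OF that] z(2) req_sym[of 0 z] by (auto simp: U_def)
  qed
  have inj: "inj_on \<pi> U"
  proof (rule inj_onI)
    fix s t assume st: "s \<in> U" "t \<in> U" "\<pi> s = \<pi> t"
    then have "x * s \<doteq> x * t"
      using req_trans[OF \<pi>(2)[of s] req_sym[OF \<pi>(2)[of t, folded st(3)]]] by simp
    then have "v x * v (s - t) < 1"
      by (simp add: req_def right_diff_distrib[symmetric] v_mult)
    then have "s \<doteq> t"
      by (simp add: vx req_def)
    then show "s = t"
      using T(5) st by (simp add: U_def)
  qed
  have finU: "finite U"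
    using T(1) by (simp add: U_def)
  have "\<pi> ` U = U"
    using finU inj \<pi>U by (intro card_subset_eq) (auto simp: card_image)
  then have "(\<Prod>t\<in>U. \<pi> t) = (\<Prod>t\<in>U. t)"
    using prod.reindex[OF inj, of "\<lambda>t. t"] by simp
  moreover have "(\<Prod>t\<in>U'. x * t) \<doteq> (\<Prod>t\<in>U'. \<pi> t)" if "U' \<subseteq> U" for U'
    using finite_subset[OF that finU] that
  proof (induction U' rule: finite_induct)
    case (insert t U')
    have "v (\<Prod>t\<in>U'. \<pi> t) \<le> 1"
      unfolding v_prod using insert.prems \<pi>(1) T(4) v_nonneg by (intro prod_le_1) auto
    then show ?case
      using insert \<pi>(2) vU vx by (auto intro!: req_mult simp: v_mult)
  qed simp
  ultimately have "(\<Prod>t\<in>U. x * t) \<doteq> (\<Prod>t\<in>U. t)"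
    by (metis order_refl)
  then have "v ((x ^ card U - 1) * (\<Prod>t\<in>U. t)) < 1"
    by (simp add: req_def prod.distrib left_diff_distrib)
  moreover have "v (\<Prod>t\<in>U. t) = 1"
    unfolding v_prod using vU by simp
  ultimately have "x ^ card U \<doteq> 1"
    by (simp add: v_mult req_def)
  then have "x ^ card U * x \<doteq> 1 * x"
    using vx by (intro req_mult) (auto intro: v_power_le)
  moreover have "Suc (card U) = residue_card F v"
    using cardU residue_card_ge_2 by simp
  ultimately show ?thesis
    by (metis mult_1 power_Suc2)
qed

text \<open>Stated for an arbitrary exponent because it is applied both to the residue cardinality
  and to the residue characteristic.\<close>

lemma frobenius_add_gen:
  assumes "\<And>i. 0 < i \<Longrightarrow> i < q \<Longrightarrow> v (of_nat (q choose i)) < 1" "q > 0" "v x \<le> 1" "v y \<le> 1"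
  shows "(x + y) ^ q \<doteq> x ^ q + y ^ q"
proof -
  have "(x + y) ^ q = (\<Sum>k\<le>q. of_nat (q choose k) * x ^ k * y ^ (q - k))"
    by (rule binomial_ring)
  also have "\<dots> \<doteq> (\<Sum>k\<le>q. if k = q then x ^ q else if k = 0 then y ^ q else 0)"
  proof (rule req_sum)
    fix k assume k: "k \<in> {..q}"
    show "of_nat (q choose k) * x ^ k * y ^ (q - k) \<doteq> (if k = q then x ^ q else if k = 0 then y ^ q else 0)"
    proof (cases "0 < k \<and> k < q")
      case True
      then have "of_nat (q choose k) * (x ^ k * y ^ (q - k)) \<doteq> 0 * (x ^ k * y ^ (q - k))"
        using assms by (intro req_mult) (auto simp: req_zero v_of_nat_le intro!: v_mult_le v_power_le)
      then show ?thesis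
        using True by (simp add: mult.assoc)
    qed (use k assms(2) in auto)
  qed
  also have "(\<Sum>k\<le>q. if k = q then x ^ q else if k = 0 then y ^ q else 0) = x ^ q + y ^ q"
  proof -
    have "{..q} = insert q (insert 0 {0<..<q})"
      using assms(2) by auto
    then show ?thesis
      using assms(2) by simp
  qed
  finally show ?thesis .
qed

text \<open>That \<open>q\<close> is a power of \<open>p\<close> has not been established. Instead,
  by \<open>residue_fermat\<close> the polynomial \<open>(X + 1) ^ q - X ^ q - 1\<close> vanishes in
  the residue field at \<open>q\<close> incongruent points; its degree is below \<open>q\<close>, so
  its coefficients, the inner binomial coefficients, vanish there.\<close>

lemma residue_card_choose:
  assumes "0 < i" "i < residue_card F v"
  shows "v (of_nat (residue_card F v choose i)) < 1"
proof -
  let ?q = "residue_card F v"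
  obtain T where "residue_system T"
    by (rule residue_system_exists)
  note T = residue_systemD[OF this]
  define G :: "'k poly" where "G = (\<Sum>i=1..<?q. monom (of_nat (?q choose i)) i)"
  have coeff: "coeff G i = (if 1 \<le> i \<and> i < ?q then of_nat (?q choose i) else 0)" for i
    by (simp add: G_def coeff_sum coeff_monom)
  have q2: "?q \<ge> 2"
    by (rule residue_card_ge_2)
  have "coeff G i \<doteq> 0"
  proof (rule poly_residue_zero[OF T(1)])
    have "degree G \<le> ?q - 1"
      by (rule degree_le) (auto simp: coeff)
    then show "degree G < card T"
      using T(2) q2 by simp
    show "v (coeff G i) \<le> 1" for i
      by (simp add: coeff v_of_nat_le)
    fix t assume t: "t \<in> T"
    have "{..?q} = insert 0 (insert ?q {1..<?q})"
      using q2 by auto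
    then have "(t + 1) ^ ?q = 1 + (t ^ ?q + (\<Sum>i=1..<?q. of_nat (?q choose i) * t ^ i))"
      using q2 by (subst binomial_ring) simp
    then have "poly G t = (t + 1) ^ ?q - (t ^ ?q + 1)"
      by (simp add: G_def poly_sum poly_monom)
    also have "\<dots> \<doteq> (t + 1) - (t + 1)"
      using t T(3,4) by (intro req_diff req_add residue_fermat v_add_le F_add F_one) auto
    finally show "poly G t \<doteq> 0" by simp
  qed (use T in auto)
  then show ?thesis
    using assms by (simp add: coeff req_zero)
qed

lemma frobenius_add:
  assumes "v x \<le> 1" "v y \<le> 1"
  shows "(x + y) ^ residue_card F v \<doteq> x ^ residue_card F v + y ^ residue_card F v"
  using assms residue_card_ge_2 by (intro frobenius_add_gen residue_card_choose) auto

text \<open>The \<open>q\<close> residue classes of \<open>F\<close> are already roots of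
  \<open>X ^ q - X\<close>; a root in a further class would exceed the degree.\<close>

lemma frobenius_fixed:
  assumes "v e \<le> 1" "e ^ residue_card F v \<doteq> e"
  shows "\<exists>a\<in>F. e \<doteq> a"
proof (rule ccontr)
  assume none: "\<not> ?thesis"
  let ?q = "residue_card F v"
  obtain T where "residue_system T"
    by (rule residue_system_exists)
  note T = residue_systemD[OF this]
  define G :: "'k poly" where "G = monom 1 ?q - monom 1 1"
  have q2: "?q \<ge> 2"
    by (rule residue_card_ge_2)
  have "coeff G ?q \<doteq> 0"
  proof (rule poly_residue_zero[where S = "insert e T"])
    have "e \<notin> T"
      using none T(3) req_refl[of e] by blast
    then have "card (insert e T) = Suc ?q"
      using T(1,2) by simp
    moreover have "degree G \<le> ?q"
      unfolding G_def using q2 by (intro degree_diff_le) (auto simp: degree_monom_le intro: order_trans[OF degree_monom_le])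
    ultimately show "degree G < card (insert e T)" by simp
    show "v (coeff G i) \<le> 1" for i
      by (simp add: G_def coeff_monom)
    show "poly G s \<doteq> 0" if "s \<in> insert e T" for s
    proof -
      have "s ^ ?q \<doteq> s"
        using that assms residue_fermat T(3,4) by blast
      then show ?thesis
        by (simp add: G_def poly_monom req_def)
    qed
    show "\<not> s \<doteq> t" if "s \<in> insert e T" "t \<in> insert e T" "s \<noteq> t" for s t
      using that none T(3) T(5)[of s t] req_sym[of s t] by blast
  qed (use T assms in auto)
  then show False
    using q2 by (simp add: G_def coeff_monom req_zero)
qed

section \<open>Lifting residue classes to roots of unity\<close>

lemma root_of_unity_v:
  assumes "\<zeta> ^ m = 1" "m > 0"
  shows "v \<zeta> = 1"
proof -
  have "v \<zeta> ^ m = 1"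
    using assms(1) by (simp add: v_power[symmetric])
  then show ?thesis
    using assms(2) v_nonneg[of \<zeta>] power_eq_iff_eq_base[of m "v \<zeta>" 1] by simp
qed

text \<open>The cofactor of \<open>\<zeta> - \<eta>\<close> in
  \<open>\<zeta> ^ m - \<eta> ^ m\<close> is congruent to \<open>m * \<eta> ^ (m - 1)\<close>, a
  unit when \<open>m\<close> is prime to the residue characteristic. The latter condition is written
  \<open>v (of_nat m) = 1\<close> throughout.\<close>

lemma root_of_unity_req_eq:
  assumes "\<zeta> ^ m = 1" "\<eta> ^ m = 1" "v (of_nat m) = 1" "\<zeta> \<doteq> \<eta>"
  shows "\<zeta> = \<eta>"
proof (rule ccontr)
  assume ne: "\<zeta> \<noteq> \<eta>"
  have m: "m > 0"
    using assms(3) by (metis gr0I of_nat_0 v_zero zero_neq_one)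
  have v1: "v \<zeta> = 1" "v \<eta> = 1"
    using assms m root_of_unity_v by auto
  have "(\<zeta> - \<eta>) * (\<Sum>i<m. \<eta> ^ (m - Suc i) * \<zeta> ^ i) = 0"
    using assms(1,2) power_diff_sumr2[of \<zeta> m \<eta>] by simp
  then have "(\<Sum>i<m. \<eta> ^ (m - Suc i) * \<zeta> ^ i) = 0"
    using ne by simp
  moreover have "(\<Sum>i<m. \<eta> ^ (m - Suc i) * \<zeta> ^ i) \<doteq> (\<Sum>i<m. \<eta> ^ (m - Suc i) * \<eta> ^ i)"
    using v1 assms(4) by (intro req_sum req_mult req_power) (auto intro: v_power_le)
  moreover have "(\<Sum>i<m. \<eta> ^ (m - Suc i) * \<eta> ^ i) = of_nat m * \<eta> ^ (m - 1)"
    by (simp add: power_add[symmetric])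
  ultimately have "v (of_nat m * \<eta> ^ (m - 1)) < 1"
    by (metis req_sym req_zero)
  then show False
    by (simp add: v_mult v_power v1 assms(3))
qed

text \<open>A Teichmueller lift. The powers of \<open>x\<close> meet finitely many residue classes,
  so some positive power is congruent to 1; the least such exponent \<open>m\<close> is prime to
  \<open>p\<close>, and \<open>X ^ m - 1\<close> splits, so \<open>x\<close> is congruent to one of
  its roots.\<close>

lemma unit_req_root_of_unity:
  assumes x: "v x = 1"
  obtains m \<zeta> where "v (of_nat m) = 1" "\<zeta> ^ m = 1" "x \<doteq> \<zeta>"
proof -
  obtain B where B: "finite B" "\<And>m. x ^ m \<in> Qp_span B"
    using powers_finite_span[of x] by (elim exE conjE) simp
  obtain U where U: "finite U" "\<forall>x\<in>Qp_span B. v x \<le> 1 \<longrightarrow> (\<exists>t\<in>U. x \<doteq> t)"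
    using Qp_span_residues[OF B(1)] by (elim exE conjE)
  have "\<exists>t\<in>U. x ^ n \<doteq> t" for n
    using U(2) B(2)[of n] x by (simp add: v_power)
  then obtain t where t: "\<And>n. t n \<in> U" "\<And>n. x ^ n \<doteq> t n"
    by metis
  have "\<not> inj t"
    using U(1) t(1) by (metis finite_imageD finite_subset image_subsetI infinite_UNIV_nat)
  then obtain i j where ij: "i < j" "t i = t j"
    unfolding inj_on_def by (metis linorder_neqE_nat)
  then have "x ^ i \<doteq> x ^ j"
    using req_trans[OF t(2)[of i] req_sym[OF t(2)[of j, folded ij(2)]]] by simp
  moreover have "x ^ j - x ^ i = x ^ i * (x ^ (j - i) - 1)"
    using ij(1) by (simp add: right_diff_distrib power_add[symmetric])
  ultimately have "v (x ^ (j - i) - 1) < 1"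
    using v_minus_commute[of "x ^ i" "x ^ j"] by (simp add: req_def v_mult v_power x)
  then have ex: "\<exists>m>0. x ^ m \<doteq> 1"
    using ij(1) by (intro exI[of _ "j - i"]) (simp add: req_def)
  define m where "m = (LEAST m. m > 0 \<and> x ^ m \<doteq> 1)"
  have m: "m > 0" "x ^ m \<doteq> 1"
    using LeastI_ex[OF ex] by (simp_all add: m_def)
  have least: "\<not> x ^ l \<doteq> 1" if "l > 0" "l < m" for l
    using that not_less_Least[of l "\<lambda>m. m > 0 \<and> x ^ m \<doteq> 1"] by (simp add: m_def)
  obtain p where p: "prime p" "v (of_nat p) = 1 / real p"
    by (rule residue_char)
  have p1: "p > 1"
    using p(1) by (rule prime_gt_1_nat)
  have "\<not> p dvd m"
  proof
    assume "p dvd m"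
    \<comment> \<open>Frobenius is injective on residues: with \<open>y = x ^ l - 1\<close>, the
      power \<open>y ^ p\<close> is congruent to \<open>x ^ m - 1\<close>, hence to 0, and so
      \<open>x ^ l\<close> is congruent to 1, against the minimality of \<open>m\<close>.\<close>
    then obtain l where l: "m = p * l" by blast
    define y where "y = x ^ l - 1"
    have vy: "v y \<le> 1"
      unfolding y_def using v_diff[of "x ^ l" 1] by (simp add: v_power x)
    have "v (of_nat (p choose i)) < 1" if "0 < i" "i < p" for i
    proof -
      have "p dvd (p choose i)"
        using that p(1) by (intro dvd_choose_prime) auto
      then obtain c where "p choose i = p * c" by blast
      then have "v (of_nat (p choose i)) = v (of_nat c) / real p"
        by (simp add: v_mult p(2))
      also have "\<dots> < 1"
        using v_of_nat_le[of c] p1 by (simp add: divide_less_eq)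
      finally show ?thesis .
    qed
    then have "(y + 1) ^ p \<doteq> y ^ p + 1 ^ p"
      using vy p1 by (intro frobenius_add_gen) auto
    moreover have "(y + 1) ^ p = x ^ m"
      by (simp add: y_def l power_mult[symmetric] mult.commute)
    ultimately have "y ^ p + 1 \<doteq> 1"
      using req_trans[OF req_sym[of "(y + 1) ^ p" "y ^ p + 1"], of 1] m(2) by simp
    then have "v y ^ p < 1"
      by (simp add: req_def v_power)
    then have "x ^ l \<doteq> 1"
      using vy v_nonneg[of y] by (metis less_eq_real_def order_less_irrefl power_one req_def y_def)
    moreover have "l > 0" "l < m"
      using l m(1) p1 by auto
    ultimately show False
      using least by blast
  qed
  then have vm: "v (of_nat m) = 1"
    using v_coprime[OF p, of "int m"] by simp
  define P :: "'k poly" where "P = monom 1 m - 1"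
  have deg: "degree P = m" and lc: "lead_coeff P = 1"
  proof -
    have "degree P = degree (monom (1::'k) m)"
      unfolding P_def diff_conv_add_uminus using m(1)
      by (intro degree_add_eq_left) (simp add: degree_monom_eq)
    then show "degree P = m"
      by (simp add: degree_monom_eq)
    then show "lead_coeff P = 1"
      using m(1) by (simp add: P_def coeff_monom)
  qed
  then have "P \<noteq> 0" by auto
  then obtain A where A: "P = smult (lead_coeff P) (\<Prod>a\<in>#A. [:- a, 1:])"
    using alg_closed_imp_factorization by blast
  have polyP: "poly P y = y ^ m - 1" for y
    by (simp add: P_def poly_monom)
  have polyA: "poly P y = (\<Prod>a\<in>#A. y - a)" for y
    by (subst A) (simp add: lc poly_prod_mset)
  have "v (\<Prod>a\<in>#A. x - a) < 1"
    using m(2) by (simp add: polyA[symmetric] polyP req_def)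
  moreover have "v (\<Prod>a\<in>#A. x - a) \<ge> 1" if "\<And>a. a \<in># A \<Longrightarrow> v (x - a) \<ge> 1"
    using that
  proof (induction A)
    case (add a A)
    then show ?case
      using mult_mono[of 1 "v (x - a)" 1 "v (\<Prod>a\<in>#A. x - a)"] v_nonneg[of "x - a"] by (simp add: v_mult)
  qed simp
  ultimately obtain a where a: "a \<in># A" "x \<doteq> a"
    unfolding req_def by (metis not_le)
  have "poly P a = 0"
    unfolding polyA using a(1) by (simp add: prod_mset_zero_iff)
  then have "a ^ m = 1"
    by (simp add: polyP)
  with vm a(2) show ?thesis
    using that by blast
qed

end

section \<open>Polynomials over a subfield and homomorphisms defined on it\<close>

definition poly_over :: "'a::zero set \<Rightarrow> 'a poly \<Rightarrow> bool" where
  "poly_over D p \<longleftrightarrow> (\<forall>i. coeff p i \<in> D)"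

text \<open>The function is total but constrained only on \<open>D\<close>; \<open>f 0 = 0\<close>
  is listed separately so that \<open>map_poly\<close> acts coefficientwise on every
  polynomial.\<close>

definition hom_on :: "'a::comm_ring_1 set \<Rightarrow> ('a \<Rightarrow> 'a) \<Rightarrow> bool" where
  "hom_on D f \<longleftrightarrow> f 0 = 0 \<and> f 1 = 1 \<and>
     (\<forall>x\<in>D. \<forall>y\<in>D. f (x + y) = f x + f y \<and> f (x * y) = f x * f y)"

context
  fixes D :: "'a::field set"
  assumes D: "is_subfield D"
begin

lemma subfield_closed:
  "x \<in> D \<Longrightarrow> y \<in> D \<Longrightarrow> x + y \<in> D" "x \<in> D \<Longrightarrow> y \<in> D \<Longrightarrow> x * y \<in> D"
  "x \<in> D \<Longrightarrow> - x \<in> D" "x \<in> D \<Longrightarrow> inverse x \<in> D" "0 \<in> D" "1 \<in> D"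
  using D unfolding is_subfield_def by auto

lemma subfield_sum: "(\<And>i. i \<in> I \<Longrightarrow> f i \<in> D) \<Longrightarrow> sum f I \<in> D"
  by (induction I rule: infinite_finite_induct) (auto intro: subfield_closed)

lemma poly_over_add: "poly_over D p \<Longrightarrow> poly_over D q \<Longrightarrow> poly_over D (p + q)"
  by (simp add: poly_over_def subfield_closed)

lemma poly_over_mult: "poly_over D p \<Longrightarrow> poly_over D q \<Longrightarrow> poly_over D (p * q)"
  by (auto simp: poly_over_def coeff_mult intro!: subfield_sum subfield_closed)

lemma poly_over_monom: "a \<in> D \<Longrightarrow> poly_over D (monom a n)"
  by (simp add: poly_over_def coeff_monom subfield_closed)

lemma poly_over_const: "a \<in> D \<Longrightarrow> poly_over D [:a:]"
  using poly_over_monom[of a 0] by (simp add: monom_0)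

lemma poly_over_smult: "a \<in> D \<Longrightarrow> poly_over D p \<Longrightarrow> poly_over D (smult a p)"
  by (simp add: poly_over_def subfield_closed)

lemma poly_over_diff: "poly_over D p \<Longrightarrow> poly_over D q \<Longrightarrow> poly_over D (p - q)"
  using poly_over_add[of p "smult (-1) q"] poly_over_smult[of "-1" q] subfield_closed(3)[of 1] subfield_closed(6)
  by simp

lemma poly_over_pcompose: "poly_over D p \<Longrightarrow> poly_over D q \<Longrightarrow> poly_over D (pcompose p q)"
proof (induction p)
  case (pCons a p)
  then have "a \<in> D" "poly_over D p"
    unfolding poly_over_def by (metis coeff_pCons_0, metis coeff_pCons_Suc)
  with pCons show ?case
    by (auto simp: pcompose_pCons intro!: poly_over_add poly_over_mult poly_over_const)
qed simp

text \<open>Division with remainder, leading term by leading term, keeps the cofactor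
  \<open>h\<close> over \<open>D\<close>. This is what allows a homomorphism of \<open>D\<close> to
  be applied to both factors later.\<close>

lemma minimal_polynomial:
  assumes "g0 \<noteq> 0" "poly_over D g0" "poly g0 x = 0"
  shows "\<exists>f. poly_over D f \<and> lead_coeff f = 1 \<and> poly f x = 0 \<and> degree f > 0 \<and>
    (\<forall>g. poly_over D g \<and> poly g x = 0 \<longrightarrow> (\<exists>h. poly_over D h \<and> g = f * h))"
proof -
  let ?P = "\<lambda>g. g \<noteq> 0 \<and> poly_over D g \<and> poly g x = 0"
  obtain f0 where f0: "?P f0" and min: "\<And>g. ?P g \<Longrightarrow> degree f0 \<le> degree g"
    using ex_has_least_nat[of ?P g0 degree] assms by blast
  define f where "f = smult (inverse (lead_coeff f0)) f0"
  have lc0: "lead_coeff f0 \<noteq> 0"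
    using f0 by simp
  have f: "poly_over D f" "lead_coeff f = 1" "poly f x = 0" "degree f = degree f0"
    using f0 lc0 by (auto simp: f_def poly_over_def subfield_closed)
  have pos: "degree f > 0"
  proof (rule ccontr)
    assume "\<not> degree f > 0"
    then have "f = [:1:]"
      using f(2) degree_eq_zeroE[of f] by fastforce
    then show False
      using f(3) by simp
  qed
  have "\<exists>h. poly_over D h \<and> g = f * h" if "poly_over D g" "poly g x = 0" for g
    using that
  proof (induction "degree g" arbitrary: g rule: less_induct)
    case less
    show ?case
    proof (cases "g = 0")
      case True
      then show ?thesis
        by (intro exI[of _ 0]) (simp add: poly_over_def subfield_closed)
    next
      case False
      have le: "degree f \<le> degree g"
        using min[of g] less.prems False f(4) by simp
      define m where "m = monom (lead_coeff g) (degree g - degree f)"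
      have m: "poly_over D m"
        unfolding m_def using less.prems(1) by (intro poly_over_monom) (simp add: poly_over_def)
      define r where "r = g - f * m"
      have r: "poly_over D r" "poly r x = 0"
        using less.prems m f by (auto simp: r_def intro: poly_over_diff poly_over_mult)
      have "degree m = degree g - degree f" "m \<noteq> 0"
        using False by (auto simp: m_def degree_monom_eq)
      then have deg: "degree (f * m) = degree g"
        using pos le by (subst degree_mult_eq) auto
      have "coeff (f * m) (degree g) = lead_coeff g"
        using deg f(2) lead_coeff_mult[of f m] \<open>degree m = _\<close> by (simp add: m_def)
      then have "coeff r (degree g) = 0"
        by (simp add: r_def)
      moreover have "degree r \<le> degree g"
        unfolding r_def using deg by (intro degree_diff_le) auto
      ultimately have "r = 0 \<or> degree r < degree g"
        using degree_less_if_less_eqI[of r g] by blast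
      then obtain h where h: "poly_over D h" "r = f * h"
      proof
        assume "r = 0"
        then show ?thesis
          by (intro that[of 0]) (simp_all add: poly_over_def subfield_closed)
      qed (use less.hyps r that in blast)
      have "g = f * (h + m)"
        using h(2) by (simp add: r_def algebra_simps)
      then show ?thesis
        using h(1) m poly_over_add by blast
    qed
  qed
  then show ?thesis
    using f(1-3) pos by blast
qed

context
  fixes \<phi> :: "'a \<Rightarrow> 'a"
  assumes \<phi>: "hom_on D \<phi>"
begin

lemma hom_on_sum: "(\<And>i. i \<in> I \<Longrightarrow> f i \<in> D) \<Longrightarrow> \<phi> (sum f I) = (\<Sum>i\<in>I. \<phi> (f i))"
proof (induction I rule: infinite_finite_induct)
  case (insert i I)
  then have "f i \<in> D" "sum f I \<in> D"
    by (auto intro: subfield_sum)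
  with insert \<phi> show ?case
    by (simp add: hom_on_def)
qed (use \<phi> in \<open>auto simp: hom_on_def\<close>)

lemma coeff_map_hom: "coeff (map_poly \<phi> p) i = \<phi> (coeff p i)"
  using \<phi> by (simp add: coeff_map_poly hom_on_def)

lemma map_hom_add: "poly_over D p \<Longrightarrow> poly_over D q \<Longrightarrow>
    map_poly \<phi> (p + q) = map_poly \<phi> p + map_poly \<phi> q"
  using \<phi> by (intro poly_eqI) (simp add: coeff_map_hom poly_over_def hom_on_def)

lemma map_hom_mult: "poly_over D p \<Longrightarrow> poly_over D q \<Longrightarrow>
    map_poly \<phi> (p * q) = map_poly \<phi> p * map_poly \<phi> q"
proof (rule poly_eqI)
  fix n assume "poly_over D p" "poly_over D q"
  then have D': "coeff p i \<in> D" "coeff q i \<in> D" for i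
    by (auto simp: poly_over_def)
  have "coeff (map_poly \<phi> (p * q)) n = \<phi> (\<Sum>i\<le>n. coeff p i * coeff q (n - i))"
    by (simp only: coeff_map_hom coeff_mult)
  also have "\<dots> = (\<Sum>i\<le>n. \<phi> (coeff p i * coeff q (n - i)))"
    by (intro hom_on_sum subfield_closed D')
  also have "\<dots> = (\<Sum>i\<le>n. \<phi> (coeff p i) * \<phi> (coeff q (n - i)))"
    using \<phi> D' by (simp add: hom_on_def)
  also have "\<dots> = coeff (map_poly \<phi> p * map_poly \<phi> q) n"
    by (simp only: coeff_map_hom coeff_mult)
  finally show "coeff (map_poly \<phi> (p * q)) n = coeff (map_poly \<phi> p * map_poly \<phi> q) n" .
qed

lemma map_hom_const: "map_poly \<phi> [:a:] = [:\<phi> a:]"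
  using \<phi> by (intro poly_eqI) (simp add: coeff_map_hom hom_on_def coeff_pCons split: nat.split)

lemma map_hom_monom: "map_poly \<phi> (monom a n) = monom (\<phi> a) n"
  using \<phi> by (intro poly_eqI) (simp add: coeff_map_hom hom_on_def coeff_monom)

text \<open>Substituting \<open>X ^ a\<close> commutes with applying \<phi> to the coefficients;
  this serves to rewrite polynomials in two roots of unity as polynomials in a common one.\<close>

lemma poly_map_hom_pcompose:
  "poly_over D p \<Longrightarrow> poly (map_poly \<phi> (pcompose p (monom 1 a))) z = poly (map_poly \<phi> p) (z ^ a)"
proof (induction p)
  case (pCons c p)
  then have cp: "c \<in> D" "poly_over D p"
    unfolding poly_over_def by (metis coeff_pCons_0, metis coeff_pCons_Suc)
  have X: "poly_over D (monom 1 a)" "poly_over D [:0, 1:]"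
    using poly_over_monom[of 1 a] poly_over_monom[of 1 1] subfield_closed(6) by (simp_all add: monom_Suc monom_0)
  have eq: "pCons c p = [:c:] + [:0, 1:] * p" by simp
  have "map_poly \<phi> (pCons c p) = [:\<phi> c:] + map_poly \<phi> [:0, 1:] * map_poly \<phi> p"
    unfolding eq using cp X by (simp only: map_hom_add map_hom_mult poly_over_const poly_over_mult map_hom_const)
  moreover have "map_poly \<phi> [:0, 1:] = [:0, 1:]"
    using map_hom_monom[of 1 1] \<phi> by (simp add: monom_Suc monom_0 hom_on_def)
  moreover have "map_poly \<phi> (pcompose (pCons c p) (monom 1 a)) =
      [:\<phi> c:] + monom 1 a * map_poly \<phi> (pcompose p (monom 1 a))"
    unfolding pcompose_pCons using cp X \<phi>
    by (simp only: map_hom_add map_hom_mult poly_over_const poly_over_mult poly_over_pcompose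
        map_hom_const map_hom_monom) (simp add: hom_on_def)
  ultimately show ?case
    using pCons.IH[OF cp(2)] by (simp add: poly_monom)
qed simp

lemma map_hom_monic:
  assumes "lead_coeff f = 1"
  shows "degree (map_poly \<phi> f) = degree f" "lead_coeff (map_poly \<phi> f) = 1"
proof -
  have "coeff (map_poly \<phi> f) (degree f) = 1"
    using assms \<phi> by (simp add: coeff_map_hom hom_on_def)
  moreover have "degree (map_poly \<phi> f) \<le> degree f"
    by (rule degree_le) (use \<phi> in \<open>auto simp: coeff_map_hom coeff_eq_0 hom_on_def\<close>)
  moreover from calculation(1) have "degree f \<le> degree (map_poly \<phi> f)"
    by (intro le_degree) (simp only: one_neq_zero not_False_eq_True)
  ultimately show "degree (map_poly \<phi> f) = degree f"
    by simp
  then show "lead_coeff (map_poly \<phi> f) = 1"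
    using \<open>coeff (map_poly \<phi> f) (degree f) = 1\<close> by simp
qed

end

end

lemma poly_map_hom:
  fixes \<phi> :: "'a::field \<Rightarrow> 'a"
  assumes "hom_on UNIV \<phi>"
  shows "poly (map_poly \<phi> p) (\<phi> x) = \<phi> (poly p x)"
  using assms by (induction p) (auto simp: map_poly_pCons hom_on_def)

section \<open>Roots of unity in an algebraically closed field\<close>

lemma root_of_unity_gcd:
  fixes \<theta> :: "'a::field"
  assumes "\<theta> ^ k = 1" "\<theta> ^ l = 1" "coprime k l"
  shows "\<theta> = 1"
proof (cases "k = 0")
  case True
  then show ?thesis using assms by simp
next
  case False
  obtain a b where "k * a = l * b + gcd k l"
    using bezout_nat[OF False] by blast
  then have "\<theta> ^ (k * a) = \<theta> ^ (l * b) * \<theta>"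
    using assms(3) by (simp add: power_add)
  then show ?thesis
    using assms by (simp add: power_mult)
qed

text \<open>Induction over prime factors, \<open>n = l * m\<close>. If \<open>l\<close> divides
  \<open>m\<close>, an \<open>l\<close>-th root of a primitive \<open>m\<close>-th root works;
  otherwise the primitive \<open>m\<close>-th root is multiplied by a primitive \<open>l\<close>-th
  root.\<close>

lemma primitive_root_exists:
  assumes "n > 0"
  shows "\<exists>\<xi>::'a::{alg_closed_field, field_char_0}. \<forall>k. \<xi> ^ k = 1 \<longleftrightarrow> n dvd k"
  using assms
proof (induction n rule: less_induct)
  case (less n)
  show ?case
  proof (cases "n = 1")
    case True
    then show ?thesis by (intro exI[of _ 1]) simp
  next
    case False
    then obtain l where l: "prime l" "l dvd n"
      using prime_factor_nat by blast
    then obtain m where n: "n = l * m" by blast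
    have l1: "l > 1"
      using l(1) by (rule prime_gt_1_nat)
    have "m < n" "m > 0"
      using n less.prems l1 by auto
    then obtain \<xi> :: 'a where \<xi>: "\<And>k. \<xi> ^ k = 1 \<longleftrightarrow> m dvd k"
      using less.IH by blast
    show ?thesis
    proof (cases "l dvd m")
      case True
      obtain \<omega> where \<omega>: "\<omega> ^ l = \<xi>"
        using nth_root_exists[of l \<xi>] l1 by auto
      have "\<omega> ^ k = 1 \<longleftrightarrow> n dvd k" for k
      proof
        assume k: "\<omega> ^ k = 1"
        then have "\<xi> ^ k = 1"
          by (metis \<omega> power_mult mult.commute power_one)
        then obtain k' where k': "k = l * k'"
          using \<xi> True by (meson dvdE dvd_trans)
        then have "\<xi> ^ k' = 1"
          using k \<omega> by (simp add: power_mult)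
        then show "n dvd k"
          using \<xi> k' n by simp
      next
        assume "n dvd k"
        then obtain c where c: "k = l * (m * c)"
          using n by (metis dvdE mult.assoc)
        have "\<xi> ^ (m * c) = 1"
          using \<xi> by simp
        then show "\<omega> ^ k = 1"
          unfolding c by (simp only: power_mult[of \<omega>] \<omega>)
      qed
      then show ?thesis by blast
    next
      case False
      then have cop: "coprime l m"
        using l(1) by (simp add: prime_imp_coprime)
      \<comment> \<open>A root of \<open>1 + X + ... + X ^ (l - 1)\<close> is an \<open>l\<close>-th
        root of unity; it is not 1, since there the value is \<open>l\<close>, nonzero in
        characteristic 0.\<close>
      have "\<exists>\<theta>::'a. (\<Sum>i\<le>l - 1. 1 * \<theta> ^ i) = 0"
        using l1 by (intro alg_closed) auto
      then obtain \<theta> :: 'a where \<theta>0: "(\<Sum>i<l. \<theta> ^ i) = 0"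
        using l1 by (auto simp: lessThan_Suc_atMost[symmetric])
      have \<theta>1: "\<theta> ^ l = 1"
        using power_diff_1_eq[of \<theta> l] \<theta>0 by simp
      have "\<theta> \<noteq> 1"
        using \<theta>0 l1 by auto
      then have \<theta>: "l dvd k" if "\<theta> ^ k = 1" for k
        using that root_of_unity_gcd[OF _ \<theta>1, of k] l(1) prime_imp_coprime[of l k] coprime_commute by blast
      have "(\<xi> * \<theta>) ^ k = 1 \<longleftrightarrow> n dvd k" for k
      proof
        assume k: "(\<xi> * \<theta>) ^ k = 1"
        have "\<xi> ^ (k * l) = ((\<xi> * \<theta>) ^ k) ^ l"
          using \<theta>1 by (simp add: power_mult_distrib power_mult[symmetric]) (simp add: mult.commute[of k] power_mult)
        then have "m dvd k * l"
          using k \<xi> by simp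
        then have m: "m dvd k"
          using cop by (metis coprime_commute coprime_dvd_mult_left_iff)
        then have "\<xi> ^ k = 1"
          using \<xi> by simp
        then have "\<theta> ^ k = 1"
          using k by (simp add: power_mult_distrib)
        then have "l dvd k" by (rule \<theta>)
        with m cop show "n dvd k"
          unfolding n by (simp add: divides_mult)
      next
        assume "n dvd k"
        then obtain c where c: "k = l * m * c"
          using n by auto
        then have "\<xi> ^ k = 1"
          using \<xi> by simp
        moreover have "\<theta> ^ k = 1"
          using \<theta>1 c by (simp add: power_mult)
        ultimately show "(\<xi> * \<theta>) ^ k = 1"
          by (simp add: power_mult_distrib)
      qed
      then show ?thesis by blast
    qed
  qed
qed

text \<open>The first \<open>n\<close> powers of a primitive root are distinct, and
  \<open>X ^ n - 1\<close> has no more than \<open>n\<close> roots.\<close>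

lemma roots_of_unity_cyclic:
  assumes "n > 0"
  shows "\<exists>\<xi>::'a::{alg_closed_field, field_char_0}. \<xi> ^ n = 1 \<and> (\<forall>z. z ^ n = 1 \<longrightarrow> (\<exists>a. z = \<xi> ^ a))"
proof -
  obtain \<xi> :: 'a where \<xi>: "\<And>k. \<xi> ^ k = 1 \<longleftrightarrow> n dvd k"
    using primitive_root_exists[OF assms] by blast
  then have nz: "\<xi> \<noteq> 0"
    using assms by (metis dvd_refl power_0_left zero_neq_one neq0_conv)
  define P :: "'a poly" where "P = monom 1 n - 1"
  have polyP: "poly P z = z ^ n - 1" for z
    by (simp add: P_def poly_monom)
  have P0: "P \<noteq> 0"
    using assms polyP[of 0] by (auto simp: power_0_left)
  have degP: "degree P \<le> n"
    unfolding P_def by (intro degree_diff_le degree_monom_le) simp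
  have inj: "inj_on (\<lambda>i. \<xi> ^ i) {..<n}"
  proof (rule linorder_inj_onI)
    fix i j assume ij: "i < j" "i \<in> {..<n}" "j \<in> {..<n}"
    show "\<xi> ^ i \<noteq> \<xi> ^ j"
    proof
      assume "\<xi> ^ i = \<xi> ^ j"
      also have "\<xi> ^ j = \<xi> ^ i * \<xi> ^ (j - i)"
        using ij(1) by (simp add: power_add[symmetric])
      finally have "\<xi> ^ (j - i) = 1"
        using nz by simp
      then have "n dvd j - i"
        using \<xi> by blast
      then show False
        using ij by (auto dest: dvd_imp_le)
    qed
  qed auto
  let ?Z = "{z. poly P z = 0}"
  have "(\<lambda>i. \<xi> ^ i) ` {..<n} = ?Z"
  proof (rule card_seteq)
    show "finite ?Z"
      using P0 by (rule poly_roots_finite)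
    have "(\<xi> ^ i) ^ n = 1" for i
      using \<xi>[of "i * n"] by (simp add: power_mult)
    then show "(\<lambda>i. \<xi> ^ i) ` {..<n} \<subseteq> ?Z"
      by (auto simp: polyP)
    have "card ?Z \<le> n"
      using card_poly_roots_bound[OF P0] degP by linarith
    then show "card ?Z \<le> card ((\<lambda>i. \<xi> ^ i) ` {..<n})"
      using inj by (simp add: card_image)
  qed
  then have "\<exists>a. z = \<xi> ^ a" if "z ^ n = 1" for z
    using that polyP[of z] by (auto simp: set_eq_iff image_iff)
  moreover have "\<xi> ^ n = 1"
    using \<xi> by simp
  ultimately show ?thesis by blast
qed

context padic_field begin

section \<open>Monic polynomials over the algebraic closure and their reductions\<close>

lemma poly_le: "(\<And>i. v (coeff p i) \<le> 1) \<Longrightarrow> v z \<le> 1 \<Longrightarrow> v (poly p z) \<le> 1"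
  unfolding poly_altdef by (intro v_sum_le v_mult_le v_power_le) auto

lemma monic_factorization:
  assumes "lead_coeff (f :: 'k poly) = 1"
  shows "\<exists>A. f = (\<Prod>a\<in>#A. [:- a, 1:]) \<and> (\<forall>a\<in>#A. poly f a = 0)"
proof -
  have "f \<noteq> 0"
    using assms by auto
  then obtain A where "f = smult (lead_coeff f) (\<Prod>a\<in>#A. [:- a, 1:])"
    using alg_closed_imp_factorization by blast
  then have A: "f = (\<Prod>a\<in>#A. [:- a, 1:])"
    by (simp only: assms smult_1_left)
  have "poly f a = 0" if "a \<in># A" for a
    using that by (subst A) (simp add: poly_prod_mset prod_mset_zero_iff image_iff)
  with A show ?thesis by blast
qed

text \<open>\<open>poly f x\<close> is the product of the differences \<open>x - a\<close> over the
  roots; if each of these had absolute value at least 1, so would the product.\<close>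

lemma monic_close_root:
  assumes "lead_coeff f = 1" "poly f x \<doteq> 0"
  shows "\<exists>a. poly f a = 0 \<and> x \<doteq> a"
proof -
  obtain A where A: "f = (\<Prod>a\<in>#A. [:- a, 1:])" "\<forall>a\<in>#A. poly f a = 0"
    using monic_factorization[OF assms(1)] by blast
  have "poly f x = (\<Prod>a\<in>#A. x - a)"
    by (subst A(1)) (simp add: poly_prod_mset)
  then have "v (\<Prod>a\<in>#A. x - a) < 1"
    using assms(2) by (simp add: req_zero)
  moreover have "v (\<Prod>a\<in>#A. x - a) \<ge> 1" if "\<And>a. a \<in># A \<Longrightarrow> v (x - a) \<ge> 1"
    using that
  proof (induction A)
    case (add a A)
    then show ?case
      using mult_mono[of 1 "v (x - a)" 1 "v (\<Prod>a\<in>#A. x - a)"] v_nonneg[of "x - a"] by (simp add: v_mult)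
  qed simp
  ultimately obtain a where "a \<in># A" "x \<doteq> a"
    unfolding req_def by (metis not_le)
  with A(2) show ?thesis by blast
qed

text \<open>Up to sign the coefficients are elementary symmetric functions of the roots; the
  induction multiplies in one linear factor at a time.\<close>

lemma monic_integral_roots:
  assumes "lead_coeff f = 1" "\<And>a. poly f a = 0 \<Longrightarrow> v a \<le> 1"
  shows "v (coeff f i) \<le> 1"
proof -
  obtain A where A: "f = (\<Prod>a\<in>#A. [:- a, 1:])" "\<forall>a\<in>#A. poly f a = 0"
    using monic_factorization[OF assms(1)] by blast
  have "v (coeff (\<Prod>a\<in>#A. [:- a, 1:]) i) \<le> 1" if "\<And>a. a \<in># A \<Longrightarrow> v a \<le> 1" for i
    using that
  proof (induction A arbitrary: i)
    case (add a A)
    have IH: "v (coeff (\<Prod>a\<in>#A. [:- a, 1:]) j) \<le> 1" for j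
      using add by simp
    have "coeff (\<Prod>a\<in>#add_mset a A. [:- a, 1:]) i = - a * coeff (\<Prod>a\<in>#A. [:- a, 1:]) i +
        (if i = 0 then 0 else coeff (\<Prod>a\<in>#A. [:- a, 1:]) (i - 1))"
      by (simp add: coeff_pCons split: nat.split)
    moreover have "v (- a * coeff (\<Prod>a\<in>#A. [:- a, 1:]) i) \<le> 1"
      using IH add.prems[of a] by (intro v_mult_le) auto
    moreover have "v (if i = 0 then 0 else coeff (\<Prod>a\<in>#A. [:- a, 1:]) (i - 1)) \<le> 1"
      using IH by simp
    ultimately show ?case
      by (simp only: v_add_le)
  qed (simp add: coeff_1)
  then show ?thesis
    using assms(2) A by metis
qed

lemma frobenius_sum:
  assumes "\<And>i. i \<in> I \<Longrightarrow> v (f i) \<le> 1"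
  shows "(sum f I) ^ residue_card F v \<doteq> (\<Sum>i\<in>I. f i ^ residue_card F v)"
  using assms
proof (induction I rule: infinite_finite_induct)
  case (insert i I)
  have "(f i + sum f I) ^ residue_card F v \<doteq> f i ^ residue_card F v + sum f I ^ residue_card F v"
    using insert.prems by (intro frobenius_add v_sum_le) auto
  also have "\<dots> \<doteq> f i ^ residue_card F v + (\<Sum>i\<in>I. f i ^ residue_card F v)"
    using insert by (intro req_add) auto
  finally show ?case
    using insert.hyps by simp
qed (use residue_card_ge_2 in \<open>auto simp: power_0_left\<close>)

section \<open>Tame roots of unity and the extension of partial homomorphisms\<close>

definition tame_roots :: "'k set" where
  "tame_roots = {\<zeta>. \<exists>m. v (of_nat m) = 1 \<and> \<zeta> ^ m = 1}"

text \<open>Both lie in the cyclic group of \<open>m * n\<close>-th roots of unity, and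
  \<open>m * n\<close> is again prime to the residue characteristic. A single generator is what
  makes the relation in \<open>exists_weil_moving\<close> closed under sums and products.\<close>

lemma tame_roots_common:
  assumes "\<zeta> \<in> tame_roots" "\<eta> \<in> tame_roots"
  obtains \<xi> a b where "\<xi> \<in> tame_roots" "\<zeta> = \<xi> ^ a" "\<eta> = \<xi> ^ b"
proof -
  obtain m n where mn: "v (of_nat m) = 1" "\<zeta> ^ m = 1" "v (of_nat n) = 1" "\<eta> ^ n = 1"
    using assms by (auto simp: tame_roots_def)
  then have v1: "v (of_nat (m * n)) = 1"
    by (simp add: v_mult)
  then have "m * n > 0"
    by (metis gr0I of_nat_0 v_zero zero_neq_one)
  then obtain \<xi> :: 'k where \<xi>: "\<xi> ^ (m * n) = 1" "\<And>z. z ^ (m * n) = 1 \<Longrightarrow> \<exists>a. z = \<xi> ^ a"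
    using roots_of_unity_cyclic[of "m * n"] by blast
  have "\<zeta> ^ (m * n) = 1"
    using mn by (simp add: power_mult)
  then obtain a where a: "\<zeta> = \<xi> ^ a"
    using \<xi>(2) by blast
  have "\<eta> ^ (m * n) = 1"
    using mn by (subst mult.commute) (simp add: power_mult)
  then obtain b where b: "\<eta> = \<xi> ^ b"
    using \<xi>(2) by blast
  have "\<xi> \<in> tame_roots"
    unfolding tame_roots_def using \<xi>(1) v1 by (intro CollectI exI[of _ "m * n"]) simp
  then show ?thesis
    using a b by (rule that)
qed

text \<open>The graph of a partial ring homomorphism over \<open>F\<close>. Graphs are used because
  the union of a chain of them is again one; single-valuedness is the condition that only 0 lies
  over 0.\<close>

definition pair_ring :: "('k \<times> 'k) set \<Rightarrow> bool" where
  "pair_ring R \<longleftrightarrow> (\<forall>x\<in>F. (x, x) \<in> R) \<and>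
     (\<forall>a b c d. (a, b) \<in> R \<longrightarrow> (c, d) \<in> R \<longrightarrow> (a + c, b + d) \<in> R \<and> (a * c, b * d) \<in> R) \<and>
     (\<forall>y. (0, y) \<in> R \<longrightarrow> y = 0)"

lemma pair_ringD:
  assumes "pair_ring R"
  shows "x \<in> F \<Longrightarrow> (x, x) \<in> R" "(a, b) \<in> R \<Longrightarrow> (c, d) \<in> R \<Longrightarrow> (a + c, b + d) \<in> R"
    "(a, b) \<in> R \<Longrightarrow> (c, d) \<in> R \<Longrightarrow> (a * c, b * d) \<in> R" "(0, y) \<in> R \<Longrightarrow> y = 0"
  using assms by (simp_all add: pair_ring_def)

text \<open>The domain is a ring containing \<open>F\<close>, and it is a field because its elements
  are algebraic: an inverse is a polynomial expression over \<open>F\<close>.\<close>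

lemma pair_ring_graph:
  assumes R: "pair_ring R"
  defines "D \<equiv> fst ` R" and "\<phi> \<equiv> \<lambda>x. THE y. (x, y) \<in> R"
  shows "(x, y) \<in> R \<longleftrightarrow> x \<in> D \<and> y = \<phi> x" "is_subfield D" "hom_on D \<phi>" "F \<subseteq> D"
    "x \<in> F \<Longrightarrow> \<phi> x = x"
proof -
  have id: "(x, x) \<in> R" if "x \<in> F" for x
    using R that by (simp add: pair_ring_def)
  have add: "(a + c, b + d) \<in> R" and mult: "(a * c, b * d) \<in> R" if "(a, b) \<in> R" "(c, d) \<in> R" for a b c d
    using R that by (simp_all add: pair_ring_def)
  have zero: "y = 0" if "(0, y) \<in> R" for y
    using R that by (simp add: pair_ring_def)
  have m1: "(-1, -1) \<in> R"
    by (intro id F_minus F_one)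
  have neg: "(- a, - b) \<in> R" if "(a, b) \<in> R" for a b
    using mult[OF m1 that] by simp
  have single: "y = z" if "(x, y) \<in> R" "(x, z) \<in> R" for x y z
    using zero[of "y - z"] add[OF that(1) neg[OF that(2)]] by simp
  have \<phi>: "\<phi> x = y" if "(x, y) \<in> R" for x y
    unfolding \<phi>_def using that by (rule the_equality) (rule single[OF _ that])
  show graph: "(x, y) \<in> R \<longleftrightarrow> x \<in> D \<and> y = \<phi> x" for x y
  proof
    assume "(x, y) \<in> R"
    then show "x \<in> D \<and> y = \<phi> x"
      using \<phi>[of x y] by (force simp: D_def)
  next
    assume "x \<in> D \<and> y = \<phi> x"
    then obtain z where "(x, z) \<in> R" "y = \<phi> x"
      by (auto simp: D_def)
    then show "(x, y) \<in> R"
      using \<phi>[of x z] by simp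
  qed
  show "F \<subseteq> D"
    using id by (force simp: D_def)
  show "x \<in> F \<Longrightarrow> \<phi> x = x" for x
    using id \<phi> by blast
  show "hom_on D \<phi>"
    unfolding hom_on_def
  proof (intro conjI ballI)
    show "\<phi> 0 = 0" "\<phi> 1 = 1"
      by (intro \<phi> id F_zero F_one)+
    fix x y assume "x \<in> D" "y \<in> D"
    then have "(x, \<phi> x) \<in> R" "(y, \<phi> y) \<in> R"
      by (simp_all add: graph)
    then show "\<phi> (x + y) = \<phi> x + \<phi> y" "\<phi> (x * y) = \<phi> x * \<phi> y"
      using add mult by (auto intro!: \<phi>)
  qed
  have polyD: "poly g x \<in> D" if "\<And>i. coeff g i \<in> F" "x \<in> D" for g x
    using that
  proof (induction g)
    case 0
    then show ?case
      using \<open>F \<subseteq> D\<close> F_zero by auto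
  next
    case (pCons a g)
    have "a \<in> F" "\<And>i. coeff g i \<in> F"
      using pCons.prems(1) by (metis coeff_pCons_0, metis coeff_pCons_Suc)
    then have "(a, a) \<in> R" "(x, \<phi> x) \<in> R" "(poly g x, \<phi> (poly g x)) \<in> R"
      using id pCons.IH pCons.prems(2) graph by auto
    then have "(a + x * poly g x, a + \<phi> x * \<phi> (poly g x)) \<in> R"
      by (intro add mult)
    then show ?case
      by (simp add: graph)
  qed
  \<comment> \<open>Factors \<open>X\<close> are stripped from the relation until its constant term
    \<open>a\<close> is nonzero; then \<open>x * poly f x = - a\<close> exhibits the
    inverse.\<close>
  have inv: "\<exists>g. (\<forall>i. coeff g i \<in> F) \<and> x * poly g x = 1"
    if "f \<noteq> 0" "\<And>i. coeff f i \<in> F" "poly f x = 0" "x \<noteq> 0" for f x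
    using that
  proof (induction f)
    case (pCons a f)
    have af: "a \<in> F" "\<And>i. coeff f i \<in> F"
      using pCons.prems(2) by (metis coeff_pCons_0, metis coeff_pCons_Suc)
    show ?case
    proof (cases "a = 0")
      case True
      with pCons af show ?thesis by auto
    next
      case False
      have "x * poly f x = - a"
        using pCons.prems(3) by (simp add: eq_neg_iff_add_eq_0 add.commute)
      then have "x * poly (smult (- inverse a) f) x = 1"
        using False by (simp add: mult.left_commute[of x])
      moreover have "coeff (smult (- inverse a) f) i \<in> F" for i
        using af by (auto intro!: F_mult F_minus F_inverse simp del: mult_minus_left)
      ultimately show ?thesis by blast
    qed
  qed simp
  show "is_subfield D"
    unfolding is_subfield_def
  proof (intro conjI ballI)
    show "0 \<in> D" "1 \<in> D"
      using \<open>F \<subseteq> D\<close> F_zero F_one by auto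
    show "x + y \<in> D" "x * y \<in> D" if "x \<in> D" "y \<in> D" for x y
      using that add[of x "\<phi> x" y "\<phi> y"] mult[of x "\<phi> x" y "\<phi> y"] graph by simp_all
    show "- x \<in> D" if "x \<in> D" for x
      using that neg[of x "\<phi> x"] graph by simp
    show "inverse x \<in> D" if x: "x \<in> D" for x
    proof (cases "x = 0")
      case False
      obtain f where "f \<noteq> 0" "\<And>i. coeff f i \<in> F" "poly f x = 0"
        using algebraic by blast
      then obtain g where g: "\<And>i. coeff g i \<in> F" "x * poly g x = 1"
        using inv[of f x] False by blast
      have "inverse x = poly g x"
        using g(2) by (rule inverse_unique)
      then show ?thesis
        using polyD[OF g(1) x] by simp
    qed (use x in simp)
  qed
qed

text \<open>Zorn's lemma. A maximal graph has full domain: for any \<open>x\<close>, \<phi> carries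
  the minimal polynomial of \<open>x\<close> to a polynomial with a root \<open>y\<close> in the
  algebraic closure, and sending \<open>x\<close> to \<open>y\<close> extends the graph.\<close>

lemma pair_ring_extend:
  assumes "pair_ring R0"
  shows "\<exists>w. F_hom w \<and> (\<forall>(x, y)\<in>R0. w x = y)"
proof -
  let ?A = "{R. pair_ring R \<and> R0 \<subseteq> R}"
  have "\<exists>M\<in>?A. \<forall>X\<in>?A. M \<subseteq> X \<longrightarrow> X = M"
  proof (rule subset_Zorn_nonempty)
    show "?A \<noteq> {}"
      using assms by blast
    fix C assume C: "C \<noteq> {}" "subset.chain ?A C"
    have sub: "R0 \<subseteq> \<Union>C"
      using C unfolding subset_chain_def by blast
    have ring: "pair_ring X" if "X \<in> C" for X
      using C that unfolding subset_chain_def by blast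
    have pair: "\<exists>X\<in>C. p \<in> X \<and> q \<in> X" if "p \<in> \<Union>C" "q \<in> \<Union>C" for p q
    proof -
      obtain X Y where XY: "X \<in> C" "Y \<in> C" "p \<in> X" "q \<in> Y"
        using \<open>p \<in> \<Union>C\<close> \<open>q \<in> \<Union>C\<close> by blast
      then have "X \<subseteq> Y \<or> Y \<subseteq> X"
        using C(2) unfolding subset_chain_def by blast
      then show ?thesis
        using XY by blast
    qed
    have c2: "(a + c, b + d) \<in> \<Union>C \<and> (a * c, b * d) \<in> \<Union>C"
      if mem: "(a, b) \<in> \<Union>C" "(c, d) \<in> \<Union>C" for a b c d
    proof -
      obtain X where X: "X \<in> C" "(a, b) \<in> X" "(c, d) \<in> X"
        using pair[OF mem] by blast
      then have "(a + c, b + d) \<in> X \<and> (a * c, b * d) \<in> X"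
        using pair_ringD[OF ring] by simp
      then show ?thesis
        using X(1) by blast
    qed
    have c1: "(x, x) \<in> \<Union>C" if "x \<in> F" for x
    proof -
      obtain X where "X \<in> C"
        using C(1) by blast
      then show ?thesis
        using pair_ringD(1)[OF ring that] by blast
    qed
    have c3: "y = 0" if mem: "(0, y) \<in> \<Union>C" for y
    proof -
      obtain X where "X \<in> C" "(0, y) \<in> X"
        using mem by blast
      then show ?thesis
        using pair_ringD(4)[OF ring] by blast
    qed
    have "pair_ring (\<Union>C)"
      unfolding pair_ring_def by (intro conjI allI ballI impI c1 c3 c2[THEN conjunct1] c2[THEN conjunct2])
    with sub show "\<Union>C \<in> ?A" by blast
  qed
  then obtain M where M: "pair_ring M" "R0 \<subseteq> M"
    and "\<forall>X\<in>?A. M \<subseteq> X \<longrightarrow> X = M"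
    by blast
  then have max: "X = M" if "pair_ring X" "M \<subseteq> X" for X
    using that by blast
  define D where "D = fst ` M"
  define \<phi> where "\<phi> x = (THE y. (x, y) \<in> M)" for x
  note graph = pair_ring_graph[OF M(1), folded D_def \<phi>_def]
  note D = graph(2) and \<phi> = graph(3)
  have "x \<in> D" for x
  proof -
    obtain f0 where "f0 \<noteq> 0" "\<And>i. coeff f0 i \<in> F" "poly f0 x = 0"
      using algebraic by blast
    then have "f0 \<noteq> 0" "poly_over D f0" "poly f0 x = 0"
      using graph(4) by (auto simp: poly_over_def)
    obtain f where f: "poly_over D f" "lead_coeff f = 1" "poly f x = 0" "degree f > 0"
      and fmin: "\<forall>g. poly_over D g \<and> poly g x = 0 \<longrightarrow> (\<exists>h. poly_over D h \<and> g = f * h)"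
      using minimal_polynomial[OF D \<open>f0 \<noteq> 0\<close> \<open>poly_over D f0\<close> \<open>poly f0 x = 0\<close>]
      by (elim exE conjE) (rule that; assumption)
    have "degree (map_poly \<phi> f) > 0"
      using map_hom_monic(1)[OF D \<phi> f(2)] f(4) by simp
    then obtain y where y: "poly (map_poly \<phi> f) y = 0"
      using alg_closed_imp_poly_has_root by blast
    \<comment> \<open>Values at \<open>x\<close> are paired with values of the conjugate polynomial
      at \<open>y\<close>. A polynomial vanishing at \<open>x\<close> is a multiple of
      \<open>f\<close>, so its conjugate vanishes at \<open>y\<close>; this is the
      single-valuedness.\<close>
    let ?M = "{(poly g x, poly (map_poly \<phi> g) y) |g. poly_over D g}"
    have const: "(a, \<phi> a) \<in> ?M" if "a \<in> D" for a
      using poly_over_const[OF D that] map_hom_const[OF D \<phi>, of a]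
      by (intro CollectI exI[of _ "[:a:]"]) simp
    have "pair_ring ?M"
      unfolding pair_ring_def
    proof (intro conjI allI impI ballI)
      show "(a, a) \<in> ?M" if "a \<in> F" for a
        using const[of a] graph(4) graph(5)[OF that] that by (simp only: subset_iff)
      fix a b c d assume "(a, b) \<in> ?M" "(c, d) \<in> ?M"
      then obtain g h where gh: "poly_over D g" "poly_over D h"
        "a = poly g x" "b = poly (map_poly \<phi> g) y" "c = poly h x" "d = poly (map_poly \<phi> h) y"
        unfolding mem_Collect_eq prod.inject by (elim exE conjE) (rule that; assumption)
      show "(a + c, b + d) \<in> ?M"
        using gh poly_over_add[OF D gh(1,2)] map_hom_add[OF D \<phi> gh(1,2)]
        by (intro CollectI exI[of _ "g + h"]) simp
      show "(a * c, b * d) \<in> ?M"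
        using gh poly_over_mult[OF D gh(1,2)] map_hom_mult[OF D \<phi> gh(1,2)]
        by (intro CollectI exI[of _ "g * h"]) simp
    next
      fix z assume "(0, z) \<in> ?M"
      then obtain g where g: "poly_over D g" "poly g x = 0" "z = poly (map_poly \<phi> g) y"
        by auto
      then obtain h where "poly_over D h" "g = f * h"
        using fmin by blast
      then show "z = 0"
        using g(3) y map_hom_mult[OF D \<phi> f(1)] by simp
    qed
    moreover have "M \<subseteq> ?M"
      using const graph(1) by auto
    ultimately have "?M = M"
      by (rule max)
    moreover have "(x, y) \<in> ?M"
    proof (intro CollectI exI[of _ "monom 1 1"] conjI)
      show "(x, y) = (poly (monom 1 1) x, poly (map_poly \<phi> (monom 1 1)) y)"
        using map_hom_monom[OF D \<phi>, of 1 1] \<phi> by (simp add: poly_monom hom_on_def)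
      show "poly_over D (monom 1 1)"
        using poly_over_monom[OF D] subfield_closed(6)[OF D] by blast
    qed
    ultimately show "x \<in> D"
      using graph(1) by blast
  qed
  then have "D = UNIV" by blast
  show ?thesis
  proof (intro exI[of _ \<phi>] conjI ballI)
    show "F_hom \<phi>"
      using \<phi> graph(5) by (simp add: F_hom_def hom_on_def \<open>D = UNIV\<close>)
    show "case p of (x, y) \<Rightarrow> \<phi> x = y" if "p \<in> R0" for p
      using that M(2) graph(1) by (cases p) auto
  qed
qed

text \<open>An injective endomorphism over \<open>F\<close> permutes the finite root set of each
  nonzero polynomial over \<open>F\<close>, so it is onto.\<close>

lemma F_hom_galois:
  assumes w: "F_hom w"
  shows "w \<in> carrier (galois_group F)"
proof -
  have "inj w"
  proof (rule injI)
    fix x y assume "w x = w y"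
    then have "w (x - y) = 0"
      by (simp add: F_homD(7)[OF w])
    then have "w ((x - y) * inverse (x - y)) = 0"
      by (simp add: F_homD(2)[OF w])
    then show "x = y"
      using F_homD(5)[OF w] by (cases "x = y") auto
  qed
  moreover have "surj w"
  proof -
    have "\<exists>x. y = w x" for y
    proof -
      obtain f where f: "f \<noteq> 0" "\<And>i. coeff f i \<in> F" "poly f y = 0"
        using algebraic by blast
      have hom: "hom_on UNIV w"
        using F_homD[OF w] by (simp add: hom_on_def)
      have mapf: "map_poly w f = f"
        using f(2) F_homD(3,4)[OF w] by (intro poly_eqI) (simp add: coeff_map_poly)
      let ?Z = "{z. poly f z = 0}"
      have "w ` ?Z \<subseteq> ?Z"
        using poly_map_hom[OF hom, of f] F_homD(4)[OF w] by (auto simp: mapf)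
      then have "w ` ?Z = ?Z"
        using poly_roots_finite[OF f(1)] \<open>inj w\<close> by (intro endo_inj_surj) (auto intro: inj_on_subset)
      then show ?thesis
        using f(3) by blast
    qed
    then show ?thesis
      by (auto simp: surj_def)
  qed
  ultimately show ?thesis
    using w by (simp add: galois_group_def F_hom_def bij_def)
qed

text \<open>Every unit is congruent to a tame root of unity and \<open>w\<close> does not increase
  \<open>v\<close>, so the action on tame roots determines the action on residues; non-units reduce
  to 0 on both sides. The exponent \<open>n\<close> in \<open>weil_group\<close> is taken to be
  1.\<close>

lemma F_hom_weil:
  assumes w: "F_hom w" and roots: "\<And>\<zeta>. \<zeta> \<in> tame_roots \<Longrightarrow> w \<zeta> = \<zeta> ^ residue_card F v"
  shows "w \<in> carrier (weil_group F v)"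
proof -
  have "w x \<doteq> x ^ residue_card F v" if x: "v x \<le> 1" for x
  proof (cases "v x = 1")
    case True
    obtain m \<zeta> where \<zeta>: "v (of_nat m) = 1" "\<zeta> ^ m = 1" "x \<doteq> \<zeta>"
      using True by (rule unit_req_root_of_unity)
    have "v (w (x - \<zeta>)) < 1"
      using F_hom_v[OF w, of "x - \<zeta>"] \<zeta>(3) by (simp add: req_def)
    then have "w x \<doteq> w \<zeta>"
      by (simp add: req_def F_homD(7)[OF w])
    also have "w \<zeta> = \<zeta> ^ residue_card F v"
      using \<zeta> by (intro roots) (auto simp: tame_roots_def)
    also have "\<dots> \<doteq> x ^ residue_card F v"
      using req_power[OF \<zeta>(3) x] by (rule req_sym)
    finally show ?thesis .
  next
    case False
    with x have "x \<doteq> 0"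
      by (simp add: req_zero)
    then have "x ^ residue_card F v \<doteq> 0"
      using req_power[of x 0 "residue_card F v"] x residue_card_ge_2 by (simp add: power_0_left)
    moreover have "w x \<doteq> 0"
      using F_hom_v[OF w, of x] \<open>x \<doteq> 0\<close> by (simp add: req_zero)
    ultimately show ?thesis
      using req_trans[of "w x" 0 "x ^ residue_card F v"] req_sym[of "x ^ residue_card F v" 0] by blast
  qed
  then have "\<exists>n. \<forall>x. v x \<le> 1 \<longrightarrow> v (w x - x ^ (residue_card F v ^ n)) < 1"
    by (intro exI[of _ 1]) (simp add: req_def)
  then show ?thesis
    using F_hom_galois[OF w] by (auto simp: weil_group_def)
qed

text \<open>The quadratic extension generated by \<open>s\<close>: on its integers, the nontrivial
  automorphism is congruent to the Frobenius map, whether the extension is ramified or not.\<close>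

context
  fixes \<sigma> :: "'k \<Rightarrow> 'k" and s :: 'k
  assumes \<sigma>: "F_hom \<sigma>" and s: "s ^ 2 \<in> F" "\<sigma> s \<noteq> s"
begin

definition quadratic_ext :: "'k set" where
  "quadratic_ext = {a + b * s |a b. a \<in> F \<and> b \<in> F}"

lemma conj_s: "\<sigma> s = - s"
proof -
  have "\<sigma> s ^ 2 = s ^ 2"
    using F_homD(3)[OF \<sigma> s(1)] F_homD(8)[OF \<sigma>] by simp
  then show ?thesis
    using s(2) by (simp add: power2_eq_iff)
qed

lemma conj_quadratic: "a \<in> F \<Longrightarrow> b \<in> F \<Longrightarrow> \<sigma> (a + b * s) = a - b * s"
  by (simp add: F_homD[OF \<sigma>] conj_s)

lemma norm_quadratic: "a \<in> F \<Longrightarrow> b \<in> F \<Longrightarrow> (a + b * s) * (a - b * s) \<in> F"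
proof -
  assume ab: "a \<in> F" "b \<in> F"
  have "(a + b * s) * (a - b * s) = a * a - b * b * s ^ 2"
    by (simp add: algebra_simps power2_eq_square)
  then show ?thesis
    using ab s(1) by (simp add: F_diff F_mult)
qed

lemma quadratic_ext_subfield: "is_subfield quadratic_ext"
  unfolding is_subfield_def
proof (intro conjI ballI)
  have F: "a \<in> quadratic_ext" if "a \<in> F" for a
    unfolding quadratic_ext_def using that F_zero by (intro CollectI exI[of _ a] exI[of _ 0]) simp
  show "0 \<in> quadratic_ext" "1 \<in> quadratic_ext"
    by (intro F F_zero F_one)+
  fix x assume "x \<in> quadratic_ext"
  then obtain a b where ab: "x = a + b * s" "a \<in> F" "b \<in> F"
    by (auto simp: quadratic_ext_def)
  show "- x \<in> quadratic_ext"
    unfolding quadratic_ext_def using ab by (intro CollectI exI[of _ "- a"] exI[of _ "- b"]) (simp add: F_minus)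
  show "inverse x \<in> quadratic_ext"
  proof (cases "x = 0")
    case False
    have "\<sigma> x \<noteq> 0"
    proof
      assume "\<sigma> x = 0"
      then have "\<sigma> (x * inverse x) = 0"
        by (simp add: F_homD(2)[OF \<sigma>])
      then show False
        using False F_homD(5)[OF \<sigma>] by simp
    qed
    then have nz: "a - b * s \<noteq> 0"
      using conj_quadratic ab by simp
    define n where "n = x * (a - b * s)"
    have n: "n \<in> F" "n \<noteq> 0"
      using norm_quadratic ab False nz by (auto simp: n_def)
    have "inverse x = (a - b * s) / n"
      using False nz by (simp add: n_def divide_inverse)
    then have "inverse x = a / n + (- b / n) * s"
      by (simp add: diff_divide_distrib)
    then show ?thesis
      unfolding quadratic_ext_def using ab n by (blast intro: F_divide F_minus)
  qed (use F F_zero in simp)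
  fix y assume "y \<in> quadratic_ext"
  then obtain c d where cd: "y = c + d * s" "c \<in> F" "d \<in> F"
    by (auto simp: quadratic_ext_def)
  show "x + y \<in> quadratic_ext"
    unfolding quadratic_ext_def using ab cd
    by (intro CollectI exI[of _ "a + c"] exI[of _ "b + d"]) (simp add: F_add algebra_simps)
  have "x * y = (a * c + b * d * s ^ 2) + (a * d + b * c) * s"
    by (simp add: ab cd algebra_simps power2_eq_square)
  then show "x * y \<in> quadratic_ext"
    unfolding quadratic_ext_def using ab cd s(1)
    by (intro CollectI exI[of _ "a * c + b * d * s ^ 2"] exI[of _ "a * d + b * c"]) (simp add: F_add F_mult)
qed

text \<open>\<open>e\<close> and \<open>\<sigma> e\<close> are the roots of
  \<open>X ^ 2 - t * X + n\<close> over \<open>F\<close>. As \<open>t\<close> and \<open>n\<close>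
  are fixed by the \<open>q\<close>-th power modulo the maximal ideal, \<open>e ^ q\<close> is a
  root modulo that ideal too, and is congruent to \<open>e\<close> or to \<open>\<sigma> e\<close>.
  In the former case \<open>e\<close> is congruent to an element of \<open>F\<close>, and then
  \<open>\<sigma> e\<close>, \<open>e\<close> and \<open>e ^ q\<close> all agree.\<close>

lemma conj_frobenius:
  assumes "e \<in> quadratic_ext" "v e \<le> 1"
  shows "\<sigma> e \<doteq> e ^ residue_card F v"
proof -
  let ?q = "residue_card F v"
  obtain a b where ab: "e = a + b * s" "a \<in> F" "b \<in> F"
    using assms(1) by (auto simp: quadratic_ext_def)
  define t n where "t = e + \<sigma> e" and "n = e * \<sigma> e"
  have \<sigma>e: "\<sigma> e = a - b * s"
    using ab conj_quadratic by simp
  have "t = a + a" "n = (a + b * s) * (a - b * s)"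
    unfolding t_def n_def \<sigma>e by (simp_all add: ab(1))
  then have tF: "t \<in> F" "n \<in> F"
    using ab(2,3) by (simp_all only: F_add norm_quadratic)
  have v\<sigma>: "v (\<sigma> e) \<le> 1"
    using F_hom_v[OF \<sigma>, of e] assms(2) by simp
  then have tn: "v t \<le> 1" "v n \<le> 1"
    using assms(2) by (auto simp: t_def n_def intro: v_add_le v_mult_le)
  note veq = v_power_le[OF assms(2), of ?q]
  have "(e ^ ?q - e) * (e ^ ?q - \<sigma> e) = (e ^ 2) ^ ?q + (n - t * e ^ ?q)"
    by (simp add: t_def n_def power2_eq_square power_mult_distrib algebra_simps)
  also have "\<dots> \<doteq> (e ^ 2) ^ ?q + (n ^ ?q - (t ^ ?q) * e ^ ?q)"
    using tF tn veq by (intro req_add req_diff req_mult req_refl req_sym[OF residue_fermat])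
  also have "(e ^ 2) ^ ?q + (n ^ ?q - (t ^ ?q) * e ^ ?q) = (e ^ 2) ^ ?q + n ^ ?q - (t * e) ^ ?q"
    by (simp add: power_mult_distrib)
  also have "\<dots> \<doteq> (e ^ 2 + n) ^ ?q - (t * e) ^ ?q"
    using assms(2) tn by (intro req_diff req_refl req_sym[OF frobenius_add] v_power_le)
  also have "e ^ 2 + n = t * e"
    by (simp add: t_def n_def power2_eq_square algebra_simps)
  finally have prod: "(e ^ ?q - e) * (e ^ ?q - \<sigma> e) \<doteq> 0"
    by simp
  have "e ^ ?q - e \<doteq> 0 \<or> e ^ ?q - \<sigma> e \<doteq> 0"
  proof (rule req_mult_zero[OF prod])
    show "v (e ^ ?q - e) \<le> 1" "v (e ^ ?q - \<sigma> e) \<le> 1"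
      using v_diff[of "e ^ ?q" e] v_diff[of "e ^ ?q" "\<sigma> e"] veq assms(2) v\<sigma> by auto
  qed
  then show ?thesis
  proof
    assume "e ^ ?q - e \<doteq> 0"
    then have eq: "e ^ ?q \<doteq> e"
      by (simp add: req_def)
    then obtain c where c: "c \<in> F" "e \<doteq> c"
      using frobenius_fixed[OF assms(2)] by blast
    have "v (\<sigma> (e - c)) < 1"
      using F_hom_v[OF \<sigma>, of "e - c"] c(2) by (simp add: req_def)
    then have "\<sigma> e \<doteq> c"
      using c(1) by (simp add: req_def F_homD[OF \<sigma>])
    also have "c \<doteq> e"
      using c(2) by (rule req_sym)
    also have "e \<doteq> e ^ ?q"
      using eq by (rule req_sym)
    finally show ?thesis .
  next
    assume "e ^ ?q - \<sigma> e \<doteq> 0"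
    then have "e ^ ?q \<doteq> \<sigma> e"
      by (simp add: req_def)
    then show ?thesis
      by (rule req_sym)
  qed
qed

lemma hom_on_\<sigma>: "hom_on D \<sigma>"
  by (simp add: hom_on_def F_homD[OF \<sigma>])

text \<open>The minimal polynomial \<open>f\<close> of \<open>\<zeta>\<close> over the quadratic
  extension divides \<open>X ^ m - 1\<close>, so its coefficients are integral. By
  \<open>conj_frobenius\<close> the conjugate of \<open>f\<close> at \<open>\<zeta> ^ q\<close> is
  congruent to \<open>(poly f \<zeta>) ^ q = 0\<close>, so \<open>\<zeta> ^ q\<close> is congruent
  to one of its roots; both being \<open>m\<close>-th roots of unity, they are equal.\<close>

lemma conj_tame_root:
  assumes \<zeta>: "\<zeta> \<in> tame_roots" and g: "poly_over quadratic_ext g" "poly g \<zeta> = 0"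
  shows "poly (map_poly \<sigma> g) (\<zeta> ^ residue_card F v) = 0"
proof -
  let ?q = "residue_card F v" and ?E = quadratic_ext
  note E = quadratic_ext_subfield and hom = hom_on_\<sigma>[of quadratic_ext]
  obtain m where m: "v (of_nat m) = 1" "\<zeta> ^ m = 1"
    using \<zeta> by (auto simp: tame_roots_def)
  then have m0: "m > 0"
    by (metis gr0I of_nat_0 v_zero zero_neq_one)
  define P :: "'k poly" where "P = monom 1 m - 1"
  have polyP: "poly P z = z ^ m - 1" for z
    by (simp add: P_def poly_monom)
  have P: "P \<noteq> 0" "poly_over ?E P" "poly P \<zeta> = 0"
  proof -
    show "P \<noteq> 0"
      using m0 polyP[of 0] by (auto simp: power_0_left)
    show "poly_over ?E P"
      unfolding P_def using poly_over_diff[OF E] poly_over_monom[OF E subfield_closed(6)[OF E]]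
      by (metis monom_eq_1)
    show "poly P \<zeta> = 0"
      using m by (simp add: polyP)
  qed
  obtain f where f: "poly_over ?E f" "lead_coeff f = 1" "poly f \<zeta> = 0"
    and fmin: "\<forall>g. poly_over ?E g \<and> poly g \<zeta> = 0 \<longrightarrow> (\<exists>h. poly_over ?E h \<and> g = f * h)"
    using minimal_polynomial[OF E P] by (elim exE conjE) (rule that; assumption)
  obtain h where h: "poly_over ?E h" "P = f * h"
    using fmin P by blast
  have root_f: "a ^ m = 1" if "poly f a = 0" for a
    using that polyP[of a] h(2) by simp
  have fO: "v (coeff f i) \<le> 1" for i
    using root_f root_of_unity_v[OF _ m0] by (intro monic_integral_roots[OF f(2)]) simp
  define f' where "f' = map_poly \<sigma> f"
  have "map_poly \<sigma> P = P"
    by (intro poly_eqI) (simp add: coeff_map_hom[OF E hom] P_def coeff_monom F_homD[OF \<sigma>])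
  then have "P = f' * map_poly \<sigma> h"
    using map_hom_mult[OF E hom f(1) h(1)] h(2) by (simp add: f'_def)
  then have root_f': "a ^ m = 1" if "poly f' a = 0" for a
    using that polyP[of a] by simp
  have v\<zeta>: "v \<zeta> = 1"
    using m(2) m0 by (rule root_of_unity_v)
  have "poly f' (\<zeta> ^ ?q) = (\<Sum>i\<le>degree f. \<sigma> (coeff f i) * (\<zeta> ^ i) ^ ?q)"
    using map_hom_monic(1)[OF E hom f(2)]
    by (simp add: f'_def poly_altdef coeff_map_hom[OF E hom] power_mult[symmetric] mult.commute)
  also have "\<dots> \<doteq> (\<Sum>i\<le>degree f. coeff f i ^ ?q * (\<zeta> ^ i) ^ ?q)"
    using f(1) fO v\<zeta> order_trans[OF F_hom_v[OF \<sigma>] fO]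
    by (intro req_sum req_mult conj_frobenius req_refl v_power_le) (auto simp: poly_over_def)
  also have "(\<Sum>i\<le>degree f. coeff f i ^ ?q * (\<zeta> ^ i) ^ ?q) = (\<Sum>i\<le>degree f. (coeff f i * \<zeta> ^ i) ^ ?q)"
    by (simp add: power_mult_distrib)
  also have "\<dots> \<doteq> (\<Sum>i\<le>degree f. coeff f i * \<zeta> ^ i) ^ ?q"
    using fO v\<zeta> by (intro req_sym[OF frobenius_sum] v_mult_le v_power_le) auto
  also have "(\<Sum>i\<le>degree f. coeff f i * \<zeta> ^ i) ^ ?q = 0"
    using f(3) residue_card_ge_2 by (simp add: poly_altdef)
  finally obtain a where a: "poly f' a = 0" "\<zeta> ^ ?q \<doteq> a"
    using monic_close_root[of f' "\<zeta> ^ ?q"] map_hom_monic(2)[OF E hom f(2), folded f'_def] by blast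
  have "(\<zeta> ^ ?q) ^ m = 1"
    using m(2) by (metis mult.commute power_mult power_one)
  then have "\<zeta> ^ ?q = a"
    using root_of_unity_req_eq[OF _ root_f'[OF a(1)] m(1) a(2)] by blast
  then have root: "poly f' (\<zeta> ^ ?q) = 0"
    using a(1) by simp
  obtain k where k: "poly_over ?E k" "g = f * k"
    using fmin g by blast
  then show ?thesis
    using map_hom_mult[OF E hom f(1) k(1)] root by (simp add: f'_def)
qed

text \<open>The relation \<open>R\<close> sends the value of \<open>g\<close> at
  \<open>\<zeta>\<close> to the value of its conjugate at \<open>\<zeta> ^ q\<close>, for all tame
  roots at once. Constants give \<sigma> on the quadratic extension, \<open>g = X\<close> gives the
  \<open>q\<close>-th power on tame roots, and \<open>conj_tame_root\<close> is exactly the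
  single-valuedness.\<close>

lemma exists_weil_moving: "\<exists>w \<in> carrier (weil_group F v). w s \<noteq> s"
proof -
  let ?q = "residue_card F v" and ?E = quadratic_ext
  note E = quadratic_ext_subfield and hom = hom_on_\<sigma>[of quadratic_ext]
  define R where "R = {(poly g \<zeta>, poly (map_poly \<sigma> g) (\<zeta> ^ ?q)) |g \<zeta>. poly_over ?E g \<and> \<zeta> \<in> tame_roots}"
  have const: "(a, \<sigma> a) \<in> R" if "a \<in> ?E" for a
  proof -
    have "1 \<in> tame_roots"
      by (auto simp: tame_roots_def intro: exI[of _ 1])
    then show ?thesis
      unfolding R_def using poly_over_const[OF E that] map_hom_const[OF E hom, of a]
      by (intro CollectI exI[of _ "[:a:]"] exI[of _ 1]) simp
  qed
  have FE: "a \<in> ?E" if "a \<in> F" for a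
    unfolding quadratic_ext_def using that F_zero by (intro CollectI exI[of _ a] exI[of _ 0]) simp
  have "pair_ring R"
    unfolding pair_ring_def
  proof (intro conjI allI impI ballI)
    show "(a, a) \<in> R" if "a \<in> F" for a
      using const[OF FE[OF that]] F_homD(3)[OF \<sigma> that] by simp
    fix a b c d assume "(a, b) \<in> R" "(c, d) \<in> R"
    then obtain g \<zeta> h \<eta> where gh: "poly_over ?E g" "\<zeta> \<in> tame_roots" "poly_over ?E h" "\<eta> \<in> tame_roots"
      "a = poly g \<zeta>" "b = poly (map_poly \<sigma> g) (\<zeta> ^ ?q)" "c = poly h \<eta>" "d = poly (map_poly \<sigma> h) (\<eta> ^ ?q)"
      unfolding R_def mem_Collect_eq prod.inject by (elim exE conjE) (rule that; assumption)
    obtain \<xi> i j where \<xi>: "\<xi> \<in> tame_roots" "\<zeta> = \<xi> ^ i" "\<eta> = \<xi> ^ j"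
      using gh(2,4) by (rule tame_roots_common)
    define g' h' where "g' = pcompose g (monom 1 i)" and "h' = pcompose h (monom 1 j)"
    have over: "poly_over ?E g'" "poly_over ?E h'"
      unfolding g'_def h'_def using gh poly_over_monom[OF E subfield_closed(6)[OF E]]
      by (auto intro: poly_over_pcompose[OF E])
    have val: "a = poly g' \<xi>" "c = poly h' \<xi>"
      using gh(5,7) \<xi> by (simp_all add: g'_def h'_def poly_pcompose poly_monom)
    have val': "b = poly (map_poly \<sigma> g') (\<xi> ^ ?q)" "d = poly (map_poly \<sigma> h') (\<xi> ^ ?q)"
      using gh(6,8) \<xi> poly_map_hom_pcompose[OF E hom gh(1)] poly_map_hom_pcompose[OF E hom gh(3)]
      by (simp_all add: g'_def h'_def power_mult[symmetric] mult.commute)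
    show "(a + c, b + d) \<in> R"
      unfolding R_def using val val' \<xi>(1) poly_over_add[OF E over] map_hom_add[OF E hom over]
      by (intro CollectI exI[of _ "g' + h'"] exI[of _ \<xi>]) simp
    show "(a * c, b * d) \<in> R"
      unfolding R_def using val val' \<xi>(1) poly_over_mult[OF E over] map_hom_mult[OF E hom over]
      by (intro CollectI exI[of _ "g' * h'"] exI[of _ \<xi>]) simp
  next
    fix y assume "(0, y) \<in> R"
    then obtain g \<zeta> where "poly_over ?E g" "\<zeta> \<in> tame_roots" "poly g \<zeta> = 0"
      "y = poly (map_poly \<sigma> g) (\<zeta> ^ ?q)"
      unfolding R_def by auto
    then show "y = 0"
      using conj_tame_root by blast
  qed
  then obtain w where w: "F_hom w" and "\<forall>(x, y)\<in>R. w x = y"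
    using pair_ring_extend by blast
  then have wR: "w x = y" if "(x, y) \<in> R" for x y
    using that by auto
  have "w \<zeta> = \<zeta> ^ ?q" if "\<zeta> \<in> tame_roots" for \<zeta>
  proof (rule wR)
    show "(\<zeta>, \<zeta> ^ ?q) \<in> R"
      unfolding R_def
    proof (intro CollectI exI[of _ "monom 1 1"] exI[of _ \<zeta>] conjI)
      show "(\<zeta>, \<zeta> ^ ?q) = (poly (monom 1 1) \<zeta>, poly (map_poly \<sigma> (monom 1 1)) (\<zeta> ^ ?q))"
        using map_hom_monom[OF E hom, of 1 1] F_homD(5)[OF \<sigma>] by (simp add: poly_monom)
    qed (use that poly_over_monom[OF E subfield_closed(6)[OF E]] in auto)
  qed
  then have "w \<in> carrier (weil_group F v)"
    by (rule F_hom_weil[OF w(1)])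
  moreover have "s \<in> ?E"
    unfolding quadratic_ext_def using F_zero F_one by (intro CollectI exI[of _ 0] exI[of _ 1]) simp
  then have "w s = \<sigma> s"
    by (intro wR const)
  ultimately show ?thesis
    using s(2) by (intro bexI[of _ w]) simp_all
qed

end

lemma weil_group_moves:
  assumes "\<sigma> \<in> carrier (galois_group F)" "s ^ 2 \<in> F" "\<sigma> s \<noteq> s"
  shows "\<exists>w \<in> carrier (weil_group F v). w s \<noteq> s"
  using assms by (intro exists_weil_moving[of \<sigma>]) (auto simp: galois_group_def F_hom_def)

end


section \<open>Equivariant representations\<close>

lemma smult_smult_mat: "a \<cdot>\<^sub>m (b \<cdot>\<^sub>m A) = (a * b :: 'a :: semigroup_mult) \<cdot>\<^sub>m A"
  by (rule eq_matI) (auto simp: mult.assoc)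

lemma one_smult_mat: "(1 :: 'a :: monoid_mult) \<cdot>\<^sub>m A = A"
  by (rule eq_matI) auto

text \<open>\<open>invertible_mat\<close> prescribes no format for the inverse; the formats of the
  two products force it.\<close>

lemma GL_carrier: "T \<in> carrier (GL d) \<longleftrightarrow>
    T \<in> carrier_mat d d \<and> (\<exists>S\<in>carrier_mat d d. T * S = 1\<^sub>m d \<and> S * T = 1\<^sub>m d)"
proof
  assume "T \<in> carrier (GL d)"
  then have T: "T \<in> carrier_mat d d" and "invertible_mat T"
    by (auto simp: GL_def mat_group_def)
  then obtain S where S: "T * S = 1\<^sub>m (dim_row T)" "S * T = 1\<^sub>m (dim_row S)"
    unfolding invertible_mat_def inverts_mat_def by blast
  have "dim_col S = d" "dim_row S = d"
    using T arg_cong[OF S(1), of dim_col] arg_cong[OF S(2), of dim_col] by auto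
  then have "S \<in> carrier_mat d d" by auto
  then show "T \<in> carrier_mat d d \<and> (\<exists>S\<in>carrier_mat d d. T * S = 1\<^sub>m d \<and> S * T = 1\<^sub>m d)"
    using S T by auto
next
  assume "T \<in> carrier_mat d d \<and> (\<exists>S\<in>carrier_mat d d. T * S = 1\<^sub>m d \<and> S * T = 1\<^sub>m d)"
  then obtain S where "T \<in> carrier_mat d d" "S \<in> carrier_mat d d" "T * S = 1\<^sub>m d" "S * T = 1\<^sub>m d"
    by blast
  then show "T \<in> carrier (GL d)"
    by (auto simp: GL_def mat_group_def invertible_mat_def inverts_mat_def intro!: exI[of _ S])
qed

lemma mat_one_commute: "A \<in> carrier_mat d d \<Longrightarrow> A * 1\<^sub>m d = 1\<^sub>m d * (A :: 'a :: semiring_1 mat)"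
  by simp

lemma GL_mult: "A \<otimes>\<^bsub>GL d\<^esub> B = A * B" and GL_one: "\<one>\<^bsub>GL d\<^esub> = 1\<^sub>m d"
  by (simp_all add: GL_def mat_group_def)

lemma GL_group: "group (GL d)"
proof (rule groupI)
  fix A B assume "A \<in> carrier (GL d)" "B \<in> carrier (GL d)"
  then obtain A' B' where AB: "A \<in> carrier_mat d d" "A' \<in> carrier_mat d d" "A * A' = 1\<^sub>m d" "A' * A = 1\<^sub>m d"
    "B \<in> carrier_mat d d" "B' \<in> carrier_mat d d" "B * B' = 1\<^sub>m d" "B' * B = 1\<^sub>m d"
    unfolding GL_carrier by blast
  have "(A * B) * (B' * A') = A * (B * B') * A'"
    using AB(1,2,5,6) by (simp add: assoc_mult_mat[of _ d d _ d _ d])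
  moreover have "(B' * A') * (A * B) = B' * (A' * A) * B"
    using AB(1,2,5,6) by (simp add: assoc_mult_mat[of _ d d _ d _ d])
  ultimately have "(A * B) * (B' * A') = 1\<^sub>m d" "(B' * A') * (A * B) = 1\<^sub>m d"
    using AB by simp_all
  then show "A \<otimes>\<^bsub>GL d\<^esub> B \<in> carrier (GL d)"
    unfolding GL_carrier GL_mult using AB by (intro conjI bexI[of _ "B' * A'"]) auto
next
  show "\<one>\<^bsub>GL d\<^esub> \<in> carrier (GL d)"
    unfolding GL_carrier GL_one by (intro conjI bexI[of _ "1\<^sub>m d"]) auto
next
  fix A assume "A \<in> carrier (GL d)"
  then obtain A' where A: "A \<in> carrier_mat d d" "A' \<in> carrier_mat d d" "A * A' = 1\<^sub>m d" "A' * A = 1\<^sub>m d"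
    unfolding GL_carrier by blast
  then show "\<exists>y\<in>carrier (GL d). y \<otimes>\<^bsub>GL d\<^esub> A = \<one>\<^bsub>GL d\<^esub>"
    unfolding GL_mult GL_one by (intro bexI[of _ A']) (auto simp: GL_carrier)
  show "\<one>\<^bsub>GL d\<^esub> \<otimes>\<^bsub>GL d\<^esub> A = A"
    using A by (simp add: GL_mult GL_one)
qed (auto simp: GL_carrier GL_mult assoc_mult_mat[of _ d d _ d _ d])

lemma GL_smult:
  assumes "c \<noteq> 0" "T \<in> carrier (GL d)"
  shows "c \<cdot>\<^sub>m T \<in> carrier (GL d)"
proof -
  obtain S where S: "T \<in> carrier_mat d d" "S \<in> carrier_mat d d" "T * S = 1\<^sub>m d" "S * T = 1\<^sub>m d"
    using assms(2) unfolding GL_carrier by blast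
  have "(c \<cdot>\<^sub>m T) * (inverse c \<cdot>\<^sub>m S) = 1\<^sub>m d" "(inverse c \<cdot>\<^sub>m S) * (c \<cdot>\<^sub>m T) = 1\<^sub>m d"
    using S assms(1) by (simp_all add: mult_smult_assoc_mat[of _ d d _ d] mult_smult_distrib[of _ d d _ d] smult_smult_mat one_smult_mat)
  then show ?thesis
    unfolding GL_carrier using S by (intro conjI bexI[of _ "inverse c \<cdot>\<^sub>m S"]) auto
qed

lemma Cstar_simps: "carrier Cstar = - {0}" "x \<otimes>\<^bsub>Cstar\<^esub> y = x * y" "\<one>\<^bsub>Cstar\<^esub> = 1"
  by (simp_all add: Cstar_def)

lemma Cstar_group: "group Cstar"
  by (rule groupI) (auto simp: Cstar_simps intro!: exI[of _ "inverse _"] bexI[of _ "inverse _"])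

lemma representationsD:
  assumes "(d, \<rho>) \<in> representations A" "group A"
  shows "a \<in> carrier A \<Longrightarrow> \<rho> a \<in> carrier (GL d)" "a \<in> carrier A \<Longrightarrow> \<rho> a \<in> carrier_mat d d"
    "a \<in> carrier A \<Longrightarrow> b \<in> carrier A \<Longrightarrow> \<rho> (a \<otimes>\<^bsub>A\<^esub> b) = \<rho> a * \<rho> b" "\<rho> \<one>\<^bsub>A\<^esub> = 1\<^sub>m d"
proof -
  have hom: "\<rho> \<in> hom A (GL d)"
    using assms(1) by (simp add: representations_def)
  then show GL: "a \<in> carrier A \<Longrightarrow> \<rho> a \<in> carrier (GL d)" for a
    by (rule hom_in_carrier)
  then show "a \<in> carrier A \<Longrightarrow> \<rho> a \<in> carrier_mat d d" for a
    by (simp add: GL_carrier)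
  show "a \<in> carrier A \<Longrightarrow> b \<in> carrier A \<Longrightarrow> \<rho> (a \<otimes>\<^bsub>A\<^esub> b) = \<rho> a * \<rho> b" for a b
    using hom_mult[OF hom] by (simp add: GL_mult)
  show "\<rho> \<one>\<^bsub>A\<^esub> = 1\<^sub>m d"
    using hom_one[OF hom assms(2) GL_group] by (simp add: GL_one)
qed

lemma rep_equivE:
  assumes "(x, y) \<in> rep_equiv A"
  obtains d \<rho> \<rho>' T where "x = (d, \<rho>)" "y = (d, \<rho>')" "(d, \<rho>) \<in> representations A"
    "(d, \<rho>') \<in> representations A" "T \<in> carrier (GL d)" "\<forall>a\<in>carrier A. \<rho>' a * T = T * \<rho> a"
  using assms unfolding rep_equiv_def by blast

lemma equivariant_repsE:
  assumes "x \<in> equivariant_reps A Z i chi"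
  obtains d \<rho> where "x = (d, \<rho>)" "(d, \<rho>) \<in> representations A"
    "\<forall>z\<in>carrier Z. \<rho> (i z) = chi z \<cdot>\<^sub>m 1\<^sub>m d"
  using assms unfolding equivariant_reps_def by blast

lemma rep_equiv_equiv: "equiv (representations A) (rep_equiv A)"
proof (rule equivI)
  show "rep_equiv A \<subseteq> representations A \<times> representations A"
    by (auto simp: rep_equiv_def)
  have mat: "\<rho> a \<in> carrier_mat d d" if "(d, \<rho>) \<in> representations A" "a \<in> carrier A" for d \<rho> a
    using that by (auto simp: representations_def GL_carrier dest!: hom_in_carrier)
  show "refl_on (representations A) (rep_equiv A)"
  proof (rule refl_onI)
    fix r assume r: "r \<in> representations A"
    obtain d \<rho> where "r = (d, \<rho>)" by fastforce
    then show "(r, r) \<in> rep_equiv A"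
      using r monoid.one_closed[OF group.is_monoid[OF GL_group, of d]] mat[of d \<rho>]
      by (auto simp: rep_equiv_def GL_one intro!: bexI[of _ "1\<^sub>m d"] mat_one_commute)
  qed
  show "sym (rep_equiv A)"
  proof (rule symI)
    fix r r' assume "(r, r') \<in> rep_equiv A"
    then obtain d \<rho> \<rho>' T where r: "r = (d, \<rho>)" "r' = (d, \<rho>')" "(d, \<rho>) \<in> representations A"
      "(d, \<rho>') \<in> representations A" "T \<in> carrier (GL d)" "\<And>a. a \<in> carrier A \<Longrightarrow> \<rho>' a * T = T * \<rho> a"
      by (auto simp: rep_equiv_def)
    then obtain S where S: "T \<in> carrier_mat d d" "S \<in> carrier_mat d d" "T * S = 1\<^sub>m d" "S * T = 1\<^sub>m d"
      unfolding GL_carrier by blast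
    have "\<rho> a * S = S * \<rho>' a" if a: "a \<in> carrier A" for a
    proof -
      note m = mat[OF r(3) a] mat[OF r(4) a]
      have "\<rho> a * S = S * (T * \<rho> a) * S"
        using m S by (simp add: assoc_mult_mat[of _ d d _ d _ d, symmetric])
      also have "\<dots> = S * (\<rho>' a * T) * S"
        using r(6)[OF a] by simp
      also have "\<dots> = S * \<rho>' a * (T * S)"
        using m S(1,2) by (simp add: assoc_mult_mat[of _ d d _ d _ d])
      also have "\<dots> = S * \<rho>' a"
        using m S by simp
      finally show ?thesis .
    qed
    moreover have "S \<in> carrier (GL d)"
      using S unfolding GL_carrier by blast
    ultimately show "(r', r) \<in> rep_equiv A"
      using r by (auto simp: rep_equiv_def)
  qed
  show "trans (rep_equiv A)"
  proof (rule transI)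
    fix r r' r'' assume "(r, r') \<in> rep_equiv A" "(r', r'') \<in> rep_equiv A"
    then obtain d \<rho> \<rho>' \<rho>'' T S where r: "r = (d, \<rho>)" "r' = (d, \<rho>')" "r'' = (d, \<rho>'')"
      "(d, \<rho>) \<in> representations A" "(d, \<rho>') \<in> representations A" "(d, \<rho>'') \<in> representations A"
      "T \<in> carrier (GL d)" "\<And>a. a \<in> carrier A \<Longrightarrow> \<rho>' a * T = T * \<rho> a"
      "S \<in> carrier (GL d)" "\<And>a. a \<in> carrier A \<Longrightarrow> \<rho>'' a * S = S * \<rho>' a"
      by (auto simp: rep_equiv_def)
    have TS: "T \<in> carrier_mat d d" "S \<in> carrier_mat d d"
      using r by (auto simp: GL_carrier)
    have "\<rho>'' a * (S * T) = (S * T) * \<rho> a" if a: "a \<in> carrier A" for a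
    proof -
      note m = mat[OF r(4) a] mat[OF r(5) a] mat[OF r(6) a]
      have "\<rho>'' a * (S * T) = (\<rho>'' a * S) * T"
        using m TS by (simp add: assoc_mult_mat[of _ d d _ d _ d])
      also have "\<dots> = S * (\<rho>' a * T)"
        using m TS r(10)[OF a] by (simp add: assoc_mult_mat[of _ d d _ d _ d])
      also have "\<dots> = (S * T) * \<rho> a"
        using m TS r(8)[OF a] by (simp add: assoc_mult_mat[of _ d d _ d _ d])
      finally show ?thesis .
    qed
    moreover have "S * T \<in> carrier (GL d)"
      using monoid.m_closed[OF group.is_monoid[OF GL_group] r(9) r(7)] by (simp add: GL_mult)
    ultimately show "(r, r'') \<in> rep_equiv A"
      using r by (auto simp: rep_equiv_def)
  qed
qed

text \<open>\<Phi> saturates the image of a class, so no representatives are chosen.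
  \<open>g\<close> respects the relations on all of \<open>X\<close>, while bijectivity concerns
  only the subsets \<open>P\<close> and \<open>Q\<close>; the last clause records that \<Phi> is
  induced by \<open>g\<close>.\<close>

lemma bij_betw_quotient:
  assumes E: "equiv X E" and E': "equiv Y E'" and PQ: "P \<subseteq> X" "Q \<subseteq> Y"
    and resp: "\<And>x y. (x, y) \<in> E \<Longrightarrow> (g x, g y) \<in> E'"
    and maps: "\<And>x. x \<in> P \<Longrightarrow> g x \<in> Q"
    and inj: "\<And>x y. x \<in> P \<Longrightarrow> y \<in> P \<Longrightarrow> (g x, g y) \<in> E' \<Longrightarrow> (x, y) \<in> E"
    and surj: "\<And>y. y \<in> Q \<Longrightarrow> \<exists>x\<in>P. (g x, y) \<in> E'"
  shows "\<exists>\<Phi>. bij_betw \<Phi> (P // E) (Q // E') \<and> (\<forall>x. E `` {x} \<in> P // E \<longrightarrow> \<Phi> (E `` {x}) = E' `` {g x})"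
proof -
  define \<Phi> where "\<Phi> C = E' `` (g ` C)" for C
  have \<Phi>: "\<Phi> (E `` {x}) = E' `` {g x}" if "x \<in> X" for x
  proof
    show "\<Phi> (E `` {x}) \<subseteq> E' `` {g x}"
    proof
      fix z assume "z \<in> \<Phi> (E `` {x})"
      then obtain y where "(x, y) \<in> E" "(g y, z) \<in> E'"
        unfolding \<Phi>_def by blast
      then have "(g x, z) \<in> E'"
        using resp[of x y] E' unfolding equiv_def by (meson transD)
      then show "z \<in> E' `` {g x}" by blast
    qed
    have "(x, x) \<in> E"
      using E that by (simp add: equiv_def refl_on_def)
    then show "E' `` {g x} \<subseteq> \<Phi> (E `` {x})"
      unfolding \<Phi>_def by blast
  qed
  have "bij_betw \<Phi> (P // E) (Q // E')"
    unfolding bij_betw_def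
  proof
    show "inj_on \<Phi> (P // E)"
    proof (rule inj_onI)
      fix C D assume "C \<in> P // E" "D \<in> P // E" and eq: "\<Phi> C = \<Phi> D"
      then obtain x y where xy: "x \<in> P" "C = E `` {x}" "y \<in> P" "D = E `` {y}"
        by (auto elim!: quotientE)
      then have "E' `` {g x} = E' `` {g y}"
        using eq \<Phi> PQ by auto
      then have "(g x, g y) \<in> E'"
        using eq_equiv_class[OF _ E'] maps[OF xy(3)] PQ by blast
      then have "(x, y) \<in> E"
        using inj xy by blast
      then show "C = D"
        using equiv_class_eq[OF E] xy by simp
    qed
    show "\<Phi> ` (P // E) = Q // E'"
    proof (intro equalityI subsetI)
      fix D assume "D \<in> \<Phi> ` (P // E)"
      then obtain x where "x \<in> P" "D = \<Phi> (E `` {x})"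
        by (auto elim!: quotientE)
      then show "D \<in> Q // E'"
        using \<Phi>[of x] PQ(1) quotientI[OF maps[of x], of E'] by auto
    next
      fix D assume "D \<in> Q // E'"
      then obtain y where y: "y \<in> Q" "D = E' `` {y}"
        by (auto elim!: quotientE)
      then obtain x where x: "x \<in> P" "(g x, y) \<in> E'"
        using surj by blast
      then have "D = \<Phi> (E `` {x})"
        using \<Phi>[of x] PQ(1) y(2) equiv_class_eq[OF E' x(2)] by auto
      then show "D \<in> \<Phi> ` (P // E)"
        using x by (auto intro: quotientI)
    qed
  qed
  moreover have "\<Phi> (E `` {x}) = E' `` {g x}" if x: "E `` {x} \<in> P // E" for x
  proof -
    obtain y where y: "y \<in> P" "E `` {x} = E `` {y}"
      using x by (auto elim!: quotientE)
    have "(y, y) \<in> E"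
      using E y(1) PQ(1) by (auto simp: equiv_def refl_on_def)
    then have "E `` {x} \<noteq> {}"
      unfolding y(2) by blast
    then have "x \<in> X"
      using E by (auto simp: equiv_def)
    then show ?thesis by (rule \<Phi>)
  qed
  ultimately show ?thesis by blast
qed

text \<open>By \<open>gen\<close>, a \<open>chi\<close>-equivariant representation is determined by
  its pull-back up to the scalars \<open>chi z\<close>, so intertwiners over \<open>B\<close> are
  intertwiners over \<open>A\<close>. \<open>match\<close> makes the pull-back
  \<open>zeta\<close>-equivariant, and \<open>ker\<close> makes the extension
  \<open>chi z \<cdot>\<^sub>m \<rho> x\<close> well defined.\<close>

lemma equivariant_pullback_bij:
  fixes A :: "('a, 'm) monoid_scheme" and B :: "('b, 'n) monoid_scheme"
    and Z :: "('c, 'r) monoid_scheme" and Y :: "('e, 's) monoid_scheme"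
  assumes A: "group A" and B: "group B" and Z: "group Z"
    and f: "f \<in> hom B A" and i: "i \<in> hom Z A" and chi: "chi \<in> hom Z Cstar"
    and j: "\<And>y. y \<in> carrier Y \<Longrightarrow> j y \<in> carrier B"
    and central: "\<And>z a. z \<in> carrier Z \<Longrightarrow> a \<in> carrier A \<Longrightarrow> i z \<otimes>\<^bsub>A\<^esub> a = a \<otimes>\<^bsub>A\<^esub> i z"
    and gen: "\<And>a. a \<in> carrier A \<Longrightarrow> \<exists>x\<in>carrier B. \<exists>z\<in>carrier Z. a = f x \<otimes>\<^bsub>A\<^esub> i z"
    and ker: "\<And>x z. x \<in> carrier B \<Longrightarrow> z \<in> carrier Z \<Longrightarrow> f x \<otimes>\<^bsub>A\<^esub> i z = \<one>\<^bsub>A\<^esub> \<Longrightarrow>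
      \<exists>y\<in>carrier Y. x = j y \<and> zeta y * chi z = 1"
    and match: "\<And>y. y \<in> carrier Y \<Longrightarrow> \<exists>z\<in>carrier Z. f (j y) = i z \<and> chi z = zeta y"
  shows "\<exists>\<Phi>. bij_betw \<Phi> (Rep_equivariant A Z i chi) (Rep_equivariant B Y j zeta) \<and>
    (\<forall>d \<rho>. rep_equiv A `` {(d, \<rho>)} \<in> Rep_equivariant A Z i chi \<longrightarrow>
       \<Phi> (rep_equiv A `` {(d, \<rho>)}) = rep_equiv B `` {(d, \<rho> \<circ> f)})"
proof -
  interpret A: group A by (rule A)
  interpret B: group B by (rule B)
  interpret Z: group Z by (rule Z)
  let ?P = "equivariant_reps A Z i chi" and ?Q = "equivariant_reps B Y j zeta"
  define g where "g r = (fst r, snd r \<circ> f)" for r :: "nat \<times> ('a \<Rightarrow> complex mat)"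
  have fc: "f x \<in> carrier A" if "x \<in> carrier B" for x
    using f that by (rule hom_in_carrier)
  have ic: "i z \<in> carrier A" if "z \<in> carrier Z" for z
    using i that by (rule hom_in_carrier)
  have chi0: "chi z \<noteq> 0" if "z \<in> carrier Z" for z
    using hom_in_carrier[OF chi that] by (simp add: Cstar_simps)
  have chim: "chi (z \<otimes>\<^bsub>Z\<^esub> w) = chi z * chi w" if "z \<in> carrier Z" "w \<in> carrier Z" for z w
    using hom_mult[OF chi that] by (simp add: Cstar_simps)
  have rep_g: "(d, \<rho> \<circ> f) \<in> representations B" if "(d, \<rho>) \<in> representations A" for d \<rho>
    using that hom_compose[OF f] by (auto simp: representations_def)
  have "\<exists>\<Phi>. bij_betw \<Phi> (?P // rep_equiv A) (?Q // rep_equiv B) \<and>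
    (\<forall>x. rep_equiv A `` {x} \<in> ?P // rep_equiv A \<longrightarrow> \<Phi> (rep_equiv A `` {x}) = rep_equiv B `` {g x})"
  proof (rule bij_betw_quotient[OF rep_equiv_equiv rep_equiv_equiv])
    show "?P \<subseteq> representations A" "?Q \<subseteq> representations B"
      by (auto simp: equivariant_reps_def)
    show "(g x, g y) \<in> rep_equiv B" if xy: "(x, y) \<in> rep_equiv A" for x y
    proof -
      obtain d \<rho> \<rho>' T where "x = (d, \<rho>)" "y = (d, \<rho>')" "(d, \<rho>) \<in> representations A"
        "(d, \<rho>') \<in> representations A" "T \<in> carrier (GL d)" "\<forall>a\<in>carrier A. \<rho>' a * T = T * \<rho> a"
        using xy by (rule rep_equivE)
      then show ?thesis
        using rep_g[of d \<rho>] rep_g[of d \<rho>'] fc by (auto simp: rep_equiv_def g_def intro!: bexI[of _ T])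
    qed
    show "g r \<in> ?Q" if rP: "r \<in> ?P" for r
    proof -
      obtain d \<rho> where r: "r = (d, \<rho>)" "(d, \<rho>) \<in> representations A"
        "\<forall>z\<in>carrier Z. \<rho> (i z) = chi z \<cdot>\<^sub>m 1\<^sub>m d"
        using rP by (rule equivariant_repsE)
      have "\<rho> (f (j y)) = zeta y \<cdot>\<^sub>m 1\<^sub>m d" if yY: "y \<in> carrier Y" for y
      proof -
        obtain z where "z \<in> carrier Z" "f (j y) = i z" "chi z = zeta y"
          using match[OF yY] by blast
        then show ?thesis
          using r(3) by simp
      qed
      then show ?thesis
        using r rep_g by (auto simp: equivariant_reps_def g_def)
    qed
    show "(x, y) \<in> rep_equiv A" if xy: "x \<in> ?P" "y \<in> ?P" "(g x, g y) \<in> rep_equiv B" for x y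
    proof -
      obtain d \<rho> \<rho>' T where r: "x = (d, \<rho>)" "y = (d, \<rho>')" "(d, \<rho>) \<in> representations A"
        "(d, \<rho>') \<in> representations A" "T \<in> carrier (GL d)"
        "\<And>b. b \<in> carrier B \<Longrightarrow> \<rho>' (f b) * T = T * \<rho> (f b)"
        "\<And>z. z \<in> carrier Z \<Longrightarrow> \<rho> (i z) = chi z \<cdot>\<^sub>m 1\<^sub>m d"
        "\<And>z. z \<in> carrier Z \<Longrightarrow> \<rho>' (i z) = chi z \<cdot>\<^sub>m 1\<^sub>m d"
        using xy by (auto simp: rep_equiv_def equivariant_reps_def g_def)
      note D = representationsD[OF r(3) A] and D' = representationsD[OF r(4) A]
      have T: "T \<in> carrier_mat d d"
        using r(5) by (simp add: GL_carrier)
      have "\<rho>' a * T = T * \<rho> a" if aA: "a \<in> carrier A" for a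
      proof -
        obtain b z where a: "b \<in> carrier B" "z \<in> carrier Z" "a = f b \<otimes>\<^bsub>A\<^esub> i z"
          using gen[OF aA] by blast
        have "\<rho> a = chi z \<cdot>\<^sub>m \<rho> (f b)" "\<rho>' a = chi z \<cdot>\<^sub>m \<rho>' (f b)"
          using a fc ic D(2,3) D'(2,3) r(7,8)
          by (simp_all add: mult_smult_distrib[of _ d d _ d] right_mult_one_mat[of _ d d])
        then show ?thesis
          using r(6)[OF a(1)] T D(2)[OF fc[OF a(1)]] D'(2)[OF fc[OF a(1)]]
          by (simp add: mult_smult_distrib[of _ d d _ d] mult_smult_assoc_mat[of _ d d _ d])
      qed
      then show ?thesis
        using r by (auto simp: rep_equiv_def)
    qed
    show "\<exists>x\<in>?P. (g x, y) \<in> rep_equiv B" if yQ: "y \<in> ?Q" for y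
    proof -
      obtain d \<rho> where y: "y = (d, \<rho>)" "(d, \<rho>) \<in> representations B"
        "\<forall>y\<in>carrier Y. \<rho> (j y) = zeta y \<cdot>\<^sub>m 1\<^sub>m d"
        using yQ by (rule equivariant_repsE)
      note D = representationsD[OF y(2) B]
      \<comment> \<open>Two factorizations of one element differ by the pair \<open>?x\<close>,
        \<open>?z\<close>, on which \<open>f\<close> times \<open>i\<close> is trivial;
        \<open>ker\<close> then equates the scalars.\<close>
      have wd: "chi z \<cdot>\<^sub>m \<rho> x = chi z' \<cdot>\<^sub>m \<rho> x'"
        if xz: "x \<in> carrier B" "z \<in> carrier Z" "x' \<in> carrier B" "z' \<in> carrier Z"
          and eq: "f x \<otimes>\<^bsub>A\<^esub> i z = f x' \<otimes>\<^bsub>A\<^esub> i z'" for x z x' z'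
      proof -
        let ?x = "inv\<^bsub>B\<^esub> x \<otimes>\<^bsub>B\<^esub> x'" and ?z = "z' \<otimes>\<^bsub>Z\<^esub> inv\<^bsub>Z\<^esub> z"
        interpret f: group_hom B A f
          using A B f by (simp add: group_hom_def group_hom_axioms_def)
        interpret i: group_hom Z A i
          using A Z i by (simp add: group_hom_def group_hom_axioms_def)
        have "f ?x \<otimes>\<^bsub>A\<^esub> i ?z = inv\<^bsub>A\<^esub> f x \<otimes>\<^bsub>A\<^esub> (f x' \<otimes>\<^bsub>A\<^esub> i z') \<otimes>\<^bsub>A\<^esub> inv\<^bsub>A\<^esub> i z"
          using xz by (simp add: A.m_assoc)
        also have "\<dots> = \<one>\<^bsub>A\<^esub>"
          unfolding eq[symmetric] using xz by (simp add: A.m_assoc)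
        finally obtain y where yy: "y \<in> carrier Y" "?x = j y" "zeta y * chi ?z = 1"
          using ker[of ?x ?z] xz by auto
        have "\<rho> x' = \<rho> (x \<otimes>\<^bsub>B\<^esub> ?x)"
          using xz by (simp add: B.m_assoc[symmetric])
        also have "\<dots> = \<rho> x * (zeta y \<cdot>\<^sub>m 1\<^sub>m d)"
          using xz D(3)[of x "j y"] yy(1) y(3) j by (simp add: yy(2))
        also have "\<dots> = zeta y \<cdot>\<^sub>m \<rho> x"
          using D(2)[OF xz(1)] by (simp add: mult_smult_distrib[of _ d d _ d])
        finally have "chi z' \<cdot>\<^sub>m \<rho> x' = (chi z' * zeta y) \<cdot>\<^sub>m \<rho> x"
          by (simp add: smult_smult_mat)
        moreover have "chi z' = chi ?z * chi z"
          using xz chim[of ?z z] by (simp add: Z.m_assoc)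
        then have "chi z' * zeta y = chi z"
          using yy(3) by (simp add: mult_ac)
        ultimately show ?thesis by simp
      qed
      define \<rho>' where "\<rho>' a = (SOME M. \<exists>x\<in>carrier B. \<exists>z\<in>carrier Z. a = f x \<otimes>\<^bsub>A\<^esub> i z \<and> M = chi z \<cdot>\<^sub>m \<rho> x)" for a
      have \<rho>': "\<rho>' (f x \<otimes>\<^bsub>A\<^esub> i z) = chi z \<cdot>\<^sub>m \<rho> x" if "x \<in> carrier B" "z \<in> carrier Z" for x z
      proof -
        have "\<exists>M. \<exists>x'\<in>carrier B. \<exists>z'\<in>carrier Z. f x \<otimes>\<^bsub>A\<^esub> i z = f x' \<otimes>\<^bsub>A\<^esub> i z' \<and> M = chi z' \<cdot>\<^sub>m \<rho> x'"
          using that by (intro exI[of _ "chi z \<cdot>\<^sub>m \<rho> x"] bexI[of _ x] bexI[of _ z] conjI refl)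
        from someI_ex[OF this] obtain x' z' where x': "x' \<in> carrier B" "z' \<in> carrier Z"
          "f x \<otimes>\<^bsub>A\<^esub> i z = f x' \<otimes>\<^bsub>A\<^esub> i z'" "\<rho>' (f x \<otimes>\<^bsub>A\<^esub> i z) = chi z' \<cdot>\<^sub>m \<rho> x'"
          unfolding \<rho>'_def by (elim bexE conjE)
        then show ?thesis
          using wd[OF that x'(1,2,3)] by simp
      qed
      have rep: "(d, \<rho>') \<in> representations A"
        unfolding representations_def mem_Collect_eq prod.case
      proof (rule homI)
        fix a assume "a \<in> carrier A"
        then obtain x z where "x \<in> carrier B" "z \<in> carrier Z" "a = f x \<otimes>\<^bsub>A\<^esub> i z"
          using gen by blast
        then show "\<rho>' a \<in> carrier (GL d)"
          using \<rho>' D(1) chi0 by (auto intro: GL_smult)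
      next
        fix a b assume ab: "a \<in> carrier A" "b \<in> carrier A"
        obtain x z where "x \<in> carrier B" "z \<in> carrier Z" "a = f x \<otimes>\<^bsub>A\<^esub> i z"
          using gen[OF ab(1)] by blast
        moreover obtain x' z' where "x' \<in> carrier B" "z' \<in> carrier Z" "b = f x' \<otimes>\<^bsub>A\<^esub> i z'"
          using gen[OF ab(2)] by blast
        ultimately have xz: "x \<in> carrier B" "z \<in> carrier Z" "a = f x \<otimes>\<^bsub>A\<^esub> i z"
          "x' \<in> carrier B" "z' \<in> carrier Z" "b = f x' \<otimes>\<^bsub>A\<^esub> i z'"
          by blast+
        have "a \<otimes>\<^bsub>A\<^esub> b = f x \<otimes>\<^bsub>A\<^esub> (i z \<otimes>\<^bsub>A\<^esub> f x') \<otimes>\<^bsub>A\<^esub> i z'"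
          using xz fc ic by (simp add: A.m_assoc)
        also have "\<dots> = f (x \<otimes>\<^bsub>B\<^esub> x') \<otimes>\<^bsub>A\<^esub> i (z \<otimes>\<^bsub>Z\<^esub> z')"
          using xz fc ic central[OF xz(2) fc[OF xz(4)]] hom_mult[OF f xz(1,4)] hom_mult[OF i xz(2,5)]
          by (simp add: A.m_assoc)
        finally have "\<rho>' (a \<otimes>\<^bsub>A\<^esub> b) = (chi z * chi z') \<cdot>\<^sub>m (\<rho> x * \<rho> x')"
          using xz chim D(3) \<rho>' by simp
        also have "\<dots> = \<rho>' a * \<rho>' b"
          using xz \<rho>' D(2)[OF xz(1)] D(2)[OF xz(4)]
          by (simp add: mult_smult_distrib[of _ d d _ d] mult_smult_assoc_mat[of _ d d _ d] smult_smult_mat mult.commute)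
        finally show "\<rho>' (a \<otimes>\<^bsub>A\<^esub> b) = \<rho>' a \<otimes>\<^bsub>GL d\<^esub> \<rho>' b"
          by (simp add: GL_mult)
      qed
      have i1: "i \<one>\<^bsub>Z\<^esub> = \<one>\<^bsub>A\<^esub>" and f1: "f \<one>\<^bsub>B\<^esub> = \<one>\<^bsub>A\<^esub>"
        using hom_one[OF i Z A] hom_one[OF f B A] by auto
      have "\<rho>' (i z) = chi z \<cdot>\<^sub>m 1\<^sub>m d" if "z \<in> carrier Z" for z
        using \<rho>'[of "\<one>\<^bsub>B\<^esub>" z] that ic[OF that] D(4) by (simp add: f1)
      then have P: "(d, \<rho>') \<in> ?P"
        using rep by (simp add: equivariant_reps_def)
      have chi1: "chi \<one>\<^bsub>Z\<^esub> = 1"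
        using hom_one[OF chi Z Cstar_group] by (simp add: Cstar_simps)
      have "\<rho>' (f x) = \<rho> x" if "x \<in> carrier B" for x
        using \<rho>'[of x "\<one>\<^bsub>Z\<^esub>"] that fc[OF that] by (simp add: i1 chi1 one_smult_mat)
      then have "(g (d, \<rho>'), y) \<in> rep_equiv B"
        using y(1,2) rep_g[OF rep] D(2) monoid.one_closed[OF group.is_monoid[OF GL_group, of d]]
        by (auto simp: rep_equiv_def g_def GL_one intro!: bexI[of _ "1\<^sub>m d"] mat_one_commute)
      with P show ?thesis by blast
    qed
  qed
  then obtain \<Phi> where \<Phi>: "bij_betw \<Phi> (?P // rep_equiv A) (?Q // rep_equiv B)"
    "\<forall>x. rep_equiv A `` {x} \<in> ?P // rep_equiv A \<longrightarrow> \<Phi> (rep_equiv A `` {x}) = rep_equiv B `` {g x}"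
    by (elim exE conjE)
  have "\<Phi> (rep_equiv A `` {(d, \<rho>)}) = rep_equiv B `` {(d, \<rho> \<circ> f)}"
    if "rep_equiv A `` {(d, \<rho>)} \<in> ?P // rep_equiv A" for d \<rho>
    using \<Phi>(2) that by (simp add: g_def)
  with \<Phi>(1) show ?thesis
    unfolding Rep_equivariant_def by (intro exI[of _ \<Phi>] conjI allI impI)
qed


section \<open>Component groups and coverings\<close>

lemma continuous_on_mat_entry:
  fixes X :: "'a::topological_space mat set"
  assumes "X \<subseteq> carrier_mat n m" "i < n" "j < m"
  shows "continuous_on X (\<lambda>A. A $$ (i, j))"
  unfolding continuous_on_open_invariant
proof (intro allI impI)
  fix B :: "'a set" assume B: "open B"
  let ?U = "{A \<in> carrier_mat n m. A $$ (i, j) \<in> B}"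
  \<comment> \<open>Openness is tested format by format: for \<open>n\<close> and \<open>m\<close>
    this is a coordinate condition, for any other format the preimage is empty.\<close>
  have "open {f. mat nr nc f \<in> ?U}" for nr nc
  proof (cases "nr = n \<and> nc = m")
    case True
    then have "{f. mat nr nc f \<in> ?U} = (\<lambda>f. f (i, j)) -` B"
      using assms(2,3) by auto
    then show ?thesis
      using open_vimage[OF B continuous_on_product_coordinates[of "(i, j)"]] by simp
  next
    case False
    then have "{f. mat nr nc f \<in> ?U} = {}"
      by auto
    then show ?thesis by (simp only: open_empty)
  qed
  then have "open ?U"
    unfolding open_mat_def by blast
  moreover have "?U \<inter> X = (\<lambda>A. A $$ (i, j)) -` B \<inter> X"
    using assms(1) by auto
  ultimately show "\<exists>A. open A \<and> A \<inter> X = (\<lambda>A. A $$ (i, j)) -` B \<inter> X"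
    by blast
qed

lemma continuous_on_matI:
  fixes F :: "'b::topological_space \<Rightarrow> 'a::{topological_space, zero} mat"
  assumes F: "\<And>x. x \<in> X \<Longrightarrow> F x \<in> carrier_mat n m"
    and cont: "\<And>i j. i < n \<Longrightarrow> j < m \<Longrightarrow> continuous_on X (\<lambda>x. F x $$ (i, j))"
  shows "continuous_on X F"
proof -
  \<comment> \<open>The entries are extended by 0 outside the format, because open sets of matrices
    are tested on functions of all index pairs.\<close>
  define g where "g x ij = (if fst ij < n \<and> snd ij < m then F x $$ ij else 0)" for x ij
  have "continuous_on X (\<lambda>x. g x ij)" for ij
  proof (cases "fst ij < n \<and> snd ij < m")
    case True
    then show ?thesis
      using cont[of "fst ij" "snd ij"] by (simp add: g_def)
  qed (auto simp: g_def)
  then have g: "continuous_on X g"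
    by (rule continuous_on_coordinatewise_then_product)
  show ?thesis
    unfolding continuous_on_open_invariant
  proof (intro allI impI)
    fix B :: "'a mat set" assume "open B"
    then have "open {f. mat n m f \<in> B}"
      by (simp add: open_mat_def)
    from g[unfolded continuous_on_open_invariant, rule_format, OF this]
    obtain A where A: "open A" "A \<inter> X = g -` {f. mat n m f \<in> B} \<inter> X"
      by blast
    have "mat n m (g x) = F x" if "x \<in> X" for x
      using F[OF that] by (intro eq_matI) (auto simp: g_def)
    then have "g -` {f. mat n m f \<in> B} \<inter> X = F -` B \<inter> X"
      by auto
    then show "\<exists>A. open A \<and> A \<inter> X = F -` B \<inter> X"
      using A by auto
  qed
qed

lemma continuous_on_entry:
  fixes F :: "'b::topological_space \<Rightarrow> 'a::topological_space mat"
  assumes "continuous_on X F" "\<And>x. x \<in> X \<Longrightarrow> F x \<in> carrier_mat n m" "i < n" "j < m"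
  shows "continuous_on X (\<lambda>x. F x $$ (i, j))"
  using continuous_on_compose2[OF continuous_on_mat_entry[of "carrier_mat n m" n m i j] assms(1)] assms(2-4)
  by auto

lemma continuous_on_mat_mult:
  fixes F G :: "'b::topological_space \<Rightarrow> complex mat"
  assumes F: "continuous_on X F" "\<And>x. x \<in> X \<Longrightarrow> F x \<in> carrier_mat n k"
    and G: "continuous_on X G" "\<And>x. x \<in> X \<Longrightarrow> G x \<in> carrier_mat k m"
  shows "continuous_on X (\<lambda>x. F x * G x)"
proof (rule continuous_on_matI)
  show "F x * G x \<in> carrier_mat n m" if "x \<in> X" for x
    using F(2)[OF that] G(2)[OF that] by simp
  fix i j assume ij: "i < n" "j < m"
  have "(F x * G x) $$ (i, j) = (\<Sum>l\<in>{0..<k}. F x $$ (i, l) * G x $$ (l, j))" if "x \<in> X" for x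
    using F(2)[OF that] G(2)[OF that] ij by (auto simp: scalar_prod_def)
  moreover have "continuous_on X (\<lambda>x. \<Sum>l\<in>{0..<k}. F x $$ (i, l) * G x $$ (l, j))"
    using ij by (intro continuous_intros continuous_on_entry[OF F] continuous_on_entry[OF G]) auto
  ultimately show "continuous_on X (\<lambda>x. (F x * G x) $$ (i, j))"
    by (simp cong: continuous_on_cong)
qed

lemma continuous_on_det:
  fixes F :: "'b::topological_space \<Rightarrow> complex mat"
  assumes F: "continuous_on X F" "\<And>x. x \<in> X \<Longrightarrow> F x \<in> carrier_mat n n"
  shows "continuous_on X (\<lambda>x. det (F x))"
proof -
  have "continuous_on X (\<lambda>x. \<Sum>p\<in>{p. p permutes {0..<n}}. signof p * (\<Prod>i = 0..<n. F x $$ (i, p i)))"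
    by (intro continuous_intros continuous_on_entry[OF F]) (auto simp: permutes_in_image)
  then show ?thesis
    by (rule continuous_on_eq) (simp add: det_def'[OF F(2)])
qed

lemma continuous_on_adj_mat:
  fixes F :: "'b::topological_space \<Rightarrow> complex mat"
  assumes F: "continuous_on X F" "\<And>x. x \<in> X \<Longrightarrow> F x \<in> carrier_mat n n"
  shows "continuous_on X (\<lambda>x. adj_mat (F x))"
proof (rule continuous_on_matI[of X _ n n])
  fix i j assume ij: "i < n" "j < n"
  have "continuous_on X (\<lambda>x. mat_delete (F x) j i)"
  proof (rule continuous_on_matI[of X _ "n - 1" "n - 1"])
    show "mat_delete (F x) j i \<in> carrier_mat (n - 1) (n - 1)" if "x \<in> X" for x
      using F(2)[OF that] by (simp add: mat_delete_def)
    fix a b assume ab: "a < n - 1" "b < n - 1"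
    have "mat_delete (F x) j i $$ (a, b) = F x $$ (if a < j then a else Suc a, if b < i then b else Suc b)"
      if "x \<in> X" for x
      using F(2)[OF that] ab by (simp add: mat_delete_def)
    moreover have "continuous_on X (\<lambda>x. F x $$ (if a < j then a else Suc a, if b < i then b else Suc b))"
      using ab by (intro continuous_on_entry[OF F]) auto
    ultimately show "continuous_on X (\<lambda>x. mat_delete (F x) j i $$ (a, b))"
      by (simp cong: continuous_on_cong)
  qed
  moreover have "mat_delete (F x) j i \<in> carrier_mat (n - 1) (n - 1)" if "x \<in> X" for x
    using F(2)[OF that] by (auto simp: mat_delete_def)
  ultimately have "continuous_on X (\<lambda>x. det (mat_delete (F x) j i))"
    by (rule continuous_on_det)
  then have "continuous_on X (\<lambda>x. (-1) ^ (j + i) * det (mat_delete (F x) j i))"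
    by (intro continuous_intros)
  moreover have "adj_mat (F x) $$ (i, j) = (-1) ^ (j + i) * det (mat_delete (F x) j i)" if "x \<in> X" for x
    using F(2)[OF that] ij by (simp add: adj_mat_def cofactor_def)
  ultimately show "continuous_on X (\<lambda>x. adj_mat (F x) $$ (i, j))"
    by (simp cong: continuous_on_cong)
qed (use F(2) adj_mat(1) in blast)

section \<open>Groups with continuous translations and their component groups\<close>

definition translation_group :: "'a::topological_space monoid \<Rightarrow> bool" where
  "translation_group G \<longleftrightarrow> group G \<and>
     (\<forall>g\<in>carrier G. continuous_on (carrier G) (\<lambda>x. g \<otimes>\<^bsub>G\<^esub> x) \<and> continuous_on (carrier G) (\<lambda>x. x \<otimes>\<^bsub>G\<^esub> g))"

lemma translation_group_subgroup:
  assumes "translation_group G" "subgroup H G"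
  shows "translation_group (G\<lparr>carrier := H\<rparr>)"
  using assms subgroup.subgroup_is_group[OF assms(2)] subgroup.subset[OF assms(2)]
  by (auto simp: translation_group_def intro: continuous_on_subset)

lemma topological_group_translation:
  assumes "topological_group G"
  shows "translation_group G"
proof -
  interpret group G
    using assms by (simp add: topological_group_def)
  have cont: "continuous_on (carrier G \<times> carrier G) (\<lambda>(x, y). x \<otimes>\<^bsub>G\<^esub> y)"
    using assms by (simp add: topological_group_def)
  have "continuous_on (carrier G) (\<lambda>x. g \<otimes>\<^bsub>G\<^esub> x)" if "g \<in> carrier G" for g
    using continuous_on_compose2[OF cont continuous_on_Pair[OF continuous_on_const continuous_on_id], of g] that
    by auto
  moreover have "continuous_on (carrier G) (\<lambda>x. x \<otimes>\<^bsub>G\<^esub> g)" if "g \<in> carrier G" for g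
    using continuous_on_compose2[OF cont continuous_on_Pair[OF continuous_on_id continuous_on_const], of g] that
    by auto
  ultimately show ?thesis
    by (simp add: translation_group_def is_group)
qed

lemma identity_componentI:
  "connected T \<Longrightarrow> T \<subseteq> carrier G \<Longrightarrow> \<one>\<^bsub>G\<^esub> \<in> T \<Longrightarrow> T \<subseteq> identity_component G"
  unfolding identity_component_def by (rule connected_component_maximal)

lemma identity_component_connected: "connected (identity_component G)"
  and identity_component_subset: "identity_component G \<subseteq> carrier G"
  by (simp_all add: identity_component_def connected_component_subset)

lemma identity_component_one: "\<one>\<^bsub>G\<^esub> \<in> carrier G \<Longrightarrow> \<one>\<^bsub>G\<^esub> \<in> identity_component G"
  by (simp add: identity_component_def)

text \<open>Continuity of the translations suffices. A translate or conjugate of the identity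
  component is connected and, once it contains 1, lies in the identity component.\<close>

lemma identity_component_normal:
  assumes "translation_group G"
  shows "identity_component G \<lhd> G"
proof -
  interpret group G
    using assms by (simp add: translation_group_def)
  let ?I = "identity_component G"
  have left: "continuous_on ?I (\<lambda>x. g \<otimes>\<^bsub>G\<^esub> x)" and right: "continuous_on ?I (\<lambda>x. x \<otimes>\<^bsub>G\<^esub> g)"
    if "g \<in> carrier G" for g
    using assms that identity_component_subset[of G]
    by (auto simp: translation_group_def intro: continuous_on_subset)
  have sub: "x \<in> carrier G" if "x \<in> ?I" for x
    using that identity_component_subset by blast
  have mult: "(\<lambda>x. g \<otimes>\<^bsub>G\<^esub> x) ` ?I \<subseteq> ?I" if g: "g \<in> carrier G" "\<one>\<^bsub>G\<^esub> \<in> (\<lambda>x. g \<otimes>\<^bsub>G\<^esub> x) ` ?I" for g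
    using g sub by (intro identity_componentI connected_continuous_image identity_component_connected left) auto
  \<comment> \<open>The translate of \<open>?I\<close> by the inverse of \<open>x\<close> contains
    1, as the image of \<open>x\<close>, and hence lies in \<open>?I\<close>; the inverse of
    \<open>x\<close> is the image of 1.\<close>
  have inv: "inv\<^bsub>G\<^esub> x \<in> ?I" if "x \<in> ?I" for x
  proof -
    have "(\<lambda>y. inv\<^bsub>G\<^esub> x \<otimes>\<^bsub>G\<^esub> y) ` ?I \<subseteq> ?I"
      using that sub[OF that] by (intro mult) (auto intro!: image_eqI[of _ _ x])
    then show ?thesis
      using identity_component_one sub[OF that] by force
  qed
  have "x \<otimes>\<^bsub>G\<^esub> y \<in> ?I" if "x \<in> ?I" "y \<in> ?I" for x y
  proof -
    have "(\<lambda>y. x \<otimes>\<^bsub>G\<^esub> y) ` ?I \<subseteq> ?I"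
      using sub[OF that(1)] inv[OF that(1)] by (intro mult) (auto intro!: image_eqI[of _ _ "inv\<^bsub>G\<^esub> x"])
    then show ?thesis
      using that by blast
  qed
  then have "subgroup ?I G"
    using sub inv identity_component_one[OF one_closed] by (intro subgroupI) auto
  moreover have "g \<otimes>\<^bsub>G\<^esub> x \<otimes>\<^bsub>G\<^esub> inv\<^bsub>G\<^esub> g \<in> ?I" if g: "g \<in> carrier G" and x: "x \<in> ?I" for g x
  proof -
    have "continuous_on ?I (\<lambda>x. g \<otimes>\<^bsub>G\<^esub> x \<otimes>\<^bsub>G\<^esub> inv\<^bsub>G\<^esub> g)"
      using assms g sub
      by (intro continuous_on_compose2[OF _ left[OF g], of "carrier G" "\<lambda>x. x \<otimes>\<^bsub>G\<^esub> inv\<^bsub>G\<^esub> g"])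
        (auto simp: translation_group_def)
    then have "(\<lambda>x. g \<otimes>\<^bsub>G\<^esub> x \<otimes>\<^bsub>G\<^esub> inv\<^bsub>G\<^esub> g) ` ?I \<subseteq> ?I"
      using g sub identity_component_one
      by (intro identity_componentI connected_continuous_image identity_component_connected)
        (auto intro!: image_eqI[of _ _ "\<one>\<^bsub>G\<^esub>"])
    then show ?thesis
      using x by blast
  qed
  ultimately show ?thesis
    by (simp add: normal_inv_iff)
qed

lemma pi0_group: "translation_group G \<Longrightarrow> group (pi0 G)"
  unfolding pi0_def by (rule normal.factorgroup_is_group[OF identity_component_normal])

lemma pi0_carrier: "carrier (pi0 G) = (\<lambda>x. identity_component G #>\<^bsub>G\<^esub> x) ` carrier G"
  by (auto simp: pi0_def FactGroup_def RCOSETS_def)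

lemma pi0_mult:
  assumes "translation_group G" "x \<in> carrier G" "y \<in> carrier G"
  shows "(identity_component G #>\<^bsub>G\<^esub> x) \<otimes>\<^bsub>pi0 G\<^esub> (identity_component G #>\<^bsub>G\<^esub> y) =
    identity_component G #>\<^bsub>G\<^esub> (x \<otimes>\<^bsub>G\<^esub> y)"
  unfolding pi0_def using normal.rcos_sum[OF identity_component_normal[OF assms(1)] assms(2,3)]
  by (simp add: FactGroup_def)

lemma pi0_one: "\<one>\<^bsub>pi0 G\<^esub> = identity_component G"
  by (simp add: pi0_def FactGroup_def)

lemma identity_component_image:
  assumes "continuous_on (carrier G) f" "f ` carrier G \<subseteq> carrier H" "f \<one>\<^bsub>G\<^esub> = \<one>\<^bsub>H\<^esub>" "\<one>\<^bsub>G\<^esub> \<in> carrier G"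
  shows "f ` identity_component G \<subseteq> identity_component H"
proof (rule identity_componentI)
  show "connected (f ` identity_component G)"
    using continuous_on_subset[OF assms(1) identity_component_subset]
    by (rule connected_continuous_image) (rule identity_component_connected)
  show "f ` identity_component G \<subseteq> carrier H"
    using assms(2) identity_component_subset by blast
  show "\<one>\<^bsub>H\<^esub> \<in> f ` identity_component G"
    using imageI[OF identity_component_one[OF assms(4)], of f] assms(3) by simp
qed

lemma pi0_map_coset:
  assumes G: "translation_group G" and H: "translation_group H" and f: "f \<in> hom G H"
    and cont: "continuous_on (carrier G) f" and x: "x \<in> carrier G"
  shows "pi0_map H f (identity_component G #>\<^bsub>G\<^esub> x) = identity_component H #>\<^bsub>H\<^esub> f x"
proof -
  interpret G: group G using G by (simp add: translation_group_def)
  interpret H: group H using H by (simp add: translation_group_def)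
  interpret I: subgroup "identity_component H" H
    using identity_component_normal[OF H] by (rule normal_imp_subgroup)
  have f1: "f \<one>\<^bsub>G\<^esub> = \<one>\<^bsub>H\<^esub>"
    using hom_one[OF f G.is_group H.is_group] .
  have img: "f ` identity_component G \<subseteq> identity_component H"
    using f f1 by (intro identity_component_image cont) (auto simp: hom_def)
  have "identity_component H #>\<^bsub>H\<^esub> f y = identity_component H #>\<^bsub>H\<^esub> f x"
    if y: "y \<in> identity_component G #>\<^bsub>G\<^esub> x" for y
  proof -
    obtain g where g: "g \<in> identity_component G" "y = g \<otimes>\<^bsub>G\<^esub> x"
      using y by (auto simp: r_coset_def)
    then have "g \<in> carrier G"
      using identity_component_subset by blast
    then have "f y = f g \<otimes>\<^bsub>H\<^esub> f x"
      using hom_mult[OF f _ x] g(2) by simp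
    moreover have "f g \<in> identity_component H"
      using img g(1) by blast
    ultimately show ?thesis
      using hom_in_carrier[OF f x] H.coset_mult_assoc[OF I.subset, of "f g" "f x"] I.rcos_const[OF H.is_group]
      by (simp add: I.mem_carrier)
  qed
  moreover have "x \<in> identity_component G #>\<^bsub>G\<^esub> x"
    using G.rcos_self[OF x normal_imp_subgroup[OF identity_component_normal[OF G]]] .
  ultimately show ?thesis
    unfolding pi0_map_def by blast
qed

lemma pi0_map_hom:
  assumes G: "translation_group G" and H: "translation_group H" and f: "f \<in> hom G H"
    and cont: "continuous_on (carrier G) f"
  shows "pi0_map H f \<in> hom (pi0 G) (pi0 H)"
proof (rule homI)
  note c = pi0_map_coset[OF assms]
  fix C assume "C \<in> carrier (pi0 G)"
  then obtain x where x: "x \<in> carrier G" "C = identity_component G #>\<^bsub>G\<^esub> x"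
    by (auto simp: pi0_carrier)
  then show "pi0_map H f C \<in> carrier (pi0 H)"
    using c hom_in_carrier[OF f] by (auto simp: pi0_carrier)
  fix D assume "D \<in> carrier (pi0 G)"
  then obtain y where y: "y \<in> carrier G" "D = identity_component G #>\<^bsub>G\<^esub> y"
    by (auto simp: pi0_carrier)
  have "x \<otimes>\<^bsub>G\<^esub> y \<in> carrier G"
    using G x(1) y(1) by (simp add: translation_group_def group.is_monoid monoid.m_closed)
  then show "pi0_map H f (C \<otimes>\<^bsub>pi0 G\<^esub> D) = pi0_map H f C \<otimes>\<^bsub>pi0 H\<^esub> pi0_map H f D"
    using x y c hom_mult[OF f x(1) y(1)] hom_in_carrier[OF f]
    by (simp add: pi0_mult[OF G] pi0_mult[OF H])
qed

section \<open>Coverings, lifts and centres\<close>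

lemma covering_lift_constant:
  assumes cov: "covering_space C p S" and T: "connected T" "continuous_on T h" "h ` T \<subseteq> C"
    and const: "\<And>t. t \<in> T \<Longrightarrow> p (h t) = c" and ab: "a \<in> T" "b \<in> T"
  shows "h a = h b"
proof (rule connected_equivalence_relation[OF T(1) ab, of "\<lambda>x y. h x = h y"])
  fix t assume t: "t \<in> T"
  then have "h t \<in> C"
    using T(3) by blast
  obtain U u q where U: "h t \<in> U" "openin (top_of_set C) U" "p (h t) \<in> u"
    "openin (top_of_set S) u" "homeomorphism U u p q"
    by (rule covering_space_local_homeomorphism[OF cov \<open>h t \<in> C\<close>])
  have hT: "h \<in> T \<rightarrow> C"
    using T(3) by auto
  have opn: "openin (top_of_set T) (T \<inter> h -` U)"
    by (rule continuous_openin_preimage[OF T(2) hT U(2)])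
  have inv: "q (p z) = z" if "z \<in> U" for z
    using homeomorphism_apply1[OF U(5) that] .
  have eq: "h t = h x" if "x \<in> T \<inter> h -` U" for x
  proof -
    have "x \<in> T" "h x \<in> U"
      using that by simp_all
    then have "p (h x) = p (h t)"
      using const t by simp
    then show ?thesis
      using inv[OF U(1)] inv[OF \<open>h x \<in> U\<close>] by simp
  qed
  have "t \<in> T \<inter> h -` U"
    using t U(1) by simp
  with opn eq show "\<exists>W. openin (top_of_set T) W \<and> t \<in> W \<and> (\<forall>x\<in>W. h t = h x)"
    by (intro exI[of _ "T \<inter> h -` U"] conjI ballI)
qed simp_all

text \<open>As \<open>p y\<close> is central, all conjugates of \<open>y\<close> lie in one fibre of
  \<open>p\<close>; conjugation is thus a lift of a constant map on a connected group, and every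
  conjugate equals \<open>y\<close>.\<close>

lemma covering_preimage_center:
  assumes G: "topological_group G" and H: "group H" and cov: "covering_space (carrier G) p (carrier H)"
    and hom: "p \<in> hom G H" and conn: "connected (carrier G)"
    and y: "y \<in> carrier G" "p y \<in> center H"
  shows "y \<in> center G"
proof -
  interpret G: group G using G by (simp add: topological_group_def)
  interpret H: group H by (rule H)
  interpret p: group_hom G H p
    using hom by (simp add: group_hom_def group_hom_axioms_def)
  have mult: "continuous_on (carrier G \<times> carrier G) (\<lambda>(x, y). x \<otimes>\<^bsub>G\<^esub> y)"
    and inv: "continuous_on (carrier G) (\<lambda>x. inv\<^bsub>G\<^esub> x)"
    using G by (auto simp: topological_group_def)
  have right: "continuous_on (carrier G) (\<lambda>x. x \<otimes>\<^bsub>G\<^esub> y)"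
    using topological_group_translation[OF G] y(1) by (simp add: translation_group_def)
  let ?h = "\<lambda>g. g \<otimes>\<^bsub>G\<^esub> y \<otimes>\<^bsub>G\<^esub> inv\<^bsub>G\<^esub> g"
  have "continuous_on (carrier G) ?h"
    using continuous_on_compose2[OF mult continuous_on_Pair[OF right inv]] y(1) by auto
  moreover have "?h ` carrier G \<subseteq> carrier G"
    using y(1) by auto
  moreover have "p (?h g) = p y" if "g \<in> carrier G" for g
  proof -
    have "p (?h g) = p g \<otimes>\<^bsub>H\<^esub> p y \<otimes>\<^bsub>H\<^esub> inv\<^bsub>H\<^esub> p g"
      using that y(1) by simp
    also have "p g \<otimes>\<^bsub>H\<^esub> p y = p y \<otimes>\<^bsub>H\<^esub> p g"
      using y(2) p.hom_closed[OF that] by (simp add: center_def)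
    finally show ?thesis
      using that y(1) by (simp add: H.m_assoc)
  qed
  ultimately have "?h g = ?h \<one>\<^bsub>G\<^esub>" if "g \<in> carrier G" for g
    by (rule covering_lift_constant[OF cov conn _ _ _ that G.one_closed])
  then have fixed: "g \<otimes>\<^bsub>G\<^esub> y \<otimes>\<^bsub>G\<^esub> inv\<^bsub>G\<^esub> g = y" if "g \<in> carrier G" for g
    using that y(1) by simp
  have "y \<otimes>\<^bsub>G\<^esub> g = g \<otimes>\<^bsub>G\<^esub> y" if g: "g \<in> carrier G" for g
  proof -
    have "y \<otimes>\<^bsub>G\<^esub> g = (g \<otimes>\<^bsub>G\<^esub> y \<otimes>\<^bsub>G\<^esub> inv\<^bsub>G\<^esub> g) \<otimes>\<^bsub>G\<^esub> g"
      by (simp only: fixed[OF g])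
    also have "\<dots> = g \<otimes>\<^bsub>G\<^esub> y"
      using g y(1) by (simp add: G.m_assoc)
    finally show ?thesis .
  qed
  then show ?thesis
    using y(1) by (simp add: center_def)
qed

text \<open>\<open>simply_connected\<close> makes any two loops freely homotopic. For the constant
  loops at \<open>a\<close> and \<open>b\<close>, the track of the base point is a path from
  \<open>a\<close> to \<open>b\<close>.\<close>

lemma simply_connected_connected:
  fixes S :: "'a::topological_space set"
  assumes "simply_connected S"
  shows "connected S"
proof (rule path_connected_imp_connected)
  show "path_connected S"
    unfolding path_connected_def
  proof (intro ballI)
    fix a b assume ab: "a \<in> S" "b \<in> S"
    define c where "c x = (\<lambda>t::real. x :: 'a)" for x
    have c: "path (c x)" "pathfinish (c x) = pathstart (c x)" "path_image (c x) = {x}" for x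
      by (auto simp: c_def path_def pathfinish_def pathstart_def path_image_def)
    have "homotopic_loops S (c a) (c b)"
      using spec[OF spec[OF assms[unfolded simply_connected_def], of "c a"], of "c b"] ab c by simp
    then obtain h where h: "continuous_on ({0..1::real} \<times> {0..1::real}) h"
      "h \<in> {0..1} \<times> {0..1} \<rightarrow> S" "\<forall>x\<in>{0..1}. h (0, x) = c a x" "\<forall>x\<in>{0..1}. h (1, x) = c b x"
      unfolding homotopic_loops by (elim exE conjE)
    have "continuous_on {0..1} (\<lambda>t. h (t, 0))"
      by (rule continuous_on_compose2[OF h(1)]) (auto intro!: continuous_intros)
    then show "\<exists>g. path g \<and> path_image g \<subseteq> S \<and> pathstart g = a \<and> pathfinish g = b"
      using h by (intro exI[of _ "\<lambda>t. h (t, 0)"])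
        (auto simp: c_def path_def path_image_def pathstart_def pathfinish_def)
  qed
qed

lemma covering_space_evenly_covered:
  assumes "covering_space C p B" "y \<in> B"
  shows "\<exists>V v. y \<in> V \<and> openin (top_of_set B) V \<and> \<Union>v = C \<inter> p -` V \<and> (\<forall>u\<in>v. \<exists>q. homeomorphism u V p q)"
proof -
  have "\<forall>x\<in>B. \<exists>T. x \<in> T \<and> openin (top_of_set B) T \<and> (\<exists>v. \<Union>v = C \<inter> p -` T \<and>
      (\<forall>u\<in>v. openin (top_of_set C) u) \<and> pairwise disjnt v \<and> (\<forall>u\<in>v. \<exists>q. homeomorphism u T p q))"
    using assms(1) unfolding covering_space_def by (elim conjE)
  from bspec[OF this assms(2)] show ?thesis
    by (elim exE conjE) (intro exI conjI; assumption)
qed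
text \<open>Path lifting, in the form of a connectedness argument that needs no separation axioms.\<close>

lemma covering_component_lift:
  fixes \<gamma> :: "'c::real_normed_vector \<Rightarrow> 'b::topological_space"
  assumes cov: "covering_space C p B" and S: "S \<subseteq> B"
    and T: "open T" "connected T" "continuous_on T \<gamma>" "\<gamma> ` T \<subseteq> S"
    and st: "s \<in> T" "t \<in> T"
    and lift: "\<gamma> s \<in> p ` connected_component_set {x \<in> C. p x \<in> S} x0"
  shows "\<gamma> t \<in> p ` connected_component_set {x \<in> C. p x \<in> S} x0"
proof -
  let ?D = "{x \<in> C. p x \<in> S}"
  let ?K = "connected_component_set ?D x0"
  have "(\<gamma> s \<in> p ` ?K) = (\<gamma> t \<in> p ` ?K)"
  proof (rule connected_equivalence_relation[OF T(2) st, of "\<lambda>a b. (\<gamma> a \<in> p ` ?K) = (\<gamma> b \<in> p ` ?K)"])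
    fix a assume a: "a \<in> T"
    then have \<gamma>B: "\<gamma> a \<in> B"
      using T(4) S by blast
    obtain V v where V: "\<gamma> a \<in> V" "openin (top_of_set B) V"
      and v: "\<Union>v = C \<inter> p -` V" "\<forall>u\<in>v. \<exists>q. homeomorphism u V p q"
      using covering_space_evenly_covered[OF cov \<gamma>B] by (elim exE conjE)
    have "openin (top_of_set T) (T \<inter> \<gamma> -` V)"
      using T(3,4) S by (intro continuous_openin_preimage[OF _ _ V(2)]) auto
    then have "open (T \<inter> \<gamma> -` V)"
      using T(1) openin_open_eq by blast
    then obtain e where e: "e > 0" "ball a e \<subseteq> T \<inter> \<gamma> -` V"
      using a V(1) openE[of "T \<inter> \<gamma> -` V" a] by auto
    \<comment> \<open>The inverse of \<open>p\<close> on the sheet through \<open>x\<close> lifts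
      \<gamma> over the ball; the lifted image is connected and contains \<open>x\<close>, so it
      stays in the component.\<close>
    have step: "\<gamma> c \<in> p ` ?K" if bc: "b \<in> ball a e" "c \<in> ball a e" "\<gamma> b \<in> p ` ?K" for b c
    proof -
      obtain x where x: "x \<in> ?K" "\<gamma> b = p x"
        using bc(3) by blast
      then have xD: "x \<in> ?D"
        using connected_component_subset by blast
      moreover have "p x \<in> V"
        using bc(1) e(2) x(2) by auto
      ultimately obtain u where u: "u \<in> v" "x \<in> u"
        using v(1) by blast
      then obtain q where q: "homeomorphism u V p q"
        using v(2) by blast
      have uC: "u \<subseteq> C"
        using u(1) v(1) by blast
      let ?L = "(\<lambda>t. q (\<gamma> t)) ` ball a e"
      have "continuous_on (ball a e) (\<lambda>t. q (\<gamma> t))"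
        using q e(2) T(3) by (intro continuous_on_compose2[OF _ continuous_on_subset[OF T(3)]])
          (auto simp: homeomorphism_def)
      then have "connected ?L"
        by (intro connected_continuous_image) auto
      moreover have "?L \<subseteq> ?D"
      proof
        fix z assume "z \<in> ?L"
        then obtain t where t: "t \<in> ball a e" "z = q (\<gamma> t)" by blast
        then have "\<gamma> t \<in> V" "\<gamma> t \<in> S"
          using e(2) image_subset_iff[THEN iffD1, OF T(4)] by auto
        then show "z \<in> ?D"
          using q uC t(2) by (auto simp: homeomorphism_def)
      qed
      moreover have "x \<in> ?L"
        using q u(2) x(2) bc(1) by (intro image_eqI[of _ _ b]) (auto simp: homeomorphism_def)
      ultimately have "?L \<subseteq> connected_component_set ?D x"
        by (intro connected_component_maximal)
      then have "?L \<subseteq> ?K"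
        by (simp only: connected_component_eq[OF x(1)])
      then have "q (\<gamma> c) \<in> ?K"
        by (rule subsetD) (rule imageI[OF bc(2)])
      moreover have "\<gamma> c = p (q (\<gamma> c))"
        using q bc(2) e(2) by (auto simp: homeomorphism_def)
      ultimately show ?thesis by blast
    qed
    have "a \<in> ball a e" using e(1) by simp
    then have "\<forall>x\<in>ball a e. (\<gamma> a \<in> p ` ?K) = (\<gamma> x \<in> p ` ?K)"
      using step by blast
    moreover have "openin (top_of_set T) (ball a e)"
      using e(2) by (intro open_subset) auto
    ultimately show "\<exists>W. openin (top_of_set T) W \<and> a \<in> W \<and> (\<forall>x\<in>W. (\<gamma> a \<in> p ` ?K) = (\<gamma> x \<in> p ` ?K))"
      using e(1) by (intro exI[of _ "ball a e"]) auto
  qed auto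
  then show ?thesis
    using lift by simp
qed


section \<open>Centralizers in isometry groups\<close>

lemma sig_carrier:
  assumes "J \<in> carrier_mat n n"
  shows "A \<in> carrier (special_isometry_group J) \<longleftrightarrow>
    A \<in> carrier_mat n n \<and> transpose_mat A * J * A = J \<and> det A = 1"
  using assms by (auto simp: special_isometry_group_def mat_group_def)

lemma sig_mult [simp]: "A \<otimes>\<^bsub>special_isometry_group J\<^esub> B = A * B"
  by (simp add: special_isometry_group_def mat_group_def)

lemma sig_one: "J \<in> carrier_mat n n \<Longrightarrow> \<one>\<^bsub>special_isometry_group J\<^esub> = 1\<^sub>m n"
  by (simp add: special_isometry_group_def mat_group_def)

lemma adj_mat_inverse:
  assumes "A \<in> carrier_mat n n" "det A = (1 :: 'a :: comm_ring_1)"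
  shows "adj_mat A \<in> carrier_mat n n" "A * adj_mat A = 1\<^sub>m n" "adj_mat A * A = 1\<^sub>m n"
proof -
  have "1 \<cdot>\<^sub>m 1\<^sub>m n = (1\<^sub>m n :: 'a mat)"
    by (rule eq_matI) auto
  then show "adj_mat A \<in> carrier_mat n n" "A * adj_mat A = 1\<^sub>m n" "adj_mat A * A = 1\<^sub>m n"
    using adj_mat[OF assms(1)] assms(2) by simp_all
qed

lemma isometry_mult:
  assumes "J \<in> carrier_mat n n" "A \<in> carrier_mat n n" "B \<in> carrier_mat n n"
    and "transpose_mat A * J * A = J" "transpose_mat B * J * B = (J :: 'a :: comm_ring_1 mat)"
  shows "transpose_mat (A * B) * J * (A * B) = J"
proof -
  have "transpose_mat (A * B) * J * (A * B) = transpose_mat B * (transpose_mat A * J * A) * B"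
    using assms(1-3) by (simp add: transpose_mult[of _ n n _ n] assoc_mult_mat[of _ n n _ n _ n])
  then show ?thesis
    using assms(4,5) by simp
qed

lemma isometry_inverse:
  assumes "J \<in> carrier_mat n n" "A \<in> carrier_mat n n" "B \<in> carrier_mat n n"
    and "transpose_mat A * J * A = (J :: 'a :: comm_ring_1 mat)" "A * B = 1\<^sub>m n"
  shows "transpose_mat B * J * B = J"
proof -
  have "transpose_mat B * J * B = transpose_mat B * (transpose_mat A * J * A) * B"
    using assms(4) by simp
  also have "\<dots> = transpose_mat (A * B) * J * (A * B)"
    using assms(1-3) by (simp add: transpose_mult[of _ n n _ n] assoc_mult_mat[of _ n n _ n _ n])
  also have "\<dots> = J"
    using assms(1,5) by simp
  finally show ?thesis .
qed

lemma sig_group: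
  fixes J :: "'a::comm_ring_1 mat"
  assumes J: "J \<in> carrier_mat n n"
  shows "group (special_isometry_group J)"
proof (rule groupI)
  let ?G = "special_isometry_group J"
  note car = sig_carrier[OF J] and one = sig_one[OF J]
  show "\<one>\<^bsub>?G\<^esub> \<in> carrier ?G"
    using J by (simp add: car one)
  show "A \<otimes>\<^bsub>?G\<^esub> B \<in> carrier ?G" if "A \<in> carrier ?G" "B \<in> carrier ?G" for A B
  proof -
    have AB: "A \<in> carrier_mat n n" "B \<in> carrier_mat n n"
      using that by (simp_all add: car)
    then show ?thesis
      using that isometry_mult[OF J AB] det_mult[OF AB] mult_carrier_mat[OF AB] by (simp add: car)
  qed
  show "A \<otimes>\<^bsub>?G\<^esub> B \<otimes>\<^bsub>?G\<^esub> C = A \<otimes>\<^bsub>?G\<^esub> (B \<otimes>\<^bsub>?G\<^esub> C)"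
    if "A \<in> carrier ?G" "B \<in> carrier ?G" "C \<in> carrier ?G" for A B C
    using that by (simp add: car assoc_mult_mat[of _ n n _ n _ n])
  show "\<one>\<^bsub>?G\<^esub> \<otimes>\<^bsub>?G\<^esub> A = A" if "A \<in> carrier ?G" for A
    using that left_mult_one_mat[of A n n] by (simp add: car one)
  show "\<exists>B\<in>carrier ?G. B \<otimes>\<^bsub>?G\<^esub> A = \<one>\<^bsub>?G\<^esub>" if "A \<in> carrier ?G" for A
  proof -
    have A: "A \<in> carrier_mat n n" "transpose_mat A * J * A = J" "det A = 1"
      using that by (simp_all add: car)
    note B = adj_mat_inverse[OF A(1,3)]
    have "det A * det (adj_mat A) = 1"
      using det_mult[OF A(1) B(1)] B(2) by simp
    then have "adj_mat A \<in> carrier ?G"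
      using A B isometry_inverse[OF J A(1) B(1) A(2) B(2)] by (simp add: car)
    then show ?thesis
      using B(3) by (intro bexI[of _ "adj_mat A"]) (simp_all add: one)
  qed
qed

lemma sig_translation_group:
  fixes J :: "complex mat"
  assumes J: "J \<in> carrier_mat n n"
  shows "translation_group (special_isometry_group J)"
proof -
  have sub: "carrier (special_isometry_group J) \<subseteq> carrier_mat n n"
    using sig_carrier[OF J] by blast
  have "continuous_on (carrier (special_isometry_group J)) (\<lambda>x. g * x)"
    "continuous_on (carrier (special_isometry_group J)) (\<lambda>x. x * g)"
    if "g \<in> carrier (special_isometry_group J)" for g
    using that sub by (intro continuous_on_mat_mult[of _ _ n n _ n] continuous_on_const continuous_on_id; auto)+
  then show ?thesis
    unfolding translation_group_def using sig_group[OF J] by simp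
qed

section \<open>The pencil of an isometry and its Cayley transform\<close>

definition mat_lin :: "nat \<Rightarrow> 'a::comm_ring_1 mat \<Rightarrow> 'a \<Rightarrow> 'a \<Rightarrow> 'a mat" where
  "mat_lin n g x y = x \<cdot>\<^sub>m 1\<^sub>m n + y \<cdot>\<^sub>m g"

context
  fixes n :: nat and g :: "'a::comm_ring_1 mat"
  assumes g: "g \<in> carrier_mat n n"
begin

lemma mat_lin_carrier [simp]: "mat_lin n g x y \<in> carrier_mat n n"
  using g by (simp add: mat_lin_def)

lemma mat_lin_mult: "h \<in> carrier_mat n n \<Longrightarrow> mat_lin n g x y * h = x \<cdot>\<^sub>m h + y \<cdot>\<^sub>m (g * h)"
  using g by (simp add: mat_lin_def add_mult_distrib_mat[of _ n n _ _ n] mult_smult_assoc_mat[of _ n n _ n])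

lemma mult_mat_lin: "h \<in> carrier_mat n n \<Longrightarrow> h * mat_lin n g x y = x \<cdot>\<^sub>m h + y \<cdot>\<^sub>m (h * g)"
  using g by (simp add: mat_lin_def mult_add_distrib_mat[of _ n n _ n] mult_smult_distrib[of _ n n _ n])

lemma mat_lin_commute_mat:
  "h \<in> carrier_mat n n \<Longrightarrow> g * h = h * g \<Longrightarrow> mat_lin n g x y * h = h * mat_lin n g x y"
  by (simp add: mat_lin_mult mult_mat_lin)

lemma mat_lin_commute: "mat_lin n g x y * mat_lin n g z w = mat_lin n g z w * mat_lin n g x y"
proof (rule mat_lin_commute_mat)
  show "g * mat_lin n g z w = mat_lin n g z w * g"
    using g mat_lin_commute_mat[OF g, of z w] by simp
qed simp

text \<open>The isometry relation turns the transpose of \<open>g\<close> into its inverse, which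
  exchanges the two coefficients. Numerator and denominator of the Cayley transform are two elements
  of the pencil related in this way.\<close>

lemma mat_lin_isometry:
  assumes J: "J \<in> carrier_mat n n" and iso: "transpose_mat g * J * g = J"
  shows "transpose_mat (mat_lin n g x y) * J * g = J * mat_lin n g y x"
proof -
  have gt: "transpose_mat g \<in> carrier_mat n n"
    using g by simp
  have "transpose_mat (mat_lin n g x y) = x \<cdot>\<^sub>m 1\<^sub>m n + y \<cdot>\<^sub>m transpose_mat g"
    using g by (intro eq_matI) (auto simp: mat_lin_def)
  then have "transpose_mat (mat_lin n g x y) * (J * g) = x \<cdot>\<^sub>m (J * g) + y \<cdot>\<^sub>m (transpose_mat g * (J * g))"
    using g gt J by (simp add: add_mult_distrib_mat[of _ n n _ _ n] mult_smult_assoc_mat[of _ n n _ n])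
  also have "transpose_mat g * (J * g) = J"
    using iso g gt J by (simp add: assoc_mult_mat[of _ n n _ n _ n])
  also have "x \<cdot>\<^sub>m (J * g) + y \<cdot>\<^sub>m J = J * mat_lin n g y x"
    using J g by (simp add: mult_mat_lin comm_add_mat[of _ n n])
  finally show ?thesis
    using g J transpose_carrier_mat[THEN iffD2, OF mat_lin_carrier[of x y]]
    by (simp add: assoc_mult_mat[of _ n n _ n _ n])
qed

end

text \<open>Determinants of both sides of \<open>mat_lin_isometry\<close>; this is what gives the
  Cayley path determinant 1.\<close>

lemma det_mat_lin:
  fixes g J :: "'a::idom mat"
  assumes g: "g \<in> carrier_mat n n" and J: "J \<in> carrier_mat n n" "det J \<noteq> 0"
    and iso: "transpose_mat g * J * g = J" "det g = 1"
  shows "det (mat_lin n g x y) = det (mat_lin n g y x)"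
proof -
  let ?P = "mat_lin n g x y" and ?Q = "mat_lin n g y x"
  have c: "?P \<in> carrier_mat n n" "?Q \<in> carrier_mat n n"
    using g by simp_all
  have ct: "transpose_mat ?P \<in> carrier_mat n n"
    using c by simp
  have "det (transpose_mat ?P * J * g) = det ?P * det J * det g"
    using det_mult[OF mult_carrier_mat[OF ct J(1)] g] det_mult[OF ct J(1)] det_transpose[OF c(1)] by simp
  moreover have "det (J * ?Q) = det J * det ?Q"
    using c J by (simp add: det_mult[of _ n])
  ultimately show ?thesis
    using mat_lin_isometry[OF g J(1) iso(1), of x y] iso(2) J(2) by simp
qed

text \<open>The Cayley path from \<open>1\<close> to \<open>g\<close>: with \<open>P t = (1 + g) + t (1 - g)\<close> and
  \<open>Q t = (1 + g) - t (1 - g)\<close>, the matrix \<open>Q t * (P t) ^ (-1)\<close> stays in the isometry group and in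
  the commutant of \<open>g\<close>. The parameter is complex, so that the zeros of \<open>det (P t)\<close> can be avoided.\<close>

lemma cayley_path:
  fixes g J :: "complex mat"
  assumes J: "J \<in> carrier_mat n n" "det J \<noteq> 0"
    and g: "g \<in> carrier (special_isometry_group J)" and inv: "det (1\<^sub>m n + g) \<noteq> 0"
  shows "\<exists>(T :: complex set) \<gamma>. open T \<and> connected T \<and> 0 \<in> T \<and> 1 \<in> T \<and> continuous_on T \<gamma> \<and>
    \<gamma> 0 = 1\<^sub>m n \<and> \<gamma> 1 = g \<and> \<gamma> ` T \<subseteq> carrier (special_isometry_group J) \<and>
    (\<forall>h\<in>carrier_mat n n. g * h = h * g \<longrightarrow> (\<forall>t\<in>T. \<gamma> t * h = h * \<gamma> t))"
proof -
  have gc: "g \<in> carrier_mat n n" and iso: "transpose_mat g * J * g = J" and dg: "det g = 1"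
    using g by (simp_all add: sig_carrier[OF J(1)])
  define P where "P t = mat_lin n g (1 + t) (1 - t)" for t
  define Q where "Q t = mat_lin n g (1 - t) (1 + t)" for t
  define R where "R t = inverse (det (P t)) \<cdot>\<^sub>m adj_mat (P t)" for t
  define T where "T = {t. det (P t) \<noteq> 0}"
  define \<gamma> where "\<gamma> t = Q t * R t" for t
  have PQ: "P t \<in> carrier_mat n n" "Q t \<in> carrier_mat n n" for t
    using gc by (simp_all add: P_def Q_def)
  have Rc: "R t \<in> carrier_mat n n" for t
    using adj_mat(1)[OF PQ(1)] by (simp add: R_def)
  have s1: "inverse c \<cdot>\<^sub>m (c \<cdot>\<^sub>m 1\<^sub>m n) = (1\<^sub>m n :: complex mat)" if "c \<noteq> 0" for c
    using that by (intro eq_matI) auto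
  have PR: "P t * R t = 1\<^sub>m n" and RP: "R t * P t = 1\<^sub>m n" if "t \<in> T" for t
    using that adj_mat[OF PQ(1), of t] PQ(1)[of t]
    by (simp_all add: R_def T_def mult_smult_distrib[of _ n n _ n] mult_smult_assoc_mat[of _ n n _ n] s1)
  have entry: "P t $$ (i, j) = poly [:1\<^sub>m n $$ (i, j) + g $$ (i, j), 1\<^sub>m n $$ (i, j) - g $$ (i, j):] t"
    if "i < n" "j < n" for i j t
    using that gc by (simp add: P_def mat_lin_def algebra_simps)
  \<comment> \<open>The Leibniz formula exhibits \<open>det (P t)\<close> as a polynomial in
    \<open>t\<close>; it has finitely many zeros, and the complement of a finite set in the complex
    plane is connected.\<close>
  define D where "D = (\<Sum>p\<in>{p. p permutes {0..<n}}. [:signof p:] *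
      (\<Prod>i = 0..<n. [:1\<^sub>m n $$ (i, p i) + g $$ (i, p i), 1\<^sub>m n $$ (i, p i) - g $$ (i, p i):]))"
  have D: "poly D t = det (P t)" for t
    unfolding D_def det_def'[OF PQ(1)] poly_sum poly_mult poly_prod
    by (intro sum.cong prod.cong arg_cong2[where f="(*)"] refl) (auto simp: entry permutes_in_image)
  have "P 0 = 1\<^sub>m n + g"
    using gc by (intro eq_matI) (auto simp: P_def mat_lin_def)
  then have "poly D 0 \<noteq> 0"
    using inv D by simp
  then have "D \<noteq> 0" by auto
  then have fin: "finite {t. poly D t = 0}"
    by (rule poly_roots_finite)
  have TD: "T = - {t. poly D t = 0}"
    by (auto simp: T_def D)
  have "open T"
    unfolding TD using fin by (intro open_Compl finite_imp_closed)
  moreover have "connected T"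
    unfolding TD using fin by (intro path_connected_imp_connected path_connected_complement_countable countable_finite) auto
  moreover have T0: "0 \<in> T"
    using inv \<open>P 0 = 1\<^sub>m n + g\<close> by (simp add: T_def)
  moreover have P1: "P 1 = 2 \<cdot>\<^sub>m 1\<^sub>m n" and Q1: "Q 1 = 2 \<cdot>\<^sub>m g"
    using gc by (auto simp: P_def Q_def mat_lin_def intro!: eq_matI)
  then have T1: "1 \<in> T"
    by (simp add: T_def)
  moreover have contP: "continuous_on T P" and contQ: "continuous_on T Q"
  proof -
    show "continuous_on T P"
    proof (rule continuous_on_matI[OF PQ(1)])
      show "continuous_on T (\<lambda>t. P t $$ (i, j))" if "i < n" "j < n" for i j
        unfolding entry[OF that] by (intro continuous_intros)
    qed
    show "continuous_on T Q"
    proof (rule continuous_on_matI[OF PQ(2)])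
      show "continuous_on T (\<lambda>t. Q t $$ (i, j))" if "i < n" "j < n" for i j
        using that gc by (simp add: Q_def mat_lin_def) (intro conjI impI continuous_intros)
    qed
  qed
  have contR: "continuous_on T R"
  proof (rule continuous_on_matI[OF Rc])
    fix i j assume ij: "i < n" "j < n"
    have "R t $$ (i, j) = inverse (det (P t)) * adj_mat (P t) $$ (i, j)" for t
      using ij adj_mat(1)[OF PQ(1), of t] by (auto simp: R_def)
    moreover have "continuous_on T (\<lambda>t. inverse (det (P t)) * adj_mat (P t) $$ (i, j))"
      using ij by (intro continuous_intros continuous_on_det[OF contP PQ(1)]
          continuous_on_entry[OF continuous_on_adj_mat[OF contP PQ(1)] adj_mat(1)[OF PQ(1)]])
        (auto simp: T_def)
    ultimately show "continuous_on T (\<lambda>t. R t $$ (i, j))"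
      by simp
  qed
  have "continuous_on T \<gamma>"
    unfolding \<gamma>_def by (rule continuous_on_mat_mult[OF contQ PQ(2) contR Rc])
  moreover have "\<gamma> 0 = 1\<^sub>m n"
    using PR[OF T0] by (simp add: \<gamma>_def P_def Q_def)
  moreover have "\<gamma> 1 = g"
  proof -
    have "\<gamma> 1 = g * (2 \<cdot>\<^sub>m R 1)"
      using gc Rc by (simp add: \<gamma>_def Q1 mult_smult_distrib[of _ n n _ n] mult_smult_assoc_mat[of _ n n _ n])
    also have "2 \<cdot>\<^sub>m R 1 = P 1 * R 1"
      using Rc[of 1] by (simp add: P1 mult_smult_assoc_mat[of _ n n _ n])
    finally show ?thesis
      using PR[OF T1] gc by simp
  qed
  moreover have "\<gamma> t \<in> carrier (special_isometry_group J)" if t: "t \<in> T" for t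
  proof -
    note c = PQ(1)[of t] PQ(2)[of t] Rc[of t] gc J(1)
    have c': "transpose_mat (P t) \<in> carrier_mat n n" "transpose_mat (Q t) \<in> carrier_mat n n"
      using c by simp_all
    \<comment> \<open>The coefficients of \<open>P t\<close> and \<open>Q t\<close> are exchanged,
      so each is the partner of the other; as the two commute, they transform \<open>J\<close> into
      the same matrix.\<close>
    have isoP: "transpose_mat (P t) * J * g = J * Q t" and isoQ: "transpose_mat (Q t) * J * g = J * P t"
      unfolding P_def Q_def by (rule mat_lin_isometry[OF gc J(1) iso])+
    have comm: "P t * Q t = Q t * P t"
      unfolding P_def Q_def by (rule mat_lin_commute[OF gc])
    have "transpose_mat (Q t) * J * Q t = transpose_mat (Q t) * (transpose_mat (P t) * J * g)"
      using c c' isoP by (simp add: assoc_mult_mat[of _ n n _ n _ n])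
    also have "\<dots> = transpose_mat (P t * Q t) * J * g"
      using c c' by (simp add: assoc_mult_mat[of _ n n _ n _ n] transpose_mult[of _ n n _ n])
    also have "\<dots> = transpose_mat (P t) * (transpose_mat (Q t) * J * g)"
      unfolding comm using c c' by (simp add: assoc_mult_mat[of _ n n _ n _ n] transpose_mult[of _ n n _ n])
    also have "\<dots> = transpose_mat (P t) * J * P t"
      using c c' isoQ by (simp add: assoc_mult_mat[of _ n n _ n _ n])
    finally have QP: "transpose_mat (Q t) * J * Q t = transpose_mat (P t) * J * P t" .
    have "transpose_mat (\<gamma> t) * J * \<gamma> t = transpose_mat (R t) * (transpose_mat (Q t) * J * Q t) * R t"
      unfolding \<gamma>_def using c c' by (simp add: assoc_mult_mat[of _ n n _ n _ n] transpose_mult[of _ n n _ n])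
    also have "\<dots> = transpose_mat (P t * R t) * J * (P t * R t)"
      unfolding QP using c c' by (simp add: assoc_mult_mat[of _ n n _ n _ n] transpose_mult[of _ n n _ n])
    also have "\<dots> = J"
      using PR[OF t] J(1) by simp
    finally have "transpose_mat (\<gamma> t) * J * \<gamma> t = J" .
    moreover have "det (Q t) = det (P t)"
      unfolding P_def Q_def by (rule det_mat_lin[OF gc J iso dg])
    then have "det (\<gamma> t) = det (P t * R t)"
      using c by (simp add: \<gamma>_def det_mult[of _ n])
    then have "det (\<gamma> t) = 1"
      using PR[OF t] by simp
    moreover have "\<gamma> t \<in> carrier_mat n n"
      using c by (simp add: \<gamma>_def)
    ultimately show ?thesis
      by (simp add: sig_carrier[OF J(1)])
  qed
  then have "\<gamma> ` T \<subseteq> carrier (special_isometry_group J)"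
    by blast
  moreover have "\<gamma> t * h = h * \<gamma> t" if h: "h \<in> carrier_mat n n" "g * h = h * g" and t: "t \<in> T" for h t
  proof -
    note c = PQ(1)[of t] PQ(2)[of t] Rc[of t] h(1)
    have hP: "P t * h = h * P t" and hQ: "Q t * h = h * Q t"
      unfolding P_def Q_def by (rule mat_lin_commute_mat[OF gc h])+
    have "R t * h = R t * h * (P t * R t)"
      using PR[OF t] c by simp
    also have "\<dots> = R t * (h * P t) * R t"
      using c by (simp add: assoc_mult_mat[of _ n n _ n _ n])
    also have "\<dots> = (R t * P t) * h * R t"
      unfolding hP[symmetric] using c by (simp add: assoc_mult_mat[of _ n n _ n _ n])
    also have "\<dots> = h * R t"
      using RP[OF t] c by simp
    finally have hR: "R t * h = h * R t" .
    have "\<gamma> t * h = Q t * (R t * h)"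
      using c by (simp add: \<gamma>_def assoc_mult_mat[of _ n n _ n _ n])
    also have "\<dots> = (Q t * h) * R t"
      unfolding hR using c by (simp add: assoc_mult_mat[of _ n n _ n _ n])
    also have "\<dots> = h * \<gamma> t"
      unfolding hQ using c by (simp add: \<gamma>_def assoc_mult_mat[of _ n n _ n _ n])
    finally show ?thesis .
  qed
  ultimately show ?thesis
    by (intro exI[of _ T] exI[of _ \<gamma>] conjI ballI impI)
qed

section \<open>Centralizers and their identity components\<close>

lemma centralizer_subgroup:
  assumes J: "J \<in> carrier_mat n n" and H: "H \<subseteq> carrier_mat n n"
  shows "subgroup {g \<in> carrier (special_isometry_group J). \<forall>h\<in>H. g * h = h * g}
    (special_isometry_group (J :: 'a :: comm_ring_1 mat))"
proof -
  let ?G = "special_isometry_group J"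
  let ?S = "{g \<in> carrier ?G. \<forall>h\<in>H. g * h = h * g}"
  interpret group ?G
    by (rule sig_group[OF J])
  have car: "g \<in> carrier_mat n n" if "g \<in> carrier ?G" for g
    using that by (simp add: sig_carrier[OF J])
  have Hc: "h \<in> carrier_mat n n" if "h \<in> H" for h
    using that H by blast
  note assoc = assoc_mult_mat[of _ n n _ n _ n]
  show ?thesis
  proof (rule subgroupI)
    show "?S \<subseteq> carrier ?G" by blast
    show "?S \<noteq> {}"
      using one_closed Hc by (force simp: sig_one[OF J])
  next
    fix a assume a: "a \<in> ?S"
    let ?b = "inv\<^bsub>?G\<^esub> a"
    have ac: "a \<in> carrier_mat n n" "?b \<in> carrier_mat n n" "?b * a = 1\<^sub>m n" "a * ?b = 1\<^sub>m n"
      using a car[of a] car[of ?b] l_inv[of a] r_inv[of a] by (simp_all add: sig_one[OF J])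
    have "?b * h = h * ?b" if "h \<in> H" for h
    proof -
      note hc = Hc[OF that]
      have "?b * h = ?b * h * (a * ?b)"
        using ac hc by simp
      also have "\<dots> = ?b * (h * a) * ?b"
        using ac(1,2) hc by (simp add: assoc)
      also have "h * a = a * h"
        using a that by simp
      also have "?b * (a * h) * ?b = (?b * a) * h * ?b"
        using ac(1,2) hc by (simp add: assoc)
      also have "\<dots> = h * ?b"
        using ac hc by simp
      finally show ?thesis .
    qed
    then show "?b \<in> ?S"
      using a by simp
  next
    fix a b assume a: "a \<in> ?S" and b: "b \<in> ?S"
    have "a * b * h = h * (a * b)" if "h \<in> H" for h
    proof -
      have c: "a \<in> carrier_mat n n" "b \<in> carrier_mat n n" "h \<in> carrier_mat n n"
        using a b car Hc[OF that] by auto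
      have "a * b * h = a * (h * b)"
        using c b that by (simp add: assoc)
      also have "\<dots> = (a * h) * b"
        using c by (simp add: assoc)
      also have "\<dots> = h * (a * b)"
        using a that c by (simp add: assoc)
      finally show ?thesis .
    qed
    then show "a \<otimes>\<^bsub>?G\<^esub> b \<in> ?S"
      using a b m_closed[of a b] by simp
  qed
qed

text \<open>The image of the identity component upstairs is a subgroup containing every
  \<open>g\<close> in \<open>S\<close> with \<open>1 + g\<close> invertible. For \<open>b\<close>
  and \<open>x\<close> in \<open>S\<close> such that 1 plus the product of the inverse of
  \<open>b\<close> with \<open>x\<close> is invertible, \<open>b\<close> and \<open>x\<close> belong
  to that image together; membership is thus locally constant on the connected identity component
  downstairs. \<open>H\<close> may consist of arbitrary matrices, not only group elements.\<close>

lemma identity_component_centralizer_covered: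
  fixes J :: "complex mat" and Gsc :: "'g::topological_space monoid"
  assumes J: "J \<in> carrier_mat n n" "det J \<noteq> 0" and H: "H \<subseteq> carrier_mat n n"
    and G: "topological_group Gsc" and p: "p \<in> hom Gsc (special_isometry_group J)"
    and cov: "covering_space (carrier Gsc) p (carrier (special_isometry_group J))"
  defines "S \<equiv> {g \<in> carrier (special_isometry_group J). \<forall>h\<in>H. g * h = h * g}"
  shows "identity_component ((special_isometry_group J)\<lparr>carrier := S\<rparr>) \<subseteq>
    p ` identity_component (Gsc\<lparr>carrier := {x \<in> carrier Gsc. p x \<in> S}\<rparr>)"
proof -
  let ?G = "special_isometry_group J"
  let ?GS = "?G\<lparr>carrier := S\<rparr>" and ?D = "{x \<in> carrier Gsc. p x \<in> S}"
  let ?GD = "Gsc\<lparr>carrier := ?D\<rparr>"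
  let ?K = "identity_component ?GD"
  have S_iff: "g \<in> S \<longleftrightarrow> g \<in> carrier ?G \<and> (\<forall>h\<in>H. g * h = h * g)" for g
    by (simp add: S_def)
  interpret G: group ?G by (rule sig_group[OF J(1)])
  interpret Gsc: group Gsc using G by (simp add: topological_group_def)
  interpret p: group_hom Gsc ?G p
    using p by (simp add: group_hom_def group_hom_axioms_def)
  have sub: "subgroup S ?G"
    unfolding S_def by (rule centralizer_subgroup[OF J(1) H])
  interpret S: subgroup S ?G by (rule sub)
  have subD: "subgroup ?D Gsc"
  proof (rule Gsc.subgroupI)
    show "?D \<subseteq> carrier Gsc" by blast
    show "?D \<noteq> {}"
      using Gsc.one_closed S.one_closed p.hom_one by (metis (mono_tags, lifting) empty_Collect_eq)
    show "inv\<^bsub>Gsc\<^esub> x \<in> ?D" if "x \<in> ?D" for x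
      using that S.m_inv_closed by simp
    show "x \<otimes>\<^bsub>Gsc\<^esub> y \<in> ?D" if "x \<in> ?D" "y \<in> ?D" for x y
      using that S.m_closed by (simp del: sig_mult)
  qed
  have "translation_group ?GD"
    by (rule translation_group_subgroup[OF topological_group_translation[OF G] subD])
  then have "subgroup ?K ?GD"
    by (intro normal_imp_subgroup identity_component_normal)
  then have "subgroup ?K Gsc"
    by (rule Gsc.incl_subgroup[OF subD])
  then have Q: "subgroup (p ` ?K) ?G"
    by (rule p.subgroup_img_is_subgroup)
  interpret Q: subgroup "p ` ?K" ?G by (rule Q)
  have one: "\<one>\<^bsub>?G\<^esub> = 1\<^sub>m n"
    by (rule sig_one[OF J(1)])
  have K: "?K = connected_component_set ?D \<one>\<^bsub>Gsc\<^esub>"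
    by (simp add: identity_component_def)
  have near: "g \<in> p ` ?K" if g: "g \<in> S" "det (1\<^sub>m n + g) \<noteq> 0" for g
  proof -
    have gG: "g \<in> carrier ?G"
      by (rule S.mem_carrier[OF g(1)])
    obtain T \<gamma> where T: "open T" "connected T" "(0::complex) \<in> T" "1 \<in> T" "continuous_on T \<gamma>"
      "\<gamma> 0 = 1\<^sub>m n" "\<gamma> 1 = g" "\<gamma> ` T \<subseteq> carrier ?G"
      "\<forall>h\<in>carrier_mat n n. g * h = h * g \<longrightarrow> (\<forall>t\<in>T. \<gamma> t * h = h * \<gamma> t)"
      using cayley_path[OF J gG g(2)] by (elim exE conjE)
    have "\<gamma> ` T \<subseteq> S"
    proof
      fix y assume "y \<in> \<gamma> ` T"
      then obtain t where t: "t \<in> T" "y = \<gamma> t" by blast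
      have "\<gamma> t * h = h * \<gamma> t" if "h \<in> H" for h
        using T(9)[rule_format, OF subsetD[OF H that] S_iff[THEN iffD1, OF g(1), THEN conjunct2, rule_format, OF that] t(1)] .
      moreover have "\<gamma> t \<in> carrier ?G"
        by (rule subsetD[OF T(8) imageI[OF t(1)]])
      ultimately show "y \<in> S"
        unfolding t(2) by (intro S_iff[THEN iffD2] conjI ballI)
    qed
    moreover have "\<gamma> 0 \<in> p ` ?K"
      using Q.one_closed by (simp add: T(6) one)
    ultimately have "\<gamma> 1 \<in> p ` ?K"
      unfolding K by (intro covering_component_lift[OF cov S.subset T(1,2,5) _ T(3,4)])
    then show ?thesis
      by (simp add: T(7))
  qed
  let ?I = "identity_component ?GS"
  have IS: "?I \<subseteq> S"
    using identity_component_subset[of ?GS] by simp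
  have "a \<in> p ` ?K" if a: "a \<in> ?I" for a
  proof -
    have "(1\<^sub>m n \<in> p ` ?K) = (a \<in> p ` ?K)"
    proof (rule connected_equivalence_relation[OF identity_component_connected[of ?GS],
          where R = "\<lambda>x y. (x \<in> p ` ?K) = (y \<in> p ` ?K)"])
      show "1\<^sub>m n \<in> ?I"
        using identity_component_one[of ?GS] S.one_closed by (simp add: one)
      show "a \<in> ?I" by (rule a)
      fix b assume b: "b \<in> ?I"
      then have bS: "b \<in> S"
        using IS by blast
      then have bG: "b \<in> carrier ?G"
        by (rule S.mem_carrier)
      let ?b = "inv\<^bsub>?G\<^esub> b"
      \<comment> \<open>At \<open>x = b\<close> the matrix is twice the identity, so the
        nonvanishing of \<open>?f\<close> is an open condition satisfied at
        \<open>b\<close>.\<close>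
      let ?f = "\<lambda>x. det (1\<^sub>m n + ?b * x)"
      have bi: "?b \<in> S" "?b * b = 1\<^sub>m n"
        using S.m_inv_closed[OF bS] G.l_inv[OF bG] by (simp_all add: one)
      have car: "x \<in> carrier_mat n n" if "x \<in> S" for x
        using S.mem_carrier[OF that] by (simp add: sig_carrier[OF J(1)])
      have cont_mult: "continuous_on ?I (\<lambda>x. ?b * x)"
        using IS car bi(1) by (intro continuous_on_mat_mult[of _ _ n n _ n] continuous_on_const continuous_on_id) auto
      have "continuous_on ?I (\<lambda>x. 1\<^sub>m n + ?b * x)"
      proof (rule continuous_on_matI[of _ _ n n])
        show c: "1\<^sub>m n + ?b * x \<in> carrier_mat n n" if "x \<in> ?I" for x
          using IS that car[of x] car[OF bi(1)] by auto
        fix i j assume ij: "i < n" "j < n"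
        have m: "?b * x \<in> carrier_mat n n" if "x \<in> ?I" for x
          using IS that car[of x] car[OF bi(1)] by auto
        have "continuous_on ?I (\<lambda>x. 1\<^sub>m n $$ (i, j) + (?b * x) $$ (i, j))"
          using ij by (intro continuous_intros continuous_on_entry[OF cont_mult m])
        then show "continuous_on ?I (\<lambda>x. (1\<^sub>m n + ?b * x) $$ (i, j))"
        proof (rule continuous_on_eq)
          fix x assume "x \<in> ?I"
          then show "1\<^sub>m n $$ (i, j) + (?b * x) $$ (i, j) = (1\<^sub>m n + ?b * x) $$ (i, j)"
            using index_add_mat(1)[of i "?b * x" j "1\<^sub>m n"] carrier_matD[OF m[of x]] ij by simp
        qed
      qed
      then have "continuous_on ?I ?f"
        using IS car car[OF bi(1)] by (intro continuous_on_det[of _ _ n]) auto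
      then have "openin (top_of_set ?I) (?I \<inter> ?f -` (- {0}))"
        by (rule continuous_openin_preimage_gen) (simp add: open_Compl)
      moreover have "(1\<^sub>m n + 1\<^sub>m n :: complex mat) = 2 \<cdot>\<^sub>m 1\<^sub>m n"
        by (intro eq_matI) auto
      then have "b \<in> ?I \<inter> ?f -` (- {0})"
        using b by (simp add: bi(2))
      moreover have "(b \<in> p ` ?K) = (x \<in> p ` ?K)" if x: "x \<in> ?I \<inter> ?f -` (- {0})" for x
      proof -
        have xS: "x \<in> S"
          using x IS by blast
        have "?b \<otimes>\<^bsub>?G\<^esub> x \<in> S"
          using bi(1) xS by (rule S.m_closed)
        then have Qx: "?b \<otimes>\<^bsub>?G\<^esub> x \<in> p ` ?K"
          using x near[of "?b * x"] by simp
        have xG: "x \<in> carrier ?G"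
          using xS by (rule S.mem_carrier)
        have biG: "?b \<in> carrier ?G"
          using bG by (rule G.inv_closed)
        have x_eq: "b \<otimes>\<^bsub>?G\<^esub> (?b \<otimes>\<^bsub>?G\<^esub> x) = x"
          by (simp only: G.m_assoc[OF bG biG xG, symmetric] G.r_inv[OF bG] G.l_one[OF xG])
        have b_eq: "x \<otimes>\<^bsub>?G\<^esub> inv\<^bsub>?G\<^esub> (?b \<otimes>\<^bsub>?G\<^esub> x) = b"
          by (simp only: G.inv_mult_group[OF biG xG] G.inv_inv[OF bG] G.m_assoc[OF xG G.inv_closed[OF xG] bG, symmetric]
              G.r_inv[OF xG] G.l_one[OF bG])
        show ?thesis
        proof (rule iffI)
          assume bK: "b \<in> p ` ?K"
          show "x \<in> p ` ?K"
            using Q.m_closed[OF bK Qx] by (simp only: x_eq)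
        next
          assume xK: "x \<in> p ` ?K"
          show "b \<in> p ` ?K"
            using Q.m_closed[OF xK Q.m_inv_closed[OF Qx]] by (simp only: b_eq)
        qed
      qed
      ultimately show "\<exists>W. openin (top_of_set ?I) W \<and> b \<in> W \<and> (\<forall>x\<in>W. (b \<in> p ` ?K) = (x \<in> p ` ?K))"
        by (intro exI[of _ "?I \<inter> ?f -` (- {0})"] conjI ballI)
    qed simp_all
    then show ?thesis
      using Q.one_closed by (simp add: one)
  qed
  then show ?thesis by blast
qed

text \<open>The comparison of component groups, in abstract form: \<open>S\<close> is generated by the image of \<open>T\<close> and the
  central subgroup \<open>Z\<close>, and the same holds for the identity components.\<close>

lemma component_group_rep_bij:
  fixes S :: "'b::topological_space monoid" and T :: "'a::topological_space monoid"
  assumes S: "translation_group S" and T: "translation_group T"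
    and p: "p \<in> hom T S" and cont: "continuous_on (carrier T) p"
    and K: "subgroup K S" and Z: "Z = S\<lparr>carrier := K\<rparr>" and Y: "Y = T\<lparr>carrier := {x \<in> carrier T. p x \<in> K}\<rparr>"
    and central: "\<And>z s. z \<in> K \<Longrightarrow> s \<in> carrier S \<Longrightarrow> z \<otimes>\<^bsub>S\<^esub> s = s \<otimes>\<^bsub>S\<^esub> z"
    and gen: "\<And>s. s \<in> carrier S \<Longrightarrow> \<exists>x\<in>carrier T. \<exists>z\<in>K. s = p x \<otimes>\<^bsub>S\<^esub> z"
    and comp: "\<And>s. s \<in> identity_component S \<Longrightarrow>
      \<exists>x\<in>identity_component T. \<exists>z\<in>identity_component Z. s = p x \<otimes>\<^bsub>S\<^esub> z"
    and chi: "chi \<in> hom (pi0 Z) Cstar"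
    and match: "\<And>x. x \<in> carrier T \<Longrightarrow> p x \<in> K \<Longrightarrow> chi (identity_component Z #>\<^bsub>Z\<^esub> p x) = zeta x"
  shows "\<exists>\<Phi>. bij_betw \<Phi> (Rep_equivariant (pi0 S) (pi0 Z) (pi0_map S (\<lambda>z. z)) chi)
      (Rep_equivariant (pi0 T) Y (\<lambda>y. identity_component T #>\<^bsub>T\<^esub> y) zeta) \<and>
    (\<forall>d \<rho>. rep_equiv (pi0 S) `` {(d, \<rho>)} \<in> Rep_equivariant (pi0 S) (pi0 Z) (pi0_map S (\<lambda>z. z)) chi \<longrightarrow>
       \<Phi> (rep_equiv (pi0 S) `` {(d, \<rho>)}) = rep_equiv (pi0 T) `` {(d, \<rho> \<circ> pi0_map S p)})"
proof -
  have tZ: "translation_group Z"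
    unfolding Z by (rule translation_group_subgroup[OF S K])
  interpret S: group S using S by (simp add: translation_group_def)
  interpret T: group T using T by (simp add: translation_group_def)
  interpret Z: group Z using tZ by (simp add: translation_group_def)
  interpret S0: normal "identity_component S" S by (rule identity_component_normal[OF S])
  interpret T0: normal "identity_component T" T by (rule identity_component_normal[OF T])
  interpret Z0: normal "identity_component Z" Z by (rule identity_component_normal[OF tZ])
  have KS: "z \<in> carrier S" if "z \<in> K" for z
    using subgroup.mem_carrier[OF K that] .
  have Zc: "carrier Z = K" and Zm: "x \<otimes>\<^bsub>Z\<^esub> y = x \<otimes>\<^bsub>S\<^esub> y" for x y
    by (simp_all add: Z)
  have pS: "p x \<in> carrier S" if "x \<in> carrier T" for x
    using hom_in_carrier[OF p that] .
  have inc: "(\<lambda>z. z) \<in> hom Z S"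
    by (rule homI) (auto simp: Zc Zm KS)
  have icont: "continuous_on (carrier Z) (\<lambda>z. z)"
    by (rule continuous_on_id)
  let ?i = "pi0_map S (\<lambda>z. z)" and ?f = "pi0_map S p"
  let ?S = "\<lambda>s. identity_component S #>\<^bsub>S\<^esub> s" and ?T = "\<lambda>s. identity_component T #>\<^bsub>T\<^esub> s"
    and ?Z = "\<lambda>s. identity_component Z #>\<^bsub>Z\<^esub> s"
  have i: "?i (?Z z) = ?S z" if "z \<in> K" for z
    by (rule pi0_map_coset[OF tZ S inc icont]) (simp add: Zc that)
  have f: "?f (?T x) = ?S (p x)" if "x \<in> carrier T" for x
    by (rule pi0_map_coset[OF T S p cont that])
  note mS = pi0_mult[OF S] and mZ = pi0_mult[OF tZ]
  have prod: "?f (?T x) \<otimes>\<^bsub>pi0 S\<^esub> ?i (?Z z) = ?S (p x \<otimes>\<^bsub>S\<^esub> z)" if "x \<in> carrier T" "z \<in> K" for x z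
    by (simp add: f i that mS pS KS)
  have cone: "chi (identity_component Z) = 1"
  proof -
    have o: "\<one>\<^bsub>pi0 Z\<^esub> \<in> carrier (pi0 Z)"
      by (rule monoid.one_closed[OF group.is_monoid[OF pi0_group[OF tZ]]])
    have "chi \<one>\<^bsub>pi0 Z\<^esub> = chi \<one>\<^bsub>pi0 Z\<^esub> * chi \<one>\<^bsub>pi0 Z\<^esub>"
      using hom_mult[OF chi o o] monoid.l_one[OF group.is_monoid[OF pi0_group[OF tZ]] o] by (simp add: Cstar_def)
    moreover have "chi \<one>\<^bsub>pi0 Z\<^esub> \<noteq> 0"
      using hom_in_carrier[OF chi o] by (simp add: Cstar_def)
    ultimately have "chi \<one>\<^bsub>pi0 Z\<^esub> = 1" by simp
    then show ?thesis by (simp only: pi0_one)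
  qed
  have cmult: "chi (?Z a) * chi (?Z b) = chi (?Z (a \<otimes>\<^bsub>S\<^esub> b))" if ab: "a \<in> K" "b \<in> K" for a b
  proof -
    have "?Z a \<in> carrier (pi0 Z)" "?Z b \<in> carrier (pi0 Z)"
      using ab by (auto simp: pi0_carrier Zc)
    then have "chi (?Z a \<otimes>\<^bsub>pi0 Z\<^esub> ?Z b) = chi (?Z a) * chi (?Z b)"
      using hom_mult[OF chi] by (simp add: Cstar_def)
    then show ?thesis
      using ab by (simp add: mZ Zc Zm)
  qed
  show ?thesis
  proof (rule equivariant_pullback_bij[OF pi0_group[OF S] pi0_group[OF T] pi0_group[OF tZ]
        pi0_map_hom[OF T S p cont] pi0_map_hom[OF tZ S inc icont] chi])
    fix y assume "y \<in> carrier Y"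
    then show "?T y \<in> carrier (pi0 T)"
      by (auto simp: Y pi0_carrier)
  next
    fix z a assume "z \<in> carrier (pi0 Z)" "a \<in> carrier (pi0 S)"
    then obtain z' a' where za: "z' \<in> K" "z = ?Z z'" "a' \<in> carrier S" "a = ?S a'"
      by (auto simp: pi0_carrier Zc)
    then show "?i z \<otimes>\<^bsub>pi0 S\<^esub> a = a \<otimes>\<^bsub>pi0 S\<^esub> ?i z"
      by (simp add: i mS KS central)
  next
    fix a assume "a \<in> carrier (pi0 S)"
    then obtain s where s: "s \<in> carrier S" "a = ?S s"
      by (auto simp: pi0_carrier)
    obtain x z where xz: "x \<in> carrier T" "z \<in> K" "s = p x \<otimes>\<^bsub>S\<^esub> z"
      using gen[OF s(1)] by blast
    have "?T x \<in> carrier (pi0 T)" "?Z z \<in> carrier (pi0 Z)"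
      using xz by (auto simp: pi0_carrier Zc)
    then show "\<exists>x\<in>carrier (pi0 T). \<exists>z\<in>carrier (pi0 Z). a = ?f x \<otimes>\<^bsub>pi0 S\<^esub> ?i z"
      using prod[OF xz(1,2)] xz(3) s(2) by blast
  next
    fix X z assume "X \<in> carrier (pi0 T)" "z \<in> carrier (pi0 Z)" and one: "?f X \<otimes>\<^bsub>pi0 S\<^esub> ?i z = \<one>\<^bsub>pi0 S\<^esub>"
    then obtain x z' where xz: "x \<in> carrier T" "X = ?T x" "z' \<in> K" "z = ?Z z'"
      by (auto simp: pi0_carrier Zc)
    have "?S (p x \<otimes>\<^bsub>S\<^esub> z') = identity_component S"
      using one prod[OF xz(1,3)] by (simp add: xz(2,4) pi0_one)
    moreover have "p x \<otimes>\<^bsub>S\<^esub> z' \<in> ?S (p x \<otimes>\<^bsub>S\<^esub> z')"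
      by (rule S.rcos_self[OF _ S0.subgroup_axioms]) (simp add: pS xz KS)
    ultimately obtain x0 z0 where xz0: "x0 \<in> identity_component T" "z0 \<in> identity_component Z"
        "p x \<otimes>\<^bsub>S\<^esub> z' = p x0 \<otimes>\<^bsub>S\<^esub> z0"
      using comp by blast
    have x0: "x0 \<in> carrier T" and z0: "z0 \<in> K"
      using T0.mem_carrier[OF xz0(1)] Z0.mem_carrier[OF xz0(2)] by (simp_all add: Zc)
    \<comment> \<open>Dividing by \<open>x0\<close> leaves the class of \<open>x\<close> unchanged
      and turns the relation into \<open>kz\<close>. So \<open>p y\<close> lies in \<open>K\<close>,
      where \<open>match\<close> expresses \<open>zeta y\<close> through \<open>chi\<close>.\<close>
    define y where "y = inv\<^bsub>T\<^esub> x0 \<otimes>\<^bsub>T\<^esub> x"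
    have y: "y \<in> carrier T"
      using x0 xz(1) by (simp add: y_def)
    have x: "x = x0 \<otimes>\<^bsub>T\<^esub> y"
      using x0 xz(1) by (simp add: y_def T.m_assoc[symmetric])
    have "p x0 \<otimes>\<^bsub>S\<^esub> (p y \<otimes>\<^bsub>S\<^esub> z') = p x0 \<otimes>\<^bsub>S\<^esub> z0"
      using xz0(3) hom_mult[OF p x0 y] by (simp add: x S.m_assoc pS x0 y KS xz(3))
    then have kz: "p y \<otimes>\<^bsub>S\<^esub> z' = z0"
      using S.Units_l_cancel[of "p x0"] S.Units_eq pS x0 y KS xz(3) z0 by simp
    have "p y = z0 \<otimes>\<^bsub>S\<^esub> inv\<^bsub>S\<^esub> z'"
      using kz S.inv_solve_right' pS[OF y] KS[OF z0] KS[OF xz(3)] by metis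
    then have k: "p y \<in> K"
      using subgroup.m_closed[OF K z0 subgroup.m_inv_closed[OF K xz(3)]] by simp
    have "y \<in> ?T x"
      unfolding y_def r_coset_def using T0.m_inv_closed[OF xz0(1)] by blast
    then have "X = ?T y"
      unfolding xz(2) by (rule T.repr_independence[OF _ xz(1) T0.subgroup_axioms])
    moreover have "zeta y * chi z = 1"
    proof -
      have "zeta y * chi z = chi (?Z (p y)) * chi (?Z z')"
        by (simp add: match[OF y k] xz(4))
      also have "\<dots> = chi (?Z z0)"
        by (simp add: cmult[OF k xz(3)] kz)
      also have "?Z z0 = identity_component Z"
        by (rule Z.coset_join2[OF _ Z0.subgroup_axioms xz0(2)]) (simp add: Zc z0)
      finally show ?thesis by (simp add: cone)
    qed
    moreover have "y \<in> carrier Y"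
      using y k by (simp add: Y)
    ultimately show "\<exists>y\<in>carrier Y. X = ?T y \<and> zeta y * chi z = 1"
      by blast
  next
    fix y assume "y \<in> carrier Y"
    then have y: "y \<in> carrier T" "p y \<in> K"
      by (simp_all add: Y)
    have "?Z (p y) \<in> carrier (pi0 Z)"
      using y by (auto simp: pi0_carrier Zc)
    then show "\<exists>z\<in>carrier (pi0 Z). ?f (?T y) = ?i z \<and> chi z = zeta y"
      using f[OF y(1)] i[OF y(2)] match[OF y] by metis
  qed
qed


section \<open>Perfectness of the dual groups\<close>

definition bform :: "'a::comm_ring_1 mat \<Rightarrow> 'a vec \<Rightarrow> 'a vec \<Rightarrow> 'a" where
  "bform J x y = x \<bullet> (J *\<^sub>v y)"

text \<open>The map \<open>x \<mapsto> x + c B(u, x) u\<close>: a transvection when \<open>B\<close>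
  is alternating, the reflection in \<open>u\<close> when \<open>B\<close> is symmetric,
  \<open>B(u, u) = 1\<close> and \<open>c = -2\<close>.\<close>

definition rank_one_isometry :: "'a::comm_ring_1 mat \<Rightarrow> 'a \<Rightarrow> 'a vec \<Rightarrow> 'a mat" where
  "rank_one_isometry J c u = mat (dim_row J) (dim_row J)
     (\<lambda>(i, j). (if i = j then 1 else 0) + c * u $ i * (transpose_mat J *\<^sub>v u) $ j)"

lemma mat_vec_smult:
  fixes A :: "'a::comm_ring_1 mat"
  assumes "A \<in> carrier_mat n m" "x \<in> carrier_vec m"
  shows "A *\<^sub>v (c \<cdot>\<^sub>v x) = c \<cdot>\<^sub>v (A *\<^sub>v x)"
  using assms by (intro eq_vecI) (auto intro!: scalar_prod_smult_distrib[of _ m])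

lemma mat_eq_mult_vecI:
  fixes A B :: "'a::comm_ring_1 mat"
  assumes AB: "A \<in> carrier_mat n n" "B \<in> carrier_mat n n"
    and eq: "\<And>x. x \<in> carrier_vec n \<Longrightarrow> A *\<^sub>v x = B *\<^sub>v x"
  shows "A = B"
proof (rule eq_matI)
  have entry: "M $$ (i, j) = (M *\<^sub>v unit_vec n j) $ i" if "M \<in> carrier_mat n n" "i < n" "j < n" for M :: "'a mat" and i j
    using that by simp
  fix i j assume "i < dim_row B" "j < dim_col B"
  then have ij: "i < n" "j < n"
    using AB by simp_all
  show "A $$ (i, j) = B $$ (i, j)"
    using entry[OF AB(1) ij] entry[OF AB(2) ij] eq[OF unit_vec_carrier[of n j]] by simp
qed (use AB in simp_all)

context
  fixes n :: nat and J :: "'a::comm_ring_1 mat"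
  assumes J: "J \<in> carrier_mat n n"
begin

lemma bform_add_left:
  "\<lbrakk>x \<in> carrier_vec n; y \<in> carrier_vec n; z \<in> carrier_vec n\<rbrakk> \<Longrightarrow>
    bform J (x + y) z = bform J x z + bform J y z"
  unfolding bform_def using J by (intro add_scalar_prod_distrib[of _ n]) auto

lemma bform_add_right:
  "\<lbrakk>x \<in> carrier_vec n; y \<in> carrier_vec n; z \<in> carrier_vec n\<rbrakk> \<Longrightarrow>
    bform J z (x + y) = bform J z x + bform J z y"
  unfolding bform_def using J by (simp add: mult_add_distrib_mat_vec[of _ n n] scalar_prod_add_distrib[of _ n])

lemma bform_smult_left:
  "\<lbrakk>x \<in> carrier_vec n; z \<in> carrier_vec n\<rbrakk> \<Longrightarrow> bform J (c \<cdot>\<^sub>v x) z = c * bform J x z"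
  unfolding bform_def using J by (intro smult_scalar_prod_distrib[of _ n]) auto

lemma bform_smult_right:
  "\<lbrakk>x \<in> carrier_vec n; z \<in> carrier_vec n\<rbrakk> \<Longrightarrow> bform J z (c \<cdot>\<^sub>v x) = c * bform J z x"
  unfolding bform_def using J by (simp add: mat_vec_smult[OF J] scalar_prod_smult_distrib[of z n "J *\<^sub>v x"])

lemmas bform_simps = bform_add_left bform_add_right bform_smult_left bform_smult_right

lemma rank_one_carrier [simp]: "rank_one_isometry J c u \<in> carrier_mat n n"
  using J by (simp add: rank_one_isometry_def)

lemma rank_one_apply:
  assumes u: "u \<in> carrier_vec n" and x: "x \<in> carrier_vec n"
  shows "rank_one_isometry J c u *\<^sub>v x = x + (c * bform J u x) \<cdot>\<^sub>v u"
proof (rule eq_vecI)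
  let ?w = "transpose_mat J *\<^sub>v u"
  have w: "?w \<in> carrier_vec n"
    using J u by simp
  show "dim_vec (rank_one_isometry J c u *\<^sub>v x) = dim_vec (x + (c * bform J u x) \<cdot>\<^sub>v u)"
    using J u by (simp add: rank_one_isometry_def)
  fix i assume "i < dim_vec (x + (c * bform J u x) \<cdot>\<^sub>v u)"
  then have i: "i < n"
    using u by simp
  have "(rank_one_isometry J c u *\<^sub>v x) $ i = (\<Sum>j = 0..<n. ((if i = j then 1 else 0) + c * u $ i * ?w $ j) * x $ j)"
    using J i x by (simp add: rank_one_isometry_def scalar_prod_def)
  also have "\<dots> = (\<Sum>j = 0..<n. if i = j then x $ j else 0) + c * u $ i * (\<Sum>j = 0..<n. ?w $ j * x $ j)"
    by (simp add: distrib_right sum.distrib sum_distrib_left mult.assoc if_distrib[of "\<lambda>z. z * _"] cong: if_cong)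
  also have "(\<Sum>j = 0..<n. if i = j then x $ j else 0) = x $ i"
    using i by simp
  also have "(\<Sum>j = 0..<n. ?w $ j * x $ j) = ?w \<bullet> x"
    using x by (simp add: scalar_prod_def)
  also have "\<dots> = bform J u x"
    unfolding bform_def by (rule transpose_vec_mult_scalar[OF J x u])
  finally show "(rank_one_isometry J c u *\<^sub>v x) $ i = (x + (c * bform J u x) \<cdot>\<^sub>v u) $ i"
    using i x u by simp
qed

lemma bform_transform:
  assumes A: "A \<in> carrier_mat n n" and xy: "x \<in> carrier_vec n" "y \<in> carrier_vec n"
  shows "bform J (A *\<^sub>v x) (A *\<^sub>v y) = bform (transpose_mat A * J * A) x y"
proof -
  let ?z = "J *\<^sub>v (A *\<^sub>v y)"
  have z: "?z \<in> carrier_vec n"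
    using J A xy by simp
  have "bform J (A *\<^sub>v x) (A *\<^sub>v y) = ?z \<bullet> (A *\<^sub>v x)"
    unfolding bform_def using z A xy by (intro comm_scalar_prod[of _ n]) simp_all
  also have "\<dots> = (transpose_mat A *\<^sub>v ?z) \<bullet> x"
    by (rule transpose_vec_mult_scalar[OF A xy(1) z, symmetric])
  also have "\<dots> = x \<bullet> (transpose_mat A *\<^sub>v ?z)"
    using z A xy by (intro comm_scalar_prod[of _ n]) simp_all
  also have "transpose_mat A *\<^sub>v ?z = (transpose_mat A * J * A) *\<^sub>v y"
    using J A xy by (simp add: assoc_mult_mat_vec[of _ n n _ n])
  finally show ?thesis
    by (simp add: bform_def)
qed

lemma isometry_iff_bform:
  assumes A: "A \<in> carrier_mat n n"
  shows "transpose_mat A * J * A = J \<longleftrightarrow>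
    (\<forall>x\<in>carrier_vec n. \<forall>y\<in>carrier_vec n. bform J (A *\<^sub>v x) (A *\<^sub>v y) = bform J x y)"
proof
  assume "transpose_mat A * J * A = J"
  then show "\<forall>x\<in>carrier_vec n. \<forall>y\<in>carrier_vec n. bform J (A *\<^sub>v x) (A *\<^sub>v y) = bform J x y"
    by (simp add: bform_transform[OF A])
next
  assume iso: "\<forall>x\<in>carrier_vec n. \<forall>y\<in>carrier_vec n. bform J (A *\<^sub>v x) (A *\<^sub>v y) = bform J x y"
  let ?M = "transpose_mat A * J * A"
  have M: "?M \<in> carrier_mat n n"
    using A J by simp
  have entry: "bform M (unit_vec n i) (unit_vec n j) = M $$ (i, j)"
    if "M \<in> carrier_mat n n" "i < n" "j < n" for M :: "'a mat" and i j
    using that by (simp add: bform_def)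
  show "?M = J"
  proof (rule eq_matI)
    fix i j assume "i < dim_row J" "j < dim_col J"
    then have ij: "i < n" "j < n"
      using J by simp_all
    show "?M $$ (i, j) = J $$ (i, j)"
      using iso bform_transform[OF A unit_vec_carrier[of n i] unit_vec_carrier[of n j]]
        entry[OF M ij] entry[OF J ij] by simp
  qed (use carrier_matD[OF M] carrier_matD[OF J] in simp_all)
qed

lemma rank_one_conj:
  assumes h: "h \<in> carrier_mat n n" "transpose_mat h * J * h = J" and u: "u \<in> carrier_vec n"
  shows "h * rank_one_isometry J c u = rank_one_isometry J c (h *\<^sub>v u) * h"
proof (rule mat_eq_mult_vecI)
  fix x :: "'a vec" assume x: "x \<in> carrier_vec n"
  have hu: "h *\<^sub>v u \<in> carrier_vec n" and hx: "h *\<^sub>v x \<in> carrier_vec n"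
    using h u x by simp_all
  have "(h * rank_one_isometry J c u) *\<^sub>v x = h *\<^sub>v (x + (c * bform J u x) \<cdot>\<^sub>v u)"
    using h(1) x by (simp add: assoc_mult_mat_vec[of _ n n _ n] rank_one_apply[OF u x])
  also have "\<dots> = h *\<^sub>v x + (c * bform J u x) \<cdot>\<^sub>v (h *\<^sub>v u)"
    using h(1) x u by (simp add: mult_add_distrib_mat_vec[of _ n n] mat_vec_smult[of _ n n])
  also have "bform J u x = bform J (h *\<^sub>v u) (h *\<^sub>v x)"
    using isometry_iff_bform[OF h(1)] h(2) u x by simp
  also have "h *\<^sub>v x + (c * bform J (h *\<^sub>v u) (h *\<^sub>v x)) \<cdot>\<^sub>v (h *\<^sub>v u) =
      (rank_one_isometry J c (h *\<^sub>v u) * h) *\<^sub>v x"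
    using h(1) x by (simp add: assoc_mult_mat_vec[of _ n n _ n] rank_one_apply[OF hu hx])
  finally show "(h * rank_one_isometry J c u) *\<^sub>v x = (rank_one_isometry J c (h *\<^sub>v u) * h) *\<^sub>v x" .
qed (use h in \<open>simp_all add: mult_carrier_mat[of _ n n _ n]\<close>)

lemma rank_one_mult:
  assumes u: "u \<in> carrier_vec n"
  shows "rank_one_isometry J c u * rank_one_isometry J d u =
    rank_one_isometry J (c + d + c * d * bform J u u) u"
proof (rule mat_eq_mult_vecI)
  fix x :: "'a vec" assume x: "x \<in> carrier_vec n"
  let ?y = "x + (d * bform J u x) \<cdot>\<^sub>v u"
  have y: "?y \<in> carrier_vec n"
    using x u by simp
  have "(rank_one_isometry J c u * rank_one_isometry J d u) *\<^sub>v x = ?y + (c * bform J u ?y) \<cdot>\<^sub>v u"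
    using x by (simp add: assoc_mult_mat_vec[of _ n n _ n] rank_one_apply[OF u x] rank_one_apply[OF u y])
  also have "bform J u ?y = bform J u x + d * bform J u x * bform J u u"
    using x u by (simp add: bform_simps)
  also have "?y + (c * (bform J u x + d * bform J u x * bform J u u)) \<cdot>\<^sub>v u =
      x + ((c + d + c * d * bform J u u) * bform J u x) \<cdot>\<^sub>v u"
    using x u by (intro eq_vecI) (simp_all add: algebra_simps)
  also have "\<dots> = rank_one_isometry J (c + d + c * d * bform J u u) u *\<^sub>v x"
    by (rule rank_one_apply[OF u x, symmetric])
  finally show "(rank_one_isometry J c u * rank_one_isometry J d u) *\<^sub>v x =
    rank_one_isometry J (c + d + c * d * bform J u u) u *\<^sub>v x" .
qed (simp_all add: mult_carrier_mat[of _ n n _ n])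

lemma rank_one_zero: "u \<in> carrier_vec n \<Longrightarrow> rank_one_isometry J 0 u = 1\<^sub>m n"
  using J by (intro eq_matI) (auto simp: rank_one_isometry_def)

lemma rank_one_smult:
  "u \<in> carrier_vec n \<Longrightarrow> rank_one_isometry J c (k \<cdot>\<^sub>v u) = rank_one_isometry J (c * k * k) u"
proof (rule mat_eq_mult_vecI)
  fix x :: "'a vec" assume ux: "u \<in> carrier_vec n" "x \<in> carrier_vec n"
  have ku: "k \<cdot>\<^sub>v u \<in> carrier_vec n"
    using ux by simp
  show "rank_one_isometry J c (k \<cdot>\<^sub>v u) *\<^sub>v x = rank_one_isometry J (c * k * k) u *\<^sub>v x"
    using ux by (intro eq_vecI) (simp_all add: rank_one_apply[OF ku] rank_one_apply bform_simps mult_ac)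
qed simp_all

text \<open>The defect of invariance is the scalar in the last hypothesis times
  \<open>B(u, x) B(u, y)\<close>. In the alternating case \<open>s = -1\<close> and
  \<open>B(u, u) = 0\<close>, so \<open>c\<close> is free; for a unit vector of a symmetric form,
  \<open>s = 1\<close> and \<open>c = -2\<close>.\<close>

lemma rank_one_isometryI:
  assumes u: "u \<in> carrier_vec n"
    and sgn: "\<And>x. x \<in> carrier_vec n \<Longrightarrow> bform J x u = s * bform J u x"
    and c: "c * s + c + c * c * bform J u u = 0"
  shows "transpose_mat (rank_one_isometry J c u) * J * rank_one_isometry J c u = J"
  unfolding isometry_iff_bform[OF rank_one_carrier]
proof (intro ballI)
  fix x y :: "'a vec" assume xy: "x \<in> carrier_vec n" "y \<in> carrier_vec n"
  have "bform J (rank_one_isometry J c u *\<^sub>v x) (rank_one_isometry J c u *\<^sub>v y) =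
      bform J x y + c * bform J u y * bform J x u + c * bform J u x * bform J u y +
      c * c * bform J u u * bform J u x * bform J u y"
    using xy u by (simp add: rank_one_apply bform_simps algebra_simps)
  also have "\<dots> = bform J x y + (c * s + c + c * c * bform J u u) * (bform J u x * bform J u y)"
    by (simp add: sgn[OF xy(1)] algebra_simps)
  finally show "bform J (rank_one_isometry J c u *\<^sub>v x) (rank_one_isometry J c u *\<^sub>v y) = bform J x y"
    by (simp add: c)
qed

end

lemma sig_inv:
  fixes J :: "'a::comm_ring_1 mat"
  assumes J: "J \<in> carrier_mat n n" and A: "A \<in> carrier (special_isometry_group J)"
    and B: "B \<in> carrier (special_isometry_group J)" and AB: "A * B = 1\<^sub>m n"
  shows "inv\<^bsub>special_isometry_group J\<^esub> A = B"
proof -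
  interpret group "special_isometry_group J"
    by (rule sig_group[OF J])
  show ?thesis
    by (rule inv_equality[OF inv_comm[of A B] A B]) (simp_all add: AB sig_one[OF J] A B)
qed

lemma commutator_in_derived:
  assumes "a \<in> H" "b \<in> H"
  shows "a \<otimes>\<^bsub>G\<^esub> b \<otimes>\<^bsub>G\<^esub> inv\<^bsub>G\<^esub> a \<otimes>\<^bsub>G\<^esub> inv\<^bsub>G\<^esub> b \<in> derived G H"
  unfolding derived_def using assms by (intro generate.incl) blast

text \<open>A transvection is a commutator of a transvection and an element doubling its axis; the latter
  exists because two transvections suffice to map \<open>x\<close> to \<open>y\<close> through a vector \<open>z\<close> which is
  orthogonal to neither.\<close>

context
  fixes n :: nat and J :: "complex mat"
  assumes J: "J \<in> carrier_mat n n" and dJ: "det J \<noteq> 0"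
    and alternating: "\<forall>x\<in>carrier_vec n. \<forall>y\<in>carrier_vec n. bform J x y = - bform J y x"
begin

lemma alt: "x \<in> carrier_vec n \<Longrightarrow> y \<in> carrier_vec n \<Longrightarrow> bform J x y = - bform J y x"
  using alternating by blast

lemma alt_self: "x \<in> carrier_vec n \<Longrightarrow> bform J x x = 0"
  using alt[of x x] by simp

text \<open>An isometry of a nondegenerate form has determinant of square 1, and a transvection is
  the square of the one with half the coefficient.\<close>

lemma transvection_in_group:
  assumes u: "u \<in> carrier_vec n"
  shows "rank_one_isometry J c u \<in> carrier (special_isometry_group J)"
proof -
  have iso: "transpose_mat (rank_one_isometry J c u) * J * rank_one_isometry J c u = J" for c
    using alt[OF _ u] alt_self[OF u] by (intro rank_one_isometryI[OF J u, of "-1"]) simp_all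
  let ?H = "rank_one_isometry J (c / 2) u"
  have H: "?H \<in> carrier_mat n n"
    by (rule rank_one_carrier[OF J])
  have "det J = det (transpose_mat ?H * J * ?H)"
    by (simp add: iso)
  also have "\<dots> = det ?H * det ?H * det J"
    using det_mult[OF mult_carrier_mat[OF transpose_carrier_mat[THEN iffD2, OF H] J] H]
      det_mult[OF transpose_carrier_mat[THEN iffD2, OF H] J] det_transpose[OF H] by simp
  finally have "det ?H * det ?H = 1"
    using dJ by simp
  moreover have "rank_one_isometry J c u = ?H * ?H"
    using rank_one_mult[OF J u, of "c / 2" "c / 2"] alt_self[OF u] by simp
  ultimately have "det (rank_one_isometry J c u) = 1"
    using det_mult[OF H H] by simp
  then show ?thesis
    using iso rank_one_carrier[OF J] by (simp add: sig_carrier[OF J])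
qed

text \<open>Since \<open>B(x, x) = 0\<close>, the coefficient \<open>1 / B(y, x)\<close> moves
  \<open>x\<close> by exactly \<open>y - x\<close>. A vector pairing equally with \<open>x\<close>
  and \<open>y\<close> is orthogonal to the axis and fixed, which protects basis vectors already
  dealt with.\<close>

lemma transvection_move:
  assumes xy: "x \<in> carrier_vec n" "y \<in> carrier_vec n" "bform J y x \<noteq> 0"
  defines "T \<equiv> rank_one_isometry J (1 / bform J y x) (y - x)"
  shows "T *\<^sub>v x = y" "\<And>w. w \<in> carrier_vec n \<Longrightarrow> bform J x w = bform J y w \<Longrightarrow> T *\<^sub>v w = w"
proof -
  have d: "y - x \<in> carrier_vec n"
    using xy by simp
  have dw: "bform J (y - x) w = bform J y w - bform J x w" if "w \<in> carrier_vec n" for w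
  proof -
    have "y = (y - x) + x"
      using xy by (intro eq_vecI) simp_all
    then have "bform J y w = bform J (y - x) w + bform J x w"
      using bform_add_left[OF J d xy(1) that] by simp
    then show ?thesis by simp
  qed
  have "1 / bform J y x * bform J (y - x) x = 1"
    using xy alt_self[OF xy(1)] dw[OF xy(1)] by simp
  then have "T *\<^sub>v x = x + 1 \<cdot>\<^sub>v (y - x)"
    unfolding T_def rank_one_apply[OF J d xy(1)] by simp
  also have "\<dots> = y"
    using xy by (intro eq_vecI) simp_all
  finally show "T *\<^sub>v x = y" .
  fix w assume w: "w \<in> carrier_vec n" "bform J x w = bform J y w"
  have "bform J (y - x) w = 0"
    using w dw[OF w(1)] by simp
  then have "T *\<^sub>v w = w + 0 \<cdot>\<^sub>v (y - x)"
    unfolding T_def rank_one_apply[OF J d w(1)] by simp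
  also have "\<dots> = w"
    using w xy by (intro eq_vecI) simp_all
  finally show "T *\<^sub>v w = w" .
qed

lemma transvection_move2:
  assumes xyz: "x \<in> carrier_vec n" "y \<in> carrier_vec n" "z \<in> carrier_vec n"
    and nz: "bform J z x \<noteq> 0" "bform J y z \<noteq> 0"
  obtains c a d b where "a \<in> carrier_vec n" "b \<in> carrier_vec n"
    "(rank_one_isometry J c a * rank_one_isometry J d b) *\<^sub>v x = y"
    "\<forall>w\<in>carrier_vec n. bform J x w = bform J z w \<and> bform J y w = bform J z w \<longrightarrow>
      (rank_one_isometry J c a * rank_one_isometry J d b) *\<^sub>v w = w"
proof (rule that[of "y - z" "z - x" "1 / bform J y z" "1 / bform J z x"])
  let ?S = "rank_one_isometry J (1 / bform J y z) (y - z)"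
  let ?T = "rank_one_isometry J (1 / bform J z x) (z - x)"
  note c = rank_one_carrier[OF J]
  show "y - z \<in> carrier_vec n" "z - x \<in> carrier_vec n"
    using xyz by simp_all
  show "(?S * ?T) *\<^sub>v x = y"
    using assoc_mult_mat_vec[OF c c xyz(1)] transvection_move(1)[OF xyz(1,3) nz(1)]
      transvection_move(1)[OF xyz(3,2) nz(2)] by simp
  show "\<forall>w\<in>carrier_vec n. bform J x w = bform J z w \<and> bform J y w = bform J z w \<longrightarrow> (?S * ?T) *\<^sub>v w = w"
  proof (intro ballI impI)
    fix w assume w: "w \<in> carrier_vec n" "bform J x w = bform J z w \<and> bform J y w = bform J z w"
    show "(?S * ?T) *\<^sub>v w = w"
      using assoc_mult_mat_vec[OF c c w(1)] transvection_move(2)[OF xyz(1,3) nz(1) w(1)]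
        transvection_move(2)[OF xyz(3,2) nz(2) w(1)] w(2) by simp
  qed
qed

lemma transvection_in_derived:
  assumes u: "u \<in> carrier_vec n" and z: "z \<in> carrier_vec n" "bform J u z \<noteq> 0"
  shows "rank_one_isometry J c u \<in> derived (special_isometry_group J) (carrier (special_isometry_group J))"
proof -
  let ?G = "special_isometry_group J"
  interpret group ?G by (rule sig_group[OF J])
  have "bform J z u \<noteq> 0" "bform J (2 \<cdot>\<^sub>v u) z \<noteq> 0" "2 \<cdot>\<^sub>v u \<in> carrier_vec n"
    using z u alt[OF u z(1)] bform_smult_left[OF J u z(1), of 2] by simp_all
  then obtain a b e f where ab: "a \<in> carrier_vec n" "b \<in> carrier_vec n"
    "(rank_one_isometry J e a * rank_one_isometry J f b) *\<^sub>v u = 2 \<cdot>\<^sub>v u"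
    using transvection_move2[OF u _ z(1), of "2 \<cdot>\<^sub>v u"] by metis
  define h where "h = rank_one_isometry J e a * rank_one_isometry J f b"
  have hG: "h \<in> carrier ?G"
    using m_closed[OF transvection_in_group[OF ab(1)] transvection_in_group[OF ab(2)]] by (simp add: h_def)
  then have h: "h \<in> carrier_mat n n" "transpose_mat h * J * h = J"
    by (simp_all add: sig_carrier[OF J])
  \<comment> \<open>\<open>h\<close> doubles \<open>u\<close>, so conjugation by it multiplies the
    coefficient of the transvection by 4; the commutator has coefficient
    \<open>4 (c / 3) - c / 3 = c\<close>.\<close>
  let ?t = "rank_one_isometry J (c / 3) u"
  have tG: "?t \<in> carrier ?G"
    by (rule transvection_in_group[OF u])
  have inv_t: "inv\<^bsub>?G\<^esub> ?t = rank_one_isometry J (- (c / 3)) u"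
    using rank_one_mult[OF J u, of "c / 3" "- (c / 3)"] alt_self[OF u] rank_one_zero[OF J u]
    by (intro sig_inv[OF J tG transvection_in_group[OF u]]) simp
  have hu: "h *\<^sub>v u = 2 \<cdot>\<^sub>v u"
    using ab(3) by (simp add: h_def)
  have conj: "h \<otimes>\<^bsub>?G\<^esub> ?t = rank_one_isometry J (4 * (c / 3)) u \<otimes>\<^bsub>?G\<^esub> h"
    using rank_one_conj[OF J h u, of "c / 3"] rank_one_smult[OF J u, of "c / 3" 2] by (simp add: hu mult_ac)
  have sG: "rank_one_isometry J (4 * (c / 3)) u \<in> carrier ?G"
    by (rule transvection_in_group[OF u])
  have "h \<otimes>\<^bsub>?G\<^esub> ?t \<otimes>\<^bsub>?G\<^esub> inv\<^bsub>?G\<^esub> h \<otimes>\<^bsub>?G\<^esub> inv\<^bsub>?G\<^esub> ?t =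
      rank_one_isometry J (4 * (c / 3)) u \<otimes>\<^bsub>?G\<^esub> inv\<^bsub>?G\<^esub> ?t"
    unfolding conj by (simp only: m_assoc[OF sG hG inv_closed[OF hG]] r_inv[OF hG] r_one[OF sG])
  also have "\<dots> = rank_one_isometry J c u"
    unfolding inv_t sig_mult rank_one_mult[OF J u] by (simp add: alt_self[OF u])
  finally show ?thesis
    using commutator_in_derived[OF hG tG, of ?G] by simp
qed

end

section \<open>Split forms and the symplectic group\<close>

lemma mat_eq_one_unitI:
  fixes A :: "'a::comm_ring_1 mat"
  assumes A: "A \<in> carrier_mat n n" and unit: "\<And>j. j < n \<Longrightarrow> A *\<^sub>v unit_vec n j = unit_vec n j"
  shows "A = 1\<^sub>m n"
proof (rule eq_matI)
  fix i j assume "i < dim_row (1\<^sub>m n :: 'a mat)" "j < dim_col (1\<^sub>m n :: 'a mat)"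
  then have ij: "i < n" "j < n" by simp_all
  have "A $$ (i, j) = (A *\<^sub>v unit_vec n j) $ i"
    using A ij by simp
  then show "A $$ (i, j) = 1\<^sub>m n $$ (i, j)"
    using unit[OF ij(2)] ij by simp
qed (use carrier_matD[OF A] in simp_all)

lemma bform_unit:
  "M \<in> carrier_mat n n \<Longrightarrow> i < n \<Longrightarrow> j < n \<Longrightarrow> bform M (unit_vec n i) (unit_vec n j) = M $$ (i, j)"
  by (simp add: bform_def)

lemma bform_symmetry:
  fixes J :: "'a::comm_ring_1 mat"
  assumes J: "J \<in> carrier_mat n n" and s: "transpose_mat J = s \<cdot>\<^sub>m J"
    and xy: "x \<in> carrier_vec n" "y \<in> carrier_vec n"
  shows "bform J x y = s * bform J y x"
proof -
  have "bform J x y = (transpose_mat J *\<^sub>v x) \<bullet> y"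
    unfolding bform_def by (rule transpose_vec_mult_scalar[OF J xy(2,1), symmetric])
  also have "transpose_mat J *\<^sub>v x = s \<cdot>\<^sub>v (J *\<^sub>v x)"
    unfolding s using J xy by (intro eq_vecI) (auto simp: scalar_prod_def sum_distrib_left mult.assoc)
  also have "(s \<cdot>\<^sub>v (J *\<^sub>v x)) \<bullet> y = s * ((J *\<^sub>v x) \<bullet> y)"
    using J xy by (intro smult_scalar_prod_distrib[of _ n]) simp_all
  also have "(J *\<^sub>v x) \<bullet> y = y \<bullet> (J *\<^sub>v x)"
    using J xy by (intro comm_scalar_prod[of _ n]) simp_all
  finally show ?thesis
    by (simp add: bform_def)
qed

lemma split_form_carrier [simp]: "split_form ty N \<in> carrier_mat N N"
  by (simp add: split_form_def)

lemma split_form_entry: "i < N \<Longrightarrow> j < N \<Longrightarrow> split_form ty N $$ (i, j) =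
    (if i + j + 1 = N then (case ty of Symmetric \<Rightarrow> 1 | Alternating \<Rightarrow> if i < j then 1 else - 1) else 0)"
  by (simp add: split_form_def)

lemma split_form_orthogonal: "split_form ty N * transpose_mat (split_form ty N) = 1\<^sub>m N"
proof (rule eq_matI)
  let ?J = "split_form ty N"
  fix i j assume "i < dim_row (1\<^sub>m N :: complex mat)" "j < dim_col (1\<^sub>m N :: complex mat)"
  then have ij: "i < N" "j < N" by simp_all
  have "(?J * transpose_mat ?J) $$ (i, j) = (\<Sum>l = 0..<N. ?J $$ (i, l) * ?J $$ (j, l))"
    using ij carrier_matD[OF split_form_carrier[of ty N]] by (simp add: scalar_prod_def)
  also have "\<dots> = (\<Sum>l = 0..<N. if l = N - 1 - i then ?J $$ (i, l) * ?J $$ (j, l) else 0)"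
    using ij by (intro sum.cong refl) (auto simp: split_form_entry)
  also have "\<dots> = ?J $$ (i, N - 1 - i) * ?J $$ (j, N - 1 - i)"
    using ij by simp
  also have "\<dots> = 1\<^sub>m N $$ (i, j)"
    using ij by (auto simp: split_form_entry split: form_type.split)
  finally show "(?J * transpose_mat ?J) $$ (i, j) = 1\<^sub>m N $$ (i, j)" .
qed (use carrier_matD[OF split_form_carrier[of ty N]] in simp_all)

lemma det_split_form: "det (split_form ty N) \<noteq> 0"
proof -
  let ?J = "split_form ty N"
  have "det ?J * det (transpose_mat ?J) = 1"
    using det_mult[OF split_form_carrier transpose_carrier_mat[THEN iffD2, OF split_form_carrier], of ty N ty]
    by (simp add: split_form_orthogonal)
  then show ?thesis by auto
qed

lemma isometry_bform:
  assumes J: "J \<in> carrier_mat n n" and g: "g \<in> carrier (special_isometry_group J)"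
    and xy: "x \<in> carrier_vec n" "y \<in> carrier_vec n"
  shows "bform J (g *\<^sub>v x) (g *\<^sub>v y) = bform J x y"
proof -
  have "g \<in> carrier_mat n n" "transpose_mat g * J * g = J"
    using g by (simp_all add: sig_carrier[OF J])
  then show ?thesis
    using isometry_iff_bform[OF J] xy by blast
qed

lemma derived_sig_subgroup:
  assumes "J \<in> carrier_mat n n"
  shows "subgroup (derived (special_isometry_group J) (carrier (special_isometry_group J))) (special_isometry_group J)"
  by (rule group.derived_is_subgroup[OF sig_group[OF assms]]) simp

context
  fixes n :: nat and J :: "complex mat"
  assumes J: "J \<in> carrier_mat n n" and dJ: "det J \<noteq> 0"
    and alternating: "\<forall>x\<in>carrier_vec n. \<forall>y\<in>carrier_vec n. bform J x y = - bform J y x"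
begin

lemma transvection_move_derived:
  assumes xyz: "x \<in> carrier_vec n" "y \<in> carrier_vec n" "z \<in> carrier_vec n"
    and nz: "bform J z x \<noteq> 0" "bform J y z \<noteq> 0"
  shows "\<exists>d\<in>derived (special_isometry_group J) (carrier (special_isometry_group J)). d *\<^sub>v x = y \<and>
    (\<forall>w\<in>carrier_vec n. bform J x w = bform J z w \<and> bform J y w = bform J z w \<longrightarrow> d *\<^sub>v w = w)"
proof -
  let ?G = "special_isometry_group J" and ?D = "derived (special_isometry_group J) (carrier (special_isometry_group J))"
  interpret D: subgroup ?D ?G
    by (rule derived_sig_subgroup[OF J])
  have T: "rank_one_isometry J c u \<in> ?D" if u: "u \<in> carrier_vec n" for c u
  proof (cases "\<exists>z\<in>carrier_vec n. bform J u z \<noteq> 0")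
    case True
    then obtain z where "z \<in> carrier_vec n" "bform J u z \<noteq> 0" by blast
    then show ?thesis
      by (rule transvection_in_derived[OF J dJ alternating u])
  next
    case False
    have "rank_one_isometry J c u = 1\<^sub>m n"
    proof (rule mat_eq_mult_vecI)
      fix x :: "complex vec" assume x: "x \<in> carrier_vec n"
      then have "bform J u x = 0"
        using False by blast
      then show "rank_one_isometry J c u *\<^sub>v x = 1\<^sub>m n *\<^sub>v x"
        unfolding rank_one_apply[OF J u x] using x u by (intro eq_vecI) simp_all
    qed (simp_all add: rank_one_carrier[OF J])
    then show ?thesis
      using D.one_closed by (simp add: sig_one[OF J])
  qed
  obtain c a d b where ab: "a \<in> carrier_vec n" "b \<in> carrier_vec n"
    "(rank_one_isometry J c a * rank_one_isometry J d b) *\<^sub>v x = y"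
    "\<forall>w\<in>carrier_vec n. bform J x w = bform J z w \<and> bform J y w = bform J z w \<longrightarrow>
      (rank_one_isometry J c a * rank_one_isometry J d b) *\<^sub>v w = w"
    by (rule transvection_move2[OF J dJ alternating xyz nz])
  then show ?thesis
    using D.m_closed[OF T[OF ab(1), of c] T[OF ab(2), of d]]
    by (intro bexI[of _ "rank_one_isometry J c a * rank_one_isometry J d b"] conjI) simp_all
qed

end

text \<open>Hyperbolic pairs are straightened from the outside in: modulo the derived group,
  \<open>g\<close> is changed so as to fix the basis vector \<open>k\<close> and then its partner
  \<open>N - 1 - k\<close>. The earlier pairs stay fixed because all auxiliary vectors are
  orthogonal to them.\<close>

lemma symplectic_perfect:
  assumes "even N"
  defines "J \<equiv> split_form Alternating N"
  shows "carrier (special_isometry_group J) \<subseteq> derived (special_isometry_group J) (carrier (special_isometry_group J))"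
proof -
  let ?G = "special_isometry_group J" and ?e = "unit_vec N :: nat \<Rightarrow> complex vec"
  let ?D = "derived (special_isometry_group J) (carrier (special_isometry_group J))"
  obtain m where N: "N = 2 * m"
    using assms(1) by (rule evenE)
  have J: "J \<in> carrier_mat N N" and dJ: "det J \<noteq> 0"
    by (simp_all add: J_def det_split_form)
  have "transpose_mat J = (- 1) \<cdot>\<^sub>m J"
  proof (rule eq_matI)
    fix i j assume "i < dim_row ((- 1) \<cdot>\<^sub>m J)" "j < dim_col ((- 1) \<cdot>\<^sub>m J)"
    then have ij: "i < N" "j < N"
      using J by auto
    have "i = j \<Longrightarrow> i + j + 1 \<noteq> N"
      using N by presburger
    then show "transpose_mat J $$ (i, j) = ((- 1) \<cdot>\<^sub>m J) $$ (i, j)"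
      using ij by (auto simp: J_def split_form_def)
  qed (use J in auto)
  then have alt: "bform J x y = - bform J y x" if "x \<in> carrier_vec N" "y \<in> carrier_vec N" for x y
    using bform_symmetry[OF J _ that] by simp
  interpret G: group ?G by (rule sig_group[OF J])
  interpret D: subgroup ?D ?G by (rule derived_sig_subgroup[OF J])
  \<comment> \<open>The indices of the outermost \<open>k\<close> hyperbolic pairs.\<close>
  define I where "I k = {i. i < N \<and> (i < k \<or> N - k \<le> i)}" for k
  have e: "?e i \<in> carrier_vec N" for i
    by simp
  have be: "bform J (?e i) (?e j) = (if i + j + 1 = N then if i < j then 1 else - 1 else 0)"
    if "i < N" "j < N" for i j
    unfolding bform_unit[OF J that] unfolding J_def using that by (simp add: split_form_entry)
  have car: "g \<in> carrier_mat N N" if "g \<in> carrier ?G" for g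
    using that by (simp add: sig_carrier[OF J])
  note iso = isometry_bform[OF J]
  note bsimps = bform_simps[OF J]
  have "\<forall>x\<in>carrier_vec N. \<forall>y\<in>carrier_vec N. bform J x y = - bform J y x"
    using alt by blast
  note move = transvection_move_derived[OF J dJ this]
  have main: "g \<in> ?D" if "m - k = l" "k \<le> m" "g \<in> carrier ?G" "\<And>i. i \<in> I k \<Longrightarrow> g *\<^sub>v ?e i = ?e i" for g k l
    using that
  proof (induction l arbitrary: g k)
    case 0
    have "g = 1\<^sub>m N"
    proof (rule mat_eq_one_unitI[OF car[OF 0(3)]])
      show "g *\<^sub>v ?e j = ?e j" if "j < N" for j
        using 0 that by (intro 0(4)) (auto simp: I_def N)
    qed
    then show ?case
      using D.one_closed by (simp add: sig_one[OF J])
  next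
    case (Suc l)
    then have k: "k < m" by simp
    define k' where "k' = N - 1 - k"
    have kN: "k < N" "k' < N" "k < k'" "k + k' + 1 = N"
      using k by (auto simp: N k'_def)
    note gG = Suc.prems(3) and gfix = Suc.prems(4)
    have gc: "g *\<^sub>v x \<in> carrier_vec N" if "x \<in> carrier_vec N" for x
      using car[OF gG] that by simp
    have perp: "bform J (?e k) (?e i) = 0" "bform J (?e k') (?e i) = 0" if "i \<in> I k" for i
    proof -
      have "i < N" "k + i + 1 \<noteq> N" "k' + i + 1 \<noteq> N"
        using that k kN by (auto simp: I_def N)
      then show "bform J (?e k) (?e i) = 0" "bform J (?e k') (?e i) = 0"
        using kN by (simp_all only: be if_False)
    qed
    have gperp: "bform J (g *\<^sub>v ?e k) (?e i) = 0" "bform J (g *\<^sub>v ?e k') (?e i) = 0" if "i \<in> I k" for i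
      using iso[OF gG e e, of k i] iso[OF gG e e, of k' i] gfix[OF that] perp[OF that] by simp_all
    define x where "x = g *\<^sub>v ?e k"
    define f where "f = g *\<^sub>v ?e k'"
    have xf: "x \<in> carrier_vec N" "f \<in> carrier_vec N"
      by (simp_all add: x_def f_def gc)
    have bkk: "bform J (?e k) (?e k') = 1" "bform J (?e k') (?e k) = - 1" "bform J (?e k') (?e k') = 0"
      "bform J (?e k) (?e k) = 0"
      using kN by (simp_all add: be)
    have fx: "bform J f x = - 1"
      using iso[OF gG e e, of k' k] bkk by (simp add: x_def f_def)
    \<comment> \<open>The vector \<open>?e k'\<close> works unless it is orthogonal to
      \<open>x\<close>, and \<open>f\<close> works unless \<open>?e k\<close> is orthogonal to it;
      if both fail, their sum works.\<close>
    have "\<exists>z\<in>carrier_vec N. bform J z x \<noteq> 0 \<and> bform J (?e k) z \<noteq> 0 \<and> (\<forall>i\<in>I k. bform J z (?e i) = 0)"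
    proof (cases "bform J (?e k') x = 0")
      case False
      then show ?thesis
        using e perp bkk by (intro bexI[of _ "?e k'"]) auto
    next
      case True
      show ?thesis
      proof (cases "bform J (?e k) f = 0")
        case False
        then show ?thesis
          using xf fx gperp by (intro bexI[of _ f]) (auto simp: f_def)
      next
        case False': True
        have "bform J (?e k' + f) x = - 1" "bform J (?e k) (?e k' + f) = 1"
          using True False' fx bkk xf e by (simp_all add: bsimps)
        moreover have "bform J (?e k' + f) (?e i) = 0" if "i \<in> I k" for i
          using xf e perp[OF that] gperp[OF that] by (simp add: bsimps f_def)
        ultimately show ?thesis
          using xf e by (intro bexI[of _ "?e k' + f"]) auto
      qed
    qed
    then obtain z where z: "z \<in> carrier_vec N" "bform J z x \<noteq> 0" "bform J (?e k) z \<noteq> 0"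
      "\<forall>i\<in>I k. bform J z (?e i) = 0"
      by blast
    obtain d where d: "d \<in> ?D" "d *\<^sub>v x = ?e k" "\<forall>w\<in>carrier_vec N. bform J x w = bform J z w \<and>
        bform J (?e k) w = bform J z w \<longrightarrow> d *\<^sub>v w = w"
      using move[OF xf(1) e z(1,2,3)] by blast
    have dG: "d \<in> carrier ?G"
      by (rule D.mem_carrier[OF d(1)])
    define g1 where "g1 = d * g"
    have g1G: "g1 \<in> carrier ?G"
      using G.m_closed[OF dG gG] by (simp add: g1_def)
    have g1v: "g1 *\<^sub>v w = d *\<^sub>v (g *\<^sub>v w)" if "w \<in> carrier_vec N" for w
      unfolding g1_def by (rule assoc_mult_mat_vec[OF car[OF dG] car[OF gG] that])
    have g1k: "g1 *\<^sub>v ?e k = ?e k"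
      using g1v[OF e] d(2) by (simp add: x_def)
    have g1fix: "g1 *\<^sub>v ?e i = ?e i" if "i \<in> I k" for i
      using g1v[OF e] gfix[OF that] d(3) e gperp[OF that] perp[OF that] z(4) that by (simp add: x_def)
    define y where "y = g1 *\<^sub>v ?e k'"
    have y: "y \<in> carrier_vec N"
      using car[OF g1G] by (simp add: y_def)
    have yk: "bform J y (?e k) = - 1"
      using iso[OF g1G e e, of k' k] g1k bkk by (simp add: y_def)
    have ky: "bform J (?e k) y = 1"
      using alt[OF e y, of k] yk by simp
    have yperp: "bform J y (?e i) = 0" if "i \<in> I k" for i
      using iso[OF g1G e e, of k' i] g1fix[OF that] perp[OF that] by (simp add: y_def)
    \<comment> \<open>Adding a multiple of \<open>?e k\<close> to its partner keeps the pairing with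
      \<open>?e k\<close>, so the second move fixes \<open>?e k\<close>. The pairings that must not
      vanish are \<open>bform J (?e k') y + \<alpha>\<close> and \<open>- \<alpha>\<close>, whence
      the case distinction.\<close>
    define \<alpha> :: complex where "\<alpha> = (if bform J (?e k') y = - 1 then 2 else 1)"
    define z' where "z' = ?e k' + \<alpha> \<cdot>\<^sub>v ?e k"
    have z': "z' \<in> carrier_vec N"
      by (simp add: z'_def)
    have "bform J (?e k') y + \<alpha> \<noteq> 0"
      by (simp add: \<alpha>_def eq_neg_iff_add_eq_0[symmetric])
    then have n1: "bform J z' y \<noteq> 0"
      using y e ky by (simp add: z'_def bsimps)
    have n2: "bform J (?e k') z' \<noteq> 0"
      using e bkk by (simp add: z'_def bsimps \<alpha>_def)
    obtain d' where d': "d' \<in> ?D" "d' *\<^sub>v y = ?e k'" "\<forall>w\<in>carrier_vec N. bform J y w = bform J z' w \<and>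
        bform J (?e k') w = bform J z' w \<longrightarrow> d' *\<^sub>v w = w"
      using move[OF y e z' n1 n2] by blast
    have dG': "d' \<in> carrier ?G"
      by (rule D.mem_carrier[OF d'(1)])
    define g2 where "g2 = d' * g1"
    have g2G: "g2 \<in> carrier ?G"
      using G.m_closed[OF dG' g1G] by (simp add: g2_def)
    have g2v: "g2 *\<^sub>v w = d' *\<^sub>v (g1 *\<^sub>v w)" if "w \<in> carrier_vec N" for w
      unfolding g2_def by (rule assoc_mult_mat_vec[OF car[OF dG'] car[OF g1G] that])
    have z'i: "bform J z' (?e i) = 0" if "i \<in> I k" for i
      using e perp[OF that] by (simp add: z'_def bsimps)
    have z'k: "bform J z' (?e k) = - 1"
      using e bkk by (simp add: z'_def bsimps)
    have "g2 *\<^sub>v ?e i = ?e i" if i: "i \<in> I (Suc k)" for i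
    proof -
      have "i \<in> I k \<or> i = k \<or> i = k'"
        using i kN(1) unfolding I_def k'_def mem_Collect_eq by arith
      then consider "i \<in> I k" | "i = k" | "i = k'" by blast
      then show ?thesis
      proof cases
        case 1
        then show ?thesis
          using g2v[OF e] g1fix[OF 1] d'(3) e yperp[OF 1] perp[OF 1] z'i[OF 1] by simp
      next
        case 2
        then show ?thesis
          using g2v[OF e] g1k d'(3) e yk bkk z'k by simp
      next
        case 3
        then show ?thesis
          using g2v[OF e] d'(2) by (simp add: y_def)
      qed
    qed
    then have g2D: "g2 \<in> ?D"
      using k Suc.prems(1) g2G by (intro Suc.IH[of "Suc k"]) simp_all
    have "g2 = d' \<otimes>\<^bsub>?G\<^esub> (d \<otimes>\<^bsub>?G\<^esub> g)"
      by (simp add: g2_def g1_def)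
    then have "d \<otimes>\<^bsub>?G\<^esub> g = inv\<^bsub>?G\<^esub> d' \<otimes>\<^bsub>?G\<^esub> g2"
      by (rule G.inv_solve_left[OF G.m_closed[OF dG gG] dG' g2G, THEN iffD2])
    then have dg: "d \<otimes>\<^bsub>?G\<^esub> g \<in> ?D"
      using D.m_closed[OF D.m_inv_closed[OF d'(1)] g2D] by (simp only:)
    have "inv\<^bsub>?G\<^esub> d \<otimes>\<^bsub>?G\<^esub> (d \<otimes>\<^bsub>?G\<^esub> g) = g"
      by (simp only: G.m_assoc[OF G.inv_closed[OF dG] dG gG, symmetric] G.l_inv[OF dG] G.l_one[OF gG])
    then show ?case
      using D.m_closed[OF D.m_inv_closed[OF d(1)] dg] by (simp only:)
  qed
  show ?thesis
  proof
    fix g assume g: "g \<in> carrier ?G"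
    show "g \<in> ?D"
      by (rule main[of 0 m, OF _ _ g]) (auto simp: I_def)
  qed
qed

section \<open>The special orthogonal group of the standard form\<close>

definition reflection :: "nat \<Rightarrow> complex vec \<Rightarrow> complex mat" where
  "reflection n u = rank_one_isometry (1\<^sub>m n) (- 2) u"

text \<open>Two orthogonal reflections are conjugate by a third one, so that their product is a commutator;
  any two reflections are linked by a chain of orthogonal ones when \<open>n \<ge> 3\<close>.\<close>

context
  fixes n :: nat
  assumes n3: "n \<ge> 3"
begin

abbreviation (input) SOn where "SOn \<equiv> special_isometry_group (1\<^sub>m n :: complex mat)"
abbreviation (input) SOd where "SOd \<equiv> derived SOn (carrier SOn)"
abbreviation (input) R where "R \<equiv> reflection n"
abbreviation (input) ip :: "complex vec \<Rightarrow> complex vec \<Rightarrow> complex" where "ip \<equiv> bform (1\<^sub>m n)"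

definition unit_vector :: "complex vec \<Rightarrow> bool" where
  "unit_vector u \<longleftrightarrow> u \<in> carrier_vec n \<and> ip u u = 1"

lemma one_carrier: "(1\<^sub>m n :: complex mat) \<in> carrier_mat n n"
  by simp

lemmas ip_simps = bform_simps[OF one_carrier]

lemma ip_sum: "x \<in> carrier_vec n \<Longrightarrow> y \<in> carrier_vec n \<Longrightarrow> ip x y = (\<Sum>i = 0..<n. x $ i * y $ i)"
  by (simp add: bform_def scalar_prod_def)

lemma ip_comm: "x \<in> carrier_vec n \<Longrightarrow> y \<in> carrier_vec n \<Longrightarrow> ip x y = ip y x"
  by (simp add: ip_sum mult.commute)

lemma ip_unit: "x \<in> carrier_vec n \<Longrightarrow> i < n \<Longrightarrow> ip x (unit_vec n i) = x $ i"
  "x \<in> carrier_vec n \<Longrightarrow> i < n \<Longrightarrow> ip (unit_vec n i) x = x $ i"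
  by (simp_all add: bform_def)

lemma unit_vectorD: "unit_vector u \<Longrightarrow> u \<in> carrier_vec n" "unit_vector u \<Longrightarrow> ip u u = 1"
  by (simp_all add: unit_vector_def)

lemma unit_vector_unit: "i < n \<Longrightarrow> unit_vector (unit_vec n i)"
  by (simp add: unit_vector_def ip_unit)

text \<open>The form is bilinear and not Hermitian, so nonzero vectors can be isotropic; any other
  vector is normalized by a complex square root.\<close>

lemma unit_vector_normalize:
  assumes "x \<in> carrier_vec n" "ip x x \<noteq> 0"
  shows "unit_vector ((1 / csqrt (ip x x)) \<cdot>\<^sub>v x)"
proof -
  have "csqrt (ip x x) * csqrt (ip x x) = ip x x"
    by (metis power2_csqrt power2_eq_square)
  then have "1 / csqrt (ip x x) * (1 / csqrt (ip x x) * ip x x) = 1"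
    using assms(2) by (simp add: divide_simps)
  then show ?thesis
    using assms(1) by (simp add: unit_vector_def ip_simps)
qed

lemma R_carrier: "R u \<in> carrier_mat n n"
  unfolding reflection_def by (rule rank_one_carrier[OF one_carrier])

lemma R_apply: "u \<in> carrier_vec n \<Longrightarrow> x \<in> carrier_vec n \<Longrightarrow> R u *\<^sub>v x = x + (- 2 * ip u x) \<cdot>\<^sub>v u"
  unfolding reflection_def by (rule rank_one_apply[OF one_carrier])

lemma R_square: "unit_vector u \<Longrightarrow> R u * R u = 1\<^sub>m n"
  unfolding reflection_def
  by (simp add: rank_one_mult[OF one_carrier] unit_vectorD rank_one_zero[OF one_carrier])

lemma R_isometry: "unit_vector u \<Longrightarrow> transpose_mat (R u) * 1\<^sub>m n * R u = 1\<^sub>m n"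
  unfolding reflection_def
  by (rule rank_one_isometryI[OF one_carrier, of _ 1]) (simp_all add: unit_vectorD ip_comm)

lemma R_conj: "unit_vector h \<Longrightarrow> u \<in> carrier_vec n \<Longrightarrow> R h * R u = R (R h *\<^sub>v u) * R h"
  using rank_one_conj[OF one_carrier R_carrier R_isometry, of h u "- 2"] by (simp add: reflection_def)

lemma R_smult_minus: "u \<in> carrier_vec n \<Longrightarrow> R ((- 1) \<cdot>\<^sub>v u) = R u"
  using rank_one_smult[OF one_carrier, of u "- 2" "- 1"] by (simp add: reflection_def)

lemma R_fix: "u \<in> carrier_vec n \<Longrightarrow> x \<in> carrier_vec n \<Longrightarrow> ip u x = 0 \<Longrightarrow> R u *\<^sub>v x = x"
  by (subst R_apply) (auto intro!: eq_vecI)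

lemma R_commute:
  assumes "unit_vector u" "unit_vector w" "ip w u = 0"
  shows "R w * R u = R u * R w"
  using R_conj[OF assms(2) unit_vectorD(1)[OF assms(1)]]
    R_fix[OF unit_vectorD(1)[OF assms(2)] unit_vectorD(1)[OF assms(1)] assms(3)] by simp

lemma R_cancel:
  assumes "unit_vector u" "A \<in> carrier_mat n n"
  shows "R u * (R u * A) = A"
proof -
  have "R u * (R u * A) = (R u * R u) * A"
    by (rule assoc_mult_mat[OF R_carrier R_carrier assms(2), symmetric])
  then show ?thesis
    using assms by (simp add: R_square)
qed

text \<open>\<open>m\<close> is the normalized sum of \<open>u\<close> and \<open>z\<close>, and its
  reflection sends \<open>u\<close> to \<open>- z\<close>, which has the same reflection as
  \<open>z\<close>. Being in the span of \<open>u\<close> and \<open>z\<close>, it is orthogonal to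
  whatever is orthogonal to both.\<close>

lemma orthogonal_swap:
  assumes u: "unit_vector u" and z: "unit_vector z" and uz: "ip u z = 0"
  obtains m where "unit_vector m" "R m * R u = R z * R m"
    "\<And>w. w \<in> carrier_vec n \<Longrightarrow> ip w u = 0 \<Longrightarrow> ip w z = 0 \<Longrightarrow> ip w m = 0"
proof -
  note c = unit_vectorD(1)[OF u] unit_vectorD(1)[OF z]
  note n = unit_vectorD(2)[OF u] unit_vectorD(2)[OF z]
  have zu: "ip z u = 0"
    using ip_comm[OF c] uz by simp
  define s :: complex where "s = 1 / csqrt 2"
  have "csqrt 2 * csqrt 2 = 2"
    by (metis power2_csqrt power2_eq_square)
  moreover have "r * r = 2 \<Longrightarrow> 1 / r * (1 / r) * 2 = 1" for r :: complex
    by simp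
  ultimately have s2: "s * s * 2 = 1"
    unfolding s_def by blast
  define m where "m = s \<cdot>\<^sub>v (u + z)"
  have mc: "m \<in> carrier_vec n"
    using c by (simp add: m_def)
  have sum: "u + z \<in> carrier_vec n"
    using c by simp
  have "ip m m = s * s * 2"
    unfolding m_def using c sum by (simp add: ip_simps n uz zu)
  then have m: "unit_vector m"
    using mc s2 by (simp add: unit_vector_def)
  have mu: "ip m u = s"
    unfolding m_def using c sum by (simp add: ip_simps n zu)
  have "- 2 * s * s = - 1"
    using s2 by (simp add: mult_ac)
  then have ent: "u $ i + (- 2 * s) * (s * (u $ i + z $ i)) = - z $ i" for i
    by (simp add: algebra_simps) (metis (no_types, lifting) s2 mult.commute mult.left_commute mult_1)
  have "R m *\<^sub>v u = (- 1) \<cdot>\<^sub>v z"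
    unfolding R_apply[OF mc c(1)] mu using c ent by (intro eq_vecI) (simp_all add: m_def)
  then have "R m * R u = R z * R m"
    using R_conj[OF m c(1)] R_smult_minus[OF c(2)] by simp
  moreover have "ip w m = 0" if "w \<in> carrier_vec n" "ip w u = 0" "ip w z = 0" for w
    unfolding m_def using that c sum by (simp add: ip_simps)
  ultimately show ?thesis
    using m that by blast
qed

text \<open>The two reflections are conjugate, so their determinants agree, and each determinant has
  square 1.\<close>

lemma det_R_orthogonal:
  assumes u: "unit_vector u" and z: "unit_vector z" and uz: "ip u z = 0"
  shows "det (R u * R z) = 1"
proof -
  obtain m where m: "unit_vector m" "R m * R u = R z * R m"
    using orthogonal_swap[OF u z uz] by metis
  have sq: "det (R v) * det (R v) = 1" if "unit_vector v" for v
    using det_mult[OF R_carrier R_carrier, of v v] R_square[OF that] by simp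
  have "det (R m) * det (R u) = det (R z) * det (R m)"
    by (simp only: det_mult[OF R_carrier R_carrier, symmetric] m(2))
  moreover have "det (R m) \<noteq> 0"
    using sq[OF m(1)] by auto
  ultimately have "det (R u) = det (R z)"
    by (metis mult.commute mult_left_cancel)
  then show ?thesis
    using det_mult[OF R_carrier R_carrier, of u z] sq[OF u] by simp
qed

lemma R_pair_in_group:
  assumes u: "unit_vector u" and z: "unit_vector z" and uz: "ip u z = 0"
  shows "R u * R z \<in> carrier SOn"
  using isometry_mult[OF one_carrier R_carrier R_carrier R_isometry[OF u] R_isometry[OF z]]
    det_R_orthogonal[OF assms] mult_carrier_mat[OF R_carrier R_carrier, of u z]
  by (simp add: sig_carrier[OF one_carrier])

text \<open>The projection of the \<open>k\<close>-th basis vector to the orthogonal complement of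
  \<open>u\<close> and \<open>z\<close> has square length \<open>1 - u_k ^ 2 - z_k ^ 2\<close>. Over
  all \<open>k\<close> these add up to \<open>n - 2\<close>, so one of them is nonzero; here
  \<open>n \<ge> 3\<close> enters.\<close>

lemma exists_orthogonal_unit:
  assumes u: "unit_vector u" and z: "unit_vector z" and uz: "ip u z = 0"
  obtains w where "unit_vector w" "ip w u = 0" "ip w z = 0"
proof -
  note c = unit_vectorD(1)[OF u] unit_vectorD(1)[OF z]
  note n = unit_vectorD(2)[OF u] unit_vectorD(2)[OF z]
  have zu: "ip z u = 0"
    using ip_comm[OF c] uz by simp
  have "(\<Sum>k = 0..<n. 1 - u $ k * u $ k - z $ k * z $ k) = of_nat n - ip u u - ip z z"
    using c by (simp add: sum_subtractf ip_sum)
  also have "\<dots> = of_nat n - 2"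
    by (simp add: n)
  also have "\<dots> \<noteq> 0"
    using n3 by (metis eq_iff_diff_eq_0 numeral_eq_iff of_nat_eq_iff of_nat_numeral Suc_numeral not_less_eq_eq numeral_3_eq_3 numeral_2_eq_2 order_refl)
  finally obtain k where k: "k < n" "1 - u $ k * u $ k - z $ k * z $ k \<noteq> 0"
    by (metis (no_types, lifting) atLeastLessThan_iff sum.neutral)
  define w where "w = unit_vec n k + ((- (u $ k)) \<cdot>\<^sub>v u + (- (z $ k)) \<cdot>\<^sub>v z)"
  have wc: "w \<in> carrier_vec n"
    using c by (simp add: w_def)
  have parts: "(- (u $ k)) \<cdot>\<^sub>v u \<in> carrier_vec n" "(- (z $ k)) \<cdot>\<^sub>v z \<in> carrier_vec n"
    "(- (u $ k)) \<cdot>\<^sub>v u + (- (z $ k)) \<cdot>\<^sub>v z \<in> carrier_vec n" "unit_vec n k \<in> carrier_vec n"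
    using c by simp_all
  have expand: "ip w x = x $ k - u $ k * ip u x - z $ k * ip z x" if "x \<in> carrier_vec n" for x
    unfolding w_def using that parts c k by (simp add: ip_simps ip_unit)
  have wu: "ip w u = 0" and wz: "ip w z = 0"
    using expand[OF c(1)] expand[OF c(2)] by (simp_all add: n uz zu)
  have "ip w w = w $ k"
    using expand[OF wc] ip_comm[OF c(1) wc] ip_comm[OF c(2) wc] wu wz by simp
  also have "\<dots> = 1 - u $ k * u $ k - z $ k * z $ k"
    using k c by (simp add: w_def)
  finally have ww: "ip w w \<noteq> 0"
    using k by simp
  show ?thesis
    using that[OF unit_vector_normalize[OF wc ww]] wu wz wc c by (simp add: ip_simps)
qed

text \<open>A single reflection has the wrong determinant, so \<open>R u\<close> and
  \<open>R m\<close> are each paired with a reflection \<open>R w\<close> commuting with both. It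
  cancels from the commutator of \<open>R u * R w\<close> and \<open>R m * R w\<close>, leaving
  \<open>R u * (R m * R u * R m) = R u * R z\<close>.\<close>

lemma R_pair_derived_orthogonal:
  assumes u: "unit_vector u" and z: "unit_vector z" and uz: "ip u z = 0"
  shows "R u * R z \<in> SOd"
proof -
  obtain w where w: "unit_vector w" "ip w u = 0" "ip w z = 0"
    by (rule exists_orthogonal_unit[OF assms])
  obtain m where m: "unit_vector m" "R m * R u = R z * R m"
    "\<And>w. w \<in> carrier_vec n \<Longrightarrow> ip w u = 0 \<Longrightarrow> ip w z = 0 \<Longrightarrow> ip w m = 0"
    by (rule orthogonal_swap[OF assms]) blast
  note c = R_carrier
  note cc = mult_carrier_mat[OF R_carrier R_carrier]
  note assoc = assoc_mult_mat[of _ n n _ n _ n]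
  have wm: "ip w m = 0"
    by (rule m(3)[OF unit_vectorD(1)[OF w(1)] w(2,3)])
  have uw: "ip u w = 0" and mw: "ip m w = 0"
    using ip_comm[OF unit_vectorD(1)[OF w(1)]] w(2) wm u m(1) unit_vectorD(1) by metis+
  have com_u: "R w * R u = R u * R w" and com_m: "R w * R m = R m * R w"
    using R_commute u m(1) w wm by blast+
  define a where "a = R u * R w"
  define b where "b = R m * R w"
  have aG: "a \<in> carrier SOn" and bG: "b \<in> carrier SOn" and aG': "R w * R u \<in> carrier SOn" and bG': "R w * R m \<in> carrier SOn"
    unfolding a_def b_def using R_pair_in_group u m(1) w wm uw mw by blast+
  have inva: "inv\<^bsub>SOn\<^esub> a = R w * R u"
  proof (rule sig_inv[OF one_carrier aG aG'])
    have "R u * R w * (R w * R u) = R u * (R w * (R w * R u))"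
      by (rule assoc_mult_mat[OF c c cc])
    then show "a * (R w * R u) = 1\<^sub>m n"
      by (simp add: a_def R_cancel[OF w(1) c] R_square[OF u])
  qed
  have invb: "inv\<^bsub>SOn\<^esub> b = R w * R m"
  proof (rule sig_inv[OF one_carrier bG bG'])
    have "R m * R w * (R w * R m) = R m * (R w * (R w * R m))"
      by (rule assoc_mult_mat[OF c c cc])
    then show "b * (R w * R m) = 1\<^sub>m n"
      by (simp add: b_def R_cancel[OF w(1) c] R_square[OF m(1)])
  qed
  have ab: "a * b = R u * R m"
    unfolding a_def b_def com_m[symmetric] using c cc by (simp add: assoc R_cancel[OF w(1)])
  have "a * b * inv\<^bsub>SOn\<^esub> a = R u * R m * (R u * R w)"
    unfolding ab inva com_u ..
  then have "a * b * inv\<^bsub>SOn\<^esub> a * inv\<^bsub>SOn\<^esub> b = R u * R m * (R u * (R w * (R w * R m)))"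
    unfolding invb using c cc by (simp add: assoc mult_carrier_mat[of _ n n _ n])
  also have "\<dots> = R u * ((R m * R u) * R m)"
    using c cc by (simp add: assoc R_cancel[OF w(1)] mult_carrier_mat[of _ n n _ n])
  also have "\<dots> = R u * R z"
    unfolding m(2) using c cc by (simp add: assoc R_square[OF m(1)] right_mult_one_mat[OF R_carrier])
  finally have "a \<otimes>\<^bsub>SOn\<^esub> b \<otimes>\<^bsub>SOn\<^esub> inv\<^bsub>SOn\<^esub> a \<otimes>\<^bsub>SOn\<^esub> inv\<^bsub>SOn\<^esub> b = R u * R z"
    by simp
  then show ?thesis
    using commutator_in_derived[OF aG bG, of SOn] by simp
qed

lemma R_pair_trans:
  assumes "R u * R z \<in> SOd" "R z * R v \<in> SOd" "unit_vector z"
  shows "R u * R v \<in> SOd"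
proof -
  have "(R u * R z) * (R z * R v) = R u * (R z * (R z * R v))"
    by (rule assoc_mult_mat[OF R_carrier R_carrier mult_carrier_mat[OF R_carrier R_carrier]])
  then show ?thesis
    using subgroup.m_closed[OF derived_sig_subgroup[OF one_carrier] assms(1,2)]
    by (simp add: R_cancel[OF assms(3) R_carrier])
qed

text \<open>The vector \<open>u_j e_i - u_i e_j\<close> is orthogonal to \<open>u\<close> and to
  \<open>e_k\<close>, so it links their reflections by \<open>R_pair_trans\<close>, provided that it
  is not isotropic, that is, \<open>u_i ^ 2 + u_j ^ 2\<close> is nonzero.\<close>

lemma R_pair_derived_basis:
  assumes u: "unit_vector u"
  shows "R u * R (unit_vec n 0) \<in> SOd"
proof -
  let ?e = "unit_vec n :: nat \<Rightarrow> complex vec"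
  note uc = unit_vectorD(1)[OF u]
  have "(\<Sum>i = 0..<n. u $ i * u $ i) \<noteq> 0"
    using unit_vectorD(2)[OF u] ip_sum[OF uc uc] by simp
  then obtain a where a: "a < n" "u $ a \<noteq> 0"
    by (metis (no_types, lifting) atLeastLessThan_iff mult_zero_left sum.neutral)
  obtain b c where bc: "b < n" "c < n" "a \<noteq> b" "a \<noteq> c" "b \<noteq> c"
  proof -
    have "\<exists>b c. b < 3 \<and> c < 3 \<and> a \<noteq> b \<and> a \<noteq> c \<and> b \<noteq> (c::nat)"
      by presburger
    then show ?thesis
      using n3 that by (meson order_less_le_trans)
  qed
  \<comment> \<open>If the pairs \<open>(a, b)\<close> and \<open>(a, c)\<close> both fail, then
    \<open>u_b ^ 2 + u_c ^ 2 = - 2 u_a ^ 2\<close>, which is nonzero.\<close>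
  have "\<exists>i j k. i < n \<and> j < n \<and> k < n \<and> i \<noteq> j \<and> k \<noteq> i \<and> k \<noteq> j \<and> u $ i * u $ i + u $ j * u $ j \<noteq> 0"
  proof (cases "u $ a * u $ a + u $ b * u $ b = 0 \<and> u $ a * u $ a + u $ c * u $ c = 0")
    case True
    then have "u $ b * u $ b + u $ c * u $ c = - 2 * (u $ a * u $ a)"
      by (simp add: add_eq_0_iff)
    then have "u $ b * u $ b + u $ c * u $ c \<noteq> 0"
      using a(2) by simp
    then show ?thesis
      using a(1) bc by metis
  next
    case False
    then show ?thesis
      using a(1) bc by metis
  qed
  then obtain i j k where ijk: "i < n" "j < n" "k < n" "i \<noteq> j" "k \<noteq> i" "k \<noteq> j"
    "u $ i * u $ i + u $ j * u $ j \<noteq> 0"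
    by blast
  define z where "z = (u $ j) \<cdot>\<^sub>v ?e i + (- (u $ i)) \<cdot>\<^sub>v ?e j"
  have parts: "(u $ j) \<cdot>\<^sub>v ?e i \<in> carrier_vec n" "(- (u $ i)) \<cdot>\<^sub>v ?e j \<in> carrier_vec n"
    "?e i \<in> carrier_vec n" "?e j \<in> carrier_vec n"
    by simp_all
  have zc: "z \<in> carrier_vec n"
    by (simp add: z_def)
  have expand: "ip z x = u $ j * x $ i - u $ i * x $ j" if "x \<in> carrier_vec n" for x
    unfolding z_def using that parts ijk by (simp add: ip_simps ip_unit)
  have "ip z z = u $ i * u $ i + u $ j * u $ j"
    using expand[OF zc] ijk by (simp add: z_def)
  then have zz: "ip z z \<noteq> 0"
    using ijk by simp
  define y where "y = (1 / csqrt (ip z z)) \<cdot>\<^sub>v z"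
  have y: "unit_vector y"
    unfolding y_def by (rule unit_vector_normalize[OF zc zz])
  have yx: "ip y x = 1 / csqrt (ip z z) * ip z x" if "x \<in> carrier_vec n" for x
    unfolding y_def by (rule bform_smult_left[OF one_carrier zc that])
  have "ip y u = 0"
    using yx[OF uc] expand[OF uc] by simp
  then have "ip u y = 0"
    using ip_comm[OF uc unit_vectorD(1)[OF y]] by simp
  then have uy: "R u * R y \<in> SOd"
    by (rule R_pair_derived_orthogonal[OF u y])
  have "ip y (?e k) = 0"
    using yx[of "?e k"] expand[of "?e k"] ijk by simp
  then have "R y * R (?e k) \<in> SOd"
    by (rule R_pair_derived_orthogonal[OF y unit_vector_unit[OF ijk(3)]])
  with uy have uk: "R u * R (?e k) \<in> SOd"
    using y by (rule R_pair_trans)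
  show ?thesis
  proof (cases "k = 0")
    case False
    have n0: "0 < n"
      using n3 by simp
    have "ip (?e k) (?e 0) = 0"
      using ijk(3) n0 False by (simp add: ip_unit)
    then have "R (?e k) * R (?e 0) \<in> SOd"
      by (rule R_pair_derived_orthogonal[OF unit_vector_unit[OF ijk(3)] unit_vector_unit[OF n0]])
    with uk show ?thesis
      using unit_vector_unit[OF ijk(3)] by (rule R_pair_trans)
  qed (use uk in simp)
qed

text \<open>The Cartan--Dieudonne argument: an isometry is multiplied by reflections until it fixes the
  standard basis. The coset of the derived group is tracked by the condition below.\<close>

definition even_or_odd :: "complex mat \<Rightarrow> bool" where
  "even_or_odd g \<longleftrightarrow> g \<in> SOd \<or> g * R (unit_vec n 0) \<in> SOd"

text \<open>By \<open>R_pair_derived_basis\<close> all reflections lie in one coset of the derived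
  group, so it does not matter which reflection is removed.\<close>

lemma even_or_odd_reflection:
  assumes g: "g \<in> carrier_mat n n" and u: "unit_vector u" and gu: "even_or_odd (g * R u)"
  shows "even_or_odd g"
proof -
  let ?e = "unit_vec n 0 :: complex vec"
  note SOd = subgroup.m_closed[OF derived_sig_subgroup[OF one_carrier]]
  have e: "unit_vector ?e"
    using n3 by (intro unit_vector_unit) simp
  from gu[unfolded even_or_odd_def] show ?thesis
  proof
    assume "g * R u \<in> SOd"
    then have "(g * R u) * (R u * R ?e) \<in> SOd"
      using SOd[OF _ R_pair_derived_basis[OF u]] by simp
    moreover have "(g * R u) * (R u * R ?e) = g * (R u * (R u * R ?e))"
      by (rule assoc_mult_mat[OF g R_carrier mult_carrier_mat[OF R_carrier R_carrier]])
    then have "(g * R u) * (R u * R ?e) = g * R ?e"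
      by (simp add: R_cancel[OF u R_carrier])
    ultimately show ?thesis
      by (simp add: even_or_odd_def)
  next
    assume gD: "g * R u * R ?e \<in> SOd"
    have "inv\<^bsub>SOn\<^esub> (R u * R ?e) \<in> SOd"
      by (rule subgroup.m_inv_closed[OF derived_sig_subgroup[OF one_carrier] R_pair_derived_basis[OF u]])
    moreover have pG: "R u * R ?e \<in> carrier SOn"
      by (rule subgroup.mem_carrier[OF derived_sig_subgroup[OF one_carrier] R_pair_derived_basis[OF u]])
    moreover have "g * R u * R ?e = g * (R u * R ?e)"
      by (rule assoc_mult_mat[OF g R_carrier R_carrier])
    ultimately have "(g * (R u * R ?e)) * inv\<^bsub>SOn\<^esub> (R u * R ?e) \<in> SOd"
      using SOd[OF gD] by simp
    moreover have ic: "inv\<^bsub>SOn\<^esub> (R u * R ?e) \<in> carrier_mat n n"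
      using group.inv_closed[OF sig_group[OF one_carrier] pG] by (simp add: sig_carrier[OF one_carrier])
    moreover have "(R u * R ?e) * inv\<^bsub>SOn\<^esub> (R u * R ?e) = 1\<^sub>m n"
      using group.r_inv[OF sig_group[OF one_carrier] pG] by (simp add: sig_one[OF one_carrier])
    moreover have "(g * (R u * R ?e)) * inv\<^bsub>SOn\<^esub> (R u * R ?e) = g * ((R u * R ?e) * inv\<^bsub>SOn\<^esub> (R u * R ?e))"
      by (rule assoc_mult_mat[OF g mult_carrier_mat[OF R_carrier R_carrier] ic])
    ultimately have "g \<in> SOd"
      using g by simp
    then show ?thesis
      by (simp add: even_or_odd_def)
  qed
qed

text \<open>Reflection in the direction \<open>y - x\<close>, which has square length
  \<open>2 - 2 B(x, y)\<close>; the excluded case is the one where this vector is isotropic.\<close>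

lemma reflection_moves:
  assumes x: "unit_vector x" and y: "unit_vector y" and ne: "ip y x \<noteq> 1"
  obtains s where "unit_vector s" "R s *\<^sub>v x = y"
    "\<And>w. w \<in> carrier_vec n \<Longrightarrow> ip x w = ip y w \<Longrightarrow> R s *\<^sub>v w = w"
proof -
  note c = unit_vectorD(1)[OF x] unit_vectorD(1)[OF y]
  note n = unit_vectorD(2)[OF x] unit_vectorD(2)[OF y]
  define d where "d = y + (- 1) \<cdot>\<^sub>v x"
  have dc: "d \<in> carrier_vec n"
    using c by (simp add: d_def)
  have expand: "ip d w = ip y w - ip x w" if "w \<in> carrier_vec n" for w
    unfolding d_def using that c by (simp add: ip_simps)
  have xy: "ip x y = ip y x"
    by (rule ip_comm[OF c])
  have dx: "ip d x = ip y x - 1"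
    using expand[OF c(1)] n by simp
  have "ip d d = ip d y - ip d x"
    unfolding expand[OF dc] using ip_comm[OF dc c(1)] ip_comm[OF dc c(2)] by simp
  also have "\<dots> = 2 - 2 * ip y x"
    using expand[OF c(2)] dx n xy by simp
  finally have dd: "ip d d = 2 - 2 * ip y x" .
  then have dd0: "ip d d \<noteq> 0"
    using ne by simp
  define s where "s = (1 / csqrt (ip d d)) \<cdot>\<^sub>v d"
  have s: "unit_vector s"
    unfolding s_def by (rule unit_vector_normalize[OF dc dd0])
  have sq: "csqrt (ip d d) * csqrt (ip d d) = ip d d"
    by (metis power2_csqrt power2_eq_square)
  have "R s = rank_one_isometry (1\<^sub>m n) (- 2 * (1 / csqrt (ip d d)) * (1 / csqrt (ip d d))) d"
    unfolding s_def reflection_def by (rule rank_one_smult[OF one_carrier dc])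
  also have "- 2 * (1 / csqrt (ip d d)) * (1 / csqrt (ip d d)) = - 2 / ip d d"
    using sq by (simp add: divide_simps)
  finally have Rs: "R s *\<^sub>v w = w + (- 2 / ip d d * ip d w) \<cdot>\<^sub>v d" if "w \<in> carrier_vec n" for w
    using rank_one_apply[OF one_carrier dc that] by simp
  have "- 2 / ip d d * ip d x = 1"
    unfolding dx dd using ne by (simp add: field_simps)
  then have "R s *\<^sub>v x = y"
    unfolding Rs[OF c(1)] using c by (intro eq_vecI) (simp_all add: d_def)
  moreover have "R s *\<^sub>v w = w" if w: "w \<in> carrier_vec n" "ip x w = ip y w" for w
  proof -
    have "ip d w = 0"
      using expand[OF w(1)] w(2) by simp
    then show ?thesis
      unfolding Rs[OF w(1)] using w dc by (intro eq_vecI) simp_all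
  qed
  ultimately show ?thesis
    using s that by blast
qed

lemma special_orthogonal_perfect: "carrier SOn \<subseteq> SOd"
proof
  let ?e = "unit_vec n :: nat \<Rightarrow> complex vec"
  have main: "even_or_odd g" if "n - k = l" "k \<le> n" "g \<in> carrier_mat n n"
    "transpose_mat g * 1\<^sub>m n * g = 1\<^sub>m n" "\<And>i. i < k \<Longrightarrow> g *\<^sub>v ?e i = ?e i" for g k l
    using that
  proof (induction l arbitrary: g k)
    case 0
    have "g = 1\<^sub>m n"
      by (rule mat_eq_one_unitI[OF 0(3)]) (use 0 in simp)
    then show ?case
      using subgroup.one_closed[OF derived_sig_subgroup[OF one_carrier]]
      by (simp add: sig_one[OF one_carrier] even_or_odd_def)
  next
    case (Suc l)
    then have k: "k < n" by simp
    note gc = Suc.prems(3) and giso = Suc.prems(4) and gfix = Suc.prems(5)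
    have ek: "unit_vector (?e k)"
      by (rule unit_vector_unit[OF k])
    have step: "even_or_odd h" if h: "h \<in> carrier_mat n n" "transpose_mat h * 1\<^sub>m n * h = 1\<^sub>m n"
      "\<And>i. i < Suc k \<Longrightarrow> h *\<^sub>v ?e i = ?e i" for h
      using k Suc.prems(1) by (intro Suc.IH[of "Suc k", OF _ _ h]) simp_all
    define g' where "g' = transpose_mat g"
    have g'c: "g' \<in> carrier_mat n n"
      using gc by (simp add: g'_def)
    have g'g: "g' * g = 1\<^sub>m n"
      using giso gc by (simp add: g'_def)
    then have gg': "g * g' = 1\<^sub>m n"
      by (rule mat_mult_left_right_inverse[OF g'c gc])
    have g'iso: "transpose_mat g' * 1\<^sub>m n * g' = 1\<^sub>m n"
      using gg' gc by (simp add: g'_def)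
    \<comment> \<open>The preimage of the \<open>k\<close>-th basis vector under \<open>g\<close>: a
      reflection sending that basis vector to \<open>y\<close>, applied before \<open>g\<close>,
      makes the product fix it.\<close>
    define y where "y = g' *\<^sub>v ?e k"
    have yc: "y \<in> carrier_vec n"
      using g'c by (simp add: y_def)
    have iso': "ip (g' *\<^sub>v v) (g' *\<^sub>v w) = ip v w" if "v \<in> carrier_vec n" "w \<in> carrier_vec n" for v w
      using isometry_iff_bform[OF one_carrier g'c] g'iso that by blast
    have y: "unit_vector y"
      using yc iso'[of "?e k" "?e k"] unit_vectorD(2)[OF ek] by (simp add: unit_vector_def y_def)
    have gy: "g *\<^sub>v y = ?e k"
      unfolding y_def using assoc_mult_mat_vec[OF gc g'c, of "?e k"] gg' by simp
    have g'fix: "g' *\<^sub>v ?e i = ?e i" if "i < k" for i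
      using assoc_mult_mat_vec[OF g'c gc, of "?e i"] g'g gfix[OF that] by simp
    have yi: "ip y (?e i) = 0" "ip (?e k) (?e i) = 0" if i: "i < k" for i
    proof -
      show eki: "ip (?e k) (?e i) = 0"
        using i k by (simp add: ip_unit)
      show "ip y (?e i) = 0"
        using iso'[of "?e k" "?e i"] g'fix[OF i] eki by (simp add: y_def)
    qed
    have Riso: "transpose_mat (h * R s) * 1\<^sub>m n * (h * R s) = 1\<^sub>m n"
      if "h \<in> carrier_mat n n" "transpose_mat h * 1\<^sub>m n * h = 1\<^sub>m n" "unit_vector s" for h s
      by (rule isometry_mult[OF one_carrier that(1) R_carrier that(2) R_isometry[OF that(3)]])
    have Rv: "(h * R s) *\<^sub>v w = h *\<^sub>v (R s *\<^sub>v w)" if "h \<in> carrier_mat n n" "w \<in> carrier_vec n" for h s w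
      by (rule assoc_mult_mat_vec[OF that(1) R_carrier that(2)])
    show ?case
    proof (cases "ip y (?e k) = 1")
      case False
      obtain s where s: "unit_vector s" "R s *\<^sub>v ?e k = y"
        "\<And>w. w \<in> carrier_vec n \<Longrightarrow> ip (?e k) w = ip y w \<Longrightarrow> R s *\<^sub>v w = w"
        by (rule reflection_moves[OF ek y False]) blast
      have "(g * R s) *\<^sub>v ?e i = ?e i" if "i < Suc k" for i
      proof (cases "i = k")
        case True
        then show ?thesis
          using Rv[OF gc, of "?e k" s] s(2) gy by simp
      next
        case False
        then have i: "i < k"
          using that by simp
        have "R s *\<^sub>v ?e i = ?e i"
          by (rule s(3)) (simp_all add: yi[OF i])
        then show ?thesis
          using Rv[OF gc, of "?e i" s] gfix[OF i] by simp
      qed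
      then have "even_or_odd (g * R s)"
        by (intro step mult_carrier_mat[OF gc R_carrier] Riso[OF gc giso s(1)])
      then show ?thesis
        by (rule even_or_odd_reflection[OF gc s(1)])
    next
      case True
      \<comment> \<open>When \<open>y - ?e k\<close> is isotropic, \<open>?e k\<close> is first
        reflected to its negative; the vector \<open>y + ?e k\<close> has square length 4.\<close>
      define x where "x = (- 1) \<cdot>\<^sub>v ?e k"
      have x: "unit_vector x"
        using unit_vectorD(2)[OF ek] by (simp add: x_def unit_vector_def ip_simps)
      have xe: "ip x w = - ip (?e k) w" if "w \<in> carrier_vec n" for w
        unfolding x_def using bform_smult_left[OF one_carrier _ that, of "?e k" "- 1"] by simp
      have "ip y x = - 1"
        using True bform_smult_right[OF one_carrier _ yc, of "?e k" "- 1"] by (simp add: x_def)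
      then have ne: "ip y x \<noteq> 1" by simp
      obtain s where s: "unit_vector s" "R s *\<^sub>v x = y"
        "\<And>w. w \<in> carrier_vec n \<Longrightarrow> ip x w = ip y w \<Longrightarrow> R s *\<^sub>v w = w"
        by (rule reflection_moves[OF x y ne]) blast
      have Rk: "R (?e k) *\<^sub>v ?e k = x"
        using R_apply[of "?e k" "?e k"] unit_vectorD(2)[OF ek] by (intro eq_vecI) (simp_all add: x_def)
      have gsc: "g * R s \<in> carrier_mat n n"
        by (rule mult_carrier_mat[OF gc R_carrier])
      have "(g * R s * R (?e k)) *\<^sub>v ?e i = ?e i" if "i < Suc k" for i
      proof (cases "i = k")
        case True
        then show ?thesis
          using Rv[OF gsc, of "?e k" "?e k"] Rv[OF gc, of x s] unit_vectorD(1)[OF x] Rk s(2) gy by simp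
      next
        case False
        then have i: "i < k"
          using that by simp
        have "R s *\<^sub>v ?e i = ?e i"
          by (rule s(3)) (simp_all add: yi[OF i] xe)
        moreover have "R (?e k) *\<^sub>v ?e i = ?e i"
          by (rule R_fix) (simp_all add: yi[OF i])
        ultimately show ?thesis
          using Rv[OF gsc, of "?e i" "?e k"] Rv[OF gc, of "?e i" s] gfix[OF i] by simp
      qed
      then have "even_or_odd (g * R s * R (?e k))"
        by (intro step mult_carrier_mat[OF gsc R_carrier] Riso[OF gsc Riso[OF gc giso s(1)] ek])
      then have "even_or_odd (g * R s)"
        by (rule even_or_odd_reflection[OF gsc ek])
      then show ?thesis
        by (rule even_or_odd_reflection[OF gc s(1)])
    qed
  qed
  fix g assume "g \<in> carrier SOn"
  then have g: "g \<in> carrier_mat n n" "transpose_mat g * 1\<^sub>m n * g = 1\<^sub>m n" "det g = 1"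
    by (simp_all add: sig_carrier[OF one_carrier])
  have "even_or_odd g"
    by (rule main[of 0 n, OF _ _ g(1,2)]) simp_all
  \<comment> \<open>The determinant excludes the odd coset: a reflection has determinant -1.\<close>
  moreover have "g * R (?e 0) \<notin> SOd"
  proof
    assume "g * R (?e 0) \<in> SOd"
    then have "g * R (?e 0) \<in> carrier SOn"
      by (rule subgroup.mem_carrier[OF derived_sig_subgroup[OF one_carrier]])
    then have "det (g * R (?e 0)) = 1"
      by (simp add: sig_carrier[OF one_carrier])
    then have "det (R (?e 0)) = 1"
      using det_mult[OF g(1) R_carrier] g(3) by simp
    moreover have n0: "0 < n"
      using n3 by simp
    have "R (?e 0) = multrow_mat n 0 (- 1)"
      using n0 by (intro eq_matI) (auto simp: reflection_def rank_one_isometry_def multrow_mat_def)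
    then have "det (R (?e 0)) = - 1"
      using det_multrow_mat[OF n0, of "- 1 :: complex"] by simp
    ultimately show False by simp
  qed
  ultimately show "g \<in> SOd"
    by (simp add: even_or_odd_def)
qed

end

text \<open>Over the complex numbers a symmetric form has an orthonormal basis, here explicit.\<close>

lemma split_form_orthonormal_basis:
  obtains P where "P \<in> carrier_mat N N" "transpose_mat P * P = split_form Symmetric N"
proof -
  define s :: complex where "s = 1 / csqrt 2"
  have "csqrt 2 * csqrt 2 = 2"
    by (metis power2_csqrt power2_eq_square)
  moreover have "r * r = 2 \<Longrightarrow> 1 / r * (1 / r) * 2 = 1" for r :: complex
    by simp
  ultimately have s2: "s * s * 2 = 1"
    unfolding s_def by blast
  \<comment> \<open>For a pair \<open>k < k' = N - 1 - k\<close> the two rows are the linear forms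
    \<open>s (x_k + x_k')\<close> and \<open>\<i> s (x_k' - x_k)\<close>, whose squares add up to
    \<open>2 x_k x_k'\<close>. A middle index is its own partner, and \<open>b\<close> vanishes
    there so that it is not counted twice.\<close>
  define a where "a i = (if 2 * i + 1 < N then s else if 2 * i + 1 = N then 1 else \<i> * s)" for i
  define b where "b i = (if 2 * i + 1 < N then s else if 2 * i + 1 = N then 0 else - (\<i> * s))" for i
  define P where "P = mat N N (\<lambda>(k, i). (if k = i then a i else 0) + (if k + i + 1 = N then b k else 0))"
  have P: "P \<in> carrier_mat N N"
    by (simp add: P_def)
  have "transpose_mat P * P = split_form Symmetric N"
  proof (rule eq_matI)
    fix i j assume "i < dim_row (split_form Symmetric N)" "j < dim_col (split_form Symmetric N)"
    then have ij: "i < N" "j < N"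
      by (simp_all add: split_form_def)
    have iff: "k + l + 1 = N \<longleftrightarrow> k = N - Suc l" if "k < N" "l < N" for k l
      using that by auto
    let ?c = "\<lambda>l k. (if k = l then a l else 0) + (if k = N - Suc l then b (N - Suc l) else 0)"
    have ni: "N - Suc i < N" "N - Suc j < N"
      using ij by auto
    have entry: "P $$ (k, l) = ?c l k" if "k < N" "l < N" for k l
      using that iff[OF that] by (auto simp: P_def)
    have "(transpose_mat P * P) $$ (i, j) = (\<Sum>k = 0..<N. P $$ (k, i) * P $$ (k, j))"
      using ij P by (simp add: scalar_prod_def)
    also have "\<dots> = (\<Sum>k = 0..<N. ?c i k * ?c j k)"
      by (rule sum.cong) (simp_all add: entry ij)
    also have "\<dots> = (\<Sum>k = 0..<N. (if k = i then a i * ?c j i else 0)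
        + (if k = N - Suc i then b (N - Suc i) * ?c j (N - Suc i) else 0))"
      by (rule sum.cong) (auto simp: algebra_simps)
    also have "\<dots> = a i * ?c j i + b (N - Suc i) * ?c j (N - Suc i)"
      using ij ni by (simp add: sum.distrib)
    also have "\<dots> = (if i + j + 1 = N then 1 else 0)"
    proof -
      have swap: "(i = N - Suc j) = (i + j + 1 = N)" "(N - Suc i = j) = (i + j + 1 = N)"
        "(N - Suc i = N - Suc j) = (i = j)"
        using ij by auto
      have "a i * a i + b (N - Suc i) * b (N - Suc i) = (if 2 * i + 1 = N then 1 else 0)"
        using ij s2 by (auto simp: a_def b_def algebra_simps)
      moreover have "a i * b i + b (N - Suc i) * a (N - Suc i) = (if 2 * i + 1 = N then 0 else 1)"
        using ij s2 by (auto simp: a_def b_def algebra_simps)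
      moreover have "N - Suc j = i" "j = N - Suc i" if "i + j + 1 = N"
        using that by auto
      ultimately show ?thesis
        using ij by (cases "i = j"; cases "i + j + 1 = N") (auto simp: swap algebra_simps)
    qed
    finally show "(transpose_mat P * P) $$ (i, j) = split_form Symmetric N $$ (i, j)"
      using ij by (simp add: split_form_entry)
  qed (use P in \<open>simp_all add: split_form_def\<close>)
  with P show ?thesis by (rule that)
qed

text \<open>Conjugation by the orthonormal basis \<open>P\<close> identifies the group with the
  special orthogonal group of the identity form, and a surjective homomorphism maps the derived
  group onto the derived group. Since \<open>J\<close> is an involution, \<open>J * T\<close>
  inverts \<open>P\<close>.\<close>

lemma split_orthogonal_perfect:
  assumes N: "N \<ge> 3"
  defines "J \<equiv> split_form Symmetric N"
  shows "carrier (special_isometry_group J) \<subseteq> derived (special_isometry_group J) (carrier (special_isometry_group J))"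
proof -
  have J: "J \<in> carrier_mat N N"
    by (simp add: J_def)
  have I: "(1\<^sub>m N :: complex mat) \<in> carrier_mat N N"
    by simp
  obtain P where P: "P \<in> carrier_mat N N" and PP: "transpose_mat P * P = J"
    unfolding J_def by (rule split_form_orthonormal_basis)
  define T where "T = transpose_mat P"
  define Q where "Q = J * T"
  have T: "T \<in> carrier_mat N N" and Q: "Q \<in> carrier_mat N N"
    using P J by (auto simp: T_def Q_def)
  have TP: "T * P = J"
    using PP by (simp add: T_def)
  have JT: "transpose_mat J = J"
    by (rule eq_matI) (auto simp: J_def split_form_def)
  have JJ: "J * J = 1\<^sub>m N"
    using split_form_orthogonal[of Symmetric N] JT by (simp add: J_def)
  have QP: "Q * P = 1\<^sub>m N"
    unfolding Q_def using assoc_mult_mat[OF J T P] TP JJ by simp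
  then have PQ: "P * Q = 1\<^sub>m N"
    by (rule mat_mult_left_right_inverse[OF Q P])
  have QT: "transpose_mat Q = P * J"
    unfolding Q_def T_def using transpose_mult[OF J, of "transpose_mat P" N] P JT by simp
  let ?G = "special_isometry_group (1\<^sub>m N :: complex mat)" and ?H = "special_isometry_group J"
  let ?f = "\<lambda>A. Q * (A * P)"
  let ?g = "\<lambda>A. P * (A * Q)"
  note cc = mult_carrier_mat[of _ N N _ N]
  note assoc = assoc_mult_mat[of _ N N _ N _ N]
  have QPA: "Q * (P * A) = A" and PQA: "P * (Q * A) = A" if "A \<in> carrier_mat N N" for A
    using assoc_mult_mat[OF Q P that] assoc_mult_mat[OF P Q that] QP PQ that by simp_all
  have dets: "det Q * det P = 1"
    using det_mult[OF Q P] QP by simp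
  have fH: "?f A \<in> carrier ?H" if "A \<in> carrier ?G" for A
  proof -
    have A: "A \<in> carrier_mat N N" "transpose_mat A * A = 1\<^sub>m N" "det A = 1"
      using that by (auto simp: sig_carrier[OF I])
    have At: "transpose_mat A \<in> carrier_mat N N"
      using A by simp
    have AtA: "transpose_mat A * (A * X) = X" if "X \<in> carrier_mat N N" for X
      using assoc_mult_mat[OF At A(1) that] A(2) that by simp
    have tr: "transpose_mat (?f A) = T * (transpose_mat A * (P * J))"
      using A P Q J by (simp add: transpose_mult[of _ N N _ N] cc assoc T_def QT)
    have "J * (Q * (A * P)) = T * (A * P)"
      unfolding Q_def using A P T J assoc_mult_mat[OF J J cc[OF T cc[OF A(1) P]]] by (simp add: JJ assoc cc)
    then have "transpose_mat (?f A) * J * ?f A = T * (transpose_mat A * (P * (J * (T * (A * P)))))"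
      unfolding tr using A At P Q J T by (simp add: assoc cc)
    also have "\<dots> = T * (transpose_mat A * (A * P))"
      using PQA[of "A * P"] A P J T by (simp add: Q_def assoc cc)
    also have "\<dots> = J"
      using AtA[OF P] TP by simp
    finally have "transpose_mat (?f A) * J * ?f A = J" .
    moreover have "det (?f A) = 1"
      using A P Q dets by (simp add: det_mult[of _ N] cc)
    ultimately show ?thesis
      using A P Q by (simp add: sig_carrier[OF J] cc)
  qed
  have gG: "?g A \<in> carrier ?G" if "A \<in> carrier ?H" for A
  proof -
    have A: "A \<in> carrier_mat N N" "transpose_mat A * J * A = J" "det A = 1"
      using that by (auto simp: sig_carrier[OF J])
    have At: "transpose_mat A \<in> carrier_mat N N"
      using A by simp
    have AtA: "transpose_mat A * (J * (A * X)) = J * X" if "X \<in> carrier_mat N N" for X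
    proof -
      have "transpose_mat A * (J * (A * X)) = (transpose_mat A * J * A) * X"
        using A(1) At J that by (simp add: assoc cc)
      then show ?thesis by (simp add: A(2))
    qed
    have tr: "transpose_mat (?g A) = P * (J * (transpose_mat A * T))"
      using A P Q J At T by (simp add: transpose_mult[of _ N N _ N] cc assoc T_def QT)
    have TPX: "T * (P * X) = J * X" if "X \<in> carrier_mat N N" for X
      using assoc_mult_mat[OF T P that] TP by simp
    have JJX: "J * (J * X) = X" if "X \<in> carrier_mat N N" for X
      using assoc_mult_mat[OF J J that] JJ that by simp
    have "transpose_mat (?g A) * ?g A = P * (J * (transpose_mat A * (T * (P * (A * Q)))))"
      unfolding tr using A(1) At P Q J T by (simp add: assoc cc)
    also have "\<dots> = P * (J * (J * Q))"
      using TPX[of "A * Q"] AtA[OF Q] A(1) Q by (simp add: cc)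
    also have "\<dots> = 1\<^sub>m N"
      using JJX[OF Q] PQ by simp
    finally have "transpose_mat (?g A) * ?g A = 1\<^sub>m N" .
    moreover have "det (?g A) = 1"
      using A P Q dets by (simp add: det_mult[of _ N] cc mult.commute)
    ultimately show ?thesis
      using A P Q At T J tr by (simp add: sig_carrier[OF I] cc)
  qed
  have mult: "?f (A * A') = ?f A * ?f A'" if "A \<in> carrier_mat N N" "A' \<in> carrier_mat N N" for A A'
    using PQA[of "A' * P"] that P Q by (simp add: assoc cc)
  have hom: "group_hom ?G ?H ?f"
    by (intro group_hom.intro group_hom_axioms.intro sig_group[OF I] sig_group[OF J] homI fH)
       (simp_all add: mult sig_mult sig_carrier[OF I])
  have surj: "?f ` carrier ?G = carrier ?H"
  proof (intro equalityI subsetI)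
    fix A assume A: "A \<in> carrier ?H"
    then have Ac: "A \<in> carrier_mat N N"
      by (simp add: sig_carrier[OF J])
    have "A = ?f (?g A)"
      using QPA[of "A * Q * P"] Ac P Q QP by (simp add: assoc cc)
    then show "A \<in> ?f ` carrier ?G"
      using gG[OF A] by blast
  qed (use fH in auto)
  have "carrier ?G \<subseteq> derived ?G (carrier ?G)"
    by (rule special_orthogonal_perfect[OF N])
  then have "?f ` carrier ?G \<subseteq> ?f ` derived ?G (carrier ?G)"
    by (rule image_mono)
  also have "\<dots> = derived ?H (?f ` carrier ?G)"
    by (rule group_hom.derived_img[OF hom, symmetric]) simp
  finally show ?thesis
    by (simp add: surj)
qed


section \<open>The centre of the even orthogonal group\<close>

lemma det_diag:
  fixes D :: "complex mat"
  assumes "D = mat N N (\<lambda>(i, j). if i = j then d i else 0)"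
  shows "det D = (\<Prod>i = 0..<N. d i)"
proof -
  have "upper_triangular D"
    using assms by (intro upper_triangularI) auto
  then have "det D = prod_list (diag_mat D)"
    by (rule det_upper_triangular[where n = N]) (simp add: assms)
  also have "diag_mat D = map d [0..<N]"
    using assms by (auto simp: diag_mat_def)
  finally show ?thesis
    by (simp add: prod.distinct_set_conv_list[symmetric])
qed

definition swap_index :: "nat \<Rightarrow> nat \<Rightarrow> nat \<Rightarrow> nat" where
  "swap_index k l i = (if i = k then l else if i = l then k else i)"

lemma swap_index_less: "k < N \<Longrightarrow> l < N \<Longrightarrow> i < N \<Longrightarrow> swap_index k l i < N"
  by (simp add: swap_index_def)

lemma swap_index_eq_iff: "swap_index k l i = swap_index k l j \<longleftrightarrow> i = j"
  by (simp add: swap_index_def)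

lemma swaprows_mat_left:
  fixes A :: "complex mat"
  assumes "k < N" "l < N" "A \<in> carrier_mat N N" "i < N" "j < N"
  shows "(swaprows_mat N k l * A) $$ (i, j) = A $$ (swap_index k l i, j)"
proof -
  have "swaprows_mat N k l * A = swaprows k l A"
    by (rule swaprows_mat[symmetric, OF assms(3,1,2)])
  then show ?thesis
    using assms by (simp add: swap_index_def mat_swaprows_def)
qed

lemma transpose_swaprows_mat: "transpose_mat (swaprows_mat N k l) = (swaprows_mat N k l :: complex mat)"
proof (rule eq_matI)
  fix i j assume "i < dim_row (swaprows_mat N k l :: complex mat)" "j < dim_col (swaprows_mat N k l :: complex mat)"
  then have ij: "i < N" "j < N" by simp_all
  then show "transpose_mat (swaprows_mat N k l) $$ (i, j) = (swaprows_mat N k l :: complex mat) $$ (i, j)"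
    by (simp add: swaprows_mat_def)
qed simp_all

lemma swaprows_mat_right:
  fixes A :: "complex mat"
  assumes kl: "k < N" "l < N" and A: "A \<in> carrier_mat N N" and ij: "i < N" "j < N"
  shows "(A * swaprows_mat N k l) $$ (i, j) = A $$ (i, swap_index k l j)"
proof -
  let ?s = "swaprows_mat N k l :: complex mat"
  have s: "?s \<in> carrier_mat N N" by simp
  have "(A * ?s) $$ (i, j) = transpose_mat (A * ?s) $$ (j, i)"
    by (rule index_transpose_mat(1)[symmetric]) (use A ij in simp_all)
  also have "transpose_mat (A * ?s) = ?s * transpose_mat A"
    using transpose_mult[OF A s] by (simp only: transpose_swaprows_mat)
  also have "(?s * transpose_mat A) $$ (j, i) = transpose_mat A $$ (swap_index k l j, i)"
    by (rule swaprows_mat_left[OF kl _ ij(2,1)]) (use A in simp)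
  also have "\<dots> = A $$ (i, swap_index k l j)"
    by (rule index_transpose_mat(1)) (use A ij swap_index_less[OF kl ij(2)] in simp_all)
  finally show ?thesis .
qed

lemma center_split_orthogonal_diagonal:
  assumes z: "z \<in> center (special_isometry_group (split_form Symmetric N))"
    and "i < N" "j < N" "i \<noteq> j"
  shows "z $$ (i, j) = 0"
proof -
  let ?J = "split_form Symmetric N"
  let ?G = "special_isometry_group ?J"
  have J: "?J \<in> carrier_mat N N" by simp
  have zc: "z * g = g * z" if "g \<in> carrier ?G" for g
    using z that by (auto simp: center_def)
  have "z \<in> carrier ?G"
    using z by (simp add: center_def)
  then have zcar: "z \<in> carrier_mat N N"
    by (simp add: sig_carrier[OF J])
  \<comment> \<open>The entries are \<open>2 ^ (N - 1 - 2 i)\<close>, written without negative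
    exponents: they are pairwise distinct, and mutually inverse at \<open>i\<close> and
    \<open>N - 1 - i\<close>, which puts the diagonal matrix into the torus of the split
    form.\<close>
  define d :: "nat \<Rightarrow> complex" where "d i = 2 ^ (N - 1 - i) / 2 ^ i" for i
  have dd: "d i * d (N - 1 - i) = 1" if "i < N" for i
    using that by (simp add: d_def)
  have dinj: "d i \<noteq> d j" if "i < N" "j < N" "i \<noteq> j" for i j
  proof
    assume "d i = d j"
    then have "(2::complex) ^ (N - 1 - i + j) = 2 ^ (N - 1 - j + i)"
      unfolding d_def power_add by (subst (asm) frac_eq_eq) simp_all
    then have "of_nat (2 ^ (N - 1 - i + j)) = (of_nat (2 ^ (N - 1 - j + i)) :: complex)"
      by (simp only: of_nat_power of_nat_numeral)
    then have "(2::nat) ^ (N - 1 - i + j) = 2 ^ (N - 1 - j + i)"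
      by (simp only: of_nat_eq_iff)
    then have "N - 1 - i + j = N - 1 - j + i"
      by simp
    then show False
      using that by auto
  qed
  define D where "D = mat N N (\<lambda>(i, j). if i = j then d i else 0)"
  have D: "D \<in> carrier_mat N N"
    by (simp add: D_def)
  have mulD: "(A * D) $$ (i, j) = A $$ (i, j) * d j" "(D * A) $$ (i, j) = d i * A $$ (i, j)"
    if "A \<in> carrier_mat N N" "i < N" "j < N" for A i j
  proof -
    have "(A * D) $$ (i, j) = (\<Sum>k = 0..<N. A $$ (i, k) * (if k = j then d k else 0))"
      using that by (simp add: scalar_prod_def D_def)
    also have "\<dots> = (\<Sum>k = 0..<N. if k = j then A $$ (i, j) * d j else 0)"
      by (rule sum.cong) auto
    finally show "(A * D) $$ (i, j) = A $$ (i, j) * d j"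
      using that by simp
    have "(D * A) $$ (i, j) = (\<Sum>k = 0..<N. (if i = k then d i else 0) * A $$ (k, j))"
      using that by (simp add: scalar_prod_def D_def)
    also have "\<dots> = (\<Sum>k = 0..<N. if k = i then d i * A $$ (i, j) else 0)"
      by (rule sum.cong) auto
    finally show "(D * A) $$ (i, j) = d i * A $$ (i, j)"
      using that by simp
  qed
  have DT: "transpose_mat D = D"
    by (rule eq_matI) (auto simp: D_def)
  have "transpose_mat D * ?J * D = ?J"
  proof (rule eq_matI)
    fix i j assume "i < dim_row ?J" "j < dim_col ?J"
    then have ij: "i < N" "j < N" by (simp_all add: split_form_def)
    have "(transpose_mat D * ?J * D) $$ (i, j) = d i * ?J $$ (i, j) * d j"
      unfolding DT using mulD(1)[OF mult_carrier_mat[OF D J] ij] mulD(2)[OF J ij] by simp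
    also have "\<dots> = ?J $$ (i, j)"
    proof (cases "i + j + 1 = N")
      case True
      then have "d i * d j = 1"
        using dd[OF ij(1)] by (metis Suc_eq_plus1 add_diff_cancel_left' diff_Suc_1)
      then show ?thesis
        using True ij by (simp add: split_form_entry)
    qed (use ij in \<open>simp add: split_form_entry\<close>)
    finally show "(transpose_mat D * ?J * D) $$ (i, j) = ?J $$ (i, j)" .
  qed (use D in \<open>simp_all add: split_form_def\<close>)
  moreover have "det D = 1"
  proof -
    have "det D = (\<Prod>i = 0..<N. d i)"
      by (rule det_diag[OF D_def])
    also have "\<dots> = (\<Prod>i = 0..<N. 2 ^ (N - 1 - i)) / (\<Prod>i = 0..<N. 2 ^ i)"
      by (simp add: d_def prod_dividef)
    also have "(\<Prod>i = 0..<N. (2::complex) ^ (N - 1 - i)) = (\<Prod>i = 0..<N. 2 ^ i)"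
      by (rule prod.reindex_bij_witness[where i = "\<lambda>i. N - 1 - i" and j = "\<lambda>i. N - 1 - i"]) auto
    also have "(\<Prod>i = 0..<N. (2::complex) ^ i) / (\<Prod>i = 0..<N. 2 ^ i) = 1"
      by (rule divide_self) (simp del: power_sum)
    finally show ?thesis .
  qed
  ultimately have "D \<in> carrier ?G"
    using D by (simp add: sig_carrier[OF J])
  then have zD: "z * D = D * z"
    by (rule zc)
  have zdiag: "z $$ (i, j) = 0" if "i < N" "j < N" "i \<noteq> j" for i j
  proof -
    have "z $$ (i, j) * d j = d i * z $$ (i, j)"
      by (metis mulD(1)[OF zcar that(1,2)] mulD(2)[OF zcar that(1,2)] zD)
    then show ?thesis
      using dinj[OF that] dinj[OF that(2,1) that(3)[symmetric]] by simp
  qed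
  show ?thesis
    by (rule zdiag[OF assms(2-4)])
qed

text \<open>The transposition of the middle pair is an isometry of determinant -1. A second
  transposition, of the outermost pair, restores the determinant; for \<open>n \<ge> 2\<close> the
  two are disjoint.\<close>

lemma double_swap_split_orthogonal:
  assumes N: "N = 2 * n" "n \<ge> 2"
  shows "swaprows_mat N (n - 1) n * swaprows_mat N 0 (N - 1)
    \<in> carrier (special_isometry_group (split_form Symmetric N))"
proof -
  let ?J = "split_form Symmetric N" and ?s = "swap_index (n - 1) n" and ?r = "swap_index 0 (N - 1)"
  let ?\<theta> = "swaprows_mat N (n - 1) n :: complex mat" and ?\<pi> = "swaprows_mat N 0 (N - 1) :: complex mat"
  have J: "?J \<in> carrier_mat N N" by simp
  have nN: "n - 1 < N" "n < N" "0 < N" "N - 1 < N" "n - 1 \<noteq> n" "0 \<noteq> N - 1"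
    using N by auto
  have th: "?\<theta> \<in> carrier_mat N N" and pi: "?\<pi> \<in> carrier_mat N N"
    by simp_all
  define g where "g = ?\<theta> * ?\<pi>"
  have g: "g \<in> carrier_mat N N"
    unfolding g_def by (rule mult_carrier_mat[OF th pi])
  have gT: "transpose_mat g = ?\<pi> * ?\<theta>"
    unfolding g_def by (simp only: transpose_mult[OF th pi] transpose_swaprows_mat)
  have sN: "?s i < N" and rN: "?r i < N" if "i < N" for i
    using swap_index_less[OF nN(1,2) that] swap_index_less[OF nN(3,4) that] .
  have "transpose_mat g * ?J * g = ?J"
  proof (rule eq_matI)
    fix i j assume "i < dim_row ?J" "j < dim_col ?J"
    then have ij: "i < N" "j < N" by (simp_all add: split_form_def)
    have pt: "?\<pi> * ?\<theta> * ?J = ?\<pi> * (?\<theta> * ?J)"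
      by (rule assoc_mult_mat[OF pi th J])
    have tJ: "?\<theta> * ?J \<in> carrier_mat N N"
      by (rule mult_carrier_mat[OF th J])
    have gJ: "?\<pi> * (?\<theta> * ?J) \<in> carrier_mat N N"
      by (rule mult_carrier_mat[OF pi tJ])
    have "transpose_mat g * ?J * g = ?\<pi> * (?\<theta> * ?J) * ?\<theta> * ?\<pi>"
      unfolding gT pt unfolding g_def by (rule assoc_mult_mat[OF gJ th pi, symmetric])
    then have "(transpose_mat g * ?J * g) $$ (i, j) = (?\<pi> * (?\<theta> * ?J)) $$ (i, ?s (?r j))"
      using swaprows_mat_right[OF nN(3,4) mult_carrier_mat[OF gJ th] ij]
        swaprows_mat_right[OF nN(1,2) gJ ij(1) rN[OF ij(2)]] by (simp only:)
    also have "\<dots> = ?J $$ (?s (?r i), ?s (?r j))"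
      using swaprows_mat_left[OF nN(3,4) tJ ij(1) sN[OF rN[OF ij(2)]]]
        swaprows_mat_left[OF nN(1,2) J rN[OF ij(1)] sN[OF rN[OF ij(2)]]] by (simp only:)
    finally have gJg: "(transpose_mat g * ?J * g) $$ (i, j) = ?J $$ (?s (?r i), ?s (?r j))" .
    have ts: "?s a + ?s b + 1 = N \<longleftrightarrow> a + b + 1 = N" if "a < N" "b < N" for a b
      unfolding swap_index_def using that N by presburger
    have rs: "?r i + ?r j + 1 = N \<longleftrightarrow> i + j + 1 = N"
      unfolding swap_index_def using ij N by presburger
    have "?s (?r i) + ?s (?r j) + 1 = N \<longleftrightarrow> i + j + 1 = N"
      using ts[OF rN[OF ij(1)] rN[OF ij(2)]] rs by (rule trans)
    then show "(transpose_mat g * ?J * g) $$ (i, j) = ?J $$ (i, j)"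
      unfolding gJg by (simp only: split_form_entry[OF ij] split_form_entry[OF sN[OF rN[OF ij(1)]] sN[OF rN[OF ij(2)]]] form_type.case)
  qed (use g in \<open>simp_all add: split_form_def\<close>)
  moreover have "det g = 1"
    unfolding g_def det_mult[OF th pi] det_swaprows_mat[OF nN(1,2,5)] det_swaprows_mat[OF nN(3,4,6)] by simp
  ultimately show ?thesis
    using g by (simp add: sig_carrier[OF J] g_def)
qed

text \<open>A matrix commuting with a regular element of the diagonal torus is diagonal, and commuting
  with a double transposition identifies its two middle entries.\<close>

lemma center_split_orthogonal_swap:
  assumes N: "N = 2 * n" "n \<ge> 2" and z: "z \<in> center (special_isometry_group (split_form Symmetric N))"
  shows "swaprows_mat N (n - 1) n * z * swaprows_mat N (n - 1) n = z"
proof -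
  let ?J = "split_form Symmetric N" and ?s = "swap_index (n - 1) n" and ?r = "swap_index 0 (N - 1)"
  let ?\<theta> = "swaprows_mat N (n - 1) n :: complex mat" and ?\<pi> = "swaprows_mat N 0 (N - 1) :: complex mat"
  have J: "?J \<in> carrier_mat N N" by simp
  have "z \<in> carrier (special_isometry_group ?J)"
    using z by (simp add: center_def)
  then have zcar: "z \<in> carrier_mat N N"
    by (simp add: sig_carrier[OF J])
  have nN: "n - 1 < N" "n < N" "0 < N" "N - 1 < N"
    using N by auto
  have th: "?\<theta> \<in> carrier_mat N N" and pi: "?\<pi> \<in> carrier_mat N N"
    by simp_all
  have "z * (?\<theta> * ?\<pi>) = ?\<theta> * ?\<pi> * z"
    using z double_swap_split_orthogonal[OF N] by (simp add: center_def)
  then have comm: "z * ?\<theta> * ?\<pi> = ?\<theta> * (?\<pi> * z)"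
    by (simp only: assoc_mult_mat[OF zcar th pi] assoc_mult_mat[OF th pi zcar])
  have s: "?s n = n - 1" "?r (n - 1) = n - 1" "?s (n - 1) = n"
    using N by (auto simp: swap_index_def)
  have "(?\<theta> * (?\<pi> * z)) $$ (n, n - 1) = z $$ (n - 1, n - 1)"
    by (simp only: swaprows_mat_left[OF nN(1,2) mult_carrier_mat[OF pi zcar] nN(2,1)] s
      swaprows_mat_left[OF nN(3,4) zcar nN(1,1)])
  moreover have "(z * ?\<theta> * ?\<pi>) $$ (n, n - 1) = z $$ (n, n)"
    by (simp only: swaprows_mat_right[OF nN(3,4) mult_carrier_mat[OF zcar th] nN(2,1)] s
      swaprows_mat_right[OF nN(1,2) zcar nN(2,1)])
  ultimately have mid: "z $$ (n, n) = z $$ (n - 1, n - 1)"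
    by (simp only: comm)
  show ?thesis
  proof (rule eq_matI)
    fix i j assume "i < dim_row z" "j < dim_col z"
    then have ij: "i < N" "j < N" using zcar by auto
    have sN: "?s i < N" "?s j < N"
      using swap_index_less[OF nN(1,2)] ij by blast+
    have "(?\<theta> * z * ?\<theta>) $$ (i, j) = z $$ (?s i, ?s j)"
      by (simp only: swaprows_mat_right[OF nN(1,2) mult_carrier_mat[OF th zcar] ij]
        swaprows_mat_left[OF nN(1,2) zcar ij(1) sN(2)])
    also have "\<dots> = z $$ (i, j)"
    proof (cases "i = j")
      case True
      then show ?thesis
        using mid by (simp add: swap_index_def)
    next
      case False
      then show ?thesis
        using center_split_orthogonal_diagonal[OF z ij] center_split_orthogonal_diagonal[OF z sN]
        by (simp add: swap_index_eq_iff)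
    qed
    finally show "(?\<theta> * z * ?\<theta>) $$ (i, j) = z $$ (i, j)" .
  qed (use zcar in simp_all)
qed


section \<open>The groups attached to a parameter\<close>

lemma swaprows_mat_middle_square:
  "swaprows_mat (2 * n) (n - 1) n * swaprows_mat (2 * n) (n - 1) n = (1\<^sub>m (2 * n) :: complex mat)"
proof (cases "n = 0")
  case True
  then show ?thesis
    by (intro eq_matI) simp_all
next
  case False
  then show ?thesis
    by (intro swaprows_mat_inv) simp_all
qed

lemma galois_action_id: "galois_action ty B id g = g"
  by (simp add: galois_action_def Let_def)

lemma galois_action_trivial: "\<not> (ty = Symmetric \<and> even (dim_row B)) \<Longrightarrow> galois_action ty B \<sigma> g = g"
  by (auto simp: galois_action_def Let_def)

text \<open>Transposition gives \<open>det B = (-1) ^ dim_row B * det B\<close>. The parity makes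
  the dual orthogonal group one of odd dimension, so that \<open>SO(2)\<close> does not occur in the
  symplectic case.\<close>

lemma alternating_form_even:
  fixes B :: "'k::field_char_0 mat"
  assumes "classical_form F Alternating B"
  shows "even (dim_row B)"
proof -
  have B: "B \<in> carrier_mat (dim_row B) (dim_row B)" "transpose_mat B = - B" "det B \<noteq> 0"
    using assms by (auto simp: classical_form_def)
  have neg: "- B = (- 1) \<cdot>\<^sub>m B"
    by (rule eq_matI) auto
  have "det B = det (transpose_mat B)"
    by (rule det_transpose[OF B(1), symmetric])
  also have "\<dots> = det ((- 1) \<cdot>\<^sub>m B)"
    by (simp only: B(2) neg)
  also have "\<dots> = (- 1) ^ dim_row B * det B"
    by (simp only: det_smult carrier_matD(2)[OF B(1)])
  finally have "det B = (- 1) ^ dim_row B * det B" .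
  then have "(- 1 :: 'k) ^ dim_row B = 1"
    using B(3) by simp
  then show ?thesis
    by (cases "even (dim_row B)") simp_all
qed

text \<open>The facts by which the three families are treated together: a nondegenerate Gram matrix
  and perfectness. Dual groups of matrices of size 0 or 1 are trivial and are settled directly;
  \<open>SO(2)\<close> is excluded, being commutative and nontrivial.\<close>

lemma dual_group_cases:
  fixes B :: "'k::field_char_0 mat"
  assumes "classical_form F ty B"
  obtains J M where "J \<in> carrier_mat M M" "det J \<noteq> 0" "dual_group ty B = special_isometry_group J"
    "ty = Symmetric \<and> even (dim_row B) \<longrightarrow> M = dim_row B \<and> J = split_form Symmetric M"
    "\<not> (ty = Symmetric \<and> dim_row B = 2) \<longrightarrow>
       carrier (dual_group ty B) \<subseteq> derived (dual_group ty B) (carrier (dual_group ty B))"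
proof -
  have trivial: "carrier (special_isometry_group J) \<subseteq>
      derived (special_isometry_group J) (carrier (special_isometry_group J))"
    if J: "J \<in> carrier_mat n n" and one: "\<And>A::complex mat. A \<in> carrier_mat n n \<Longrightarrow> det A = 1 \<Longrightarrow> A = 1\<^sub>m n"
    for J :: "complex mat" and n
  proof
    fix A assume "A \<in> carrier (special_isometry_group J)"
    then have "A \<in> carrier_mat n n" "det A = 1"
      by (simp_all add: sig_carrier[OF J])
    then have "A = 1\<^sub>m n"
      by (rule one)
    then show "A \<in> derived (special_isometry_group J) (carrier (special_isometry_group J))"
      using subgroup.one_closed[OF derived_sig_subgroup[OF J]] by (simp add: sig_one[OF J])
  qed
  show ?thesis
  proof (cases ty)
    case Alternating
    define M where "M = dim_row B + 1"
    define J where "J = split_form Symmetric M"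
    have dual: "dual_group ty B = special_isometry_group J"
      by (simp add: dual_group_def Alternating J_def M_def)
    have ev: "even (dim_row B)"
      using alternating_form_even assms by (simp add: Alternating)
    have "carrier (special_isometry_group J) \<subseteq> derived (special_isometry_group J) (carrier (special_isometry_group J))"
    proof (cases "dim_row B = 0")
      case True
      have J1: "J \<in> carrier_mat 1 1"
        using split_form_carrier[of Symmetric 1] True by (simp add: J_def M_def)
      have "A = 1\<^sub>m 1" if "A \<in> carrier_mat 1 1" "det A = (1 :: complex)" for A
        using that det_single[of A] by (intro eq_matI) auto
      then show ?thesis
        by (rule trivial[OF J1])
    next
      case False
      then have "M \<ge> 3"
        using ev by (auto simp: M_def elim!: evenE)
      then show ?thesis
        unfolding J_def by (rule split_orthogonal_perfect)
    qed
    then show ?thesis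
      using dual Alternating by (intro that[of J M]) (simp_all add: J_def det_split_form)
  next
    case Symmetric
    show ?thesis
    proof (cases "odd (dim_row B)")
      case True
      define M where "M = dim_row B - 1"
      define J where "J = split_form Alternating M"
      have dual: "dual_group ty B = special_isometry_group J"
        by (simp add: dual_group_def Symmetric J_def M_def True)
      have "even M"
        using True by (simp add: M_def)
      then have "carrier (special_isometry_group J) \<subseteq> derived (special_isometry_group J) (carrier (special_isometry_group J))"
        unfolding J_def by (rule symplectic_perfect)
      then show ?thesis
        using dual True by (intro that[of J M]) (simp_all add: J_def det_split_form)
    next
      case False
      define J where "J = split_form Symmetric (dim_row B)"
      have dual: "dual_group ty B = special_isometry_group J"
        using False by (simp add: dual_group_def Symmetric J_def)
      have "carrier (special_isometry_group J) \<subseteq> derived (special_isometry_group J) (carrier (special_isometry_group J))"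
        if "dim_row B \<noteq> 2"
      proof (cases "dim_row B = 0")
        case True
        have J0: "J \<in> carrier_mat 0 0"
          using split_form_carrier[of Symmetric 0] True by (simp add: J_def)
        have "A = 1\<^sub>m 0" if "A \<in> carrier_mat 0 0" "det A = (1 :: complex)" for A
          using that by (intro eq_matI) auto
        then show ?thesis
          by (rule trivial[OF J0])
      next
        case B0: False
        have "dim_row B \<ge> 3"
          using False B0 \<open>dim_row B \<noteq> 2\<close> by presburger
        then show ?thesis
          unfolding J_def by (rule split_orthogonal_perfect)
      qed
      then show ?thesis
        using dual Symmetric by (intro that[of J "dim_row B"]) (simp_all add: J_def det_split_form)
    qed
  qed
qed

lemma center_dual_group_galois_fixed:
  fixes B :: "'k::field_char_0 mat"
  assumes z: "z \<in> center (dual_group ty B)" and N: "\<not> (ty = Symmetric \<and> dim_row B = 2)"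
  shows "galois_action ty B \<sigma> z = z"
proof (cases "ty = Symmetric \<and> even (dim_row B)")
  case True
  then obtain n where n: "dim_row B = 2 * n"
    by (metis evenE)
  have dual: "dual_group ty B = special_isometry_group (split_form Symmetric (dim_row B))"
    using True by (simp add: dual_group_def)
  have "swaprows_mat (dim_row B) (n - 1) n * z * swaprows_mat (dim_row B) (n - 1) n = z"
  proof (cases "n = 0")
    case True
    have "z \<in> carrier_mat 0 0"
      using z sig_carrier[OF split_form_carrier, of z Symmetric 0] n True by (simp add: center_def dual)
    then show ?thesis
      using n True by (intro eq_matI) auto
  next
    case False
    then have "n \<ge> 2"
      using N True n by simp
    then show ?thesis
      by (rule center_split_orthogonal_swap[OF n]) (use z dual in simp)
  qed
  then show ?thesis
    by (simp add: galois_action_def Let_def n)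
qed (rule galois_action_trivial)

lemma dual_galois_action_conj:
  fixes B :: "'k::field_char_0 mat"
  assumes M: "ty = Symmetric \<and> even (dim_row B) \<longrightarrow> M = dim_row B"
  shows "\<exists>e::complex mat. e \<in> carrier_mat M M \<and> e * e = 1\<^sub>m M \<and>
    (\<forall>g\<in>carrier_mat M M. galois_action ty B \<sigma> g = e * g * e)"
proof (cases "ty = Symmetric \<and> even (dim_row B) \<and> (\<exists>s. s ^ 2 = (- 1) ^ (dim_row B div 2) * det B \<and> \<sigma> s \<noteq> s)")
  case True
  then obtain n where n: "dim_row B = 2 * n"
    by (metis evenE)
  have Mn: "M = 2 * n"
    using M True n by simp
  show ?thesis
  proof (intro exI[of _ "swaprows_mat (2 * n) (n - 1) n"] conjI ballI)
    show "swaprows_mat (2 * n) (n - 1) n \<in> carrier_mat M M"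
      by (simp add: Mn)
  next
    show "swaprows_mat (2 * n) (n - 1) n * swaprows_mat (2 * n) (n - 1) n = (1\<^sub>m M :: complex mat)"
      unfolding Mn by (rule swaprows_mat_middle_square)
  next
    fix g :: "complex mat"
    show "galois_action ty B \<sigma> g = swaprows_mat (2 * n) (n - 1) n * g * swaprows_mat (2 * n) (n - 1) n"
      using True n by (auto simp: galois_action_def Let_def)
  qed
next
  case False
  then have "galois_action ty B \<sigma> g = g" for g
    by (auto simp: galois_action_def Let_def)
  then show ?thesis
    by (intro exI[of _ "1\<^sub>m M"]) simp
qed

text \<open>Commuting with \<open>(a, w)\<close> in the L-group is the twisted condition
  \<open>g a = a (e g e)\<close>; as \<open>e * e = 1\<close>, it says that \<open>g\<close>
  commutes with the matrix \<open>a e\<close>. So \<open>S_psi\<close> is an ordinary centralizer,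
  though of matrices which need not lie in the dual group.\<close>

lemma S_psi_centralizer:
  fixes B :: "'k::field_char_0 mat"
    and \<psi> :: "(('k \<Rightarrow> 'k) \<times> complex mat) \<times> complex mat \<Rightarrow> complex mat \<times> ('k \<Rightarrow> 'k)"
  assumes J: "J \<in> carrier_mat M M" and dual: "dual_group ty B = special_isometry_group J"
    and M: "ty = Symmetric \<and> even (dim_row B) \<longrightarrow> M = dim_row B"
    and psi: "\<psi> \<in> hom ((weil_group F v \<times>\<times> SL2) \<times>\<times> SL2) (L_group F v ty B)"
  obtains H where "H \<subseteq> carrier_mat M M"
    "carrier (S_psi F v ty B \<psi>) = {g \<in> carrier (special_isometry_group J). \<forall>h\<in>H. g * h = h * g}"
proof -
  let ?W = "carrier ((weil_group F v \<times>\<times> SL2) \<times>\<times> SL2)"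
  have fst_psi: "fst (\<psi> l) \<in> carrier_mat M M" if "l \<in> ?W" for l
    using hom_in_carrier[OF psi that] by (auto simp: L_group_def dual sig_carrier[OF J])
  have "\<exists>h\<in>carrier_mat M M. \<forall>g\<in>carrier_mat M M.
      g * fst (\<psi> l) = fst (\<psi> l) * galois_action ty B (snd (\<psi> l)) g \<longleftrightarrow> g * h = h * g" if l: "l \<in> ?W" for l
  proof -
    let ?a = "fst (\<psi> l)"
    have a: "?a \<in> carrier_mat M M"
      by (rule fst_psi[OF l])
    obtain e :: "complex mat" where e: "e \<in> carrier_mat M M" "e * e = 1\<^sub>m M"
      "\<forall>g\<in>carrier_mat M M. galois_action ty B (snd (\<psi> l)) g = e * g * e"
      using dual_galois_action_conj[OF M] by blast
    note cc = mult_carrier_mat[of _ M M _ M] and assoc = assoc_mult_mat[of _ M M _ M _ M]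
    have "g * ?a = ?a * (e * g * e) \<longleftrightarrow> g * (?a * e) = ?a * e * g" if g: "g \<in> carrier_mat M M" for g
    proof
      assume "g * ?a = ?a * (e * g * e)"
      then have "(g * ?a) * e = ?a * (e * g * e) * e" by simp
      also have "\<dots> = ?a * (e * (g * (e * e)))"
        using a e(1) g by (simp add: assoc cc)
      finally show "g * (?a * e) = ?a * e * g"
        using a e(1,2) g by (simp add: assoc cc)
    next
      assume "g * (?a * e) = ?a * e * g"
      then have "g * (?a * e) * e = ?a * e * g * e" by simp
      moreover have "g * (?a * e) * e = g * (?a * (e * e))"
        using a e(1) g by (simp add: assoc cc)
      ultimately show "g * ?a = ?a * (e * g * e)"
        using a e(1,2) g by (simp add: assoc cc)
    qed
    then show ?thesis
      using e(3) cc[OF a e(1)] by (intro bexI[of _ "?a * e"] ballI) simp_all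
  qed
  then obtain h where h: "\<forall>l\<in>?W. h l \<in> carrier_mat M M \<and> (\<forall>g\<in>carrier_mat M M.
      g * fst (\<psi> l) = fst (\<psi> l) * galois_action ty B (snd (\<psi> l)) g \<longleftrightarrow> g * h l = h l * g)"
    by metis
  have "carrier (S_psi F v ty B \<psi>) = {g \<in> carrier (special_isometry_group J).
      \<forall>l\<in>?W. g * fst (\<psi> l) = fst (\<psi> l) * galois_action ty B (snd (\<psi> l)) g}"
    by (simp add: S_psi_def dual L_group_def split_beta galois_action_id)
  also have "\<dots> = {g \<in> carrier (special_isometry_group J). \<forall>x\<in>h ` ?W. g * x = x * g}"
    using h by (auto simp: sig_carrier[OF J])
  finally show ?thesis
    using h by (intro that[of "h ` ?W"]) auto
qed

lemma center_in_S_psi: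
  assumes "\<psi> \<in> hom ((weil_group F v \<times>\<times> SL2) \<times>\<times> SL2) (L_group F v ty B)"
    and dual: "dual_group ty B = special_isometry_group J"
  shows "carrier (Z_Gamma F ty B) \<subseteq> carrier (S_psi F v ty B \<psi>)"
proof
  fix z assume z: "z \<in> carrier (Z_Gamma F ty B)"
  have "z * fst (\<psi> l) = fst (\<psi> l) * galois_action ty B (snd (\<psi> l)) z"
    if "l \<in> carrier ((weil_group F v \<times>\<times> SL2) \<times>\<times> SL2)" for l
  proof -
    have "\<psi> l \<in> carrier (L_group F v ty B)"
      by (rule hom_in_carrier[OF assms(1) that])
    then have "fst (\<psi> l) \<in> carrier (dual_group ty B)" "snd (\<psi> l) \<in> carrier (galois_group F)"
      by (auto simp: L_group_def weil_group_def)
    then show ?thesis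
      using z by (simp add: Z_Gamma_def center_def dual)
  qed
  then show "z \<in> carrier (S_psi F v ty B \<psi>)"
    using z by (simp add: S_psi_def Z_Gamma_def center_def dual L_group_def split_beta galois_action_id)
qed

section \<open>The dual group \<open>SO(2)\<close>\<close>

lemma subfield_sum_closed:
  assumes "is_subfield K" "\<And>i. i \<in> I \<Longrightarrow> f i \<in> K"
  shows "sum f I \<in> K"
  using assms(2) by (induction I rule: infinite_finite_induct) (use assms(1) in \<open>auto simp: is_subfield_def\<close>)

lemma subfield_prod_closed:
  assumes "is_subfield K" "\<And>i. i \<in> I \<Longrightarrow> f i \<in> K"
  shows "prod f I \<in> K"
  using assms(2) by (induction I rule: infinite_finite_induct) (use assms(1) in \<open>auto simp: is_subfield_def\<close>)

lemma det_in_subfield: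
  assumes K: "is_subfield K" and B: "B \<in> carrier_mat n n" "elements_mat B \<subseteq> K"
  shows "det B \<in> K"
proof -
  have entry: "B $$ (i, j) \<in> K" if "i < n" "j < n" for i j
    using B(2) elements_matI[OF B(1) that refl] by blast
  have "signof \<pi> * (\<Prod>i = 0..<n. B $$ (i, \<pi> i)) \<in> K" if "\<pi> permutes {0..<n}" for \<pi>
  proof -
    have "(\<Prod>i = 0..<n. B $$ (i, \<pi> i)) \<in> K"
      by (rule subfield_prod_closed[OF K]) (use that permutes_in_image[OF that] in \<open>auto intro!: entry\<close>)
    then show ?thesis
      using K by (simp add: is_subfield_def sign_def)
  qed
  then show ?thesis
    unfolding det_def'[OF B(1)] by (intro subfield_sum_closed[OF K]) simp
qed

lemma det_two:
  fixes A :: "'a::comm_ring_1 mat"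
  assumes A: "A \<in> carrier_mat 2 2"
  shows "det A = A $$ (0, 0) * A $$ (1, 1) - A $$ (0, 1) * A $$ (1, 0)"
proof -
  have "mat_delete A i 0 \<in> carrier_mat 1 1" for i
    using A by (auto simp: mat_delete_def)
  then have "det (mat_delete A 0 0) = A $$ (1, 1)" "det (mat_delete A 1 0) = A $$ (0, 1)"
    using A by (simp_all add: det_single mat_delete_def)
  then show ?thesis
    using laplace_expansion_column[OF A, of 0]
    by (simp add: numeral_2_eq_2 cofactor_def mult.commute)
qed

text \<open>The form is hyperbolic, so an isometry preserves or exchanges the two isotropic lines;
  determinant 1 excludes the exchange, and diagonal matrices commute.\<close>

lemma special_orthogonal_two_abelian:
  assumes "g \<in> carrier (special_isometry_group (split_form Symmetric 2))"
    and "h \<in> carrier (special_isometry_group (split_form Symmetric 2))"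
  shows "g * h = h * g"
proof -
  let ?J = "split_form Symmetric 2"
  have J: "?J \<in> carrier_mat 2 2"
    by simp
  have diag: "A \<in> carrier_mat 2 2 \<and> A $$ (0, 1) = 0 \<and> A $$ (1, 0) = 0"
    if "A \<in> carrier (special_isometry_group ?J)" for A
  proof -
    have A: "A \<in> carrier_mat 2 2" "transpose_mat A * ?J * A = ?J" "det A = 1"
      using that by (simp_all add: sig_carrier[OF J])
    have e: "(transpose_mat A * ?J * A) $$ (i, j) = A $$ (1, i) * A $$ (0, j) + A $$ (0, i) * A $$ (1, j)"
      if "i < 2" "j < 2" for i j
      using that A(1) by (simp add: scalar_prod_def numeral_2_eq_2 split_form_def)
    have "A $$ (0, 0) * A $$ (1, 0) = 0" "A $$ (0, 1) * A $$ (1, 1) = 0"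
        "A $$ (1, 0) * A $$ (0, 1) + A $$ (0, 0) * A $$ (1, 1) = 1"
      using e[of 0 0] e[of 1 1] e[of 0 1] by (simp_all add: A(2) split_form_entry)
    moreover have "A $$ (0, 0) * A $$ (1, 1) - A $$ (0, 1) * A $$ (1, 0) = 1"
      using det_two[OF A(1)] A(3) by simp
    ultimately have "A $$ (0, 1) * A $$ (1, 0) = 0" "A $$ (0, 0) * A $$ (1, 1) = 1"
      by (auto simp: algebra_simps)
    then show ?thesis
      using A(1) \<open>A $$ (0, 0) * A $$ (1, 0) = 0\<close> \<open>A $$ (0, 1) * A $$ (1, 1) = 0\<close> by auto
  qed
  note gd = diag[OF assms(1)] and hd = diag[OF assms(2)]
  show ?thesis
  proof (rule eq_matI)
    fix i j assume "i < dim_row (h * g)" "j < dim_col (h * g)"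
    then have ij: "i < 2" "j < 2"
      using gd hd by auto
    then have c: "i = 0 \<or> i = 1" "j = 0 \<or> j = 1"
      by auto
    have entry: "(x * y) $$ (i, j) = x $$ (i, 0) * y $$ (0, j) + x $$ (i, 1) * y $$ (1, j)"
      if "x \<in> carrier_mat 2 2" "y \<in> carrier_mat 2 2" for x y :: "complex mat"
      using that ij by (simp add: scalar_prod_def numeral_2_eq_2)
    have gc: "g \<in> carrier_mat 2 2" and hc: "h \<in> carrier_mat 2 2"
      using gd hd by blast+
    show "(g * h) $$ (i, j) = (h * g) $$ (i, j)"
      unfolding entry[OF gc hc] entry[OF hc gc] using c gd hd by (auto simp: mult.commute)
  qed (use gd hd in auto)
qed

text \<open>In a commutative dual group the component \<open>a\<close> of \<psi> at a Weil element
  \<open>w\<close> cancels from \<open>g a = a w(g)\<close>, leaving \<open>w(g) = g\<close>. The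
  action of a Galois automorphism depends only on whether it moves the square roots of the
  discriminant, so \<open>weil_group_moves\<close> extends the invariance to the Galois
  group.\<close>

lemma (in padic_field) S_psi_orthogonal_two:
  fixes B :: "'k mat"
  assumes form: "classical_form F Symmetric B" and B: "dim_row B = 2"
    and psi: "arthur_parameter F v Symmetric B \<psi>"
  shows "carrier (S_psi F v Symmetric B \<psi>) \<subseteq> carrier (Z_Gamma F Symmetric B)"
proof
  let ?G = "special_isometry_group (split_form Symmetric 2)"
  have J: "split_form Symmetric 2 \<in> carrier_mat 2 2"
    by simp
  have dual: "dual_group Symmetric B = ?G"
    by (simp add: dual_group_def B)
  have Bc: "B \<in> carrier_mat 2 2" "elements_mat B \<subseteq> F"
    using form B by (auto simp: classical_form_def)
  fix g assume g: "g \<in> carrier (S_psi F v Symmetric B \<psi>)"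
  then have gG: "g \<in> carrier ?G"
    by (simp add: S_psi_def dual)
  then have gc: "g \<in> carrier_mat 2 2"
    by (simp add: sig_carrier[OF J])
  have weil: "galois_action Symmetric B w g = g" if w: "w \<in> carrier (weil_group F v)" for w
  proof -
    let ?l = "((w, 1\<^sub>m 2), 1\<^sub>m 2 :: complex mat)"
    have l: "?l \<in> carrier ((weil_group F v \<times>\<times> SL2) \<times>\<times> SL2)"
      using w by (simp add: SL2_def mat_group_def)
    have "\<psi> ?l \<in> carrier (L_group F v Symmetric B)"
      by (rule hom_in_carrier[OF _ l]) (use psi in \<open>simp add: arthur_parameter_def\<close>)
    then have a: "fst (\<psi> ?l) \<in> carrier ?G"
      by (auto simp: L_group_def dual)
    have "snd (\<psi> ?l) = w"
      using psi w by (simp add: arthur_parameter_def SL2_def mat_group_def)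
    moreover have "g * fst (\<psi> ?l) = fst (\<psi> ?l) * galois_action Symmetric B (snd (\<psi> ?l)) g"
      using g l by (auto simp: S_psi_def dual L_group_def split_beta galois_action_id simp del: carrier_DirProd)
    moreover have "g * fst (\<psi> ?l) = fst (\<psi> ?l) * g"
      by (rule special_orthogonal_two_abelian[OF gG a])
    ultimately have eq: "fst (\<psi> ?l) * galois_action Symmetric B w g = fst (\<psi> ?l) * g"
      by simp
    have ac: "fst (\<psi> ?l) \<in> carrier_mat 2 2" "det (fst (\<psi> ?l)) = 1"
      using a by (simp_all add: sig_carrier[OF J])
    obtain e :: "complex mat" where e: "e \<in> carrier_mat 2 2"
      "\<forall>g\<in>carrier_mat 2 2. galois_action Symmetric B w g = e * g * e"
      using dual_galois_action_conj[of Symmetric B 2 w] B by auto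
    have gal: "galois_action Symmetric B w g \<in> carrier_mat 2 2"
      unfolding e(2)[rule_format, OF gc] using e(1) gc by simp
    have "x = adj_mat (fst (\<psi> ?l)) * (fst (\<psi> ?l) * x)" if "x \<in> carrier_mat 2 2" for x
      using assoc_mult_mat[OF adj_mat_inverse(1)[OF ac] ac(1) that] adj_mat_inverse(3)[OF ac] that by simp
    from this[OF gal] this[OF gc] eq show ?thesis
      by simp
  qed
  have "galois_action Symmetric B \<sigma> g = g" if \<sigma>: "\<sigma> \<in> carrier (galois_group F)" for \<sigma>
  proof (cases "\<exists>s. s ^ 2 = (- 1) ^ (dim_row B div 2) * det B \<and> \<sigma> s \<noteq> s")
    case True
    then obtain s where s: "s ^ 2 = (- 1) ^ (dim_row B div 2) * det B" "\<sigma> s \<noteq> s"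
      by blast
    have "det B \<in> F"
      by (rule det_in_subfield[OF F_subfield Bc])
    then have "s ^ 2 \<in> F"
      using F_subfield by (simp add: s(1) B is_subfield_def)
    then obtain w where w: "w \<in> carrier (weil_group F v)" "w s \<noteq> s"
      using weil_group_moves[OF \<sigma> _ s(2)] by blast
    have "galois_action Symmetric B \<sigma> g = galois_action Symmetric B w g"
      using True s(1) w(2) by (auto simp: galois_action_def Let_def)
    then show ?thesis
      using weil[OF w(1)] by simp
  next
    case False
    then show ?thesis
      by (auto simp: galois_action_def Let_def)
  qed
  then show "g \<in> carrier (Z_Gamma F Symmetric B)"
    using gG special_orthogonal_two_abelian[OF gG] by (simp add: Z_Gamma_def center_def dual)
qed

text \<open>The identity map of the covering space is a lift of a constant map.\<close>

lemma covering_of_trivial_group: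
  assumes cov: "covering_space (carrier X) p {c}" and conn: "connected (carrier X)"
    and xy: "x \<in> carrier X" "y \<in> carrier X"
  shows "x = y"
proof -
  have "p t = c" if "t \<in> carrier X" for t
    using cov that by (auto simp: covering_space_def)
  then show ?thesis
    using covering_lift_constant[OF cov conn, of "\<lambda>t. t" c x y] xy by simp
qed

text \<open>Canonicity is expressed by the shape of the conclusion: the first two conjuncts provide
  the homomorphism of component groups induced by \<open>p\<close>, and the last one describes
  \<Phi> on classes as pull-back along it.\<close>

theorem proposition3p11p1:
  fixes F :: "'k::{alg_closed_field, field_char_0} set"
    and v :: "'k \<Rightarrow> real"
    and ty :: form_type
    and B :: "'k mat"
    and \<psi> :: "(('k \<Rightarrow> 'k) \<times> complex mat) \<times> complex mat \<Rightarrow> complex mat \<times> ('k \<Rightarrow> 'k)"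
    and Gsc :: "'g::topological_space monoid"
    and p :: "'g \<Rightarrow> complex mat"
    and chi :: "complex mat set \<Rightarrow> complex"
    and zeta :: "'g \<Rightarrow> complex"
  assumes "padic_field F v"
    and "classical_form F ty B"
    and "quasi_split F B"
    and "arthur_parameter F v ty B \<psi>"
    and "simply_connected_cover Gsc p (dual_derived ty B)"
    and "chi \<in> hom (pi0 (Z_Gamma F ty B)) Cstar"
    and "zeta \<in> hom (Z_sc Gsc) Cstar"
    and "\<And>z. z \<in> Z_sharp_sc F ty B Gsc p \<Longrightarrow>
           chi (identity_component (Z_Gamma F ty B) #>\<^bsub>Z_Gamma F ty B\<^esub> p z) = zeta z"
  shows "p \<in> hom (S_psi_sc F v ty B \<psi> Gsc p) (S_psi F v ty B \<psi>) \<and>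
    pi0_map (S_psi F v ty B \<psi>) p \<in> hom (comp_psi_sc F v ty B \<psi> Gsc p) (A_psi F v ty B \<psi>) \<and>
    (\<exists>\<Phi>. bij_betw \<Phi> (Rep_A F v ty B \<psi> chi) (Rep_sc F v ty B \<psi> Gsc p zeta) \<and>
       (\<forall>d \<rho>. rep_equiv (A_psi F v ty B \<psi>) `` {(d, \<rho>)} \<in> Rep_A F v ty B \<psi> chi \<longrightarrow>
          \<Phi> (rep_equiv (A_psi F v ty B \<psi>) `` {(d, \<rho>)}) =
          rep_equiv (comp_psi_sc F v ty B \<psi> Gsc p) `` {(d, \<rho> \<circ> pi0_map (S_psi F v ty B \<psi>) p)}))"
proof -
  interpret padic_field F v "{x. \<forall>e>0. \<exists>r\<in>\<rat>. v (x - r) < e}"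
    by (rule assms(1), rule reflexive)
  obtain J M where J: "J \<in> carrier_mat M M" "det J \<noteq> 0" and dual: "dual_group ty B = special_isometry_group J"
    and M: "ty = Symmetric \<and> even (dim_row B) \<longrightarrow> M = dim_row B \<and> J = split_form Symmetric M"
    and perfect: "\<not> (ty = Symmetric \<and> dim_row B = 2) \<longrightarrow>
       carrier (dual_group ty B) \<subseteq> derived (dual_group ty B) (carrier (dual_group ty B))"
    by (rule dual_group_cases[OF assms(2)])
  define G where "G = special_isometry_group J"
  note dual = dual[folded G_def]
  have psi: "\<psi> \<in> hom ((weil_group F v \<times>\<times> SL2) \<times>\<times> SL2) (L_group F v ty B)"
    using assms(4) by (simp add: arthur_parameter_def)
  have Gtrans: "translation_group G" and Ggrp: "group G"
    unfolding G_def by (rule sig_translation_group[OF J(1)] sig_group[OF J(1)])+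
  interpret G: group G by (rule Ggrp)
  define S where "S = carrier (S_psi F v ty B \<psi>)"
  define K where "K = carrier (Z_Gamma F ty B)"
  have M': "ty = Symmetric \<and> even (dim_row B) \<longrightarrow> M = dim_row B"
    using M by blast
  obtain H where H: "H \<subseteq> carrier_mat M M" "S = {g \<in> carrier G. \<forall>h\<in>H. g * h = h * g}"
    unfolding S_def G_def
    by (rule S_psi_centralizer[OF J(1) dual[unfolded G_def] M' psi])
  have Spsi: "S_psi F v ty B \<psi> = G\<lparr>carrier := S\<rparr>"
    by (simp add: S_def S_psi_def dual)
  have ZG: "Z_Gamma F ty B = G\<lparr>carrier := K\<rparr>"
    by (simp add: K_def Z_Gamma_def dual)
  have subS: "subgroup S G"
    unfolding H(2) G_def by (rule centralizer_subgroup[OF J(1) H(1)])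
  have transS: "translation_group (G\<lparr>carrier := S\<rparr>)"
    by (rule translation_group_subgroup[OF Gtrans subS])
  have SG: "S \<subseteq> carrier G"
    by (rule subgroup.subset[OF subS])
  have KS: "K \<subseteq> S"
    unfolding K_def S_def by (rule center_in_S_psi[OF psi dual[unfolded G_def]])
  have Kcenter: "K \<subseteq> center G"
    by (auto simp: K_def Z_Gamma_def dual)
  have central: "z \<otimes>\<^bsub>G\<^esub> g = g \<otimes>\<^bsub>G\<^esub> z" if "z \<in> K" "g \<in> carrier G" for z g
    using Kcenter that by (auto simp: center_def)
  have top: "topological_group Gsc" and phom: "p \<in> hom Gsc (dual_derived ty B)"
    and cov: "covering_space (carrier Gsc) p (carrier (dual_derived ty B))"
    and conn: "connected (carrier Gsc)"
    using assms(5) simply_connected_connected by (auto simp: simply_connected_cover_def)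
  interpret Gsc: group Gsc
    using top by (simp add: topological_group_def)
  have derG: "derived G (carrier G) \<subseteq> carrier G"
    by (rule G.derived_in_carrier) simp
  have pG: "p \<in> hom Gsc G"
    using phom derG by (auto simp: hom_def dual_derived_def dual)
  interpret p: group_hom Gsc G p
    by (intro group_hom.intro group_hom_axioms.intro Gsc.is_group Ggrp pG)
  have pcont: "continuous_on (carrier Gsc) p" and pim: "p ` carrier Gsc = derived G (carrier G)"
    using cov by (auto simp: covering_space_def dual_derived_def dual)
  define T where "T = {x \<in> carrier Gsc. p x \<in> S}"
  have subT: "subgroup T Gsc"
  proof (rule Gsc.subgroupI)
    show "T \<subseteq> carrier Gsc"
      unfolding T_def by blast
  next
    have "\<one>\<^bsub>Gsc\<^esub> \<in> T"
      using subgroup.one_closed[OF subS] by (simp add: T_def)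
    then show "T \<noteq> {}"
      by blast
  next
    fix a assume "a \<in> T"
    then show "inv\<^bsub>Gsc\<^esub> a \<in> T"
      using subgroup.m_inv_closed[OF subS, of "p a"] by (simp add: T_def)
  next
    fix a b assume "a \<in> T" "b \<in> T"
    then show "a \<otimes>\<^bsub>Gsc\<^esub> b \<in> T"
      using subgroup.m_closed[OF subS, of "p a" "p b"] by (simp add: T_def)
  qed
  have transT: "translation_group (Gsc\<lparr>carrier := T\<rparr>)"
    by (rule translation_group_subgroup[OF topological_group_translation[OF top] subT])
  have oS: "\<one>\<^bsub>G\<^esub> \<in> S"
    by (rule subgroup.one_closed[OF subS])
  \<comment> \<open>These are the facts after which the two cases need no longer be distinguished.
    The second clause removes the ambiguity by the centre in \<open>S_psi_bar\<close>; the third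
    identifies \<open>Z_sc\<close> with a preimage, and the last two are the generation hypotheses
    of \<open>component_group_rep_bij\<close>.\<close>
  have main: "(K = S \<or> K = center G) \<and> (\<forall>x\<in>carrier Gsc. \<forall>s\<in>S. \<forall>c\<in>center G. p x = c * s \<longrightarrow> p x \<in> S) \<and> {x \<in> carrier Gsc. p x \<in> K} = center Gsc \<and>
      (\<forall>s\<in>S. \<exists>x\<in>T. \<exists>z\<in>K. s = p x * z) \<and>
      (\<forall>s\<in>identity_component (G\<lparr>carrier := S\<rparr>). \<exists>x\<in>identity_component (Gsc\<lparr>carrier := T\<rparr>).
         \<exists>z\<in>identity_component (G\<lparr>carrier := K\<rparr>). s = p x * z)"
  proof (cases "ty = Symmetric \<and> dim_row B = 2")
    case False
    have KC: "K = center G"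
      using center_dual_group_galois_fixed[OF _ False] by (auto simp: K_def Z_Gamma_def dual)
    have surj: "p ` carrier Gsc = carrier G"
      using perfect[rule_format, OF False] derG pim by (simp add: dual subset_antisym)
    have cov': "covering_space (carrier Gsc) p (carrier G)"
      using cov surj pim by (simp add: dual_derived_def dual)
    have c: "{x \<in> carrier Gsc. p x \<in> K} = center Gsc"
    proof (intro equalityI subsetI)
      fix x assume "x \<in> {x \<in> carrier Gsc. p x \<in> K}"
      then show "x \<in> center Gsc"
        using covering_preimage_center[OF top Ggrp cov' pG conn] KC by blast
    next
      fix x assume x: "x \<in> center Gsc"
      then have xG: "x \<in> carrier Gsc"
        by (simp add: center_def)
      have "p x \<otimes>\<^bsub>G\<^esub> g = g \<otimes>\<^bsub>G\<^esub> p x" if g: "g \<in> carrier G" for g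
      proof -
        obtain y where y: "y \<in> carrier Gsc" "g = p y"
          using g surj by blast
        have "x \<otimes>\<^bsub>Gsc\<^esub> y = y \<otimes>\<^bsub>Gsc\<^esub> x"
          using x y(1) by (simp add: center_def)
        then show ?thesis
          using p.hom_mult[OF xG y(1)] p.hom_mult[OF y(1) xG] y(2) by metis
      qed
      then show "x \<in> {x \<in> carrier Gsc. p x \<in> K}"
        using xG by (simp add: KC center_def)
    qed
    have "\<one>\<^bsub>G\<^esub> \<in> K"
      by (simp add: KC center_def)
    then have oK: "1\<^sub>m M \<in> K"
      by (simp only: G_def sig_one[OF J(1)])
    have m1: "s * 1\<^sub>m M = s" if "s \<in> carrier G" for s
      using that by (auto simp: G_def sig_carrier[OF J(1)])
    have gen: "\<forall>s\<in>S. \<exists>x\<in>T. \<exists>z\<in>K. s = p x * z"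
    proof
      fix s assume s: "s \<in> S"
      then have sG: "s \<in> carrier G"
        using SG by blast
      then obtain x where x: "x \<in> carrier Gsc" "s = p x"
        using surj by blast
      have "x \<in> T"
        using x s by (simp add: T_def)
      moreover have "s = p x * 1\<^sub>m M"
        using m1[OF sG] x(2) by metis
      ultimately show "\<exists>x\<in>T. \<exists>z\<in>K. s = p x * z"
        using oK by blast
    qed
    have o: "1\<^sub>m M \<in> identity_component (G\<lparr>carrier := K\<rparr>)"
      using identity_component_one[of "G\<lparr>carrier := K\<rparr>"] oK by (simp add: G_def sig_one[OF J(1)])
    have cc: "identity_component (G\<lparr>carrier := S\<rparr>) \<subseteq> p ` identity_component (Gsc\<lparr>carrier := T\<rparr>)"
      using identity_component_centralizer_covered[OF J H(1) top pG[unfolded G_def] cov'[unfolded G_def]]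
      unfolding T_def H(2) G_def .
    have ic: "\<forall>s\<in>identity_component (G\<lparr>carrier := S\<rparr>). \<exists>x\<in>identity_component (Gsc\<lparr>carrier := T\<rparr>).
         \<exists>z\<in>identity_component (G\<lparr>carrier := K\<rparr>). s = p x * z"
    proof
      fix s assume s: "s \<in> identity_component (G\<lparr>carrier := S\<rparr>)"
      have "s \<in> carrier (G\<lparr>carrier := S\<rparr>)"
        using s unfolding identity_component_def by (rule subsetD[OF connected_component_subset])
      then have sG: "s \<in> carrier G"
        using SG by auto
      obtain x where "x \<in> identity_component (Gsc\<lparr>carrier := T\<rparr>)" "s = p x"
        using s cc by blast
      then show "\<exists>x\<in>identity_component (Gsc\<lparr>carrier := T\<rparr>). \<exists>z\<in>identity_component (G\<lparr>carrier := K\<rparr>). s = p x * z"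
        using o m1[OF sG] by metis
    qed
    \<comment> \<open>Here the whole centre lies in \<open>S\<close>, so a central factor can be
      absorbed.\<close>
    have adj: "\<forall>x\<in>carrier Gsc. \<forall>s\<in>S. \<forall>c\<in>center G. p x = c * s \<longrightarrow> p x \<in> S"
    proof (intro ballI impI)
      fix x s c assume "s \<in> S" "c \<in> center G" "p x = c * s"
      then show "p x \<in> S"
        using subgroup.m_closed[OF subS, of c s] KS KC by (auto simp: G_def)
    qed
    show ?thesis
      by (intro conjI disjI2 KC adj c gen ic)
  next
    case True
    have J2: "J = split_form Symmetric 2" and M2: "M = 2"
      using M True by auto
    have abel: "g * h = h * g" if "g \<in> carrier G" "h \<in> carrier G" for g h
      using special_orthogonal_two_abelian[of g h] that by (simp add: G_def J2)
    have ty: "ty = Symmetric" "dim_row B = 2"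
      using True by simp_all
    have "S \<subseteq> K"
      unfolding S_def K_def ty(1)
      by (rule S_psi_orthogonal_two[OF assms(2)[unfolded ty(1)] ty(2) assms(4)[unfolded ty(1)]])
    then have SK: "S = K"
      using KS by (rule subset_antisym)
    have dG: "derived G (carrier G) = {\<one>\<^bsub>G\<^esub>}"
    proof -
      have "comm_group G"
        by (rule G.group_comm_groupI) (use abel in \<open>simp add: G_def\<close>)
      then show ?thesis
        by (rule comm_group.derived_eq_singleton) simp
    qed
    then have cov1: "covering_space (carrier Gsc) p {\<one>\<^bsub>G\<^esub>}"
      using cov by (simp add: dual_derived_def dual)
    have triv: "x = \<one>\<^bsub>Gsc\<^esub>" if "x \<in> carrier Gsc" for x
      by (rule covering_of_trivial_group[OF cov1 conn that Gsc.one_closed])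
    have pone: "p x = \<one>\<^bsub>G\<^esub>" if "x \<in> carrier Gsc" for x
      using triv[OF that] p.hom_one by simp
    have c: "{x \<in> carrier Gsc. p x \<in> K} = center Gsc"
    proof (intro equalityI subsetI)
      fix x assume "x \<in> {x \<in> carrier Gsc. p x \<in> K}"
      then have "x = \<one>\<^bsub>Gsc\<^esub>"
        using triv by blast
      then show "x \<in> center Gsc"
        by (simp add: center_def)
    next
      fix x assume "x \<in> center Gsc"
      then have x: "x \<in> carrier Gsc"
        by (simp add: center_def)
      then show "x \<in> {x \<in> carrier Gsc. p x \<in> K}"
        using pone[OF x] oS SK by simp
    qed
    have p1: "p \<one>\<^bsub>Gsc\<^esub> = 1\<^sub>m M"
      using p.hom_one by (simp only: G_def sig_one[OF J(1)])
    have l1: "p \<one>\<^bsub>Gsc\<^esub> * s = s" if s: "s \<in> S" for s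
    proof -
      have "s \<in> carrier G"
        using s SG by blast
      then have "s \<in> carrier_mat M M"
        by (simp add: G_def sig_carrier[OF J(1)])
      then show ?thesis
        unfolding p1 by (rule left_mult_one_mat)
    qed
    have oT: "\<one>\<^bsub>Gsc\<^esub> \<in> T"
      by (rule subgroup.one_closed[OF subT])
    have oT0: "\<one>\<^bsub>Gsc\<^esub> \<in> identity_component (Gsc\<lparr>carrier := T\<rparr>)"
      using identity_component_one[of "Gsc\<lparr>carrier := T\<rparr>"] oT by simp
    have gen: "\<forall>s\<in>S. \<exists>x\<in>T. \<exists>z\<in>K. s = p x * z"
    proof
      fix s assume s: "s \<in> S"
      then show "\<exists>x\<in>T. \<exists>z\<in>K. s = p x * z"
        using l1[OF s] oT SK by metis
    qed
    have ic: "\<exists>x\<in>identity_component (Gsc\<lparr>carrier := T\<rparr>). \<exists>z\<in>identity_component (G\<lparr>carrier := K\<rparr>). s = p x * z"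
      if s: "s \<in> identity_component (G\<lparr>carrier := S\<rparr>)" for s
    proof -
      have "s \<in> carrier (G\<lparr>carrier := S\<rparr>)"
        using s unfolding identity_component_def by (rule subsetD[OF connected_component_subset])
      then have "p \<one>\<^bsub>Gsc\<^esub> * s = s"
        using l1 by simp
      then show ?thesis
        using oT0 s SK by metis
    qed
    have adj: "\<forall>x\<in>carrier Gsc. \<forall>s\<in>S. \<forall>c\<in>center G. p x = c * s \<longrightarrow> p x \<in> S"
    proof (intro ballI impI)
      fix x assume "x \<in> carrier Gsc"
      then show "p x \<in> S"
        using oS by (simp only: pone)
    qed
    show ?thesis
      by (intro conjI disjI1 SK[symmetric] adj c gen ballI ic)
  qed
  note mK = main[THEN conjunct1]
    and madj = main[THEN conjunct2, THEN conjunct1]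
    and mc = main[THEN conjunct2, THEN conjunct2, THEN conjunct1]
    and mgen = main[THEN conjunct2, THEN conjunct2, THEN conjunct2, THEN conjunct1]
    and mic = main[THEN conjunct2, THEN conjunct2, THEN conjunct2, THEN conjunct2]
  \<comment> \<open>\<open>S_psi_bar\<close> only remembers elements modulo the full centre of the
    dual group, which may exceed \<open>Z_Gamma\<close>; \<open>madj\<close> shows that nothing is
    lost on the image of \<open>p\<close>.\<close>
  have toadj: "to_adjoint ty B (p x) \<in> carrier (S_psi_bar F v ty B \<psi>) \<longleftrightarrow> p x \<in> S" if x: "x \<in> carrier Gsc" for x
  proof
    assume "p x \<in> S"
    then show "to_adjoint ty B (p x) \<in> carrier (S_psi_bar F v ty B \<psi>)"
      by (auto simp: S_psi_bar_def S_def)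
  next
    assume "to_adjoint ty B (p x) \<in> carrier (S_psi_bar F v ty B \<psi>)"
    then obtain s where s: "s \<in> S" "center G #>\<^bsub>G\<^esub> p x = center G #>\<^bsub>G\<^esub> s"
      by (auto simp: S_psi_bar_def S_def to_adjoint_def dual)
    have "\<one>\<^bsub>G\<^esub> \<in> center G"
      by (simp add: center_def)
    then have "\<one>\<^bsub>G\<^esub> \<otimes>\<^bsub>G\<^esub> p x \<in> center G #>\<^bsub>G\<^esub> p x"
      unfolding r_coset_def by blast
    then have "p x \<in> center G #>\<^bsub>G\<^esub> s"
      by (simp only: s(2) G.l_one[OF hom_in_carrier[OF pG x]])
    then obtain c where "c \<in> center G" "p x = c * s"
      by (auto simp: r_coset_def G_def)
    then show "p x \<in> S"
      using madj x s(1) by blast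
  qed
  have Ssc: "S_psi_sc F v ty B \<psi> Gsc p = Gsc\<lparr>carrier := T\<rparr>"
  proof -
    have "{x \<in> carrier Gsc. to_adjoint ty B (p x) \<in> carrier (S_psi_bar F v ty B \<psi>)} = T"
      unfolding T_def using toadj by blast
    then show ?thesis
      by (simp add: S_psi_sc_def)
  qed
  have phomS: "p \<in> hom (Gsc\<lparr>carrier := T\<rparr>) (G\<lparr>carrier := S\<rparr>)"
    using pG by (auto simp: hom_def T_def)
  have pcontT: "continuous_on (carrier (Gsc\<lparr>carrier := T\<rparr>)) p"
    using continuous_on_subset[OF pcont, of T] by (simp add: T_def)
  have subK: "subgroup K (G\<lparr>carrier := S\<rparr>)"
  proof -
    have "subgroup (center G) G"
    proof (rule G.subgroupI)
      have "\<one>\<^bsub>G\<^esub> \<in> center G"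
        by (simp add: center_def)
      then show "center G \<noteq> {}"
        by blast
    next
      fix a assume a: "a \<in> center G"
      have aG: "a \<in> carrier G"
        using a by (simp add: center_def)
      have "inv\<^bsub>G\<^esub> a \<otimes>\<^bsub>G\<^esub> g = g \<otimes>\<^bsub>G\<^esub> inv\<^bsub>G\<^esub> a" if g: "g \<in> carrier G" for g
      proof -
        have "a \<otimes>\<^bsub>G\<^esub> inv\<^bsub>G\<^esub> g = inv\<^bsub>G\<^esub> g \<otimes>\<^bsub>G\<^esub> a"
          using a G.inv_closed[OF g] unfolding center_def by blast
        then have "inv\<^bsub>G\<^esub> (a \<otimes>\<^bsub>G\<^esub> inv\<^bsub>G\<^esub> g) = inv\<^bsub>G\<^esub> (inv\<^bsub>G\<^esub> g \<otimes>\<^bsub>G\<^esub> a)"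
          by simp
        then show ?thesis
          using aG g by (simp add: G.inv_mult_group)
      qed
      then show "inv\<^bsub>G\<^esub> a \<in> center G"
        using aG by (simp add: center_def)
    next
      fix a b assume ab: "a \<in> center G" "b \<in> center G"
      have abG: "a \<in> carrier G" "b \<in> carrier G"
        using ab by (simp_all add: center_def)
      have "a \<otimes>\<^bsub>G\<^esub> b \<otimes>\<^bsub>G\<^esub> g = g \<otimes>\<^bsub>G\<^esub> (a \<otimes>\<^bsub>G\<^esub> b)" if g: "g \<in> carrier G" for g
      proof -
        have "a \<otimes>\<^bsub>G\<^esub> b \<otimes>\<^bsub>G\<^esub> g = a \<otimes>\<^bsub>G\<^esub> (g \<otimes>\<^bsub>G\<^esub> b)"
        proof -
          have "b \<otimes>\<^bsub>G\<^esub> g = g \<otimes>\<^bsub>G\<^esub> b"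
            using ab(2) g unfolding center_def by blast
          then show ?thesis
            using abG g by (simp add: G.m_assoc)
        qed
        also have "\<dots> = (a \<otimes>\<^bsub>G\<^esub> g) \<otimes>\<^bsub>G\<^esub> b"
          using abG g by (simp add: G.m_assoc)
        also have "\<dots> = (g \<otimes>\<^bsub>G\<^esub> a) \<otimes>\<^bsub>G\<^esub> b"
        proof -
          have "a \<otimes>\<^bsub>G\<^esub> g = g \<otimes>\<^bsub>G\<^esub> a"
            using ab(1) g unfolding center_def by blast
          then show ?thesis
            by simp
        qed
        finally show ?thesis
          using abG g by (simp add: G.m_assoc)
      qed
      then show "a \<otimes>\<^bsub>G\<^esub> b \<in> center G"
        using abG by (simp add: center_def)
    qed (auto simp: center_def)
    then have "subgroup K G"
      using mK subS by metis
    then show ?thesis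
      using G.subgroup_incl[OF _ subS KS] by blast
  qed
  \<comment> \<open>The centre upstairs is presented as the preimage of \<open>K\<close>, the shape
    in which \<open>component_group_rep_bij\<close> takes the group \<open>Y\<close>.\<close>
  have Zsc: "Z_sc Gsc = (Gsc\<lparr>carrier := T\<rparr>)\<lparr>carrier := {x \<in> carrier (Gsc\<lparr>carrier := T\<rparr>). p x \<in> K}\<rparr>"
  proof -
    have "{x \<in> T. p x \<in> K} = center Gsc"
      unfolding mc[symmetric] T_def using KS by blast
    then show ?thesis
      by (simp add: Z_sc_def)
  qed
  have match: "chi (identity_component (Z_Gamma F ty B) #>\<^bsub>Z_Gamma F ty B\<^esub> p x) = zeta x"
    if "x \<in> carrier (Gsc\<lparr>carrier := T\<rparr>)" "p x \<in> K" for x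
    using that by (intro assms(8)) (simp add: Z_sharp_sc_def K_def T_def)
  have ZGS: "Z_Gamma F ty B = (G\<lparr>carrier := S\<rparr>)\<lparr>carrier := K\<rparr>"
    by (simp add: ZG)
  have rep: "\<exists>\<Phi>. bij_betw \<Phi> (Rep_A F v ty B \<psi> chi) (Rep_sc F v ty B \<psi> Gsc p zeta) \<and>
       (\<forall>d \<rho>. rep_equiv (A_psi F v ty B \<psi>) `` {(d, \<rho>)} \<in> Rep_A F v ty B \<psi> chi \<longrightarrow>
          \<Phi> (rep_equiv (A_psi F v ty B \<psi>) `` {(d, \<rho>)}) =
          rep_equiv (comp_psi_sc F v ty B \<psi> Gsc p) `` {(d, \<rho> \<circ> pi0_map (S_psi F v ty B \<psi>) p)})"
    unfolding Rep_A_def Rep_sc_def A_psi_def comp_psi_sc_def Spsi Ssc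
  proof (rule component_group_rep_bij[OF transS transT phomS pcontT subK ZGS Zsc _ _ _ assms(6)])
    fix z s assume z: "z \<in> K" and s: "s \<in> carrier (G\<lparr>carrier := S\<rparr>)"
    have sG: "s \<in> carrier G"
      using s SG by auto
    show "z \<otimes>\<^bsub>G\<lparr>carrier := S\<rparr>\<^esub> s = s \<otimes>\<^bsub>G\<lparr>carrier := S\<rparr>\<^esub> z"
      using central[OF z sG] by simp
  next
    fix s assume "s \<in> carrier (G\<lparr>carrier := S\<rparr>)"
    then show "\<exists>x\<in>carrier (Gsc\<lparr>carrier := T\<rparr>). \<exists>z\<in>K. s = p x \<otimes>\<^bsub>G\<lparr>carrier := S\<rparr>\<^esub> z"
      using mgen by (simp add: G_def)
  next
    fix s assume "s \<in> identity_component (G\<lparr>carrier := S\<rparr>)"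
    then show "\<exists>x\<in>identity_component (Gsc\<lparr>carrier := T\<rparr>). \<exists>z\<in>identity_component (Z_Gamma F ty B).
        s = p x \<otimes>\<^bsub>G\<lparr>carrier := S\<rparr>\<^esub> z"
      using mic by (simp add: G_def ZG)
  next
    fix x assume "x \<in> carrier (Gsc\<lparr>carrier := T\<rparr>)" "p x \<in> K"
    then show "chi (identity_component (Z_Gamma F ty B) #>\<^bsub>Z_Gamma F ty B\<^esub> p x) = zeta x"
      by (rule match)
  qed
  have r1: "p \<in> hom (S_psi_sc F v ty B \<psi> Gsc p) (S_psi F v ty B \<psi>)"
    unfolding Spsi Ssc by (rule phomS)
  have r2: "pi0_map (S_psi F v ty B \<psi>) p \<in> hom (comp_psi_sc F v ty B \<psi> Gsc p) (A_psi F v ty B \<psi>)"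
    unfolding A_psi_def comp_psi_sc_def Spsi Ssc by (rule pi0_map_hom[OF transT transS phomS pcontT])
  show ?thesis
    by (rule conjI[OF r1 conjI[OF r2 rep]])
qed

end
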